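(* Let $s\in\mathbb N$ and let $D$ be self-adjoint in $\mathcal H$ such that $(D-i)^{-1}\in\mathcal S^s$. For every $n\in\mathbb N_0$, every $f\in\mathcal W^{s,n}$ and every $V_1,\ldots,V_n\in B(\mathcal H)$, the multiple operator integral $T^D_{f^{[n]}}(V_1,\ldots,V_n)$ is trace class and satisfies $$\big\|T^D_{f^{[n]}}(V_1,\ldots,V_n)\big\|_1\le c_{s,n}(f)\,\|V_1\|\cdots\|V_n\|\,\big\|(D-i)^{-1}\big\|_s^s,$$ where $$c_{s,n}(f):=\sum_{k=0}^{\min(s,n)}\binom sk\frac{\big\|\widehat{(fu^{s-k})^{(n-k)}}\big\|_{L^1}}{(n-k)!}.$$ More generally, for $V\in B(\mathcal H)_{\mathrm{sa}}$, $$\big\|T^{D+V,D,\ldots,D}_{f^{[n]}}(V_1,\ldots,V_n)\big\|_1\le c_{s,n}(f)\,\|V_1\|\cdots\|V_n\|\,(1+\|V\|)^{2s}\,\big\|(D-i)^{-1}\big\|_s^s.$$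
   Context: Notation: $\mathbb N=\{1,2,\ldots\}$, $\mathbb N_0=\{0,1,2,\ldots\}$. $\mathcal H$ is a separable Hilbert space; $B(\mathcal H)_{\mathrm{sa}}$ is the set of bounded self-adjoint operators. Operators "self-adjoint in $\mathcal H$" may be unbounded (densely defined). $\mathcal S^s$ is the Schatten class of $s$-summable operators with norm $\|T\|_s=(\operatorname{Tr}|T|^s)^{1/s}$; $\|T\|_1$ denotes the trace norm of an operator. Fourier transform: $\hat g(x)=\int_{\mathbb R}\frac{dy}{2\pi}g(y)e^{-iyx}$, extended to distributions; for continuous $g$, "$\hat g\in L^1$" means the distributional Fourier transform is an $L^1$ function, and then $g(x)=\int\hat g(y)e^{ixy}dy$. Function class: with $u(x):=x-i$, $\mathcal W^{s,n}:=\{f\in C^n(\mathbb R,\mathbb C):\widehat{(fu^m)^{(k)}}\in L^1\text{ for all integers }0\le m\le s,\ 0\le k\le n\}$. Multiple operator integral: for $D_0,\ldots,D_n$ self-adjoint in $\mathcal H$, $f\in C^n$ with $\widehat{f^{(n)}}\in L^1$ and $V_1,\ldots,V_n\in B(\mathcal H)$, $$T^{D_0,\ldots,D_n}_{f^{[n]}}(V_1,\ldots,V_n)y:=\int_{\Delta_n}\int_{\mathbb R}e^{its_0D_0}V_1e^{its_1D_1}\cdots V_ne^{its_nD_n}y\,\widehat{f^{(n)}}(t)\,dt\,d\sigma(s_0,\ldots,s_n)\qquad(y\in\mathcal H),$$ where $\Delta_n=\{s\in\mathbb R_{\ge0}^{n+1}:\sum_j s_j=1\}$ and $\sigma$ is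 the standard measure of total mass $1/n!$. Write $T^D_{f^{[n]}}:=T^{D,\ldots,D}_{f^{[n]}}$; for $n=0$, $T^{D_0}_{f^{[0]}}=f(D_0)$. *)

theory Defs
  imports "HOL-Analysis.Analysis"
begin

section \<open>Complex Hilbert spaces and bounded operators\<close>

text \<open>The inner product is conjugate linear in its first argument. Separability is expressed by the
  class \<open>second_countable_topology\<close>, which is equivalent to it for metric spaces.\<close>

class complex_hilbert_space = banach +
  fixes scaleC :: "complex \<Rightarrow> 'a \<Rightarrow> 'a"  (infixr "*\<^sub>C" 75)
    and cinner :: "'a \<Rightarrow> 'a \<Rightarrow> complex"
  assumes scaleC_add_right: "a *\<^sub>C (x + y) = a *\<^sub>C x + a *\<^sub>C y"
    and scaleC_add_left: "(a + b) *\<^sub>C x = a *\<^sub>C x + b *\<^sub>C x"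
    and scaleC_scaleC: "a *\<^sub>C (b *\<^sub>C x) = (a * b) *\<^sub>C x"
    and scaleC_of_real: "complex_of_real r *\<^sub>C x = r *\<^sub>R x"
    and cinner_commute: "cinner x y = cnj (cinner y x)"
    and cinner_add_right: "cinner x (y + z) = cinner x y + cinner x z"
    and cinner_scaleC_right: "cinner x (a *\<^sub>C y) = a * cinner x y"
    and cinner_ge_zero: "0 \<le> Re (cinner x x)"
    and norm_eq_sqrt_cinner: "norm x = sqrt (Re (cinner x x))"

definition bounded_clinear :: "('a::complex_hilbert_space \<Rightarrow> 'a) \<Rightarrow> bool" where
  "bounded_clinear T \<longleftrightarrow> bounded_linear T \<and> (\<forall>c x. T (c *\<^sub>C x) = c *\<^sub>C T x)"

definition adj :: "('a::complex_hilbert_space \<Rightarrow> 'a) \<Rightarrow> 'a \<Rightarrow> 'a" where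
  "adj T = (THE S. \<forall>x y. cinner (S x) y = cinner x (T y))"

definition bounded_self_adjoint :: "('a::complex_hilbert_space \<Rightarrow> 'a) \<Rightarrow> bool" where
  "bounded_self_adjoint V \<longleftrightarrow>
    bounded_clinear V \<and> (\<forall>x y. cinner (V x) y = cinner x (V y))"

definition positive_op :: "('a::complex_hilbert_space \<Rightarrow> 'a) \<Rightarrow> bool" where
  "positive_op P \<longleftrightarrow>
    bounded_clinear P \<and> (\<forall>x. cinner x (P x) \<in> \<real> \<and> 0 \<le> Re (cinner x (P x)))"

text \<open>The absolute value, i.e. the positive square root of \<open>T\<^sup>* T\<close>.\<close>

definition abs_op :: "('a::complex_hilbert_space \<Rightarrow> 'a) \<Rightarrow> 'a \<Rightarrow> 'a" where
  "abs_op T = (THE P. positive_op P \<and> P \<circ> P = adj T \<circ> T)"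


section \<open>Trace and Schatten classes\<close>

definition orthonormal_basis :: "'a::complex_hilbert_space set \<Rightarrow> bool" where
  "orthonormal_basis B \<longleftrightarrow>
    (\<forall>e\<in>B. norm e = 1) \<and> (\<forall>e\<in>B. \<forall>e'\<in>B. e \<noteq> e' \<longrightarrow> cinner e e' = 0) \<and>
    (\<forall>x. (\<forall>e\<in>B. cinner e x = 0) \<longrightarrow> x = 0)"

text \<open>Only used for positive operators, for which the trace is a well-defined element of
  \<open>[0, \<infinity>]\<close> that does not depend on the orthonormal basis.\<close>

definition trace_pos :: "('a::complex_hilbert_space \<Rightarrow> 'a) \<Rightarrow> ennreal" where
  "trace_pos A = (\<Sum>\<^sub>\<infinity>e\<in>(SOME B. orthonormal_basis B). ennreal (Re (cinner e (A e))))"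

definition schatten_class :: "nat \<Rightarrow> ('a::complex_hilbert_space \<Rightarrow> 'a) \<Rightarrow> bool" where
  "schatten_class s T \<longleftrightarrow> bounded_clinear T \<and> trace_pos (abs_op T ^^ s) < \<infinity>"

definition schatten_norm :: "nat \<Rightarrow> ('a::complex_hilbert_space \<Rightarrow> 'a) \<Rightarrow> real" where
  "schatten_norm s T = enn2real (trace_pos (abs_op T ^^ s)) powr (1 / real s)"

abbreviation trace_class :: "('a::complex_hilbert_space \<Rightarrow> 'a) \<Rightarrow> bool" where
  "trace_class \<equiv> schatten_class 1"

abbreviation trace_norm :: "('a::complex_hilbert_space \<Rightarrow> 'a) \<Rightarrow> real" where
  "trace_norm \<equiv> schatten_norm 1"


section \<open>Unbounded operators\<close>

text \<open>A possibly unbounded operator is a partial function; its domain is \<^term>\<open>dom D\<close>.\<close>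

definition linear_operator :: "('a::complex_hilbert_space \<rightharpoonup> 'a) \<Rightarrow> bool" where
  "linear_operator D \<longleftrightarrow>
    D 0 = Some 0 \<and>
    (\<forall>x\<in>dom D. \<forall>y\<in>dom D. D (x + y) = Some (the (D x) + the (D y))) \<and>
    (\<forall>c. \<forall>x\<in>dom D. D (c *\<^sub>C x) = Some (c *\<^sub>C the (D x)))"

definition adjoint_operator :: "('a::complex_hilbert_space \<rightharpoonup> 'a) \<Rightarrow> ('a \<rightharpoonup> 'a)" where
  "adjoint_operator D y =
    (if \<exists>z. \<forall>x\<in>dom D. cinner y (the (D x)) = cinner z x
     then Some (THE z. \<forall>x\<in>dom D. cinner y (the (D x)) = cinner z x)
     else None)"

definition self_adjoint :: "('a::complex_hilbert_space \<rightharpoonup> 'a) \<Rightarrow> bool" where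
  "self_adjoint D \<longleftrightarrow>
    linear_operator D \<and> closure (dom D) = UNIV \<and> adjoint_operator D = D"

definition perturb :: "('a::complex_hilbert_space \<rightharpoonup> 'a) \<Rightarrow> ('a \<Rightarrow> 'a) \<Rightarrow> ('a \<rightharpoonup> 'a)" where
  "perturb D V = (\<lambda>x. map_option (\<lambda>w. w + V x) (D x))"

definition resolvent :: "('a::complex_hilbert_space \<rightharpoonup> 'a) \<Rightarrow> complex \<Rightarrow> 'a \<Rightarrow> 'a" where
  "resolvent D z y = (THE x. x \<in> dom D \<and> the (D x) - z *\<^sub>C x = y)"


section \<open>Functional calculus\<close>

definition projection_valued_measure ::
    "(real set \<Rightarrow> 'a::complex_hilbert_space \<Rightarrow> 'a) \<Rightarrow> bool" where
  "projection_valued_measure E \<longleftrightarrow>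
    (\<forall>A\<in>sets borel. bounded_self_adjoint (E A)) \<and>
    (\<forall>A\<in>sets borel. \<forall>B\<in>sets borel. E (A \<inter> B) = E A \<circ> E B) \<and>
    E UNIV = id \<and>
    (\<forall>A :: nat \<Rightarrow> real set. range A \<subseteq> sets borel \<longrightarrow> disjoint_family A \<longrightarrow>
      (\<forall>x. (\<lambda>i. E (A i) x) sums E (\<Union>i. A i) x))"

definition pvm_measure ::
    "(real set \<Rightarrow> 'a::complex_hilbert_space \<Rightarrow> 'a) \<Rightarrow> 'a \<Rightarrow> real measure" where
  "pvm_measure E x = measure_of UNIV (sets borel) (\<lambda>A. ennreal (Re (cinner x (E A x))))"

text \<open>\<open>D = \<integral> t dE(t)\<close>, including equality of domains. By polarization the diagonal matrix
  elements determine the operator, both here and in the definition of \<open>f(D)\<close>.\<close>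

definition spectral_resolution ::
    "('a::complex_hilbert_space \<rightharpoonup> 'a) \<Rightarrow> (real set \<Rightarrow> 'a \<Rightarrow> 'a) \<Rightarrow> bool" where
  "spectral_resolution D E \<longleftrightarrow>
    projection_valued_measure E \<and>
    dom D = {x. integrable (pvm_measure E x) (\<lambda>t. t\<^sup>2)} \<and>
    (\<forall>x\<in>dom D. cinner x (the (D x)) = complex_of_real (\<integral>t. t \<partial>pvm_measure E x))"

text \<open>For self-adjoint \<open>D\<close> the choice is unique on Borel sets.\<close>

definition spectral_measure ::
    "('a::complex_hilbert_space \<rightharpoonup> 'a) \<Rightarrow> real set \<Rightarrow> 'a \<Rightarrow> 'a" where
  "spectral_measure D = (SOME E. spectral_resolution D E)"

text \<open>The operator \<open>f(D)\<close> for bounded Borel functions \<open>f\<close>.\<close>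

definition fun_calc ::
    "(real \<Rightarrow> complex) \<Rightarrow> ('a::complex_hilbert_space \<rightharpoonup> 'a) \<Rightarrow> 'a \<Rightarrow> 'a" where
  "fun_calc f D = (THE T. bounded_clinear T \<and>
    (\<forall>x. cinner x (T x) = (\<integral>t. f t \<partial>pvm_measure (spectral_measure D) x)))"


section \<open>Fourier transforms and function classes\<close>

definition nderiv :: "nat \<Rightarrow> (real \<Rightarrow> complex) \<Rightarrow> real \<Rightarrow> complex" where
  "nderiv k = (\<lambda>g x. vector_derivative g (at x)) ^^ k"

definition C_n :: "nat \<Rightarrow> (real \<Rightarrow> complex) \<Rightarrow> bool" where
  "C_n n f \<longleftrightarrow>
    (\<forall>k<n. \<forall>x. nderiv k f differentiable (at x)) \<and> continuous_on UNIV (nderiv n f)"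

definition schwartz :: "(real \<Rightarrow> complex) \<Rightarrow> bool" where
  "schwartz \<phi> \<longleftrightarrow>
    (\<forall>n. C_n n \<phi>) \<and> (\<forall>a k. bounded (range (\<lambda>x. complex_of_real x ^ a * nderiv k \<phi> x)))"

definition fourier :: "(real \<Rightarrow> complex) \<Rightarrow> real \<Rightarrow> complex" where
  "fourier \<phi> x = (\<integral>y. \<phi> y * exp (- (\<i> * of_real (y * x))) / of_real (2 * pi) \<partial>lborel)"

text \<open>The distributional Fourier transform of \<open>g\<close> is the integrable function \<open>h\<close>. Since the
  Fourier transform is onto the Schwartz space, the first condition on \<open>\<phi>\<close> says that \<open>g\<close> acts
  by integration on all Schwartz functions; it always holds if the transform of \<open>g\<close> is
  integrable, as \<open>g\<close> is bounded in that case.\<close>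

definition has_L1_fourier :: "(real \<Rightarrow> complex) \<Rightarrow> (real \<Rightarrow> complex) \<Rightarrow> bool" where
  "has_L1_fourier g h \<longleftrightarrow>
    integrable lborel h \<and>
    (\<forall>\<phi>. schwartz \<phi> \<longrightarrow> integrable lborel (\<lambda>x. g x * fourier \<phi> x) \<and>
      (\<integral>x. g x * fourier \<phi> x \<partial>lborel) = (\<integral>x. h x * \<phi> x \<partial>lborel))"

text \<open>Determined up to null sets.\<close>

definition fourier_L1 :: "(real \<Rightarrow> complex) \<Rightarrow> real \<Rightarrow> complex" where
  "fourier_L1 g = (SOME h. has_L1_fourier g h)"

definition L1_norm :: "(real \<Rightarrow> complex) \<Rightarrow> real" where
  "L1_norm h = (\<integral>x. cmod (h x) \<partial>lborel)"

definition u_weight :: "real \<Rightarrow> complex" where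
  "u_weight x = of_real x - \<i>"

definition W_class :: "nat \<Rightarrow> nat \<Rightarrow> (real \<Rightarrow> complex) set" where
  "W_class s n = {f. C_n n f \<and>
    (\<forall>m\<le>s. \<forall>k\<le>n. \<exists>h. has_L1_fourier (nderiv k (\<lambda>x. f x * u_weight x ^ m)) h)}"

definition c_const :: "nat \<Rightarrow> nat \<Rightarrow> (real \<Rightarrow> complex) \<Rightarrow> real" where
  "c_const s n f = (\<Sum>k=0..min s n. real (s choose k) *
    L1_norm (fourier_L1 (nderiv (n - k) (\<lambda>x. f x * u_weight x ^ (s - k)))) / fact (n - k))"


section \<open>Multiple operator integrals\<close>

text \<open>The standard measure on the simplex \<open>{s \<ge> 0. s\<^sub>0 + \<dots> + s\<^sub>n = 1}\<close>: Lebesgue measure in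
  the coordinates \<open>s\<^sub>1, \<dots>, s\<^sub>n\<close>, which has total mass \<open>1 / n!\<close>.\<close>

definition simplex_measure :: "nat \<Rightarrow> (nat \<Rightarrow> real) measure" where
  "simplex_measure n =
    distr (restrict_space (\<Pi>\<^sub>M j\<in>{1..n}. lborel)
             {t. (\<forall>j\<in>{1..n}. 0 \<le> t j) \<and> (\<Sum>j=1..n. t j) \<le> 1})
      (\<Pi>\<^sub>M j\<in>{0..n}. borel)
      (\<lambda>t. \<lambda>j\<in>{0..n}. if j = 0 then 1 - (\<Sum>k=1..n. t k) else t j)"

primrec alternating_comp :: "(nat \<Rightarrow> 'a \<Rightarrow> 'a) \<Rightarrow> (nat \<Rightarrow> 'a \<Rightarrow> 'a) \<Rightarrow> nat \<Rightarrow> 'a \<Rightarrow> 'a" where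
  "alternating_comp U V 0 = U 0"
| "alternating_comp U V (Suc n) = alternating_comp U V n \<circ> V (Suc n) \<circ> U (Suc n)"

text \<open>The operators are \<open>D 0, \<dots>, D n\<close> and \<open>V 1, \<dots>, V n\<close>.\<close>

definition moi ::
    "nat \<Rightarrow> (nat \<Rightarrow> ('a::{complex_hilbert_space, second_countable_topology} \<rightharpoonup> 'a)) \<Rightarrow>
     (real \<Rightarrow> complex) \<Rightarrow> (nat \<Rightarrow> 'a \<Rightarrow> 'a) \<Rightarrow> 'a \<Rightarrow> 'a" where
  "moi n D f V =
    (if n = 0 then fun_calc f (D 0)
     else (\<lambda>y. \<integral>s. (\<integral>t. fourier_L1 (nderiv n f) t *\<^sub>C
         alternating_comp (\<lambda>j. fun_calc (\<lambda>x. exp (\<i> * of_real (t * s j * x))) (D j)) V n y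
       \<partial>lborel) \<partial>simplex_measure n))"

end

theory Submission
  imports Defs "HOL-Probability.Probability"
begin

text \<open>The estimate rests on one algebraic identity. The weight \<open>u(x) = x - \<i>\<close> is affine, so the Leibniz
  rule for the divided differences of \<open>f u\<close> has two terms only:
  \<open>(f u)\<^sup>[\<^sup>n\<^sup>](x\<^sub>0, \<dots>, x\<^sub>n) = u(x\<^sub>n) f\<^sup>[\<^sup>n\<^sup>](x\<^sub>0, \<dots>, x\<^sub>n) + f\<^sup>[\<^sup>n\<^sup>-\<^sup>1\<^sup>](x\<^sub>0, \<dots>, x\<^sub>n\<^sub>-\<^sub>1)\<close>.
  For multiple operator integrals and the resolvent \<open>R\<close> of \<open>D\<close> at \<open>\<i>\<close> this reads
  \<open>T(f, n) = (T(f u, n) - T(f, n - 1) V\<^sub>n) R\<close> (lemma \<open>moi_Suc_resolvent\<close>); for \<open>n = 0\<close> it is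
  \<open>f(D) = (f u)(D) R\<close>. Each use exchanges one power of the weight for one factor \<open>R\<close>. After \<open>s\<close> uses
  the operator is a sum of words \<open>A\<^sub>0 R A\<^sub>1 R \<dots> R A\<^sub>s\<close>, in which \<open>A\<^sub>0\<close> comes from a multiple operator
  integral with symbol \<open>(f u\<^sup>s\<^sup>-\<^sup>k)\<^sup>[\<^sup>n\<^sup>-\<^sup>k\<^sup>]\<close>. Its norm is controlled by the \<open>L\<^sup>1\<close> norm of the Fourier
  transform of \<open>(f u\<^sup>s\<^sup>-\<^sup>k)\<^sup>(\<^sup>n\<^sup>-\<^sup>k\<^sup>)\<close>, times the volume \<open>1 / (n - k)!\<close> of the simplex.
  Pascal's rule counts the words with a given \<open>k\<close>, and this is where the binomial coefficients of
  \<open>c_const\<close> come from (\<open>c_const_Suc_Suc\<close>, \<open>moi_R_word\<close>). A perturbation of the first operator is met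
  only after \<open>n\<close> has come down to \<open>0\<close>: the resolvent of \<open>D + B\<close> is \<open>A R\<close> with \<open>\<parallel>A\<parallel> \<le> 1 + \<parallel>B\<parallel>\<close>, so it
  costs at most \<open>(1 + \<parallel>B\<parallel>)\<^sup>s\<close>.

  A word with \<open>s\<close> factors \<open>R\<close> has trace norm at most \<open>\<parallel>A\<^sub>0\<parallel> \<dots> \<parallel>A\<^sub>s\<parallel> \<parallel>R\<parallel>\<^sub>s\<^sup>s\<close> by Hoelder's inequality. For
  equal normal factors there is a direct argument: \<open>|R|\<close> is the integral over \<open>\<tau> > 0\<close> of its spectral
  projections \<open>P\<^sub>\<tau>\<close> for \<open>(\<tau>, \<infinity>)\<close>. In a word with projections \<open>P\<^sub>\<tau>\<^sub>1, \<dots>, P\<^sub>\<tau>\<^sub>s\<close> in place of the \<open>R\<close>, the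
  trace norm is at most the rank of the smallest projection times the norms of the other factors, and
  integrating the rank of the smallest projection over all \<open>\<tau>\<^sub>j\<close> gives the sum of the \<open>|\<rho>|\<^sup>s\<close> over the
  eigenvalues \<open>\<rho>\<close> of \<open>R\<close> (\<open>R_word_truncated_bound\<close>, \<open>R_word_trace_class\<close>).

  The operator identity is reduced to the scalar one by diagonalization. A Schatten class resolvent
  is compact, so \<open>D\<close> and \<open>D + B\<close> have orthonormal bases of eigenvectors (\<open>self_adjoint_eigenbasis\<close>), and
  the functional calculus acts diagonally on them (\<open>fun_calc_eigenbasis\<close>). Fourier inversion
  identifies the symbol of the multiple operator integral as the divided difference in the form of
  Hermite and Genocchi, and truncation to finitely many eigenvectors expresses the integral as a limit
  of finite sums of divided differences (\<open>moi_tendsto\<close>). On an eigenvector of the last operator the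
  Leibniz rule applies to each summand. The Leibniz rule itself is the divergence theorem on the
  simplex, regarded as a cone over one of its faces (\<open>simplex_integration_by_parts\<close>).\<close>

section \<open>Complex Hilbert spaces\<close>

lemma scaleC_one [simp]: "1 *\<^sub>C x = (x::'a::complex_hilbert_space)"
  using scaleC_of_real[of 1 x] by simp

lemma scaleC_zero_left [simp]: "0 *\<^sub>C x = (0::'a::complex_hilbert_space)"
  using scaleC_of_real[of 0 x] by simp

lemma scaleC_zero_right [simp]: "a *\<^sub>C (0::'a::complex_hilbert_space) = 0"
  using scaleC_add_right[of a 0 0] by simp

lemma scaleC_minus_left: "(- a) *\<^sub>C x = - (a *\<^sub>C (x::'a::complex_hilbert_space))"
  using scaleC_add_left[of a "-a" x] by (simp add: eq_neg_iff_add_eq_0 add.commute)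

lemma scaleC_minus_right: "a *\<^sub>C (- x) = - (a *\<^sub>C (x::'a::complex_hilbert_space))"
  using scaleC_add_right[of a x "-x"] by (simp add: eq_neg_iff_add_eq_0 add.commute)

lemma scaleC_diff_right: "a *\<^sub>C (x - y) = a *\<^sub>C x - a *\<^sub>C (y::'a::complex_hilbert_space)"
  using scaleC_add_right[of a x "-y"] by (simp add: scaleC_minus_right)

lemma scaleR_scaleC: "r *\<^sub>R x = complex_of_real r *\<^sub>C (x::'a::complex_hilbert_space)"
  by (simp add: scaleC_of_real)

lemma scaleC_sum_right: "a *\<^sub>C (\<Sum>i\<in>I. g i) = (\<Sum>i\<in>I. a *\<^sub>C (g i :: 'a::complex_hilbert_space))"
  by (induction I rule: infinite_finite_induct) (simp_all add: scaleC_add_right)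

lemma cinner_add_left: "cinner (x + y) z = cinner x z + cinner y (z::'a::complex_hilbert_space)"
  by (metis cinner_add_right cinner_commute complex_cnj_add)

lemma cinner_scaleC_left: "cinner (a *\<^sub>C x) y = cnj a * cinner x (y::'a::complex_hilbert_space)"
  by (metis cinner_scaleC_right cinner_commute complex_cnj_mult)

lemma cinner_zero_right [simp]: "cinner x (0::'a::complex_hilbert_space) = 0"
  using cinner_add_right[of x 0 0] by simp

lemma cinner_zero_left [simp]: "cinner 0 (x::'a::complex_hilbert_space) = 0"
  using cinner_add_left[of 0 0 x] by simp

lemma cinner_minus_right: "cinner x (- y) = - cinner x (y::'a::complex_hilbert_space)"
  using cinner_add_right[of x y "-y"] by (simp add: eq_neg_iff_add_eq_0 add.commute)

lemma cinner_minus_left: "cinner (- x) y = - cinner x (y::'a::complex_hilbert_space)"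
  using cinner_add_left[of x "-x" y] by (simp add: eq_neg_iff_add_eq_0 add.commute)

lemma cinner_diff_right: "cinner x (y - z) = cinner x y - cinner x (z::'a::complex_hilbert_space)"
  using cinner_add_right[of x y "-z"] by (simp add: cinner_minus_right)

lemma cinner_diff_left: "cinner (x - y) z = cinner x z - cinner y (z::'a::complex_hilbert_space)"
  using cinner_add_left[of x "-y" z] by (simp add: cinner_minus_left)

lemma cinner_scaleR_right: "cinner x (r *\<^sub>R y) = of_real r * cinner x (y::'a::complex_hilbert_space)"
  by (simp add: scaleR_scaleC cinner_scaleC_right)

lemma cinner_scaleR_left: "cinner (r *\<^sub>R x) y = of_real r * cinner x (y::'a::complex_hilbert_space)"
  by (simp add: scaleR_scaleC cinner_scaleC_left)

lemma cinner_sum_right: "cinner x (\<Sum>i\<in>I. g i) = (\<Sum>i\<in>I. cinner x (g i :: 'a::complex_hilbert_space))"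
  by (induction I rule: infinite_finite_induct) (simp_all add: cinner_add_right)

lemma cinner_sum_left: "cinner (\<Sum>i\<in>I. g i) x = (\<Sum>i\<in>I. cinner (g i :: 'a::complex_hilbert_space) x)"
  by (induction I rule: infinite_finite_induct) (simp_all add: cinner_add_left)

lemmas cinner_simps = cinner_add_left cinner_add_right cinner_diff_left cinner_diff_right
  cinner_scaleC_left cinner_scaleC_right cinner_minus_left cinner_minus_right

lemma cinner_self: "cinner x x = complex_of_real ((norm (x::'a::complex_hilbert_space))\<^sup>2)"
proof -
  have "Im (cinner x x) = 0"
    using cinner_commute[of x x] by (metis complex_cnj_cancel_iff complex_In_mult_cnj_zero
        Reals_cnj_iff complex_is_Real_iff)
  moreover have "Re (cinner x x) = (norm x)\<^sup>2"
    using cinner_ge_zero[of x] by (simp add: norm_eq_sqrt_cinner)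
  ultimately show ?thesis by (simp add: complex_eq_iff)
qed

lemma norm_add_sq:
  "(norm (x + y))\<^sup>2 = (norm x)\<^sup>2 + 2 * Re (cinner x y) + (norm (y::'a::complex_hilbert_space))\<^sup>2"
proof -
  have "cinner (x + y) (x + y) = cinner x x + cinner x y + cnj (cinner x y) + cinner y y"
    by (simp add: cinner_simps cinner_commute[of y x])
  then have "Re (cinner (x + y) (x + y)) = Re (cinner x x + cinner x y + cnj (cinner x y) + cinner y y)"
    by simp
  then show ?thesis by (simp add: cinner_self)
qed

lemma norm_diff_sq:
  "(norm (x - y))\<^sup>2 = (norm x)\<^sup>2 - 2 * Re (cinner x y) + (norm (y::'a::complex_hilbert_space))\<^sup>2"
  using norm_add_sq[of x "-y"] by (simp add: cinner_minus_right)

lemma norm_scaleC: "norm (a *\<^sub>C x) = cmod a * norm (x::'a::complex_hilbert_space)"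
proof -
  have "complex_of_real ((norm (a *\<^sub>C x))\<^sup>2) = (cnj a * a) * complex_of_real ((norm x)\<^sup>2)"
    by (simp only: cinner_self[symmetric] cinner_scaleC_left cinner_scaleC_right ac_simps)
  also have "cnj a * a = complex_of_real ((cmod a)\<^sup>2)"
    by (metis complex_norm_square mult.commute)
  finally have "(norm (a *\<^sub>C x))\<^sup>2 = (cmod a * norm x)\<^sup>2"
    by (metis of_real_eq_iff of_real_mult power_mult_distrib)
  then show ?thesis by (simp add: power2_eq_iff_nonneg)
qed

lemma Cauchy_Schwarz: "cmod (cinner x y) \<le> norm x * norm (y::'a::complex_hilbert_space)"
proof (cases "y = 0")
  case False
  \<comment> \<open>The orthogonal projection of \<open>x\<close> to the line through \<open>y\<close> is \<open>c y\<close>.\<close>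
  define c where "c = cinner y x / of_real ((norm y)\<^sup>2)"
  have cm: "cmod c = cmod (cinner x y) / (norm y)\<^sup>2"
    unfolding c_def norm_divide by (simp only: cinner_commute[of y x] complex_mod_cnj norm_of_real) simp
  have 0: "0 \<le> (norm (x - c *\<^sub>C y))\<^sup>2" by simp
  have 1: "(norm (x - c *\<^sub>C y))\<^sup>2 = (norm x)\<^sup>2 - 2 * Re (c * cinner x y) + (cmod c)\<^sup>2 * (norm y)\<^sup>2"
    by (simp add: norm_diff_sq cinner_scaleC_right norm_scaleC power_mult_distrib)
  have 2: "c * cinner x y = of_real ((cmod (cinner x y))\<^sup>2 / (norm y)\<^sup>2)"
    unfolding c_def cinner_commute[of y x]
    using complex_norm_square[of "cinner x y"] by (simp add: mult.commute)
  have 3: "(cmod c)\<^sup>2 * (norm y)\<^sup>2 = (cmod (cinner x y))\<^sup>2 / (norm y)\<^sup>2"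
    using False unfolding cm by (simp add: power2_eq_square)
  have "(cmod (cinner x y))\<^sup>2 / (norm y)\<^sup>2 \<le> (norm x)\<^sup>2"
    using 0 unfolding 1 2 3 Re_complex_of_real by linarith
  then have "(cmod (cinner x y))\<^sup>2 \<le> (norm x * norm y)\<^sup>2"
    using False by (simp add: pos_divide_le_eq power_mult_distrib)
  then show ?thesis by (rule power2_le_imp_le) simp
qed simp

lemma bounded_bilinear_scaleC:
  "bounded_bilinear (scaleC :: complex \<Rightarrow> 'a \<Rightarrow> 'a::complex_hilbert_space)"
  by (rule bounded_bilinear.intro)
    (auto simp: scaleC_add_left scaleC_add_right scaleR_scaleC scaleC_scaleC norm_scaleC
      scaleR_conv_of_real mult.commute intro!: exI[of _ 1])

lemma bounded_bilinear_cinner: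
  "bounded_bilinear (cinner :: 'a \<Rightarrow> 'a::complex_hilbert_space \<Rightarrow> complex)"
  by (rule bounded_bilinear.intro)
    (auto simp: cinner_simps cinner_scaleR_left cinner_scaleR_right scaleR_conv_of_real
      intro!: exI[of _ 1] Cauchy_Schwarz)

lemmas bounded_linear_scaleC_right = bounded_bilinear.bounded_linear_right[OF bounded_bilinear_scaleC]
lemmas bounded_linear_scaleC_left = bounded_bilinear.bounded_linear_left[OF bounded_bilinear_scaleC]
lemmas bounded_linear_cinner_right = bounded_bilinear.bounded_linear_right[OF bounded_bilinear_cinner]
lemmas bounded_linear_cinner_left = bounded_bilinear.bounded_linear_left[OF bounded_bilinear_cinner]
lemmas tendsto_scaleC [tendsto_intros] = bounded_bilinear.tendsto[OF bounded_bilinear_scaleC]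
lemmas tendsto_cinner [tendsto_intros] = bounded_bilinear.tendsto[OF bounded_bilinear_cinner]
lemmas continuous_on_scaleC [continuous_intros] = bounded_bilinear.continuous_on[OF bounded_bilinear_scaleC]
lemmas continuous_on_cinner [continuous_intros] = bounded_bilinear.continuous_on[OF bounded_bilinear_cinner]

lemma borel_measurable_scaleC [measurable (raw)]:
  fixes g :: "'b \<Rightarrow> 'a::{complex_hilbert_space, second_countable_topology}"
  assumes "f \<in> borel_measurable M" "g \<in> borel_measurable M"
  shows "(\<lambda>x. f x *\<^sub>C g x) \<in> borel_measurable M"
  using assms by (rule borel_measurable_continuous_Pair) (intro continuous_intros)

lemma cinner_eqI: "(\<And>z. cinner z x = cinner z y) \<Longrightarrow> x = (y::'a::complex_hilbert_space)"
proof -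
  assume "\<And>z. cinner z x = cinner z y"
  then have "cinner (x - y) (x - y) = 0" by (simp add: cinner_diff_right)
  then show ?thesis by (simp add: cinner_self)
qed

lemma cinner_eqI_left: "(\<And>z. cinner x z = cinner y z) \<Longrightarrow> x = (y::'a::complex_hilbert_space)"
  by (rule cinner_eqI) (metis cinner_commute)

lemma cinner_zero_comm: "cinner x y = 0 \<longleftrightarrow> cinner y (x::'a::complex_hilbert_space) = 0"
  by (metis cinner_commute complex_cnj_zero)

subsection \<open>Bounded operators\<close>

lemma bounded_clinear_bounded_linear: "bounded_clinear T \<Longrightarrow> bounded_linear T"
  and bounded_clinear_scaleC: "bounded_clinear T \<Longrightarrow> T (c *\<^sub>C x) = c *\<^sub>C T x"
  by (simp_all add: bounded_clinear_def)

lemma bounded_clinear_add: "bounded_clinear T \<Longrightarrow> T (x + y) = T x + T y"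
  by (simp add: bounded_clinear_def linear_simps)

lemma bounded_clinear_diff: "bounded_clinear T \<Longrightarrow> T (x - y) = T x - T y"
  by (simp add: bounded_clinear_def linear_simps)

lemma bounded_clinear_minus: "bounded_clinear T \<Longrightarrow> T (- x) = - T x"
  by (simp add: bounded_clinear_def linear_simps)

lemma bounded_clinear_zero: "bounded_clinear T \<Longrightarrow> T 0 = 0"
  by (simp add: bounded_clinear_def linear_simps)

lemma bounded_clinear_sum: "bounded_clinear T \<Longrightarrow> T (\<Sum>i\<in>I. g i) = (\<Sum>i\<in>I. T (g i))"
  by (simp add: bounded_clinear_def linear_sum bounded_linear.linear)

lemmas bounded_clinear_simps = bounded_clinear_add bounded_clinear_diff bounded_clinear_minus
  bounded_clinear_zero bounded_clinear_sum bounded_clinear_scaleC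

lemma bounded_clinearI:
  assumes "\<And>x y. T (x + y) = T x + T y" "\<And>c x. T (c *\<^sub>C x) = c *\<^sub>C T x"
    "\<And>x. norm (T x) \<le> K * norm x"
  shows "bounded_clinear T"
  unfolding bounded_clinear_def
  by (intro conjI allI assms bounded_linear_intro[where K = K])
    (simp_all add: assms scaleR_scaleC mult.commute)

lemma norm_le_onorm: "bounded_clinear T \<Longrightarrow> norm (T x) \<le> onorm T * norm x"
  by (simp add: bounded_clinear_def onorm)

lemma onorm_nonneg: "bounded_clinear T \<Longrightarrow> 0 \<le> onorm T"
  by (simp add: bounded_clinear_def onorm_pos_le)

lemma bounded_clinear_id [simp]: "bounded_clinear (\<lambda>x. x)" "bounded_clinear id"
  by (auto intro!: bounded_clinearI[where K = 1])

lemma bounded_clinear_const_zero [simp]: "bounded_clinear (\<lambda>x. 0)"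
  by (auto intro!: bounded_clinearI[where K = 1])

lemma bounded_clinear_comp: "bounded_clinear S \<Longrightarrow> bounded_clinear T \<Longrightarrow> bounded_clinear (S \<circ> T)"
  unfolding bounded_clinear_def by (auto simp: o_def intro: bounded_linear_compose)

lemma bounded_clinear_compose:
  "bounded_clinear S \<Longrightarrow> bounded_clinear T \<Longrightarrow> bounded_clinear (\<lambda>x. S (T x))"
  using bounded_clinear_comp[of S T] by (simp add: o_def)

lemma bounded_clinear_plus:
  "bounded_clinear S \<Longrightarrow> bounded_clinear T \<Longrightarrow> bounded_clinear (\<lambda>x. S x + T x)"
  unfolding bounded_clinear_def by (auto simp: scaleC_add_right intro: bounded_linear_add)

lemma bounded_clinear_sub:
  "bounded_clinear S \<Longrightarrow> bounded_clinear T \<Longrightarrow> bounded_clinear (\<lambda>x. S x - T x)"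
  unfolding bounded_clinear_def by (auto simp: scaleC_diff_right intro: bounded_linear_sub)

lemma bounded_clinear_scaled: "bounded_clinear S \<Longrightarrow> bounded_clinear (\<lambda>x. c *\<^sub>C S x)"
  unfolding bounded_clinear_def
  by (auto simp: scaleC_scaleC mult.commute bounded_linear_compose[OF bounded_linear_scaleC_right])

lemma bounded_clinear_sum_fun:
  "(\<And>i. i \<in> I \<Longrightarrow> bounded_clinear (S i)) \<Longrightarrow> bounded_clinear (\<lambda>x. \<Sum>i\<in>I. S i x)"
  by (induction I rule: infinite_finite_induct) (simp_all add: bounded_clinear_plus)

lemma bounded_clinear_rank_one: "bounded_clinear (\<lambda>x. cinner e x *\<^sub>C z)"
proof (rule bounded_clinearI[where K = "norm e * norm z"])
  show "norm (cinner e x *\<^sub>C z) \<le> norm e * norm z * norm x" for x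
    unfolding norm_scaleC mult.assoc mult.commute[of "norm z" "norm x"] unfolding mult.assoc[symmetric]
    by (intro mult_right_mono Cauchy_Schwarz norm_ge_zero)
qed (simp_all add: cinner_simps scaleC_add_left scaleC_scaleC)

lemma bounded_clinear_pow: "bounded_clinear T \<Longrightarrow> bounded_clinear (T ^^ n)"
  by (induction n) (simp_all add: bounded_clinear_comp)

lemma bounded_clinear_tendsto: 
  "bounded_clinear T \<Longrightarrow> (g \<longlongrightarrow> l) F \<Longrightarrow> ((\<lambda>n. T (g n)) \<longlongrightarrow> T l) F"
  by (simp add: bounded_clinear_def bounded_linear.tendsto)

lemma bounded_clinear_continuous_on: "bounded_clinear T \<Longrightarrow> continuous_on S T"
  by (simp add: bounded_clinear_def linear_continuous_on)

text \<open>The forms at \<open>z + x\<close> and \<open>z + \<i> x\<close> determine the sum and the difference of \<open>\<langle>z, S x\<rangle>\<close> and \<open>\<langle>x, S z\<rangle>\<close>. Real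
  scalars would give only the sum.\<close>

lemma polarization:
  fixes S T :: "'a::complex_hilbert_space \<Rightarrow> 'a"
  assumes "bounded_clinear S" "bounded_clinear T" "\<And>x. cinner x (S x) = cinner x (T x)"
  shows "S = T"
proof
  fix x
  show "S x = T x"
  proof (rule cinner_eqI)
    fix z
    have 1: "cinner z (S x) + cinner x (S z) = cinner z (T x) + cinner x (T z)"
      using assms(3)[of "z + x"] assms(3)[of z] assms(3)[of x]
      by (simp add: cinner_simps assms(1,2) bounded_clinear_simps) (metis add.commute)
    have "\<i> * (cinner z (S x) - cinner x (S z)) = \<i> * (cinner z (T x) - cinner x (T z))"
      using assms(3)[of "z + \<i> *\<^sub>C x"] assms(3)[of z] assms(3)[of x]
      by (simp add: cinner_simps assms(1,2) bounded_clinear_simps algebra_simps)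
    then have 2: "cinner z (S x) - cinner x (S z) = cinner z (T x) - cinner x (T z)" by simp
    show "cinner z (S x) = cinner z (T x)"
      using arg_cong2[OF 1 2, where f = "(+)"] by simp
  qed
qed

subsection \<open>Orthogonal projection and adjoints\<close>

definition csubspace :: "'a::complex_hilbert_space set \<Rightarrow> bool" where
  "csubspace M \<longleftrightarrow> 0 \<in> M \<and> (\<forall>x\<in>M. \<forall>y\<in>M. x + y \<in> M) \<and> (\<forall>c. \<forall>x\<in>M. c *\<^sub>C x \<in> M)"

text \<open>A minimizing sequence for the distance from \<open>x\<close> to \<open>M\<close> is Cauchy by the parallelogram identity, and
  perturbing the minimizer in the direction of \<open>z\<close> shows that the error is orthogonal to \<open>z\<close>.\<close>

theorem orthogonal_projection:
  fixes M :: "'a::complex_hilbert_space set"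
  assumes M: "csubspace M" "closed M"
  obtains m where "m \<in> M" "\<And>z. z \<in> M \<Longrightarrow> cinner z (x - m) = 0"
proof -
  define d where "d = (INF z\<in>M. norm (x - z))"
  have ne: "M \<noteq> {}" using M by (auto simp: csubspace_def)
  have bdd: "bdd_below ((\<lambda>z. norm (x - z)) ` M)" by (rule bdd_belowI[of _ 0]) auto
  have d_le: "d \<le> norm (x - z)" if "z \<in> M" for z
    unfolding d_def using bdd that by (rule cINF_lower)
  have d0: "d \<ge> 0" unfolding d_def using ne by (intro cINF_greatest) auto
  have "\<exists>z\<in>M. norm (x - z) < d + 1 / real (Suc n)" for n
    using cINF_less_iff[OF ne bdd, of "d + 1 / real (Suc n)"] by (auto simp: d_def[symmetric])
  then obtain z where z: "\<And>n. z n \<in> M" "\<And>n. norm (x - z n) < d + 1 / real (Suc n)" by metis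
  have lim: "(\<lambda>n. norm (x - z n)) \<longlonglongrightarrow> d"
  proof (rule tendsto_sandwich[where f = "\<lambda>_. d" and h = "\<lambda>n. d + 1 / real (Suc n)"])
    show "(\<lambda>n. d + 1 / real (Suc n)) \<longlonglongrightarrow> d"
      using tendsto_add[OF tendsto_const LIMSEQ_inverse_real_of_nat, of d]
      by (simp add: inverse_eq_divide)
    show "\<forall>\<^sub>F n in sequentially. norm (x - z n) \<le> d + 1 / real (Suc n)"
      using z(2) by (intro always_eventually allI less_imp_le)
  qed (use z d_le in auto)
  have par: "(norm (z m - z n))\<^sup>2 \<le> 2 * (norm (x - z m))\<^sup>2 + 2 * (norm (x - z n))\<^sup>2 - 4 * d\<^sup>2" for m n
  proof -
    have "(1/2) *\<^sub>C (z m + z n) \<in> M" using M z by (simp add: csubspace_def)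
    moreover have "(x - z m) + (x - z n) = 2 *\<^sub>C (x - (1/2) *\<^sub>C (z m + z n))"
      using scaleC_of_real[of 2 x] by (simp add: scaleC_diff_right scaleC_scaleC scaleR_2)
    ultimately have "2 * d \<le> norm ((x - z m) + (x - z n))"
      using d_le[of "(1/2) *\<^sub>C (z m + z n)"] by (simp add: norm_scaleC)
    then have "(2 * d)\<^sup>2 \<le> (norm ((x - z m) + (x - z n)))\<^sup>2" using d0 by (intro power_mono) auto
    moreover have "(norm (z m - z n))\<^sup>2 = (norm ((x - z n) - (x - z m)))\<^sup>2" by simp
    ultimately show ?thesis
      by (simp only: norm_add_sq norm_diff_sq cinner_commute[of "x - z n" "x - z m"]) 
         (simp add: power_mult_distrib)
  qed
  have "Cauchy z"
  proof (rule CauchyI)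
    fix e :: real assume e: "0 < e"
    have "(\<lambda>n. (norm (x - z n))\<^sup>2 - d\<^sup>2) \<longlonglongrightarrow> d\<^sup>2 - d\<^sup>2"
      by (intro tendsto_intros lim)
    then have "eventually (\<lambda>n. (norm (x - z n))\<^sup>2 - d\<^sup>2 < e\<^sup>2 / 4) sequentially"
      using e by (intro order_tendstoD(2)[where y = 0]) auto
    then obtain N where N: "\<And>n. n \<ge> N \<Longrightarrow> (norm (x - z n))\<^sup>2 - d\<^sup>2 < e\<^sup>2 / 4"
      by (auto simp: eventually_sequentially)
    have "norm (z m - z n) < e" if "m \<ge> N" "n \<ge> N" for m n
    proof -
      have "(norm (z m - z n))\<^sup>2 < e\<^sup>2" using par[of m n] N[OF that(1)] N[OF that(2)] by simp
      then show ?thesis by (rule power2_less_imp_less) (use e in simp)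
    qed
    then show "\<exists>N. \<forall>m\<ge>N. \<forall>n\<ge>N. norm (z m - z n) < e" by blast
  qed
  then obtain m where m: "z \<longlonglongrightarrow> m" using Cauchy_convergent convergent_def by blast
  have mM: "m \<in> M" using closed_sequentially[OF M(2)] z m by blast
  have "(\<lambda>n. norm (x - z n)) \<longlonglongrightarrow> norm (x - m)" by (intro tendsto_intros m)
  then have dm: "norm (x - m) = d" using lim LIMSEQ_unique by blast
  have "cinner y (x - m) = 0" if y: "y \<in> M" for y
  proof (cases "y = 0")
    case False
    define c where "c = cinner y (x - m) / of_real ((norm y)\<^sup>2)"
    have "m + c *\<^sub>C y \<in> M" using M mM y by (simp add: csubspace_def)
    from d_le[OF this] have 0: "d\<^sup>2 \<le> (norm ((x - m) - c *\<^sub>C y))\<^sup>2"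
      using d0 by (intro power_mono) (simp_all add: algebra_simps)
    have 1: "(norm ((x - m) - c *\<^sub>C y))\<^sup>2
        = d\<^sup>2 - 2 * Re (c * cinner (x - m) y) + (cmod c)\<^sup>2 * (norm y)\<^sup>2"
      by (simp only: norm_diff_sq[of "x - m"] cinner_scaleC_right norm_scaleC power_mult_distrib dm)
    have 2: "c * cinner (x - m) y = of_real ((cmod (cinner (x - m) y))\<^sup>2 / (norm y)\<^sup>2)"
      unfolding c_def cinner_commute[of y "x - m"]
      using complex_norm_square[of "cinner (x - m) y"] by (simp add: mult.commute)
    have cm: "cmod c = cmod (cinner (x - m) y) / (norm y)\<^sup>2"
      unfolding c_def norm_divide by (simp only: cinner_commute[of y] complex_mod_cnj norm_of_real) simp
    have 3: "(cmod c)\<^sup>2 * (norm y)\<^sup>2 = (cmod (cinner (x - m) y))\<^sup>2 / (norm y)\<^sup>2"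
      using False unfolding cm by (simp add: power2_eq_square)
    have "(cmod (cinner (x - m) y))\<^sup>2 / (norm y)\<^sup>2 \<le> 0"
      using 0 unfolding 1 2 3 Re_complex_of_real by linarith
    then have "cinner (x - m) y = 0" using False by (simp add: divide_le_0_iff)
    then show ?thesis by (simp add: cinner_zero_comm)
  qed simp
  with mM that show ?thesis by blast
qed

text \<open>The kernel of \<open>\<phi>\<close> is a hyperplane; the representing vector is a multiple of the component orthogonal to it
  of a vector outside of it.\<close>

theorem Riesz_representation:
  fixes \<phi> :: "'a::complex_hilbert_space \<Rightarrow> complex"
  assumes add: "\<And>x y. \<phi> (x + y) = \<phi> x + \<phi> y" and scale: "\<And>c x. \<phi> (c *\<^sub>C x) = c * \<phi> x"
    and bound: "\<And>x. cmod (\<phi> x) \<le> K * norm x"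
  obtains z where "\<And>x. \<phi> x = cinner z x"
proof -
  have bl: "bounded_linear \<phi>"
    by (rule bounded_linear_intro[where K = K])
      (simp_all add: add scale bound scaleR_scaleC scaleR_conv_of_real mult.commute)
  define M where "M = {x. \<phi> x = 0}"
  have M: "csubspace M" using scale[of 0 0] by (auto simp: M_def csubspace_def add scale)
  have Mc: "closed M"
    unfolding M_def by (intro closed_Collect_eq linear_continuous_on bl continuous_on_const)
  show ?thesis
  proof (cases "\<forall>x. \<phi> x = 0")
    case True
    then show ?thesis using that[of 0] by simp
  next
    case False
    then obtain x0 where x0: "\<phi> x0 \<noteq> 0" by blast
    obtain m where m: "m \<in> M" "\<And>z. z \<in> M \<Longrightarrow> cinner z (x0 - m) = 0"
      using orthogonal_projection[OF M Mc] by blast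
    define w where "w = x0 - m"
    have pw: "\<phi> w \<noteq> 0"
      using x0 m(1) linear_diff[OF bounded_linear.linear[OF bl]] by (simp add: w_def M_def)
    then have w0: "norm w \<noteq> 0" using scale[of 0 0] by auto
    have "\<phi> x = cinner (cnj (\<phi> w / of_real ((norm w)\<^sup>2)) *\<^sub>C w) x" for x
    proof -
      have "\<phi> (x - (\<phi> x / \<phi> w) *\<^sub>C w) = 0"
        using pw linear_diff[OF bounded_linear.linear[OF bl]] by (simp add: scale)
      then have "x - (\<phi> x / \<phi> w) *\<^sub>C w \<in> M" by (simp add: M_def)
      from m(2)[OF this] have "cinner w (x - (\<phi> x / \<phi> w) *\<^sub>C w) = 0"
        by (simp add: w_def cinner_zero_comm)
      then have "cinner w x = (\<phi> x / \<phi> w) * of_real ((norm w)\<^sup>2)"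
        by (simp add: cinner_simps cinner_self)
      then show ?thesis using pw w0 by (simp add: cinner_scaleC_left)
    qed
    then show ?thesis using that by blast
  qed
qed

lemma adjoint_exists:
  assumes T: "bounded_clinear T"
  shows "\<exists>S. bounded_clinear S \<and> (\<forall>x y. cinner (S x) y = cinner x (T y))"
proof -
  have "\<exists>z. \<forall>y. cinner x (T y) = cinner z y" for x
  proof -
    have "cmod (cinner x (T y)) \<le> (norm x * onorm T) * norm y" for y
      using order_trans[OF Cauchy_Schwarz mult_left_mono[OF norm_le_onorm[OF T]]]
      by (simp add: mult.assoc)
    then show ?thesis
      by (metis (no_types, lifting) Riesz_representation[of "\<lambda>y. cinner x (T y)"]
          cinner_add_right cinner_scaleC_right bounded_clinear_add[OF T] bounded_clinear_scaleC[OF T])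
  qed
  then obtain S where S: "\<And>x y. cinner x (T y) = cinner (S x) y" by metis
  have "bounded_clinear S"
  proof (rule bounded_clinearI)
    show "S (x + y) = S x + S y" for x y
      by (rule cinner_eqI_left) (simp add: cinner_add_left S[symmetric])
    show "S (c *\<^sub>C x) = c *\<^sub>C S x" for c x
      by (rule cinner_eqI_left) (simp add: cinner_scaleC_left S[symmetric])
    show "norm (S x) \<le> onorm T * norm x" for x
    proof (cases "S x = 0")
      case False
      have "(norm (S x))\<^sup>2 = cmod (cinner (S x) (S x))" by (simp add: cinner_self norm_power)
      also have "\<dots> = cmod (cinner x (T (S x)))" by (simp add: S)
      also have "\<dots> \<le> norm x * (onorm T * norm (S x))"
        by (rule order_trans[OF Cauchy_Schwarz mult_left_mono[OF norm_le_onorm[OF T]]]) simp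
      finally show ?thesis using False by (simp add: power2_eq_square mult.commute)
    qed (simp add: onorm_nonneg[OF T])
  qed
  then show ?thesis using S by metis
qed

lemma adj_unique:
  assumes "\<And>x y. cinner (S x) y = cinner x (T y)"
  shows "adj T = S"
  unfolding adj_def
proof (rule the_equality)
  show "S' = S" if "\<forall>x y. cinner (S' x) y = cinner x (T y)" for S'
    by (rule ext, rule cinner_eqI_left) (simp add: that assms)
qed (simp add: assms)

lemma
  assumes "bounded_clinear T"
  shows bounded_clinear_adj: "bounded_clinear (adj T)"
    and cinner_adj: "cinner (adj T x) y = cinner x (T y)"
proof -
  obtain S where S: "bounded_clinear S" "\<And>x y. cinner (S x) y = cinner x (T y)"
    using adjoint_exists[OF assms] by blast
  with adj_unique[of S T] show "bounded_clinear (adj T)" "cinner (adj T x) y = cinner x (T y)" by simp_all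
qed

lemma cinner_adj_right: "bounded_clinear T \<Longrightarrow> cinner x (adj T y) = cinner (T x) y"
  by (metis cinner_adj cinner_commute)

section \<open>Orthonormal bases\<close>

definition orthonormal :: "'a::complex_hilbert_space set \<Rightarrow> bool" where
  "orthonormal S \<longleftrightarrow> (\<forall>e\<in>S. norm e = 1) \<and> (\<forall>e\<in>S. \<forall>e'\<in>S. e \<noteq> e' \<longrightarrow> cinner e e' = 0)"

lemma orthonormal_basis_orthonormal: "orthonormal_basis B \<Longrightarrow> orthonormal B"
  by (simp add: orthonormal_basis_def orthonormal_def)

lemma orthonormal_subset: "orthonormal S \<Longrightarrow> T \<subseteq> S \<Longrightarrow> orthonormal T"
  by (auto simp: orthonormal_def)

lemma orthonormal_cinner:
  "orthonormal S \<Longrightarrow> e \<in> S \<Longrightarrow> e' \<in> S \<Longrightarrow> cinner e e' = (if e = e' then 1 else 0)"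
  by (auto simp: orthonormal_def cinner_self)

text \<open>Zorn's lemma. The set \<open>E\<close> restricts the vectors that may be used; with the eigenvectors of an operator as
  \<open>E\<close> this produces an eigenbasis.\<close>

theorem orthonormal_basis_exists:
  fixes E :: "'a::complex_hilbert_space set"
  assumes ext: "\<And>S. orthonormal S \<Longrightarrow> S \<subseteq> E \<Longrightarrow> (\<exists>x. x \<noteq> 0 \<and> (\<forall>e\<in>S. cinner e x = 0)) \<Longrightarrow>
    \<exists>v\<in>E. norm v = 1 \<and> (\<forall>e\<in>S. cinner e v = 0)"
  obtains B where "orthonormal_basis B" "B \<subseteq> E"
proof -
  define \<A> where "\<A> = {S. orthonormal S \<and> S \<subseteq> E}"
  have "\<exists>M\<in>\<A>. \<forall>X\<in>\<A>. M \<subseteq> X \<longrightarrow> X = M"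
  proof (rule subset_Zorn')
    fix C assume C: "subset.chain \<A> C"
    have "cinner e e' = 0" if "e \<in> X" "X \<in> C" "e' \<in> Y" "Y \<in> C" "e \<noteq> e'" for e e' X Y
    proof -
      from C that have "X \<subseteq> Y \<or> Y \<subseteq> X" by (auto simp: subset.chain_def)
      moreover from C that have "orthonormal X" "orthonormal Y" by (auto simp: subset.chain_def \<A>_def)
      ultimately show ?thesis using that by (auto simp: orthonormal_def)
    qed
    moreover have "norm e = 1" "e \<in> E" if "e \<in> X" "X \<in> C" for e X
      using C that by (auto simp: subset.chain_def \<A>_def orthonormal_def)
    ultimately show "\<Union>C \<in> \<A>" unfolding \<A>_def orthonormal_def by blast
  qed
  then obtain M where M: "M \<in> \<A>" "\<And>X. X \<in> \<A> \<Longrightarrow> M \<subseteq> X \<Longrightarrow> X = M" by blast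
  have "x = 0" if x: "\<forall>e\<in>M. cinner e x = 0" for x
  proof (rule ccontr)
    assume "x \<noteq> 0"
    with ext[of M] M(1) x obtain v where v: "v \<in> E" "norm v = 1" "\<forall>e\<in>M. cinner e v = 0"
      by (auto simp: \<A>_def)
    have "\<forall>e\<in>M. cinner v e = 0" using v(3) cinner_zero_comm by blast
    then have "insert v M \<in> \<A>" using M(1) v by (auto simp: \<A>_def orthonormal_def)
    then have "v \<in> M" using M(2) by blast
    then have "cinner v v = 0" using v by blast
    then show False using v(2) by (simp add: cinner_self)
  qed
  then have "orthonormal_basis M" using M(1) by (simp add: \<A>_def orthonormal_basis_def orthonormal_def)
  moreover have "M \<subseteq> E" using M(1) by (simp add: \<A>_def)
  ultimately show ?thesis by (rule that)
qed

lemma some_orthonormal_basis: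
  "orthonormal_basis (SOME B :: 'a::complex_hilbert_space set. orthonormal_basis B)"
proof -
  obtain B :: "'a set" where "orthonormal_basis B"
  proof (rule orthonormal_basis_exists[of UNIV])
    fix S :: "'a set" assume "\<exists>x. x \<noteq> 0 \<and> (\<forall>e\<in>S. cinner e x = 0)"
    then obtain x where "x \<noteq> 0" "\<forall>e\<in>S. cinner e x = 0" by blast
    then show "\<exists>v\<in>UNIV. norm v = 1 \<and> (\<forall>e\<in>S. cinner e v = 0)"
      by (intro bexI[of _ "(1 / norm x) *\<^sub>R x"]) (auto simp: cinner_scaleR_right)
  qed
  then show ?thesis by (rule someI)
qed

definition proj_on :: "'a::complex_hilbert_space set \<Rightarrow> 'a \<Rightarrow> 'a" where
  "proj_on F x = (\<Sum>e\<in>F. cinner e x *\<^sub>C e)"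

lemma bounded_clinear_proj_on: "bounded_clinear (proj_on F)"
  unfolding proj_on_def by (intro bounded_clinear_sum_fun bounded_clinear_rank_one)

lemma cinner_orthonormal_sum:
  assumes "orthonormal F" "finite F" "e \<in> F"
  shows "cinner e (\<Sum>f\<in>F. c f *\<^sub>C f) = c e"
proof -
  have "cinner e (\<Sum>f\<in>F. c f *\<^sub>C f) = (\<Sum>f\<in>F. if f = e then c f else 0)"
    unfolding cinner_sum_right cinner_scaleC_right
    by (intro sum.cong refl) (auto simp: orthonormal_cinner[OF assms(1)] assms)
  then show ?thesis using assms by simp
qed

lemma norm_orthonormal_sum:
  assumes "orthonormal F" "finite F"
  shows "(norm (\<Sum>e\<in>F. c e *\<^sub>C e))\<^sup>2 = (\<Sum>e\<in>F. (cmod (c e))\<^sup>2)"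
proof -
  have "complex_of_real ((norm (\<Sum>e\<in>F. c e *\<^sub>C e))\<^sup>2) = (\<Sum>e\<in>F. cnj (c e) * c e)"
    unfolding cinner_self[symmetric] cinner_sum_left[of _ F]
    by (intro sum.cong) (simp_all add: cinner_scaleC_left cinner_orthonormal_sum assms)
  also have "\<dots> = complex_of_real (\<Sum>e\<in>F. (cmod (c e))\<^sup>2)"
    unfolding of_real_sum by (intro sum.cong refl) (metis complex_norm_square mult.commute)
  finally show ?thesis using of_real_eq_iff by blast
qed

lemma norm_proj_on:
  "orthonormal F \<Longrightarrow> finite F \<Longrightarrow> (norm (proj_on F x))\<^sup>2 = (\<Sum>e\<in>F. (cmod (cinner e x))\<^sup>2)"
  by (simp add: proj_on_def norm_orthonormal_sum)

lemma norm_diff_proj_on: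
  assumes "orthonormal F" "finite F"
  shows "(norm (x - proj_on F x))\<^sup>2 = (norm x)\<^sup>2 - (\<Sum>e\<in>F. (cmod (cinner e x))\<^sup>2)"
proof -
  have "cinner x (proj_on F x) = complex_of_real (\<Sum>e\<in>F. (cmod (cinner e x))\<^sup>2)"
    unfolding proj_on_def cinner_sum_right cinner_scaleC_right of_real_sum
    by (intro sum.cong refl) (metis complex_norm_square cinner_commute)
  then show ?thesis by (simp add: norm_diff_sq norm_proj_on assms)
qed

lemma Bessel:
  "orthonormal F \<Longrightarrow> finite F \<Longrightarrow> (\<Sum>e\<in>F. (cmod (cinner e x))\<^sup>2) \<le> (norm x)\<^sup>2"
  using norm_diff_proj_on[of F x] by (metis diff_ge_0_iff_ge zero_le_power2)

lemma norm_proj_on_le: "orthonormal F \<Longrightarrow> finite F \<Longrightarrow> norm (proj_on F x) \<le> norm x"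
  by (rule power2_le_imp_le) (simp_all add: norm_proj_on Bessel)

lemma norm_diff_proj_on_le: "orthonormal F \<Longrightarrow> finite F \<Longrightarrow> norm (x - proj_on F x) \<le> norm x"
  by (rule power2_le_imp_le) (simp_all add: norm_diff_proj_on sum_nonneg)

lemma norm_diff_proj_on_mono:
  assumes "orthonormal G" "finite G" "F \<subseteq> G"
  shows "norm (x - proj_on G x) \<le> norm (x - proj_on F x)"
proof (rule power2_le_imp_le)
  have "(\<Sum>e\<in>F. (cmod (cinner e x))\<^sup>2) \<le> (\<Sum>e\<in>G. (cmod (cinner e x))\<^sup>2)"
    using assms by (intro sum_mono2) auto
  then show "(norm (x - proj_on G x))\<^sup>2 \<le> (norm (x - proj_on F x))\<^sup>2"
    using assms by (simp add: norm_diff_proj_on orthonormal_subset finite_subset)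
qed simp

text \<open>The vectors that can be approximated by their partial sums form a closed subspace, which contains the basis,
  so nothing but \<open>0\<close> is orthogonal to it.\<close>

theorem orthonormal_basis_has_sum:
  assumes B: "orthonormal_basis B"
  shows "((\<lambda>e. cinner e x *\<^sub>C e) has_sum x) B"
proof -
  have o: "orthonormal F" if "F \<subseteq> B" for F
    using orthonormal_subset[OF orthonormal_basis_orthonormal[OF B] that] .
  define M where "M = {x. \<forall>\<epsilon>>0. \<exists>F\<subseteq>B. finite F \<and> norm (x - proj_on F x) < \<epsilon>}"
  have MI: "\<exists>F\<subseteq>B. finite F \<and> norm (x - proj_on F x) < \<epsilon>" if "x \<in> M" "\<epsilon> > 0" for x \<epsilon>
    using that by (auto simp: M_def)
  have "csubspace M"
    unfolding csubspace_def
  proof (intro conjI ballI allI)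
    show "0 \<in> M" unfolding M_def
      by (auto intro!: exI[of _ "{}"] simp: proj_on_def)
    fix x assume x: "x \<in> M"
    {
      fix y assume y: "y \<in> M"
      show "x + y \<in> M" unfolding M_def
      proof (clarify)
        fix \<epsilon> :: real assume "\<epsilon> > 0"
        then obtain F G where FG: "F \<subseteq> B" "finite F" "norm (x - proj_on F x) < \<epsilon>/2"
            "G \<subseteq> B" "finite G" "norm (y - proj_on G y) < \<epsilon>/2"
          using MI[OF x, of "\<epsilon>/2"] MI[OF y, of "\<epsilon>/2"] by auto
        have "norm (x + y - proj_on (F \<union> G) (x + y))
            \<le> norm (x - proj_on (F \<union> G) x) + norm (y - proj_on (F \<union> G) y)"
          by (rule order_trans[OF _ norm_triangle_ineq])
            (simp add: bounded_clinear_add[OF bounded_clinear_proj_on] algebra_simps)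
        also have "\<dots> \<le> norm (x - proj_on F x) + norm (y - proj_on G y)"
          using FG by (intro add_mono norm_diff_proj_on_mono o) auto
        finally show "\<exists>F\<subseteq>B. finite F \<and> norm (x + y - proj_on F (x + y)) < \<epsilon>"
          using FG by (intro exI[of _ "F \<union> G"]) auto
      qed
    }
    fix c
    show "c *\<^sub>C x \<in> M" unfolding M_def
    proof (clarify)
      fix \<epsilon> :: real assume e: "\<epsilon> > 0"
      then obtain F where F: "F \<subseteq> B" "finite F" "norm (x - proj_on F x) < \<epsilon> / (cmod c + 1)"
        using MI[OF x, of "\<epsilon> / (cmod c + 1)"] by (auto simp: add_nonneg_pos)
      have "norm (c *\<^sub>C x - proj_on F (c *\<^sub>C x)) = cmod c * norm (x - proj_on F x)"
        by (simp add: bounded_clinear_scaleC[OF bounded_clinear_proj_on] norm_scaleC flip: scaleC_diff_right)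
      also have "\<dots> \<le> (cmod c + 1) * norm (x - proj_on F x)" by (simp add: mult_right_mono)
      also have "\<dots> < \<epsilon>" using F(3) e by (simp add: pos_less_divide_eq add_nonneg_pos mult.commute)
      finally show "\<exists>F\<subseteq>B. finite F \<and> norm (c *\<^sub>C x - proj_on F (c *\<^sub>C x)) < \<epsilon>"
        using F by blast
    qed
  qed
  moreover have "closed M"
    unfolding closed_sequential_limits
  proof (intro allI impI, elim conjE)
    fix y l assume y: "\<forall>n. y n \<in> M" and l: "y \<longlonglongrightarrow> l"
    show "l \<in> M" unfolding M_def
    proof clarify
      fix \<epsilon> :: real assume e: "\<epsilon> > 0"
      then obtain n where n: "norm (y n - l) < \<epsilon>/2"
        using LIMSEQ_D[OF l, of "\<epsilon>/2"] by auto
      obtain F where F: "F \<subseteq> B" "finite F" "norm (y n - proj_on F (y n)) < \<epsilon>/2"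
        using MI[of "y n" "\<epsilon>/2"] y e by auto
      have "norm (l - proj_on F l) \<le> norm (y n - proj_on F (y n)) + norm ((l - y n) - proj_on F (l - y n))"
        by (rule order_trans[OF _ norm_triangle_ineq])
          (simp add: bounded_clinear_diff[OF bounded_clinear_proj_on] algebra_simps)
      also have "norm ((l - y n) - proj_on F (l - y n)) \<le> norm (l - y n)"
        using F o by (intro norm_diff_proj_on_le) auto
      finally show "\<exists>F\<subseteq>B. finite F \<and> norm (l - proj_on F l) < \<epsilon>"
        using F n by (intro exI[of _ F]) (auto simp: norm_minus_commute)
    qed
  qed
  ultimately obtain m where m: "m \<in> M" "\<And>z. z \<in> M \<Longrightarrow> cinner z (x - m) = 0"
    using orthogonal_projection by blast
  have "e \<in> M" if "e \<in> B" for e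
  proof -
    have "proj_on {e} e = e" using B that by (simp add: proj_on_def cinner_self orthonormal_basis_def)
    then show ?thesis unfolding M_def using that by (auto intro!: exI[of _ "{e}"])
  qed
  then have "x - m = 0" using m(2) B unfolding orthonormal_basis_def by blast
  with m(1) have xM: "x \<in> M" by simp
  show ?thesis unfolding has_sum_def tendsto_iff
  proof (intro allI impI)
    fix \<epsilon> :: real assume "\<epsilon> > 0"
    then obtain F where F: "F \<subseteq> B" "finite F" "norm (x - proj_on F x) < \<epsilon>" using MI[OF xM] by blast
    have "dist (proj_on G x) x < \<epsilon>" if "finite G" "F \<subseteq> G" "G \<subseteq> B" for G
      using norm_diff_proj_on_mono[OF o that(1,2), of x] that F(3)
      by (simp add: dist_norm norm_minus_commute)
    then show "\<forall>\<^sub>F G in finite_subsets_at_top B. dist (\<Sum>e\<in>G. cinner e x *\<^sub>C e) x < \<epsilon>"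
      unfolding eventually_finite_subsets_at_top proj_on_def[symmetric] using F by blast
  qed
qed

lemma Parseval:
  assumes B: "orthonormal_basis B"
  shows "((\<lambda>e. (cmod (cinner e x))\<^sup>2) has_sum (norm x)\<^sup>2) B"
proof -
  have "((\<lambda>F. (norm (\<Sum>e\<in>F. cinner e x *\<^sub>C e))\<^sup>2) \<longlongrightarrow> (norm x)\<^sup>2) (finite_subsets_at_top B)"
    using orthonormal_basis_has_sum[OF B, of x] unfolding has_sum_def by (intro tendsto_intros)
  moreover have "\<forall>\<^sub>F F in finite_subsets_at_top B.
      (norm (\<Sum>e\<in>F. cinner e x *\<^sub>C e))\<^sup>2 = (\<Sum>e\<in>F. (cmod (cinner e x))\<^sup>2)"
    using orthonormal_subset[OF orthonormal_basis_orthonormal[OF B]]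
    by (intro eventually_finite_subsets_at_top_weakI norm_orthonormal_sum) auto
  ultimately show ?thesis unfolding has_sum_def by (rule Lim_transform_eventually)
qed

lemma orthonormal_basis_ext:
  assumes B: "orthonormal_basis B" and "bounded_clinear S" "bounded_clinear T"
    and "\<And>e. e \<in> B \<Longrightarrow> S e = T e"
  shows "S = T"
proof
  fix x
  have *: "((\<lambda>e. cinner e x *\<^sub>C R e) has_sum R x) B" if "bounded_clinear R" for R
    using has_sum_bounded_linear[OF bounded_clinear_bounded_linear[OF that] orthonormal_basis_has_sum[OF B, of x]]
    by (simp add: o_def bounded_clinear_scaleC[OF that])
  have "((\<lambda>e. cinner e x *\<^sub>C S e) has_sum T x) B"
    using *[OF assms(3)] by (rule has_sum_cong[THEN iffD1, rotated]) (simp add: assms(4))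
  with *[OF assms(2)] show "S x = T x" by (rule has_sum_unique)
qed

text \<open>Distinct members of \<open>S\<close> have distance \<open>sqrt 2\<close>, so the balls of radius \<open>1 / 2\<close> around them contain different
  points of a countable dense set.\<close>

lemma orthonormal_countable:
  fixes S :: "'a::{complex_hilbert_space, second_countable_topology} set"
  assumes S: "orthonormal S"
  shows "countable S"
proof -
  obtain X :: "'a set" where X: "countable X" "\<And>U. open U \<Longrightarrow> U \<noteq> {} \<Longrightarrow> \<exists>d\<in>X. d \<in> U"
    using countable_dense_setE by blast
  have "\<exists>d\<in>X. d \<in> ball e (1/2)" for e by (rule X(2)) auto
  then obtain g where g: "\<And>e. g e \<in> X" "\<And>e. g e \<in> ball e (1/2)" by metis
  have "inj_on g S"
  proof (rule inj_onI, rule ccontr)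
    fix x y assume xy: "x \<in> S" "y \<in> S" "g x = g y" "x \<noteq> y"
    have "(norm (x - y))\<^sup>2 = 2"
      using S xy by (simp add: norm_diff_sq orthonormal_def)
    moreover have "norm (x - y) < 1"
      using g(2)[of x] g(2)[of y] xy(3) dist_triangle_half_l[of x "g x" 1 y]
      by (simp add: dist_commute dist_norm)
    then have "(norm (x - y))\<^sup>2 < 1" by (simp add: power_less_one_iff abs_square_less_1)
    ultimately show False by simp
  qed
  moreover have "countable (g ` S)" using X(1) g(1) by (auto intro: countable_subset)
  ultimately show ?thesis using countable_image_inj_on by blast
qed

section \<open>Positive operators and the absolute value\<close>

lemma positive_op_bounded_clinear: "positive_op P \<Longrightarrow> bounded_clinear P"
  and positive_op_ge: "positive_op P \<Longrightarrow> 0 \<le> Re (cinner x (P x))"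
  and positive_op_eq: "positive_op P \<Longrightarrow> cinner x (P x) = of_real (Re (cinner x (P x)))"
  by (simp_all add: positive_op_def)

lemma self_adjoint_quadratic_form:
  assumes "bounded_clinear P" "\<And>x. cinner x (P x) \<in> \<real>"
  shows "cinner (P x) y = cinner x (P y)"
proof -
  have "adj P = P"
  proof (rule polarization[OF bounded_clinear_adj[OF assms(1)] assms(1)])
    show "cinner x (adj P x) = cinner x (P x)" for x
      using assms(2)[of x] by (metis cinner_adj_right[OF assms(1)] cinner_commute Reals_cnj_iff)
  qed
  then show ?thesis using cinner_adj[OF assms(1), of x y] by simp
qed

lemma positive_op_self_adjoint: "positive_op P \<Longrightarrow> cinner (P x) y = cinner x (P y)"
  by (rule self_adjoint_quadratic_form) (auto simp: positive_op_def)

lemma positive_op_adj_comp: "bounded_clinear T \<Longrightarrow> positive_op (adj T \<circ> T)"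
  unfolding positive_op_def
  by (auto simp: bounded_clinear_comp bounded_clinear_adj cinner_adj_right cinner_self)

text \<open>Evaluating the form at \<open>x - P x / M\<close> bounds \<open>P\<close> by its own form.\<close>

lemma positive_op_norm_sq:
  assumes P: "positive_op P" and M: "M > 0" "\<And>y. Re (cinner y (P y)) \<le> M * (norm y)\<^sup>2"
  shows "(norm (P x))\<^sup>2 \<le> M * Re (cinner x (P x))"
proof -
  note bc = positive_op_bounded_clinear[OF P]
  define t where "t = complex_of_real (1 / M)"
  have "cinner (x - t *\<^sub>C P x) (P (x - t *\<^sub>C P x))
      = cinner x (P x) - t * cinner x (P (P x)) - cnj t * cinner (P x) (P x) + cnj t * t * cinner (P x) (P (P x))"
    by (simp add: cinner_simps bc bounded_clinear_simps algebra_simps)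
  also have "cinner x (P (P x)) = cinner (P x) (P x)" by (simp add: positive_op_self_adjoint[OF P])
  finally have "Re (cinner (x - t *\<^sub>C P x) (P (x - t *\<^sub>C P x)))
      = Re (cinner x (P x)) - 2 / M * (norm (P x))\<^sup>2 + (1 / M)\<^sup>2 * Re (cinner (P x) (P (P x)))"
    by (simp add: t_def cinner_self power2_eq_square)
  moreover have "(1 / M)\<^sup>2 * Re (cinner (P x) (P (P x))) \<le> (1 / M)\<^sup>2 * (M * (norm (P x))\<^sup>2)"
    by (intro mult_left_mono M) auto
  moreover have "(1 / M)\<^sup>2 * (M * (norm (P x))\<^sup>2) = 1 / M * (norm (P x))\<^sup>2"
    using M by (simp add: power2_eq_square)
  moreover have "0 \<le> Re (cinner (x - t *\<^sub>C P x) (P (x - t *\<^sub>C P x)))" by (rule positive_op_ge[OF P])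
  ultimately have "1 / M * (norm (P x))\<^sup>2 \<le> Re (cinner x (P x))" by (simp add: field_simps)
  then show ?thesis using M by (simp add: field_simps)
qed

lemma positive_op_form_le:
  assumes P: "positive_op P"
  shows "Re (cinner y (P y)) \<le> (onorm P + 1) * (norm y)\<^sup>2"
proof -
  note bc = positive_op_bounded_clinear[OF P]
  have "Re (cinner y (P y)) \<le> norm y * norm (P y)"
    using Cauchy_Schwarz complex_Re_le_cmod order_trans by blast
  also have "\<dots> \<le> norm y * (onorm P * norm y)" by (intro mult_left_mono norm_le_onorm bc) auto
  also have "\<dots> \<le> (onorm P + 1) * (norm y)\<^sup>2" by (simp add: power2_eq_square algebra_simps)
  finally show ?thesis .
qed

lemma positive_op_eq_0:
  assumes P: "positive_op P" and "cinner x (P x) = 0"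
  shows "P x = 0"
  using positive_op_norm_sq[OF P _ positive_op_form_le[OF P], of x] assms(2)
    onorm_nonneg[OF positive_op_bounded_clinear[OF P]] by simp

subsection \<open>The square root\<close>

text \<open>The coefficients of the power series of \<open>sqrt (1 - x)\<close>. All of them except the first one are negative,
  and the partial sums are nonnegative, so the series converges absolutely at \<open>x = 1\<close> and the root of
  \<open>1 - A\<close> exists for every self-adjoint contraction \<open>A\<close>.\<close>

definition sqrt_coeff :: "nat \<Rightarrow> real" where
  "sqrt_coeff k = (-1) ^ k * ((1/2) gchoose k)"

lemma sqrt_coeff_0 [simp]: "sqrt_coeff 0 = 1"
  by (simp add: sqrt_coeff_def)

lemma sqrt_coeff_partial_sum: "(\<Sum>k\<le>m. sqrt_coeff k) = (-1) ^ m * ((- 1/2) gchoose m)"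
  using gbinomial_sum_lower_neg[of "1/2::real" m] by (simp add: sqrt_coeff_def mult.commute)

lemma sqrt_coeff_partial_sum_nonneg_aux:
  "0 \<le> (-1) ^ m * ((- 1/2::real) gchoose m) \<and> sqrt_coeff (Suc m) \<le> 0"
proof (induction m)
  case 0
  then show ?case by (simp add: sqrt_coeff_def)
next
  case (Suc m)
  let ?a = "- 1/2::real"
  have st: "(1 + real k) * (a gchoose Suc k) = (a - real k) * (a gchoose k)" for a :: real and k
    using gbinomial_absorption[of k a] gbinomial_absorb_comp[of a k] by simp
  have *: "(-1) ^ Suc k * (?a gchoose Suc k) = (real k + 1/2) / (real k + 1) * ((-1) ^ k * (?a gchoose k))" for k
  proof -
    have e: "(?a gchoose Suc k) = (?a - real k) / (1 + real k) * (?a gchoose k)"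
      using st[of k ?a] by (simp add: eq_divide_eq add_nonneg_eq_0_iff mult.commute)
    show ?thesis unfolding e by (simp add: field_simps)
  qed
  have nn: "0 \<le> (-1) ^ Suc m * (?a gchoose Suc m)"
    unfolding *[of m] by (rule mult_nonneg_nonneg) (use Suc in auto)
  have "sqrt_coeff (Suc (Suc m)) = (-1) ^ Suc (Suc m) * (?a gchoose Suc (Suc m)) - (-1) ^ Suc m * (?a gchoose Suc m)"
    using sqrt_coeff_partial_sum[of "Suc (Suc m)"] sqrt_coeff_partial_sum[of "Suc m"] by simp
  also have "\<dots> = ((real (Suc m) + 1/2) / (real (Suc m) + 1) - 1) * ((-1) ^ Suc m * (?a gchoose Suc m))"
    by (simp only: *[of "Suc m"] left_diff_distrib mult_1_left)
  also have "\<dots> \<le> 0" by (intro mult_nonpos_nonneg nn) (simp add: field_simps)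
  finally show ?case using nn by simp
qed

lemma sqrt_coeff_partial_sum_nonneg: "0 \<le> (\<Sum>k\<le>m. sqrt_coeff k)"
  using sqrt_coeff_partial_sum_nonneg_aux[of m] by (simp add: sqrt_coeff_partial_sum)

lemma sqrt_coeff_nonpos: "k \<noteq> 0 \<Longrightarrow> sqrt_coeff k \<le> 0"
  using sqrt_coeff_partial_sum_nonneg_aux[of "k - 1"] by simp

lemma sqrt_coeff_abs_sum: "(\<Sum>k\<le>m. \<bar>sqrt_coeff k\<bar>) = 2 - (\<Sum>k\<le>m. sqrt_coeff k)"
  by (induction m) (simp_all add: sqrt_coeff_nonpos)

lemma summable_sqrt_coeff: "summable (\<lambda>k. \<bar>sqrt_coeff k\<bar>)"
proof (rule bounded_imp_summable[where B = 2])
  show "(\<Sum>k\<le>n. \<bar>sqrt_coeff k\<bar>) \<le> 2" for n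
    using sqrt_coeff_partial_sum_nonneg[of n] by (simp add: sqrt_coeff_abs_sum)
qed simp

lemma sqrt_coeff_Cauchy:
  "(\<Sum>k\<le>n. sqrt_coeff k * sqrt_coeff (n - k)) = (if n = 0 then 1 else if n = 1 then -1 else 0)"
proof -
  have "(\<Sum>k\<le>n. sqrt_coeff k * sqrt_coeff (n - k))
      = (\<Sum>k\<le>n. (-1) ^ n * (((1/2) gchoose k) * ((1/2) gchoose (n - k))))"
    by (intro sum.cong refl) (simp add: sqrt_coeff_def mult_ac flip: power_add)
  also have "\<dots> = (-1) ^ n * ((1::real) gchoose n)"
    using gbinomial_Vandermonde[of "1/2::real" "1/2" n]
    by (simp add: atMost_atLeast0 flip: sum_distrib_left)
  also have "(1::real) gchoose n = of_nat (1 choose n)" by (metis binomial_gbinomial of_nat_1)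
  finally show ?thesis by (cases n; cases "n - 1") auto
qed

text \<open>The products that a square of partial sums has in excess of the Cauchy product.\<close>

lemma sqrt_coeff_triangle_tendsto:
  "(\<lambda>m. \<Sum>(k, l)\<in>{..m} \<times> {..m} - {(k, l). k + l \<le> m}. \<bar>sqrt_coeff k\<bar> * \<bar>sqrt_coeff l\<bar>) \<longlonglongrightarrow> 0"
proof -
  let ?b = "\<lambda>k. \<bar>sqrt_coeff k\<bar>"
  have sn: "summable (\<lambda>k. norm (?b k))" using summable_sqrt_coeff by simp
  have "(\<lambda>m. (\<Sum>k\<le>m. ?b k) * (\<Sum>k\<le>m. ?b k) - (\<Sum>n\<le>m. \<Sum>k\<le>n. ?b k * ?b (n - k)))
      \<longlonglongrightarrow> suminf ?b * suminf ?b - suminf ?b * suminf ?b"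
    using Cauchy_product_sums[OF sn sn] summable_LIMSEQ'[OF summable_sqrt_coeff]
    by (intro tendsto_intros) (simp_all add: sums_def_le)
  moreover have "(\<Sum>k\<le>m. ?b k) * (\<Sum>k\<le>m. ?b k) - (\<Sum>n\<le>m. \<Sum>k\<le>n. ?b k * ?b (n - k))
      = (\<Sum>(k, l)\<in>{..m} \<times> {..m} - {(k, l). k + l \<le> m}. ?b k * ?b l)" for m
  proof -
    have sub: "{(k, l). k + l \<le> m} \<subseteq> {..m} \<times> {..m}" by auto
    have "(\<Sum>n\<le>m. \<Sum>k\<le>n. ?b k * ?b (n - k)) = (\<Sum>(k, l)\<in>{(k, l). k + l \<le> m}. ?b k * ?b l)"
      by (rule sum.triangle_reindex_eq[symmetric])
    then show ?thesis
      unfolding sum_product sum.cartesian_product by (subst sum_diff) (use sub in auto)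
  qed
  ultimately show ?thesis by simp
qed

lemma contraction_pow_norm:
  fixes A :: "'a::real_normed_vector \<Rightarrow> 'a"
  assumes A: "\<And>x. norm (A x) \<le> norm x"
  shows "norm ((A ^^ k) x) \<le> norm x"
proof (induction k)
  case (Suc k)
  then show ?case using A[of "(A ^^ k) x"] by simp
qed simp

lemma self_adjoint_pow:
  assumes A: "\<And>x y. cinner (A x) y = cinner x (A (y::'a::complex_hilbert_space))"
  shows "cinner ((A ^^ k) x) y = cinner x ((A ^^ k) y)"
proof (induction k arbitrary: y)
  case (Suc k)
  have "cinner ((A ^^ Suc k) x) y = cinner x ((A ^^ k) (A y))" by (simp add: A Suc)
  then show ?case by (simp only: funpow_Suc_right o_apply)
qed simp

text \<open>The root is a strong limit of polynomials in \<open>A\<close>, so it commutes with whatever commutes with \<open>A\<close>; this is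
  what makes roots unique. It is positive because the partial sums of the coefficients are.\<close>

lemma sqrt_one_minus_contraction:
  fixes A :: "'a::complex_hilbert_space \<Rightarrow> 'a"
  assumes A: "bounded_clinear A" "\<And>x y. cinner (A x) y = cinner x (A y)"
    and contr: "\<And>x. norm (A x) \<le> norm x"
  obtains P where "positive_op P" "\<And>x. P (P x) = x - A x"
    "\<forall>Q. bounded_clinear Q \<longrightarrow> (\<forall>x. Q (A x) = A (Q x)) \<longrightarrow> (\<forall>x. Q (P x) = P (Q x))"
proof -
  define S where "S m x = (\<Sum>k\<le>m. sqrt_coeff k *\<^sub>R (A ^^ k) x)" for m x
  define P where "P x = (\<Sum>k. sqrt_coeff k *\<^sub>R (A ^^ k) x)" for x
  note Ak = bounded_clinear_pow[OF A(1)] contraction_pow_norm[of A, OF contr]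
  have summ: "summable (\<lambda>k. sqrt_coeff k *\<^sub>R (A ^^ k) x)" for x
  proof (rule summable_comparison_test')
    show "summable (\<lambda>k. \<bar>sqrt_coeff k\<bar> * norm x)" by (intro summable_mult2 summable_sqrt_coeff)
  qed (simp add: mult_left_mono Ak)
  have lim: "(\<lambda>m. S m x) \<longlonglongrightarrow> P x" for x
    unfolding S_def P_def by (rule summable_LIMSEQ'[OF summ])
  have Sbc: "bounded_clinear (S m)" for m
    unfolding S_def scaleR_scaleC
    by (intro bounded_clinear_sum_fun bounded_clinear_scaled Ak)
  have Snorm: "norm (S m x) \<le> 2 * norm x" for m x
  proof -
    have "norm (S m x) \<le> (\<Sum>k\<le>m. \<bar>sqrt_coeff k\<bar> * norm x)"
      unfolding S_def by (rule order_trans[OF norm_sum sum_mono]) (simp add: mult_left_mono Ak)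
    also have "\<dots> \<le> 2 * norm x"
      unfolding sum_distrib_right[symmetric] sqrt_coeff_abs_sum
      using sqrt_coeff_partial_sum_nonneg[of m] by (intro mult_right_mono) auto
    finally show ?thesis .
  qed
  have Pbc: "bounded_clinear P"
  proof (rule bounded_clinearI)
    show "P (x + y) = P x + P y" for x y
      using tendsto_add[OF lim[of x] lim[of y]] lim[of "x + y"]
      by (simp add: bounded_clinear_add[OF Sbc] LIMSEQ_unique)
    show "P (c *\<^sub>C x) = c *\<^sub>C P x" for c x
      using tendsto_scaleC[OF tendsto_const lim[of x], of c] lim[of "c *\<^sub>C x"]
      by (simp add: bounded_clinear_scaleC[OF Sbc] LIMSEQ_unique)
    show "norm (P x) \<le> 2 * norm x" for x
      by (rule LIMSEQ_le_const2[OF tendsto_norm[OF lim]]) (use Snorm in auto)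
  qed
  have Sform: "cinner x (S m x) \<in> \<real> \<and> 0 \<le> Re (cinner x (S m x))" for m x
  proof -
    have real: "cinner x ((A ^^ k) x) \<in> \<real>" for k
      using self_adjoint_pow[of A k x x, OF A(2)] cinner_commute[of x "(A ^^ k) x"]
      by (simp add: Reals_cnj_iff)
    have eq: "cinner x (S m x) = (\<Sum>k\<le>m. of_real (sqrt_coeff k) * cinner x ((A ^^ k) x))"
      by (simp add: S_def cinner_sum_right cinner_scaleR_right)
    have "sqrt_coeff k * (norm x)\<^sup>2 \<le> Re (of_real (sqrt_coeff k) * cinner x ((A ^^ k) x))" for k
    proof (cases "k = 0")
      case False
      have "Re (cinner x ((A ^^ k) x)) \<le> norm x * norm ((A ^^ k) x)"
        using Cauchy_Schwarz complex_Re_le_cmod order_trans by blast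
      also have "\<dots> \<le> (norm x)\<^sup>2" by (simp add: power2_eq_square mult_left_mono Ak)
      finally show ?thesis using sqrt_coeff_nonpos[OF False] by (simp add: mult_left_mono_neg)
    qed (simp add: cinner_self)
    then have "(\<Sum>k\<le>m. sqrt_coeff k * (norm x)\<^sup>2) \<le> Re (cinner x (S m x))"
      unfolding eq Re_sum by (intro sum_mono)
    moreover have "0 \<le> (\<Sum>k\<le>m. sqrt_coeff k * (norm x)\<^sup>2)"
      unfolding sum_distrib_right[symmetric] by (intro mult_nonneg_nonneg sqrt_coeff_partial_sum_nonneg) auto
    ultimately show ?thesis unfolding eq using real by (auto intro!: Reals_mult sum_in_Reals)
  qed
  have lim_form: "(\<lambda>m. cinner x (S m x)) \<longlonglongrightarrow> cinner x (P x)" for x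
    by (intro tendsto_intros lim)
  have "positive_op P"
    unfolding positive_op_def
  proof (intro conjI allI Pbc)
    fix x
    show "cinner x (P x) \<in> \<real>"
      by (rule closed_sequentially[OF closed_complex_Reals _ lim_form]) (use Sform in blast)
    show "0 \<le> Re (cinner x (P x))"
      by (rule LIMSEQ_le_const[OF tendsto_Re[OF lim_form]]) (use Sform in auto)
  qed
  moreover have "P (P x) = x - A x" for x
  proof -
    \<comment> \<open>The limit of \<open>S\<^sub>m S\<^sub>m x\<close> is computed in two ways, by continuity and by the Cauchy product.\<close>
    have "(\<lambda>m. S m (S m x)) \<longlonglongrightarrow> P (P x)"
    proof -
      have 1: "(\<lambda>m. S m (P x)) \<longlonglongrightarrow> P (P x)" by (rule lim)
      have "(\<lambda>m. S m (S m x - P x)) \<longlonglongrightarrow> 0"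
      proof (rule Lim_null_comparison)
        show "\<forall>\<^sub>F m in sequentially. norm (S m (S m x - P x)) \<le> 2 * norm (S m x - P x)"
          using Snorm by simp
        have "(\<lambda>m. 2 * norm (S m x - P x)) \<longlonglongrightarrow> 2 * norm (P x - P x)" by (intro tendsto_intros lim)
        then show "(\<lambda>m. 2 * norm (S m x - P x)) \<longlonglongrightarrow> 0" by simp
      qed
      from tendsto_add[OF this 1] show ?thesis by (simp add: bounded_clinear_diff[OF Sbc])
    qed
    moreover have "(\<lambda>m. S m (S m x) - (x - A x)) \<longlonglongrightarrow> 0"
    proof (rule Lim_null_comparison)
      let ?D = "\<lambda>m. {..m} \<times> {..m} - {(k, l). k + l \<le> m}"
      let ?f = "\<lambda>k l. (sqrt_coeff k * sqrt_coeff l) *\<^sub>R (A ^^ (k + l)) x"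
      have eq: "S m (S m x) = (x - A x) + (\<Sum>(k, l)\<in>?D m. ?f k l)" if m: "m \<ge> 1" for m
      proof -
        have "S m (S m x) = (\<Sum>k\<le>m. \<Sum>l\<le>m. ?f k l)"
          unfolding S_def
          by (intro sum.cong refl)
            (simp add: bounded_clinear_sum[OF Ak(1)] scaleR_scaleC bounded_clinear_scaleC[OF Ak(1)]
              scaleC_sum_right scaleC_scaleC funpow_add)
        also have "\<dots> = (\<Sum>(k, l)\<in>{..m} \<times> {..m}. ?f k l)" by (simp add: sum.cartesian_product)
        also have "\<dots> = (\<Sum>(k, l)\<in>{(k, l). k + l \<le> m}. ?f k l) + (\<Sum>(k, l)\<in>?D m. ?f k l)"
        proof -
          have sub: "{(k, l). k + l \<le> m} \<subseteq> {..m} \<times> {..m}" by auto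
          then show ?thesis by (subst sum_diff) auto
        qed
        also have "(\<Sum>(k, l)\<in>{(k, l). k + l \<le> m}. ?f k l)
            = (\<Sum>n\<le>m. (\<Sum>k\<le>n. sqrt_coeff k * sqrt_coeff (n - k)) *\<^sub>R (A ^^ n) x)"
          unfolding sum.triangle_reindex_eq scaleR_left.sum by (intro sum.cong refl) simp
        also have "\<dots> = (\<Sum>n\<in>{0, 1}. (if n = 0 then 1 else -1) *\<^sub>R (A ^^ n) x)"
          unfolding sqrt_coeff_Cauchy using m by (intro sum.mono_neutral_cong_right) auto
        also have "\<dots> = x - A x" by simp
        finally show ?thesis .
      qed
      have "norm (S m (S m x) - (x - A x)) \<le> (\<Sum>(k, l)\<in>?D m. \<bar>sqrt_coeff k\<bar> * \<bar>sqrt_coeff l\<bar>) * norm x"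
        if m: "m \<ge> 1" for m
      proof -
        have "norm (S m (S m x) - (x - A x)) \<le> (\<Sum>p\<in>?D m. norm (case p of (k, l) \<Rightarrow> ?f k l))"
          unfolding eq[OF m] by (simp add: norm_sum)
        also have "\<dots> \<le> (\<Sum>p\<in>?D m. (case p of (k, l) \<Rightarrow> \<bar>sqrt_coeff k\<bar> * \<bar>sqrt_coeff l\<bar>) * norm x)"
          by (intro sum_mono) (auto simp: abs_mult intro!: mult_left_mono Ak)
        finally show ?thesis by (simp add: sum_distrib_right)
      qed
      then show "\<forall>\<^sub>F m in sequentially. norm (S m (S m x) - (x - A x))
          \<le> (\<Sum>(k, l)\<in>?D m. \<bar>sqrt_coeff k\<bar> * \<bar>sqrt_coeff l\<bar>) * norm x"
        by (auto simp: eventually_sequentially)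
      show "(\<lambda>m. (\<Sum>(k, l)\<in>?D m. \<bar>sqrt_coeff k\<bar> * \<bar>sqrt_coeff l\<bar>) * norm x) \<longlonglongrightarrow> 0"
        using tendsto_mult_left_zero[OF sqrt_coeff_triangle_tendsto] by simp
    qed
    then have "(\<lambda>m. S m (S m x)) \<longlonglongrightarrow> x - A x" by (simp add: LIM_zero_iff)
    ultimately show ?thesis by (rule LIMSEQ_unique)
  qed
  moreover have "Q (P x) = P (Q x)" if Q: "bounded_clinear Q" "\<And>x. Q (A x) = A (Q x)" for Q x
  proof -
    have c: "Q ((A ^^ k) x) = (A ^^ k) (Q x)" for k by (induction k) (simp_all add: Q)
    have "Q (S m x) = S m (Q x)" for m
      by (simp add: S_def scaleR_scaleC bounded_clinear_sum[OF Q(1)] bounded_clinear_scaleC[OF Q(1)] c)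
    then show ?thesis
      using bounded_clinear_tendsto[OF Q(1) lim[of x]] lim[of "Q x"] by (simp add: LIMSEQ_unique)
  qed
  ultimately show ?thesis using that by blast
qed

theorem positive_sqrt_exists:
  fixes S :: "'a::complex_hilbert_space \<Rightarrow> 'a"
  assumes S: "positive_op S"
  obtains P where "positive_op P" "P \<circ> P = S"
    "\<And>Q. bounded_clinear Q \<Longrightarrow> Q \<circ> S = S \<circ> Q \<Longrightarrow> Q \<circ> P = P \<circ> Q"
proof -
  note bc = positive_op_bounded_clinear[OF S]
  define K where "K = onorm S + 1"
  have K: "K > 0" using onorm_nonneg[OF bc] by (simp add: K_def)
  define A where "A x = x - (1 / K) *\<^sub>R S x" for x
  have Abc: "bounded_clinear A"
    unfolding A_def scaleR_scaleC by (intro bounded_clinear_sub bounded_clinear_scaled bc) simp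
  have Aform: "cinner x (A x) = of_real ((norm x)\<^sup>2 - 1 / K * Re (cinner x (S x)))" for x
  proof -
    obtain r where "cinner x (S x) = complex_of_real r" using positive_op_eq[OF S] by blast
    then show ?thesis by (simp add: A_def cinner_diff_right cinner_scaleR_right cinner_self)
  qed
  have "positive_op A"
    unfolding positive_op_def
  proof (intro conjI allI Abc)
    show "cinner x (A x) \<in> \<real>" for x unfolding Aform by simp
    show "0 \<le> Re (cinner x (A x))" for x
      unfolding Aform using positive_op_form_le[OF S, of x, folded K_def] K by (simp add: field_simps)
  qed
  have "norm (A x) \<le> norm x" for x
  proof (rule power2_le_imp_le)
    have le: "Re (cinner y (A y)) \<le> 1 * (norm y)\<^sup>2" for y
      unfolding Aform using positive_op_ge[OF S, of y] K by simp
    show "(norm (A x))\<^sup>2 \<le> (norm x)\<^sup>2"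
      using positive_op_norm_sq[OF \<open>positive_op A\<close> _ le, of x] le[of x] by linarith
  qed simp
  then obtain P where P: "positive_op P" "\<And>x. P (P x) = x - A x"
    "\<forall>Q. bounded_clinear Q \<longrightarrow> (\<forall>x. Q (A x) = A (Q x)) \<longrightarrow> (\<forall>x. Q (P x) = P (Q x))"
    using sqrt_one_minus_contraction[OF Abc positive_op_self_adjoint[OF \<open>positive_op A\<close>]] by blast
  note Pbc = positive_op_bounded_clinear[OF P(1)]
  define P' where "P' x = complex_of_real (sqrt K) *\<^sub>C P x" for x
  have "positive_op P'"
    using P(1) K unfolding positive_op_def P'_def
    by (auto simp: cinner_scaleC_right bounded_clinear_scaled intro!: Reals_mult)
  moreover have "P' \<circ> P' = S"
  proof
    fix x
    have K': "complex_of_real (sqrt K) * complex_of_real (sqrt K) = complex_of_real K"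
      using K by (metis of_real_mult real_sqrt_mult_self abs_of_pos)
    have "(P' \<circ> P') x = complex_of_real K *\<^sub>C (x - A x)"
      by (simp add: P'_def bounded_clinear_scaleC[OF Pbc] scaleC_scaleC P(2) K')
    then show "(P' \<circ> P') x = S x" using K by (simp add: A_def scaleC_of_real)
  qed
  moreover have "Q \<circ> P' = P' \<circ> Q" if Q: "bounded_clinear Q" "Q \<circ> S = S \<circ> Q" for Q
  proof -
    have "Q (A x) = A (Q x)" for x
      using fun_cong[OF Q(2), of x]
      by (simp add: A_def scaleR_scaleC bounded_clinear_diff[OF Q(1)] bounded_clinear_scaleC[OF Q(1)])
    then show ?thesis using P(3) Q(1)
      by (auto simp: fun_eq_iff P'_def bounded_clinear_scaleC[OF Q(1)])
  qed
  ultimately show ?thesis using that by blast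
qed

theorem positive_sqrt_unique:
  fixes P Q :: "'a::complex_hilbert_space \<Rightarrow> 'a"
  assumes P: "positive_op P" and Q: "positive_op Q" and eq: "P \<circ> P = Q \<circ> Q"
  shows "P = Q"
proof -
  \<comment> \<open>A root \<open>P'\<close> that commutes with everything that commutes with the square equals every other root \<open>Q'\<close>: for
  \<open>y = P' x - Q' x\<close> commutation gives \<open>(P' + Q') y = 0\<close>, so by positivity \<open>P' y = Q' y = 0\<close>.\<close>
  have comm: "P' = Q'"
    if P': "positive_op P'" "\<And>T. bounded_clinear T \<Longrightarrow> T \<circ> (Q' \<circ> Q') = (Q' \<circ> Q') \<circ> T \<Longrightarrow> T \<circ> P' = P' \<circ> T"
      and Q': "positive_op Q'" and eq': "P' \<circ> P' = Q' \<circ> Q'" for P' Q' :: "'a \<Rightarrow> 'a"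
  proof
    fix x
    note bP = positive_op_bounded_clinear[OF P'(1)] and bQ = positive_op_bounded_clinear[OF Q']
    have c: "Q' (P' z) = P' (Q' z)" for z
      using P'(2)[OF bQ] by (auto simp: fun_eq_iff)
    define y where "y = P' x - Q' x"
    have "P' y + Q' y = 0"
      using fun_cong[OF eq', of x] by (simp add: y_def bounded_clinear_diff bP bQ c)
    then have "cinner y (P' y) + cinner y (Q' y) = 0"
      by (metis cinner_add_right cinner_zero_right)
    then have "complex_of_real (Re (cinner y (P' y)) + Re (cinner y (Q' y))) = 0"
      using positive_op_eq[OF P'(1), of y] positive_op_eq[OF Q', of y] by simp
    then have s: "Re (cinner y (P' y)) + Re (cinner y (Q' y)) = 0" using of_real_eq_0_iff by blast
    have "Re (cinner y (P' y)) = 0" "Re (cinner y (Q' y)) = 0"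
      using s positive_op_ge[OF P'(1), of y] positive_op_ge[OF Q', of y] by auto
    then have "P' y = 0" "Q' y = 0"
      using positive_op_eq[OF P'(1), of y] positive_op_eq[OF Q', of y]
      by (auto intro!: positive_op_eq_0[OF P'(1)] positive_op_eq_0[OF Q'])
    moreover have "cinner y y = cinner x (P' y) - cinner x (Q' y)"
      by (simp add: y_def cinner_diff_left positive_op_self_adjoint[OF P'(1)] positive_op_self_adjoint[OF Q'])
    ultimately have "y = 0" by (simp add: cinner_self)
    then show "P' x = Q' x" by (simp add: y_def)
  qed
  have "positive_op (P \<circ> P)"
  proof -
    note bP = positive_op_bounded_clinear[OF P]
    have "cinner x (P (P x)) = of_real ((norm (P x))\<^sup>2)" for x
      by (simp add: positive_op_self_adjoint[OF P, symmetric] cinner_self)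
    then show ?thesis by (simp add: positive_op_def bounded_clinear_comp bP)
  qed
  then obtain R where R: "positive_op R" "R \<circ> R = P \<circ> P"
    "\<And>T. bounded_clinear T \<Longrightarrow> T \<circ> (P \<circ> P) = (P \<circ> P) \<circ> T \<Longrightarrow> T \<circ> R = R \<circ> T"
    using positive_sqrt_exists by blast
  have "R = P" by (rule comm) (use R P in auto)
  moreover have "R = Q" by (rule comm) (use R Q eq in auto)
  ultimately show ?thesis by simp
qed

lemma
  assumes "bounded_clinear T"
  shows positive_op_abs_op: "positive_op (abs_op T)"
    and abs_op_square: "abs_op T \<circ> abs_op T = adj T \<circ> T"
proof -
  obtain P where P: "positive_op P" "P \<circ> P = adj T \<circ> T"
    using positive_sqrt_exists[OF positive_op_adj_comp[OF assms]] by blast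
  have "abs_op T = P"
    unfolding abs_op_def using P by (intro the_equality) (auto intro: positive_sqrt_unique)
  with P show "positive_op (abs_op T)" "abs_op T \<circ> abs_op T = adj T \<circ> T" by simp_all
qed

lemma norm_abs_op:
  assumes "bounded_clinear T"
  shows "norm (abs_op T x) = norm (T x)"
proof -
  have "cinner (abs_op T x) (abs_op T x) = cinner x ((abs_op T \<circ> abs_op T) x)"
    by (simp add: positive_op_self_adjoint[OF positive_op_abs_op[OF assms]])
  also have "\<dots> = cinner (T x) (T x)"
    unfolding abs_op_square[OF assms] by (simp add: cinner_adj_right[OF assms])
  finally have "(norm (abs_op T x))\<^sup>2 = (norm (T x))\<^sup>2"
    unfolding cinner_self of_real_eq_iff .
  then show ?thesis by simp
qed

text \<open>Since \<open>|T|\<^sup>2 - \<sigma>\<^sup>2 = (|T| + \<sigma>) (|T| - \<sigma>)\<close> and \<open>|T| + \<sigma>\<close> is injective for \<open>\<sigma> > 0\<close>.\<close>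

lemma abs_op_eigenvector:
  assumes "bounded_clinear T" "adj T (T x) = complex_of_real (\<sigma>\<^sup>2) *\<^sub>C x" "\<sigma> \<ge> 0"
  shows "abs_op T x = complex_of_real \<sigma> *\<^sub>C x"
proof -
  let ?P = "abs_op T"
  note P = positive_op_abs_op[OF assms(1)] and bP = positive_op_bounded_clinear[OF positive_op_abs_op[OF assms(1)]]
  have sq: "?P (?P x) = complex_of_real (\<sigma>\<^sup>2) *\<^sub>C x"
    using fun_cong[OF abs_op_square[OF assms(1)], of x] assms(2) by simp
  define y where "y = ?P x - complex_of_real \<sigma> *\<^sub>C x"
  have "?P y + complex_of_real \<sigma> *\<^sub>C y = 0"
    by (simp add: y_def bounded_clinear_simps bP sq scaleC_diff_right scaleC_scaleC power2_eq_square)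
  then have "cinner y (?P y) + of_real \<sigma> * cinner y y = 0"
    by (metis cinner_add_right cinner_scaleC_right cinner_zero_right)
  then have "complex_of_real (Re (cinner y (?P y)) + \<sigma> * (norm y)\<^sup>2) = 0"
    by (simp add: cinner_self positive_op_eq[OF P, of y, symmetric])
  then have s: "Re (cinner y (?P y)) + \<sigma> * (norm y)\<^sup>2 = 0" using of_real_eq_0_iff by blast
  then have z: "\<sigma> * (norm y)\<^sup>2 = 0"
    using positive_op_ge[OF P, of y] mult_nonneg_nonneg[OF assms(3), of "(norm y)\<^sup>2"] zero_le_power2[of "norm y"]
    by linarith
  show ?thesis
  proof (cases "\<sigma> = 0")
    case False
    then have "norm y = 0" using z by simp
    then show ?thesis by (simp add: y_def)
  next
    case True
    have "cinner (T x) (T x) = cinner (adj T (T x)) x" by (simp only: cinner_adj[OF assms(1)])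
    also have "\<dots> = 0" unfolding assms(2) True by simp
    finally have "T x = 0" by (simp add: cinner_self)
    then have "?P x = 0" using norm_abs_op[OF assms(1), of x] by (metis norm_eq_zero)
    then show ?thesis using True by simp
  qed
qed

section \<open>Compact operators\<close>

text \<open>In a complete space total boundedness amounts to relative compactness and is easier to verify.\<close>

definition compact_op :: "('a::complex_hilbert_space \<Rightarrow> 'a) \<Rightarrow> bool" where
  "compact_op T \<longleftrightarrow> bounded_clinear T \<and>
    (\<forall>\<epsilon>>0. \<exists>K. finite K \<and> T ` cball 0 1 \<subseteq> (\<Union>k\<in>K. ball k \<epsilon>))"

lemma compact_op_bounded_clinear: "compact_op T \<Longrightarrow> bounded_clinear T"
  by (simp add: compact_op_def)

lemma compact_op_cover:
  assumes "compact_op T" "\<epsilon> > 0"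
  obtains K where "finite K" "\<And>x. norm x \<le> 1 \<Longrightarrow> \<exists>k\<in>K. norm (T x - k) < \<epsilon>"
proof -
  obtain K where K: "finite K" "T ` cball 0 1 \<subseteq> (\<Union>k\<in>K. ball k \<epsilon>)"
    using assms by (auto simp: compact_op_def)
  have "\<exists>k\<in>K. norm (T x - k) < \<epsilon>" if "norm x \<le> 1" for x
  proof -
    have "T x \<in> (\<Union>k\<in>K. ball k \<epsilon>)" by (rule subsetD[OF K(2)]) (use that in simp)
    then show ?thesis by (auto simp: dist_norm norm_minus_commute)
  qed
  with K(1) that show ?thesis by blast
qed

lemma compact_opI:
  assumes "bounded_clinear T"
    and "\<And>\<epsilon>. \<epsilon> > 0 \<Longrightarrow> \<exists>K. finite K \<and> (\<forall>x. norm x \<le> 1 \<longrightarrow> (\<exists>k\<in>K. norm (T x - k) < \<epsilon>))"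
  shows "compact_op T"
  unfolding compact_op_def
proof (intro conjI assms(1) allI impI)
  fix \<epsilon> :: real assume "\<epsilon> > 0"
  then obtain K where "finite K" "\<forall>x. norm x \<le> 1 \<longrightarrow> (\<exists>k\<in>K. norm (T x - k) < \<epsilon>)" using assms(2) by blast
  then show "\<exists>K. finite K \<and> T ` cball 0 1 \<subseteq> (\<Union>k\<in>K. ball k \<epsilon>)"
    by (intro exI[of _ K]) (auto simp: dist_norm norm_minus_commute)
qed

text \<open>The square on the left is needed for \<open>\<parallel>P\<^sup>s\<^sup>+\<^sup>1 x\<parallel>\<^sup>2 \<le> \<parallel>P\<^sup>s\<parallel> \<parallel>x\<parallel> \<parallel>P\<^sup>s\<^sup>+\<^sup>2 x\<parallel>\<close>, through which compactness descends from
  the powers of a self-adjoint operator \<open>P\<close> to \<open>P\<close>.\<close>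

lemma compact_op_dominated:
  assumes S: "compact_op S" and T: "bounded_clinear T" and C: "C \<ge> 0"
    and le: "\<And>x. (norm (T x))\<^sup>2 \<le> C * norm x * norm (S x)"
  shows "compact_op T"
proof (rule compact_opI[OF T])
  fix \<epsilon> :: real assume e: "\<epsilon> > 0"
  define \<delta> where "\<delta> = \<epsilon>\<^sup>2 / (4 * C + 4)"
  have d: "\<delta> > 0" "4 * C * \<delta> < \<epsilon>\<^sup>2" using e C by (auto simp: \<delta>_def field_simps)
  obtain K where K: "finite K" "\<And>x. norm x \<le> 1 \<Longrightarrow> \<exists>k\<in>K. norm (S x - k) < \<delta>"
    using compact_op_cover[OF S d(1)] by blast
  \<comment> \<open>Centres \<open>k\<close> far from all values of \<open>S\<close> get an arbitrary \<open>p k\<close>, which only adds a superfluous centre.\<close>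
  define p where "p k = (SOME x. norm x \<le> 1 \<and> norm (S x - k) < \<delta>)" for k
  have "\<exists>k\<in>(\<lambda>k. T (p k)) ` K. norm (T x - k) < \<epsilon>" if x: "norm x \<le> 1" for x
  proof -
    obtain k where k: "k \<in> K" "norm (S x - k) < \<delta>" using K(2)[OF x] by blast
    have pk: "norm (p k) \<le> 1 \<and> norm (S (p k) - k) < \<delta>"
      unfolding p_def by (rule someI[of _ x]) (use x k in auto)
    have "norm (S (x - p k)) = norm ((S x - k) - (S (p k) - k))"
      by (simp add: bounded_clinear_diff[OF compact_op_bounded_clinear[OF S]])
    also have "\<dots> \<le> norm (S x - k) + norm (S (p k) - k)" by (rule norm_triangle_ineq4)
    finally have s: "norm (S (x - p k)) \<le> 2 * \<delta>" using k pk by simp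
    have x2: "norm (x - p k) \<le> 2" using norm_triangle_ineq4[of x "p k"] x pk by simp
    have "(norm (T x - T (p k)))\<^sup>2 \<le> C * norm (x - p k) * norm (S (x - p k))"
      using le[of "x - p k"] by (simp add: bounded_clinear_diff[OF T])
    also have "\<dots> \<le> C * 2 * (2 * \<delta>)"
      using C s x2 d by (intro mult_mono) auto
    also have "\<dots> < \<epsilon>\<^sup>2" using d by simp
    finally have "norm (T x - T (p k)) < \<epsilon>" by (rule power2_less_imp_less) (use e in simp)
    with k(1) show ?thesis by blast
  qed
  with K(1) show "\<exists>K. finite K \<and> (\<forall>x. norm x \<le> 1 \<longrightarrow> (\<exists>k\<in>K. norm (T x - k) < \<epsilon>))" by blast
qed

lemma compact_op_le:
  assumes S: "compact_op S" and T: "bounded_clinear T" and C: "C \<ge> 0"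
    and le: "\<And>x. norm (T x) \<le> C * norm (S x)"
  shows "compact_op T"
proof (rule compact_op_dominated[OF S T, of "C\<^sup>2 * onorm S"])
  note bc = compact_op_bounded_clinear[OF S]
  show "C\<^sup>2 * onorm S \<ge> 0" using onorm_nonneg[OF bc] by simp
  fix x
  have "(norm (T x))\<^sup>2 \<le> (C * norm (S x))\<^sup>2" using le by (intro power_mono) auto
  also have "\<dots> = C\<^sup>2 * norm (S x) * norm (S x)" by (simp add: power2_eq_square)
  also have "\<dots> \<le> C\<^sup>2 * (onorm S * norm x) * norm (S x)"
    by (intro mult_right_mono mult_left_mono norm_le_onorm bc) auto
  finally show "(norm (T x))\<^sup>2 \<le> C\<^sup>2 * onorm S * norm x * norm (S x)" by (simp add: mult.assoc)
qed

lemma compact_op_comp_left: "bounded_clinear A \<Longrightarrow> compact_op S \<Longrightarrow> compact_op (A \<circ> S)"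
  by (rule compact_op_le[where C = "onorm A"])
    (auto simp: onorm_nonneg bounded_clinear_comp compact_op_bounded_clinear norm_le_onorm)

lemma compact_op_comp_right:
  assumes S: "compact_op S" and A: "bounded_clinear A"
  shows "compact_op (S \<circ> A)"
proof (rule compact_opI)
  note bc = compact_op_bounded_clinear[OF S]
  show "bounded_clinear (S \<circ> A)" by (intro bounded_clinear_comp bc A)
  fix \<epsilon> :: real assume e: "\<epsilon> > 0"
  define r where "r = onorm A + 1"
  have r: "r > 0" using onorm_nonneg[OF A] by (simp add: r_def)
  obtain K where K: "finite K" "\<And>x. norm x \<le> 1 \<Longrightarrow> \<exists>k\<in>K. norm (S x - k) < \<epsilon> / r"
    using compact_op_cover[OF S, of "\<epsilon> / r"] e r by auto
  have "\<exists>k\<in>(*\<^sub>R) r ` K. norm ((S \<circ> A) x - k) < \<epsilon>" if x: "norm x \<le> 1" for x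
  proof -
    have "norm (A x) \<le> onorm A * 1"
      using norm_le_onorm[OF A, of x] mult_left_mono[OF x onorm_nonneg[OF A]] by linarith
    then have "norm ((1 / r) *\<^sub>R A x) \<le> 1" using r by (simp add: r_def)
    then obtain k where k: "k \<in> K" "norm (S ((1 / r) *\<^sub>R A x) - k) < \<epsilon> / r" using K(2) by blast
    have "S (A x) - r *\<^sub>R k = r *\<^sub>R (S ((1 / r) *\<^sub>R A x) - k)"
      using r by (simp add: scaleC_diff_right scaleR_scaleC bounded_clinear_scaleC[OF bc] scaleC_scaleC)
    then have "norm (S (A x) - r *\<^sub>R k) = r * norm (S ((1 / r) *\<^sub>R A x) - k)" using r by simp
    also have "\<dots> < \<epsilon>" using k(2) r by (simp add: pos_less_divide_eq mult.commute)
    finally show ?thesis using k(1) by auto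
  qed
  with K(1) show "\<exists>K. finite K \<and> (\<forall>x. norm x \<le> 1 \<longrightarrow> (\<exists>k\<in>K. norm ((S \<circ> A) x - k) < \<epsilon>))" by blast
qed

lemma compact_op_add:
  assumes S: "compact_op S" and T: "compact_op T"
  shows "compact_op (\<lambda>x. S x + T x)"
proof (rule compact_opI)
  show "bounded_clinear (\<lambda>x. S x + T x)"
    by (intro bounded_clinear_plus compact_op_bounded_clinear S T)
  fix \<epsilon> :: real assume e: "\<epsilon> > 0"
  obtain K where K: "finite K" "\<And>x. norm x \<le> 1 \<Longrightarrow> \<exists>k\<in>K. norm (S x - k) < \<epsilon> / 2"
    using compact_op_cover[OF S, of "\<epsilon> / 2"] e by auto
  obtain L where L: "finite L" "\<And>x. norm x \<le> 1 \<Longrightarrow> \<exists>k\<in>L. norm (T x - k) < \<epsilon> / 2"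
    using compact_op_cover[OF T, of "\<epsilon> / 2"] e by auto
  have "\<exists>k\<in>(\<lambda>(k, l). k + l) ` (K \<times> L). norm (S x + T x - k) < \<epsilon>" if x: "norm x \<le> 1" for x
  proof -
    obtain k l where kl: "k \<in> K" "norm (S x - k) < \<epsilon> / 2" "l \<in> L" "norm (T x - l) < \<epsilon> / 2"
      using K(2)[OF x] L(2)[OF x] by blast
    have "norm (S x + T x - (k + l)) \<le> norm (S x - k) + norm (T x - l)"
      by (rule order_trans[OF _ norm_triangle_ineq]) (simp add: algebra_simps)
    then have "norm (S x + T x - (k + l)) < \<epsilon>" using kl by simp
    then show ?thesis using kl by force
  qed
  then show "\<exists>K. finite K \<and> (\<forall>x. norm x \<le> 1 \<longrightarrow> (\<exists>k\<in>K. norm (S x + T x - k) < \<epsilon>))"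
    using K(1) L(1) by (intro exI[of _ "(\<lambda>(k, l). k + l) ` (K \<times> L)"]) auto
qed

lemma compact_op_zero: "compact_op (\<lambda>x. 0)"
  by (rule compact_opI) (auto intro!: exI[of _ "{0}"])

lemma compact_op_sum:
  "(\<And>i. i \<in> I \<Longrightarrow> compact_op (S i)) \<Longrightarrow> compact_op (\<lambda>x. \<Sum>i\<in>I. S i x)"
  by (induction I rule: infinite_finite_induct) (simp_all add: compact_op_add compact_op_zero)

lemma compact_op_rank_one: "compact_op (\<lambda>x. cinner e x *\<^sub>C z)"
proof (rule compact_opI[OF bounded_clinear_rank_one])
  fix \<epsilon> :: real assume e: "\<epsilon> > 0"
  have "compact ((\<lambda>c. c *\<^sub>C z) ` cball 0 (norm e))"
    by (intro compact_continuous_image continuous_intros) auto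
  then obtain K where K: "finite K" "(\<lambda>c. c *\<^sub>C z) ` cball 0 (norm e) \<subseteq> (\<Union>k\<in>K. ball k \<epsilon>)"
    using e unfolding compact_eq_totally_bounded by blast
  have "\<exists>k\<in>K. norm (cinner e x *\<^sub>C z - k) < \<epsilon>" if "norm x \<le> 1" for x
  proof -
    have "cmod (cinner e x) \<le> norm e"
      using Cauchy_Schwarz[of e x] mult_left_mono[OF that, of "norm e"] by simp
    then have "cinner e x *\<^sub>C z \<in> (\<Union>k\<in>K. ball k \<epsilon>)" by (intro subsetD[OF K(2)] imageI) simp
    then show ?thesis by (auto simp: dist_norm norm_minus_commute)
  qed
  with K(1) show "\<exists>K. finite K \<and> (\<forall>x. norm x \<le> 1 \<longrightarrow> (\<exists>k\<in>K. norm (cinner e x *\<^sub>C z - k) < \<epsilon>))" by blast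
qed

lemma compact_op_limit:
  assumes T: "bounded_clinear T"
    and lim: "\<And>\<epsilon>. \<epsilon> > 0 \<Longrightarrow> \<exists>S. compact_op S \<and> (\<forall>x. norm (T x - S x) \<le> \<epsilon> * norm x)"
  shows "compact_op T"
proof (rule compact_opI[OF T])
  fix \<epsilon> :: real assume e: "\<epsilon> > 0"
  obtain S where S: "compact_op S" "\<And>x. norm (T x - S x) \<le> \<epsilon> / 2 * norm x"
    using lim[of "\<epsilon> / 2"] e by auto
  obtain K where K: "finite K" "\<And>x. norm x \<le> 1 \<Longrightarrow> \<exists>k\<in>K. norm (S x - k) < \<epsilon> / 2"
    using compact_op_cover[OF S(1), of "\<epsilon> / 2"] e by auto
  have "\<exists>k\<in>K. norm (T x - k) < \<epsilon>" if x: "norm x \<le> 1" for x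
  proof -
    obtain k where k: "k \<in> K" "norm (S x - k) < \<epsilon> / 2" using K(2)[OF x] by blast
    have "norm (T x - k) \<le> norm (T x - S x) + norm (S x - k)"
      by (rule order_trans[OF _ norm_triangle_ineq]) simp
    also have "norm (T x - S x) \<le> \<epsilon> / 2"
      using S(2)[of x] mult_left_mono[OF x, of "\<epsilon> / 2"] e by linarith
    finally show ?thesis using k by (intro bexI[of _ k]) auto
  qed
  with K(1) show "\<exists>K. finite K \<and> (\<forall>x. norm x \<le> 1 \<longrightarrow> (\<exists>k\<in>K. norm (T x - k) < \<epsilon>))" by blast
qed

text \<open>Hilbert--Schmidt operators are compact, being norm limits of their finite rank truncations.\<close>

lemma compact_op_Hilbert_Schmidt:
  assumes B: "orthonormal_basis B" and T: "bounded_clinear T"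
    and summ: "(\<lambda>e. (norm (T e))\<^sup>2) summable_on B"
  shows "compact_op T"
proof (rule compact_op_limit[OF T])
  fix \<epsilon> :: real assume e: "\<epsilon> > 0"
  define s where "s = infsum (\<lambda>e. (norm (T e))\<^sup>2) B"
  have "((\<lambda>F. \<Sum>e\<in>F. (norm (T e))\<^sup>2) \<longlongrightarrow> s) (finite_subsets_at_top B)"
    using has_sum_infsum[OF summ] by (simp add: s_def has_sum_def)
  then have "\<forall>\<^sub>F F in finite_subsets_at_top B. s - \<epsilon>\<^sup>2 < (\<Sum>e\<in>F. (norm (T e))\<^sup>2)"
    using e by (intro order_tendstoD(1)) auto
  then obtain F where F: "finite F" "F \<subseteq> B" "s - \<epsilon>\<^sup>2 < (\<Sum>e\<in>F. (norm (T e))\<^sup>2)"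
    unfolding eventually_finite_subsets_at_top by blast
  have tail: "(\<Sum>e\<in>G - F. (norm (T e))\<^sup>2) \<le> \<epsilon>\<^sup>2" if G: "finite G" "F \<subseteq> G" "G \<subseteq> B" for G
  proof -
    have "(\<Sum>e\<in>G. (norm (T e))\<^sup>2) \<le> s"
      unfolding s_def using G by (intro finite_sum_le_infsum summ) auto
    then show ?thesis using F G by (simp add: sum_diff)
  qed
  have "norm (T x - T (proj_on F x)) \<le> \<epsilon> * norm x" for x
  proof -
    have le: "norm (T (proj_on G x) - T (proj_on F x)) \<le> \<epsilon> * norm x"
      if G: "finite G" "F \<subseteq> G" "G \<subseteq> B" for G
    proof -
      have "T (proj_on G x) - T (proj_on F x) = (\<Sum>e\<in>G - F. cinner e x *\<^sub>C T e)"
        using G F unfolding proj_on_def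
        by (simp add: bounded_clinear_sum[OF T] bounded_clinear_scaleC[OF T] sum_diff)
      then have "norm (T (proj_on G x) - T (proj_on F x)) \<le> (\<Sum>e\<in>G - F. cmod (cinner e x) * norm (T e))"
        by (simp add: sum_norm_le norm_scaleC)
      then have "(norm (T (proj_on G x) - T (proj_on F x)))\<^sup>2 \<le> (\<Sum>e\<in>G - F. cmod (cinner e x) * norm (T e))\<^sup>2"
        by (intro power_mono) auto
      also have "\<dots> \<le> (\<Sum>e\<in>G - F. (cmod (cinner e x))\<^sup>2) * (\<Sum>e\<in>G - F. (norm (T e))\<^sup>2)"
        by (rule Cauchy_Schwarz_ineq_sum)
      also have "\<dots> \<le> (norm x)\<^sup>2 * \<epsilon>\<^sup>2"
      proof (intro mult_mono Bessel tail G)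
        show "orthonormal (G - F)"
          by (rule orthonormal_subset[OF orthonormal_basis_orthonormal[OF B]]) (use G in auto)
      qed (use G in \<open>auto intro: sum_nonneg\<close>)
      finally have "(norm (T (proj_on G x) - T (proj_on F x)))\<^sup>2 \<le> (\<epsilon> * norm x)\<^sup>2"
        by (simp add: power_mult_distrib mult.commute)
      then show ?thesis by (rule power2_le_imp_le) (use e in simp)
    qed
    have "((\<lambda>G. norm (T (proj_on G x) - T (proj_on F x))) \<longlongrightarrow> norm (T x - T (proj_on F x))) (finite_subsets_at_top B)"
      using orthonormal_basis_has_sum[OF B, of x] unfolding has_sum_def proj_on_def[symmetric]
      by (intro tendsto_intros bounded_clinear_tendsto[OF T])
    then show ?thesis
    proof (rule tendsto_upperbound)
      show "\<forall>\<^sub>F G in finite_subsets_at_top B. norm (T (proj_on G x) - T (proj_on F x)) \<le> \<epsilon> * norm x"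
        unfolding eventually_finite_subsets_at_top using F le by blast
    qed simp
  qed
  moreover have "compact_op (\<lambda>x. T (proj_on F x))"
    unfolding proj_on_def bounded_clinear_sum[OF T] bounded_clinear_scaleC[OF T]
    by (intro compact_op_sum compact_op_rank_one)
  ultimately show "\<exists>S. compact_op S \<and> (\<forall>x. norm (T x - S x) \<le> \<epsilon> * norm x)" by blast
qed

lemma compact_op_convergent_subseq:
  assumes T: "compact_op T" and x: "\<And>n. norm (x n) \<le> 1"
  obtains r l where "strict_mono (r :: nat \<Rightarrow> nat)" "(\<lambda>n. T (x (r n))) \<longlonglongrightarrow> l"
proof -
  define C where "C = closure (T ` cball 0 1)"
  have "compact C"
    unfolding compact_eq_totally_bounded
  proof (intro conjI allI impI)
    show "uniform_space_class.complete C" unfolding C_def by (simp add: complete_eq_closed)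
    fix \<epsilon> :: real assume e: "\<epsilon> > 0"
    obtain K where K: "finite K" "T ` cball 0 1 \<subseteq> (\<Union>k\<in>K. ball k (\<epsilon> / 2))"
      using T e unfolding compact_op_def by (metis half_gt_zero)
    have "T ` cball 0 1 \<subseteq> (\<Union>k\<in>K. cball k (\<epsilon> / 2))"
      by (rule order_trans[OF K(2)]) (intro UN_mono ball_subset_cball order_refl)
    then have "C \<subseteq> (\<Union>k\<in>K. cball k (\<epsilon> / 2))"
      unfolding C_def using K(1) by (intro closure_minimal closed_UN) auto
    also have "\<dots> \<subseteq> (\<Union>k\<in>K. ball k \<epsilon>)"
    proof (rule UN_mono[OF order_refl])
      show "cball k (\<epsilon> / 2) \<subseteq> ball k \<epsilon>" for k :: 'a using e by (auto simp: subset_iff)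
    qed
    finally show "\<exists>K. finite K \<and> C \<subseteq> (\<Union>k\<in>K. ball k \<epsilon>)" using K(1) by blast
  qed
  moreover have "\<forall>n. T (x n) \<in> C"
    unfolding C_def using x by (intro allI subsetD[OF closure_subset] imageI) auto
  ultimately obtain l r where "strict_mono (r :: nat \<Rightarrow> nat)" "((\<lambda>n. T (x n)) \<circ> r) \<longlonglongrightarrow> l"
    unfolding compact_def by metis
  then show ?thesis unfolding o_def by (rule that)
qed

section \<open>The spectral theorem for compact self-adjoint operators\<close>

text \<open>Let \<open>s\<close> be the norm of \<open>A\<close> on \<open>M\<close>, and \<open>s > 0\<close>. A maximizing sequence converges along a subsequence, because
  \<open>A\<^sup>2 x\<^sub>n - s\<^sup>2 x\<^sub>n\<close> tends to \<open>0\<close> and \<open>A\<^sup>2\<close> is compact. The limit \<open>y\<close> satisfies \<open>A\<^sup>2 y = s\<^sup>2 y\<close>, so either \<open>y\<close> itself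
  or \<open>A y + s y\<close> is an eigenvector.\<close>

lemma compact_eigenvector:
  fixes A :: "'a::complex_hilbert_space \<Rightarrow> 'a"
  assumes A: "compact_op A" and sa: "\<And>x y. cinner (A x) y = cinner x (A y)"
    and M: "csubspace M" "closed M" "\<And>x. x \<in> M \<Longrightarrow> A x \<in> M" and ne: "z \<in> M" "z \<noteq> 0"
  obtains v \<mu> where "v \<in> M" "norm v = 1" "A v = complex_of_real \<mu> *\<^sub>C v"
proof -
  note bc = compact_op_bounded_clinear[OF A]
  have nM: "(1 / norm x) *\<^sub>R x \<in> M" if "x \<in> M" for x
    using M(1) that by (simp add: csubspace_def scaleR_scaleC)
  define U where "U = {x\<in>M. norm x = 1}"
  define s where "s = (SUP x\<in>U. norm (A x))"
  have Une: "U \<noteq> {}" using nM[OF ne(1)] ne(2) unfolding U_def by force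
  have bdd: "bdd_above ((\<lambda>x. norm (A x)) ` U)"
  proof (rule bdd_aboveI2)
    show "norm (A x) \<le> onorm A" if "x \<in> U" for x
      using norm_le_onorm[OF bc, of x] that by (simp add: U_def)
  qed
  have le1: "norm (A x) \<le> s" if "x \<in> U" for x
    unfolding s_def using bdd that by (rule cSUP_upper2) simp
  have le: "norm (A x) \<le> s * norm x" if "x \<in> M" for x
  proof (cases "x = 0")
    case False
    then have "(1 / norm x) *\<^sub>R x \<in> U" using nM[OF that] by (simp add: U_def)
    from le1[OF this] show ?thesis using False
      by (simp add: scaleR_scaleC bounded_clinear_scaleC[OF bc] norm_scaleC norm_divide field_simps)
  qed (simp add: bounded_clinear_zero[OF bc])
  have s0: "s \<ge> 0" using Une le1 norm_ge_zero order_trans by blast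
  show ?thesis
  proof (cases "s = 0")
    case True
    obtain v where "v \<in> U" using Une by blast
    then have "v \<in> M" "norm v = 1" "A v = complex_of_real 0 *\<^sub>C v"
      using le1[of v] True by (simp_all add: U_def)
    then show ?thesis by (rule that)
  next
    case False
    with s0 have s: "s > 0" by simp
    have "\<exists>x\<in>U. s - 1 / real (Suc n) < norm (A x)" for n
      using less_cSUP_iff[OF Une bdd, of "s - 1 / real (Suc n)"] by (simp add: s_def)
    then obtain x where x: "\<And>n. x n \<in> U" "\<And>n. s - 1 / real (Suc n) < norm (A (x n))" by metis
    have lim: "(\<lambda>n. norm (A (x n))) \<longlonglongrightarrow> s"
    proof (rule tendsto_sandwich[where h = "\<lambda>_. s" and f = "\<lambda>n. s - 1 / real (Suc n)"])
      show "(\<lambda>n. s - 1 / real (Suc n)) \<longlonglongrightarrow> s"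
        using tendsto_diff[OF tendsto_const LIMSEQ_inverse_real_of_nat, of s]
        by (simp add: inverse_eq_divide)
      show "\<forall>\<^sub>F n in sequentially. s - 1 / real (Suc n) \<le> norm (A (x n))"
        using x(2) by (intro always_eventually allI less_imp_le)
    qed (use x le1 in auto)
    have "norm (x n) \<le> 1" for n using x(1)[of n] by (simp add: U_def)
    then obtain r l where rl: "strict_mono (r :: nat \<Rightarrow> nat)" "(\<lambda>n. A (x (r n))) \<longlonglongrightarrow> l"
      using compact_op_convergent_subseq[OF A] by blast
    define y where "y = (1 / s\<^sup>2) *\<^sub>R A l"
    have est: "(norm (A (A (x n)) - s\<^sup>2 *\<^sub>R x n))\<^sup>2 \<le> s\<^sup>2 * (s\<^sup>2 - (norm (A (x n)))\<^sup>2)" for n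
    proof -
      have xM: "x n \<in> M" "norm (x n) = 1" using x(1)[of n] by (auto simp: U_def)
      have "(norm (A (A (x n))))\<^sup>2 \<le> (s * norm (A (x n)))\<^sup>2"
        using le[OF M(3)[OF xM(1)]] by (intro power_mono) auto
      moreover have "cinner (A (A (x n))) (s\<^sup>2 *\<^sub>R x n) = of_real (s\<^sup>2 * (norm (A (x n)))\<^sup>2)"
        by (simp add: cinner_scaleR_right sa[of "A (x n)"] cinner_self)
      moreover have "(norm (s\<^sup>2 *\<^sub>R x n))\<^sup>2 = s\<^sup>2 * s\<^sup>2" using xM(2) by (simp add: power2_eq_square)
      ultimately have "(norm (A (A (x n)) - s\<^sup>2 *\<^sub>R x n))\<^sup>2
          \<le> (s * norm (A (x n)))\<^sup>2 - 2 * (s\<^sup>2 * (norm (A (x n)))\<^sup>2) + s\<^sup>2 * s\<^sup>2"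
        unfolding norm_diff_sq by simp
      also have "\<dots> = s\<^sup>2 * (s\<^sup>2 - (norm (A (x n)))\<^sup>2)" unfolding power_mult_distrib by algebra
      finally show ?thesis .
    qed
    have "(\<lambda>n. A (A (x (r n))) - s\<^sup>2 *\<^sub>R x (r n)) \<longlonglongrightarrow> 0"
    proof -
      have "(\<lambda>n. s\<^sup>2 * (s\<^sup>2 - (norm (A (x n)))\<^sup>2)) \<longlonglongrightarrow> s\<^sup>2 * (s\<^sup>2 - s\<^sup>2)"
        by (rule tendsto_mult[OF tendsto_const tendsto_diff[OF tendsto_const tendsto_power[OF lim]]])
      then have l0: "(\<lambda>n. s\<^sup>2 * (s\<^sup>2 - (norm (A (x n)))\<^sup>2)) \<longlonglongrightarrow> 0" by simp
      have "(\<lambda>n. (norm (A (A (x n)) - s\<^sup>2 *\<^sub>R x n))\<^sup>2) \<longlonglongrightarrow> 0"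
      proof (rule Lim_null_comparison[OF _ l0], intro always_eventually allI)
        fix n
        show "norm ((norm (A (A (x n)) - s\<^sup>2 *\<^sub>R x n))\<^sup>2) \<le> s\<^sup>2 * (s\<^sup>2 - (norm (A (x n)))\<^sup>2)"
          unfolding real_norm_def abs_power2 by (rule est)
      qed
      from tendsto_real_sqrt[OF this] have "(\<lambda>n. norm (A (A (x n)) - s\<^sup>2 *\<^sub>R x n)) \<longlonglongrightarrow> 0"
        by (simp only: real_sqrt_abs abs_norm_cancel real_sqrt_zero)
      then have "(\<lambda>n. A (A (x n)) - s\<^sup>2 *\<^sub>R x n) \<longlonglongrightarrow> 0" by (rule tendsto_norm_zero_cancel)
      from LIMSEQ_subseq_LIMSEQ[OF this rl(1)] show ?thesis by (simp add: o_def)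
    qed
    from tendsto_diff[OF bounded_clinear_tendsto[OF bc rl(2)] this]
    have "(\<lambda>n. s\<^sup>2 *\<^sub>R x (r n)) \<longlonglongrightarrow> A l" by simp
    then have "(\<lambda>n. (1 / s\<^sup>2) *\<^sub>R (s\<^sup>2 *\<^sub>R x (r n))) \<longlonglongrightarrow> y" unfolding y_def by (intro tendsto_intros)
    then have xy: "(\<lambda>n. x (r n)) \<longlonglongrightarrow> y" using s by simp
    have yM: "y \<in> M" using closed_sequentially[OF M(2) _ xy] x(1) by (simp add: U_def)
    have "(\<lambda>n. norm (x (r n))) \<longlonglongrightarrow> norm y" by (intro tendsto_intros xy)
    then have y1: "norm y = 1" using x(1) by (simp add: U_def LIMSEQ_const_iff)
    have "l = A y" using bounded_clinear_tendsto[OF bc xy] rl(2) LIMSEQ_unique by blast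
    moreover have "s\<^sup>2 *\<^sub>R y = A l" unfolding y_def using s by simp
    ultimately have A2: "A (A y) = s\<^sup>2 *\<^sub>R y" by simp
    define w where "w = A y + complex_of_real s *\<^sub>C y"
    have wM: "w \<in> M" unfolding w_def using M yM by (simp add: csubspace_def)
    show ?thesis
    proof (cases "w = 0")
      case True
      then have "A y = - (complex_of_real s *\<^sub>C y)"
        unfolding w_def by (rule eq_neg_iff_add_eq_0[THEN iffD2])
      then have "A y = complex_of_real (- s) *\<^sub>C y" by (simp add: scaleC_minus_left)
      with yM y1 show ?thesis by (rule that)
    next
      case False
      have "A w = A (A y) + complex_of_real s *\<^sub>C A y"
        by (simp only: w_def bounded_clinear_add[OF bc] bounded_clinear_scaleC[OF bc])
      also have "\<dots> = complex_of_real s *\<^sub>C (complex_of_real s *\<^sub>C y) + complex_of_real s *\<^sub>C A y"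
        by (simp add: A2 scaleR_scaleC scaleC_scaleC power2_eq_square)
      also have "\<dots> = complex_of_real s *\<^sub>C w"
        unfolding w_def scaleC_add_right by (rule add.commute)
      finally have Aw: "A w = complex_of_real s *\<^sub>C w" .
      show ?thesis
      proof (rule that)
        show "(1 / norm w) *\<^sub>R w \<in> M" by (rule nM[OF wM])
        show "norm ((1 / norm w) *\<^sub>R w) = 1" using False by simp
        show "A ((1 / norm w) *\<^sub>R w) = complex_of_real s *\<^sub>C ((1 / norm w) *\<^sub>R w)"
          unfolding scaleR_scaleC bounded_clinear_scaleC[OF bc] Aw scaleC_scaleC by (simp add: mult.commute)
      qed
    qed
  qed
qed

text \<open>An orthonormal set of joint eigenvectors can be extended: its orthogonal complement is invariant and contains an
  eigenvector of \<open>A\<close>, and the eigenspace of \<open>A\<close> within the complement is invariant under \<open>B\<close>.\<close>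

theorem compact_joint_eigenbasis:
  fixes A :: "'a::complex_hilbert_space \<Rightarrow> 'a"
  assumes A: "compact_op A" "\<And>x y. cinner (A x) y = cinner x (A y)"
    and B: "compact_op B" "\<And>x y. cinner (B x) y = cinner x (B y)"
    and comm: "\<And>x. A (B x) = B (A x)"
  obtains F where "orthonormal_basis F"
    "\<And>e. e \<in> F \<Longrightarrow> \<exists>\<alpha>. A e = complex_of_real \<alpha> *\<^sub>C e"
    "\<And>e. e \<in> F \<Longrightarrow> \<exists>\<beta>. B e = complex_of_real \<beta> *\<^sub>C e"
proof -
  note bA = compact_op_bounded_clinear[OF A(1)] and bB = compact_op_bounded_clinear[OF B(1)]
  define E where "E = {v. (\<exists>\<alpha>. A v = complex_of_real \<alpha> *\<^sub>C v) \<and> (\<exists>\<beta>. B v = complex_of_real \<beta> *\<^sub>C v)}"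
  have "\<exists>v\<in>E. norm v = 1 \<and> (\<forall>e\<in>S. cinner e v = 0)"
    if S: "S \<subseteq> E" and x: "x \<noteq> 0" "\<forall>e\<in>S. cinner e x = 0" for S x
  proof -
    define M where "M = {x. \<forall>e\<in>S. cinner e x = 0}"
    have M: "csubspace M" by (auto simp: M_def csubspace_def cinner_simps)
    have "closed M"
    proof -
      have "M = (\<Inter>e\<in>S. {x. cinner e x = 0})" by (auto simp: M_def)
      then show ?thesis by (simp only:) (intro closed_INT ballI closed_Collect_eq continuous_intros)
    qed
    have inv: "T x \<in> M" if "x \<in> M" and T: "\<And>x y. cinner (T x) y = cinner x (T y)"
      and ev: "\<And>e. e \<in> S \<Longrightarrow> \<exists>\<alpha>. T e = complex_of_real \<alpha> *\<^sub>C e" for T x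
    proof -
      have "cinner e (T x) = 0" if e: "e \<in> S" for e
      proof -
        obtain \<alpha> where "T e = complex_of_real \<alpha> *\<^sub>C e" using ev[OF e] by blast
        then have "cinner e (T x) = of_real \<alpha> * cinner e x"
          by (simp add: T[symmetric] cinner_scaleC_left)
        also have "\<dots> = 0" using \<open>x \<in> M\<close> e by (simp add: M_def)
        finally show ?thesis .
      qed
      then show ?thesis by (simp add: M_def)
    qed
    have Ainv: "A x \<in> M" if "x \<in> M" for x using inv[OF that A(2)] S by (auto simp: E_def)
    have Binv: "B x \<in> M" if "x \<in> M" for x using inv[OF that B(2)] S by (auto simp: E_def)
    obtain v \<alpha> where v: "v \<in> M" "norm v = 1" "A v = complex_of_real \<alpha> *\<^sub>C v"
      by (rule compact_eigenvector[OF A M \<open>closed M\<close> Ainv, of x]) (use x in \<open>auto simp: M_def\<close>)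
    define N where "N = {x\<in>M. A x = complex_of_real \<alpha> *\<^sub>C x}"
    have N: "csubspace N"
      using M by (auto simp: N_def csubspace_def bounded_clinear_simps[OF bA] scaleC_add_right scaleC_scaleC mult.commute)
    have "closed N"
    proof -
      have "closed {x. A x = complex_of_real \<alpha> *\<^sub>C x}"
        by (intro closed_Collect_eq continuous_intros bounded_clinear_continuous_on bA)
      then show ?thesis unfolding N_def using closed_Int[OF \<open>closed M\<close>] by (simp add: Collect_conj_eq)
    qed
    have NB: "B x \<in> N" if "x \<in> N" for x
      using that Binv by (simp add: N_def comm bounded_clinear_scaleC[OF bB])
    obtain w \<beta> where "w \<in> N" "norm w = 1" "B w = complex_of_real \<beta> *\<^sub>C w"
      by (rule compact_eigenvector[OF B N \<open>closed N\<close> NB, of v]) (use v in \<open>auto simp: N_def\<close>)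
    then show ?thesis by (intro bexI[of _ w]) (auto simp: E_def N_def M_def)
  qed
  then obtain F where "orthonormal_basis F" "F \<subseteq> E"
    using orthonormal_basis_exists[of E] by metis
  then show ?thesis using that by (auto simp: E_def subset_iff)
qed

section \<open>Traces and singular values\<close>

lemma ennreal_summable_on: "(f :: 'a \<Rightarrow> ennreal) summable_on A"
  by (rule nonneg_summable_on_complete) simp

lemma ennreal_finite_sum_le_infsum:
  fixes f :: "'a \<Rightarrow> ennreal"
  shows "finite F \<Longrightarrow> F \<subseteq> A \<Longrightarrow> sum f F \<le> infsum f A"
  by (subst nonneg_infsum_complete) (auto intro: SUP_upper)

lemma ennreal_infsum_swap_le:
  fixes g :: "'a \<Rightarrow> 'b \<Rightarrow> ennreal"
  shows "(\<Sum>\<^sub>\<infinity>x\<in>A. \<Sum>\<^sub>\<infinity>y\<in>B. g x y) \<le> (\<Sum>\<^sub>\<infinity>y\<in>B. \<Sum>\<^sub>\<infinity>x\<in>A. g x y)"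
proof (rule infsum_le_finite_sums)
  fix F assume F: "finite F" "F \<subseteq> A"
  have "(\<Sum>x\<in>F. \<Sum>\<^sub>\<infinity>y\<in>B. g x y) = (\<Sum>\<^sub>\<infinity>y\<in>B. \<Sum>x\<in>F. g x y)"
    using F(1)
  proof (induction F)
    case (insert x F)
    have "((\<lambda>y. g x y + (\<Sum>x\<in>F. g x y)) has_sum infsum (g x) B + (\<Sum>\<^sub>\<infinity>y\<in>B. \<Sum>x\<in>F. g x y)) B"
      by (intro has_sum_add has_sum_infsum ennreal_summable_on)
    from infsumI[OF this] insert show ?case by simp
  qed simp
  also have "\<dots> \<le> (\<Sum>\<^sub>\<infinity>y\<in>B. \<Sum>\<^sub>\<infinity>x\<in>A. g x y)"
    using F by (intro infsum_mono ennreal_finite_sum_le_infsum ennreal_summable_on)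
  finally show "(\<Sum>x\<in>F. \<Sum>\<^sub>\<infinity>y\<in>B. g x y) \<le> (\<Sum>\<^sub>\<infinity>y\<in>B. \<Sum>\<^sub>\<infinity>x\<in>A. g x y)" .
qed (rule ennreal_summable_on)

lemma ennreal_infsum_swap:
  fixes g :: "'a \<Rightarrow> 'b \<Rightarrow> ennreal"
  shows "(\<Sum>\<^sub>\<infinity>x\<in>A. \<Sum>\<^sub>\<infinity>y\<in>B. g x y) = (\<Sum>\<^sub>\<infinity>y\<in>B. \<Sum>\<^sub>\<infinity>x\<in>A. g x y)"
  by (intro antisym ennreal_infsum_swap_le)

lemma infsum_ennreal_has_sum:
  fixes f :: "'a \<Rightarrow> real"
  assumes "(f has_sum r) A" "\<And>x. x \<in> A \<Longrightarrow> 0 \<le> f x"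
  shows "(\<Sum>\<^sub>\<infinity>x\<in>A. ennreal (f x)) = ennreal r"
proof -
  have "ennreal r = ennreal (infsum f A)" using assms(1) by (simp add: infsumI)
  also have "\<dots> = (SUP F\<in>{F. finite F \<and> F \<subseteq> A}. ennreal (sum f F))"
    using assms by (intro infsum_nonneg_is_SUPREMUM_ennreal) (auto simp: summable_on_def)
  also have "\<dots> = (SUP F\<in>{F. finite F \<and> F \<subseteq> A}. (\<Sum>x\<in>F. ennreal (f x)))"
    using assms(2) by (intro SUP_cong refl sum_ennreal[symmetric]) auto
  also have "\<dots> = (\<Sum>\<^sub>\<infinity>x\<in>A. ennreal (f x))" by (rule nonneg_infsum_complete[symmetric]) simp
  finally show ?thesis by simp
qed

lemma summable_on_ennreal_bounded:
  fixes f :: "'a \<Rightarrow> real"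
  assumes "(\<Sum>\<^sub>\<infinity>x\<in>A. ennreal (f x)) < \<infinity>" and f: "\<And>x. x \<in> A \<Longrightarrow> 0 \<le> f x"
  shows "f summable_on A" "(\<Sum>\<^sub>\<infinity>x\<in>A. ennreal (f x)) = ennreal (infsum f A)"
proof -
  obtain C where C: "(\<Sum>\<^sub>\<infinity>x\<in>A. ennreal (f x)) = ennreal C" "C \<ge> 0"
    using assms(1) by (cases "\<Sum>\<^sub>\<infinity>x\<in>A. ennreal (f x)") auto
  show s: "f summable_on A"
  proof (rule nonneg_bdd_above_summable_on; (rule bdd_aboveI)?)
    show "0 \<le> f x" if "x \<in> A" for x using f[OF that] .
    fix y assume "y \<in> sum f ` {F. F \<subseteq> A \<and> finite F}"
    then obtain F where F: "y = sum f F" "F \<subseteq> A" "finite F" by blast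
    have "ennreal (sum f F) = (\<Sum>x\<in>F. ennreal (f x))" using F f by (simp add: sum_ennreal subset_iff)
    also have "\<dots> \<le> ennreal C" unfolding C(1)[symmetric] using F by (intro ennreal_finite_sum_le_infsum) auto
    finally show "y \<le> C" using C(2) F(1) by simp
  qed
  show "(\<Sum>\<^sub>\<infinity>x\<in>A. ennreal (f x)) = ennreal (infsum f A)"
    by (rule infsum_ennreal_has_sum[OF has_sum_infsum[OF s] f])
qed

lemma eigenbasis_has_sum:
  assumes F: "orthonormal_basis F" and T: "bounded_clinear T"
    and ev: "\<And>f. f \<in> F \<Longrightarrow> T f = c f *\<^sub>C f"
  shows "((\<lambda>f. cinner z f * c f * cinner f x) has_sum cinner z (T x)) F"
proof -
  have "((\<lambda>f. cinner z (T (cinner f x *\<^sub>C f))) has_sum cinner z (T x)) F"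
    using has_sum_bounded_linear[OF bounded_linear_compose[OF bounded_linear_cinner_right
          bounded_clinear_bounded_linear[OF T]] orthonormal_basis_has_sum[OF F, of x]]
    by (simp add: o_def)
  then show ?thesis
    by (rule has_sum_cong[THEN iffD1, rotated])
      (simp add: ev bounded_clinear_scaleC[OF T] cinner_scaleC_right mult_ac)
qed

text \<open>Expand \<open>\<langle>e, P e\<rangle>\<close> in the eigenbasis and exchange the two sums of nonnegative terms; the inner sum is then
  Parseval's identity for \<open>f\<close>.\<close>

theorem trace_pos_eigenbasis:
  fixes P :: "'a::complex_hilbert_space \<Rightarrow> 'a"
  assumes F: "orthonormal_basis F" and P: "bounded_clinear P"
    and ev: "\<And>f. f \<in> F \<Longrightarrow> P f = complex_of_real (\<sigma> f) *\<^sub>C f" and pos: "\<And>f. f \<in> F \<Longrightarrow> 0 \<le> \<sigma> f"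
  shows "trace_pos P = (\<Sum>\<^sub>\<infinity>f\<in>F. ennreal (\<sigma> f))"
proof -
  define B where "B = (SOME B :: 'a set. orthonormal_basis B)"
  have B: "orthonormal_basis B" unfolding B_def by (rule some_orthonormal_basis)
  have e: "((\<lambda>f. \<sigma> f * (cmod (cinner e f))\<^sup>2) has_sum Re (cinner e (P e))) F" for e
  proof -
    have "cinner e f * complex_of_real (\<sigma> f) * cinner f e = complex_of_real (\<sigma> f * (cmod (cinner e f))\<^sup>2)" for f
      using complex_norm_square[of "cinner e f"] cinner_commute[of f e] by (simp add: mult_ac)
    with has_sum_Re[OF eigenbasis_has_sum[OF F P ev, of e e]] show ?thesis by simp
  qed
  have "trace_pos P = (\<Sum>\<^sub>\<infinity>e\<in>B. ennreal (Re (cinner e (P e))))" by (simp add: trace_pos_def B_def)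
  also have "\<dots> = (\<Sum>\<^sub>\<infinity>e\<in>B. \<Sum>\<^sub>\<infinity>f\<in>F. ennreal (\<sigma> f * (cmod (cinner e f))\<^sup>2))"
    by (intro infsum_cong infsum_ennreal_has_sum[OF e, symmetric]) (simp add: pos)
  also have "\<dots> = (\<Sum>\<^sub>\<infinity>f\<in>F. \<Sum>\<^sub>\<infinity>e\<in>B. ennreal (\<sigma> f * (cmod (cinner e f))\<^sup>2))" by (rule ennreal_infsum_swap)
  also have "\<dots> = (\<Sum>\<^sub>\<infinity>f\<in>F. ennreal (\<sigma> f))"
  proof (rule infsum_cong)
    fix f assume f: "f \<in> F"
    have "((\<lambda>e. \<sigma> f * (cmod (cinner e f))\<^sup>2) has_sum \<sigma> f * (norm f)\<^sup>2) B"
      by (intro has_sum_cmult_right Parseval B)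
    then show "(\<Sum>\<^sub>\<infinity>e\<in>B. ennreal (\<sigma> f * (cmod (cinner e f))\<^sup>2)) = ennreal (\<sigma> f)"
      using F f pos by (subst infsum_ennreal_has_sum) (auto simp: orthonormal_basis_def)
  qed
  finally show ?thesis .
qed

lemma bounded_clinear_pow_eigenvector:
  "bounded_clinear T \<Longrightarrow> T x = c *\<^sub>C x \<Longrightarrow> (T ^^ k) x = c ^ k *\<^sub>C x"
  by (induction k) (simp_all add: bounded_clinear_scaleC scaleC_scaleC mult.commute)

text \<open>The eigenvalues \<open>\<sigma>\<close> of the absolute value are the singular values.\<close>

lemma trace_pos_abs_op_pow:
  assumes F: "orthonormal_basis F" and T: "bounded_clinear T"
    and ev: "\<And>f. f \<in> F \<Longrightarrow> adj T (T f) = complex_of_real ((\<sigma> f)\<^sup>2) *\<^sub>C f" and pos: "\<And>f. f \<in> F \<Longrightarrow> 0 \<le> \<sigma> f"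
  shows "trace_pos (abs_op T ^^ s) = (\<Sum>\<^sub>\<infinity>f\<in>F. ennreal (\<sigma> f ^ s))"
proof (rule trace_pos_eigenbasis[OF F])
  note bc = positive_op_bounded_clinear[OF positive_op_abs_op[OF T]]
  show "bounded_clinear (abs_op T ^^ s)" by (rule bounded_clinear_pow[OF bc])
  show "(abs_op T ^^ s) f = complex_of_real (\<sigma> f ^ s) *\<^sub>C f" if "f \<in> F" for f
    using bounded_clinear_pow_eigenvector[OF bc abs_op_eigenvector[OF T ev[OF that] pos[OF that]], of s] by simp
qed (simp add: pos)

subsection \<open>Schatten class operators are compact\<close>

text \<open>Even powers are squares, and odd powers are squares with one factor \<open>P\<close> in the middle.\<close>

lemma positive_op_pow:
  assumes P: "positive_op P"
  shows "positive_op (P ^^ s)"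
  unfolding positive_op_def
proof (intro conjI allI)
  note bc = positive_op_bounded_clinear[OF P]
  show "bounded_clinear (P ^^ s)" by (rule bounded_clinear_pow[OF bc])
  fix x
  obtain k where "s = k + k \<or> s = Suc (k + k)" by (metis oddE evenE mult_2 Suc_eq_plus1)
  moreover have "cinner x ((P ^^ (k + k)) x) = cinner ((P ^^ k) x) ((P ^^ k) x)"
    unfolding funpow_add o_apply using self_adjoint_pow[of P k x] positive_op_self_adjoint[OF P] by simp
  moreover have "cinner x ((P ^^ Suc (k + k)) x) = cinner ((P ^^ k) x) (P ((P ^^ k) x))"
  proof -
    have "(P ^^ Suc (k + k)) x = (P ^^ k) ((P ^^ Suc k) x)"
      using funpow_add[of k "Suc k" P] by simp
    then show ?thesis using self_adjoint_pow[of P k x] positive_op_self_adjoint[OF P] by simp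
  qed
  ultimately show "cinner x ((P ^^ s) x) \<in> \<real>" "0 \<le> Re (cinner x ((P ^^ s) x))"
    using P by (auto simp: positive_op_def cinner_self)
qed

lemma compact_op_pow_descend:
  assumes P: "bounded_clinear P" "\<And>x y. cinner (P x) y = cinner x (P y)"
    and "compact_op (P ^^ Suc s)"
  shows "compact_op P"
  using assms(3)
proof (induction s)
  case (Suc s)
  have "compact_op (P ^^ Suc s)"
  proof (rule compact_op_dominated[OF Suc.prems, where C = "onorm (P ^^ s)"])
    show "onorm (P ^^ s) \<ge> 0" by (intro onorm_nonneg bounded_clinear_pow P)
    show "bounded_clinear (P ^^ Suc s)" by (intro bounded_clinear_pow P)
    fix x
    have "cinner ((P ^^ Suc s) x) ((P ^^ Suc s) x) = cinner ((P ^^ s) x) ((P ^^ Suc (Suc s)) x)"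
      by (simp add: P(2))
    then have "cmod (complex_of_real ((norm ((P ^^ Suc s) x))\<^sup>2)) = cmod (cinner ((P ^^ s) x) ((P ^^ Suc (Suc s)) x))"
      unfolding cinner_self by (rule arg_cong)
    then have "(norm ((P ^^ Suc s) x))\<^sup>2 = cmod (cinner ((P ^^ s) x) ((P ^^ Suc (Suc s)) x))"
      by (simp only: norm_of_real abs_power2)
    also have "\<dots> \<le> norm ((P ^^ s) x) * norm ((P ^^ Suc (Suc s)) x)" by (rule Cauchy_Schwarz)
    also have "\<dots> \<le> onorm (P ^^ s) * norm x * norm ((P ^^ Suc (Suc s)) x)"
      by (intro mult_right_mono norm_le_onorm bounded_clinear_pow P) simp
    finally show "(norm ((P ^^ Suc s) x))\<^sup>2 \<le> onorm (P ^^ s) * norm x * norm ((P ^^ Suc (Suc s)) x)" .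
  qed
  then show ?case by (rule Suc.IH)
qed simp

text \<open>The operator is even Hilbert--Schmidt, since \<open>\<parallel>Q e\<parallel>\<^sup>2\<close> is at most a constant times \<open>\<langle>e, Q e\<rangle>\<close>.\<close>

lemma compact_op_of_trace_pos:
  assumes Q: "positive_op Q" and tr: "trace_pos Q < \<infinity>"
  shows "compact_op Q"
proof -
  note bc = positive_op_bounded_clinear[OF Q]
  define B where "B = (SOME B :: 'a set. orthonormal_basis B)"
  have B: "orthonormal_basis B" unfolding B_def by (rule some_orthonormal_basis)
  have s: "(\<lambda>e. Re (cinner e (Q e))) summable_on B"
    using tr positive_op_ge[OF Q] by (intro summable_on_ennreal_bounded(1)) (auto simp: trace_pos_def B_def)
  show ?thesis
  proof (rule compact_op_Hilbert_Schmidt[OF B bc])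
    show "(\<lambda>e. (norm (Q e))\<^sup>2) summable_on B"
    proof (rule summable_on_comparison_test)
      show "(\<lambda>e. (onorm Q + 1) * Re (cinner e (Q e))) summable_on B" by (intro summable_on_cmult_right s)
      show "(norm (Q e))\<^sup>2 \<le> (onorm Q + 1) * Re (cinner e (Q e))" for e
        using onorm_nonneg[OF bc] by (intro positive_op_norm_sq[OF Q] positive_op_form_le[OF Q]) simp
    qed simp
  qed
qed

theorem schatten_class_compact:
  assumes "schatten_class s T" "s \<ge> 1"
  shows "compact_op T"
proof -
  have T: "bounded_clinear T" and tr: "trace_pos (abs_op T ^^ s) < \<infinity>"
    using assms by (auto simp: schatten_class_def)
  note P = positive_op_abs_op[OF T]
  obtain k where k: "s = Suc k" using assms(2) by (cases s) auto
  have "compact_op (abs_op T ^^ Suc k)"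
    using compact_op_of_trace_pos[OF positive_op_pow[OF P] tr] unfolding k .
  then have "compact_op (abs_op T)"
    by (rule compact_op_pow_descend[OF positive_op_bounded_clinear[OF P] positive_op_self_adjoint[OF P]])
  then show ?thesis
  proof (rule compact_op_le[OF _ T])
    show "norm (T x) \<le> 1 * norm (abs_op T x)" for x by (simp add: norm_abs_op[OF T])
  qed simp
qed

section \<open>Unbounded self-adjoint operators\<close>

lemma dense_cinner_eqI:
  fixes S :: "'a::complex_hilbert_space set"
  assumes S: "closure S = UNIV" and eq: "\<And>x. x \<in> S \<Longrightarrow> cinner z x = cinner z' x"
  shows "z = z'"
proof (rule cinner_eqI_left)
  fix x
  have "closed {x. cinner z x = cinner z' x}" by (intro closed_Collect_eq continuous_intros)
  moreover have "S \<subseteq> {x. cinner z x = cinner z' x}" using eq by blast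
  ultimately have "closure S \<subseteq> {x. cinner z x = cinner z' x}" by (rule closure_minimal[rotated])
  then show "cinner z x = cinner z' x" using S by blast
qed

lemma adjoint_operator_eq_Some_iff:
  assumes "closure (dom D) = UNIV"
  shows "adjoint_operator D y = Some z \<longleftrightarrow> (\<forall>x\<in>dom D. cinner y (the (D x)) = cinner z x)"
proof
  assume l: "adjoint_operator D y = Some z"
  then obtain w where w: "\<forall>x\<in>dom D. cinner y (the (D x)) = cinner w x"
    by (auto simp: adjoint_operator_def split: if_splits)
  have "(THE z. \<forall>x\<in>dom D. cinner y (the (D x)) = cinner z x) = w"
    using w by (intro the_equality) (auto intro!: dense_cinner_eqI[OF assms])
  then have "z = w" using l w by (auto simp: adjoint_operator_def split: if_splits)
  then show "\<forall>x\<in>dom D. cinner y (the (D x)) = cinner z x" using w by simp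
next
  assume r: "\<forall>x\<in>dom D. cinner y (the (D x)) = cinner z x"
  have "(THE z. \<forall>x\<in>dom D. cinner y (the (D x)) = cinner z x) = z"
    using r by (intro the_equality) (auto intro!: dense_cinner_eqI[OF assms])
  then show "adjoint_operator D y = Some z" unfolding adjoint_operator_def using r by auto
qed

text \<open>For a dense domain the description operator in the adjoint is determined, and self-adjointness becomes a condition on
  the graph.\<close>

lemma self_adjoint_iff:
  "self_adjoint D \<longleftrightarrow> linear_operator D \<and> closure (dom D) = UNIV \<and>
    (\<forall>y z. D y = Some z \<longleftrightarrow> (\<forall>x\<in>dom D. cinner y (the (D x)) = cinner z x))"
  (is "?L \<longleftrightarrow> ?R")
proof
  assume ?L
  then show ?R unfolding self_adjoint_def using adjoint_operator_eq_Some_iff[of D] by metis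
next
  assume R: ?R
  have "adjoint_operator D y = D y" for y
  proof -
    have "adjoint_operator D y = Some z \<longleftrightarrow> D y = Some z" for z
      using R adjoint_operator_eq_Some_iff[of D y z] by blast
    then show ?thesis by (metis option.exhaust)
  qed
  then show ?L using R unfolding self_adjoint_def by blast
qed

context
  fixes D :: "'a::complex_hilbert_space \<rightharpoonup> 'a"
  assumes D: "self_adjoint D"
begin

lemma self_adjoint_SomeI: "(\<And>x. x \<in> dom D \<Longrightarrow> cinner y (the (D x)) = cinner z x) \<Longrightarrow> D y = Some z"
  using D by (simp add: self_adjoint_iff)

lemma self_adjoint_symmetric:
  "x \<in> dom D \<Longrightarrow> y \<in> dom D \<Longrightarrow> cinner y (the (D x)) = cinner (the (D y)) x"
  using D unfolding self_adjoint_iff by fastforce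

lemma self_adjoint_zero: "D 0 = Some 0"
  using D by (simp add: self_adjoint_def linear_operator_def)

lemma self_adjoint_add: "x \<in> dom D \<Longrightarrow> y \<in> dom D \<Longrightarrow> D (x + y) = Some (the (D x) + the (D y))"
  using D by (simp add: self_adjoint_def linear_operator_def)

lemma self_adjoint_scaleC: "x \<in> dom D \<Longrightarrow> D (c *\<^sub>C x) = Some (c *\<^sub>C the (D x))"
  using D by (simp add: self_adjoint_def linear_operator_def)

lemma self_adjoint_diff:
  assumes "x \<in> dom D" "y \<in> dom D"
  shows "D (x - y) = Some (the (D x) - the (D y))"
proof -
  have m: "D ((-1) *\<^sub>C y) = Some ((-1) *\<^sub>C the (D y))" by (rule self_adjoint_scaleC[OF assms(2)])
  have "D (x + (-1) *\<^sub>C y) = Some (the (D x) + the (D ((-1) *\<^sub>C y)))"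
    by (rule self_adjoint_add[OF assms(1)]) (use m in blast)
  then show ?thesis using m by (simp add: scaleC_minus_left)
qed

lemma self_adjoint_form_real: "x \<in> dom D \<Longrightarrow> cinner x (the (D x)) \<in> \<real>"
  using self_adjoint_symmetric[of x x] cinner_commute[of x "the (D x)"] by (simp add: Reals_cnj_iff)

lemma self_adjoint_eigenvalue_real:
  assumes x: "D x = Some (c *\<^sub>C x)" "x \<noteq> 0"
  shows "c \<in> \<real>"
proof -
  have "x \<in> dom D" using x by blast
  from self_adjoint_form_real[OF this] have "c * of_real ((norm x)\<^sup>2) \<in> \<real>"
    using x by (simp add: cinner_scaleC_right cinner_self)
  then have "c * of_real ((norm x)\<^sup>2) / of_real ((norm x)\<^sup>2) \<in> \<real>" by (rule Reals_divide) simp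
  then show ?thesis using x(2) by simp
qed

text \<open>The cross term vanishes because \<open>\<langle>D x, x\<rangle>\<close> is real and \<open>z\<close> is imaginary.\<close>

lemma self_adjoint_norm_shift:
  assumes z: "z = \<i> \<or> z = -\<i>" and x: "x \<in> dom D"
  shows "(norm (the (D x) - z *\<^sub>C x))\<^sup>2 = (norm (the (D x)))\<^sup>2 + (norm x)\<^sup>2"
proof -
  have r: "cinner (the (D x)) x \<in> \<real>"
    using self_adjoint_form_real[OF x] cinner_commute[of x "the (D x)"] by (simp add: Reals_cnj_iff)
  then have "Re (cinner (the (D x)) (z *\<^sub>C x)) = 0"
    using z by (auto simp: cinner_scaleC_right complex_is_Real_iff)
  then show ?thesis using z unfolding norm_diff_sq by (auto simp: norm_scaleC)
qed

text \<open>The range of \<open>D - z\<close> is closed because \<open>D - z\<close> is bounded below. A vector orthogonal to it would be an eigenvector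
  of \<open>D\<close> for the eigenvalue \<open>cnj z\<close>, which is not real.\<close>

lemma self_adjoint_shift_surj:
  assumes z: "z = \<i> \<or> z = -\<i>"
  obtains x where "x \<in> dom D" "the (D x) - z *\<^sub>C x = y"
proof -
  define M where "M = (\<lambda>x. the (D x) - z *\<^sub>C x) ` dom D"
  have M: "csubspace M"
    unfolding csubspace_def
  proof (intro conjI ballI allI)
    show "0 \<in> M" unfolding M_def by (rule image_eqI[of _ _ 0]) (auto simp: self_adjoint_zero)
    fix a assume "a \<in> M"
    then obtain x where x: "x \<in> dom D" "a = the (D x) - z *\<^sub>C x" unfolding M_def by blast
    show "c *\<^sub>C a \<in> M" for c
      unfolding M_def
      by (rule image_eqI[of _ _ "c *\<^sub>C x"])
        (use self_adjoint_scaleC[OF x(1), of c] x in \<open>auto simp: scaleC_diff_right scaleC_scaleC mult.commute\<close>)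
    fix b assume "b \<in> M"
    then obtain v where v: "v \<in> dom D" "b = the (D v) - z *\<^sub>C v" unfolding M_def by blast
    show "a + b \<in> M"
      unfolding M_def
      by (rule image_eqI[of _ _ "x + v"])
        (use self_adjoint_add[OF x(1) v(1)] x v in \<open>auto simp: scaleC_add_right\<close>)
  qed
  have "closed M"
    unfolding closed_sequential_limits
  proof (intro allI impI, elim conjE)
    fix a l assume a: "\<forall>n. a n \<in> M" and l: "a \<longlonglongrightarrow> l"
    have "\<exists>x. x \<in> dom D \<and> a n = the (D x) - z *\<^sub>C x" for n using a unfolding M_def by blast
    then obtain x where x: "\<And>n. x n \<in> dom D" "\<And>n. a n = the (D (x n)) - z *\<^sub>C x n" by metis
    have dx: "norm (x m - x n) \<le> norm (a m - a n)" for m n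
    proof (rule power2_le_imp_le)
      have d: "D (x m - x n) = Some (the (D (x m)) - the (D (x n)))" by (intro self_adjoint_diff x)
      have "(norm (a m - a n))\<^sup>2 = (norm (the (D (x m - x n)) - z *\<^sub>C (x m - x n)))\<^sup>2"
        unfolding d x(2) by (simp add: scaleC_diff_right algebra_simps)
      also have "\<dots> = (norm (the (D (x m - x n))))\<^sup>2 + (norm (x m - x n))\<^sup>2"
        by (rule self_adjoint_norm_shift[OF z]) (use d in blast)
      finally show "(norm (x m - x n))\<^sup>2 \<le> (norm (a m - a n))\<^sup>2" by simp
    qed simp
    have "Cauchy x"
    proof (rule CauchyI)
      fix e :: real assume "0 < e"
      then obtain N where "\<forall>m\<ge>N. \<forall>n\<ge>N. norm (a m - a n) < e"
        using CauchyD[OF LIMSEQ_imp_Cauchy[OF l]] by blast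
      then show "\<exists>N. \<forall>m\<ge>N. \<forall>n\<ge>N. norm (x m - x n) < e" using dx order_le_less_trans by blast
    qed
    then obtain x' where x': "x \<longlonglongrightarrow> x'" using Cauchy_convergent convergent_def by blast
    have "D x' = Some (l + z *\<^sub>C x')"
    proof (rule self_adjoint_SomeI)
      fix v assume v: "v \<in> dom D"
      have 1: "(\<lambda>n. cinner (x n) (the (D v))) \<longlonglongrightarrow> cinner x' (the (D v))"
        by (rule tendsto_cinner[OF x' tendsto_const])
      have 2: "(\<lambda>n. cinner (a n + z *\<^sub>C x n) v) \<longlonglongrightarrow> cinner (l + z *\<^sub>C x') v"
        by (intro tendsto_cinner tendsto_add tendsto_scaleC tendsto_const l x')
      have "cinner (x n) (the (D v)) = cinner (a n + z *\<^sub>C x n) v" for n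
        using self_adjoint_symmetric[OF v x(1)] x(2) by simp
      with 1 2 show "cinner x' (the (D v)) = cinner (l + z *\<^sub>C x') v"
        using LIMSEQ_unique by simp
    qed
    then show "l \<in> M" unfolding M_def by (intro image_eqI[of _ _ x']) auto
  qed
  obtain m where m: "m \<in> M" "\<And>z. z \<in> M \<Longrightarrow> cinner z (y - m) = 0"
    using orthogonal_projection[OF M \<open>closed M\<close>] by blast
  define w where "w = y - m"
  have "D w = Some (cnj z *\<^sub>C w)"
  proof (rule self_adjoint_SomeI)
    fix x assume "x \<in> dom D"
    then have "cinner (the (D x) - z *\<^sub>C x) w = 0" unfolding w_def by (intro m(2)) (auto simp: M_def)
    then have "cinner w (the (D x) - z *\<^sub>C x) = 0" by (simp add: cinner_zero_comm)
    then show "cinner w (the (D x)) = cinner (cnj z *\<^sub>C w) x" by (simp add: cinner_simps)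
  qed
  have "w = 0"
  proof (rule ccontr)
    assume "w \<noteq> 0"
    with \<open>D w = Some (cnj z *\<^sub>C w)\<close> have "cnj z \<in> \<real>" by (rule self_adjoint_eigenvalue_real)
    then show False using z by (auto simp: complex_is_Real_iff)
  qed
  then have "y \<in> M" using m(1) by (simp add: w_def)
  then show ?thesis using that unfolding M_def by blast
qed

lemma resolvent_shift:
  assumes z: "z = \<i> \<or> z = -\<i>" and x: "x \<in> dom D"
  shows "resolvent D z (the (D x) - z *\<^sub>C x) = x"
  unfolding resolvent_def
proof (rule the_equality)
  fix v assume v: "v \<in> dom D \<and> the (D v) - z *\<^sub>C v = the (D x) - z *\<^sub>C x"
  then have d: "D (v - x) = Some (the (D v) - the (D x))" by (intro self_adjoint_diff x) auto
  have "(norm (the (D (v - x)) - z *\<^sub>C (v - x)))\<^sup>2 = (norm (the (D (v - x))))\<^sup>2 + (norm (v - x))\<^sup>2"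
    by (rule self_adjoint_norm_shift[OF z]) (use d in blast)
  moreover have "the (D (v - x)) - z *\<^sub>C (v - x) = 0"
    unfolding d using v by (simp add: scaleC_diff_right algebra_simps)
  ultimately have "(norm (the (D (v - x))))\<^sup>2 + (norm (v - x))\<^sup>2 = 0" by simp
  then show "v = x" by (simp add: add_nonneg_eq_0_iff)
qed (use x in simp)

lemma resolvent_dom: "z = \<i> \<or> z = -\<i> \<Longrightarrow> resolvent D z y \<in> dom D"
  and resolvent_eq: "z = \<i> \<or> z = -\<i> \<Longrightarrow> the (D (resolvent D z y)) = y + z *\<^sub>C resolvent D z y"
proof -
  assume z: "z = \<i> \<or> z = -\<i>"
  obtain x where x: "x \<in> dom D" "the (D x) - z *\<^sub>C x = y" using self_adjoint_shift_surj[OF z] by blast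
  then have "resolvent D z y = x" using resolvent_shift[OF z x(1)] by simp
  then show "resolvent D z y \<in> dom D" "the (D (resolvent D z y)) = y + z *\<^sub>C resolvent D z y"
    using x by (auto simp: diff_eq_eq)
qed

lemma resolventI:
  assumes z: "z = \<i> \<or> z = -\<i>" and "D x = Some w" "w = y + z *\<^sub>C x"
  shows "resolvent D z y = x"
  using resolvent_shift[OF z, of x] assms(2,3) by auto

lemma
  assumes z: "z = \<i> \<or> z = -\<i>"
  shows bounded_clinear_resolvent: "bounded_clinear (resolvent D z)"
    and norm_resolvent_le: "norm (resolvent D z y) \<le> norm y"
proof -
  note dom = resolvent_dom[OF z] and eq = resolvent_eq[OF z]
  have n: "norm (resolvent D z y) \<le> 1 * norm y" for y
  proof (rule power2_le_imp_le)
    show "(norm (resolvent D z y))\<^sup>2 \<le> (1 * norm y)\<^sup>2"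
      using self_adjoint_norm_shift[OF z dom[of y]] by (simp add: eq)
  qed simp
  then show "norm (resolvent D z y) \<le> norm y" by simp
  show "bounded_clinear (resolvent D z)"
  proof (rule bounded_clinearI[OF _ _ n])
    show "resolvent D z (x + y) = resolvent D z x + resolvent D z y" for x y
      by (rule resolventI[OF z self_adjoint_add[OF dom dom]]) (simp add: eq scaleC_add_right)
    show "resolvent D z (c *\<^sub>C x) = c *\<^sub>C resolvent D z x" for c x
      by (rule resolventI[OF z self_adjoint_scaleC[OF dom]])
        (simp add: eq scaleC_add_right scaleC_scaleC mult.commute)
  qed
qed

lemma adj_resolvent:
  assumes z: "z = \<i> \<or> z = -\<i>"
  shows "adj (resolvent D z) = resolvent D (- z)"
proof (rule adj_unique)
  fix x y
  have z': "- z = \<i> \<or> - z = -\<i>" and cz: "cnj z = - z" using z by auto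
  let ?a = "resolvent D (- z) x" and ?b = "resolvent D z y"
  have "cinner ?a (the (D ?b)) = cinner (the (D ?a)) ?b"
    by (rule self_adjoint_symmetric[OF resolvent_dom[OF z] resolvent_dom[OF z']])
  then show "cinner ?a y = cinner x ?b"
    unfolding resolvent_eq[OF z] resolvent_eq[OF z'] by (simp add: cinner_simps cz)
qed

lemma resolvent_diff:
  assumes z: "z = \<i> \<or> z = -\<i>"
  shows "resolvent D z y - resolvent D (- z) y = (2 * z) *\<^sub>C resolvent D (- z) (resolvent D z y)"
proof -
  have z': "- z = \<i> \<or> - z = -\<i>" using z by auto
  note bc = bounded_clinear_resolvent[OF z']
  let ?a = "resolvent D z y"
  have "resolvent D (- z) (y + (2 * z) *\<^sub>C ?a) = ?a"
  proof (rule resolventI[OF z'])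
    show "D ?a = Some (the (D ?a))" using resolvent_dom[OF z, of y] by (auto simp: dom_def)
    show "the (D ?a) = y + (2 * z) *\<^sub>C ?a + (- z) *\<^sub>C ?a"
      by (simp add: resolvent_eq[OF z] add.assoc flip: scaleC_add_left)
  qed
  then show ?thesis by (simp add: bounded_clinear_add[OF bc] bounded_clinear_scaleC[OF bc] algebra_simps)
qed

end

definition eigenbasis :: "('a::complex_hilbert_space \<rightharpoonup> 'a) \<Rightarrow> 'a set \<Rightarrow> ('a \<Rightarrow> real) \<Rightarrow> bool" where
  "eigenbasis D F \<mu> \<longleftrightarrow>
    orthonormal_basis F \<and> (\<forall>e\<in>F. D e = Some (complex_of_real (\<mu> e) *\<^sub>C e))"

text \<open>The resolvents \<open>R\<close> and \<open>R'\<close> at \<open>\<i>\<close> and \<open>- \<i>\<close> are adjoint to each other and commute by the resolvent identity. So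
  \<open>R + R'\<close> and \<open>R' R\<close> are commuting compact self-adjoint operators, and \<open>2 R = (R + R') + 2 \<i> R' R\<close>. A joint
  eigenvector of the two is an eigenvector of \<open>R\<close>, hence of \<open>D\<close>.\<close>

theorem self_adjoint_eigenbasis:
  assumes D: "self_adjoint D" and comp: "compact_op (resolvent D \<i>)"
  obtains F \<mu> where "eigenbasis D F \<mu>"
proof -
  define R where "R = resolvent D \<i>"
  define R' where "R' = resolvent D (-\<i>)"
  have bR: "bounded_clinear R" and bR': "bounded_clinear R'"
    unfolding R_def R'_def by (simp_all add: bounded_clinear_resolvent[OF D])
  have c1: "cinner (R' x) y = cinner x (R y)" for x y
    using adj_resolvent[OF D, of \<i>] cinner_adj[OF bR] by (simp add: R_def R'_def)
  have c2: "cinner (R x) y = cinner x (R' y)" for x y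
    using c1[of y x] cinner_commute[of "R x" y] cinner_commute[of x "R' y"] by simp
  have d1: "R y - R' y = (2 * \<i>) *\<^sub>C R' (R y)" for y
    using resolvent_diff[OF D, of \<i> y] by (simp add: R_def R'_def)
  have d2: "R' y - R y = - ((2 * \<i>) *\<^sub>C R (R' y))" for y
    using resolvent_diff[OF D, of "-\<i>" y] by (simp add: R_def R'_def scaleC_minus_left)
  have comm: "R' (R y) = R (R' y)" for y
  proof -
    have "(2 * \<i>) *\<^sub>C R' (R y) = (2 * \<i>) *\<^sub>C R (R' y)" using d1[of y] d2[of y]
      by (metis minus_diff_eq neg_equal_iff_equal)
    then have "(1 / (2 * \<i>)) *\<^sub>C ((2 * \<i>) *\<^sub>C R' (R y)) = (1 / (2 * \<i>)) *\<^sub>C ((2 * \<i>) *\<^sub>C R (R' y))" by simp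
    then show ?thesis by (simp add: scaleC_scaleC)
  qed
  have cR: "compact_op R" using comp by (simp add: R_def)
  have cR': "compact_op R'"
  proof (rule compact_op_le[OF cR bR'])
    fix x
    have "R' x = R x - (2 * \<i>) *\<^sub>C R' (R x)" using d1[of x] by (simp add: algebra_simps)
    then have "norm (R' x) \<le> norm (R x) + norm ((2 * \<i>) *\<^sub>C R' (R x))" by (metis norm_triangle_ineq4)
    also have "norm ((2 * \<i>) *\<^sub>C R' (R x)) \<le> 2 * norm (R x)"
      unfolding R'_def norm_scaleC using norm_resolvent_le[OF D, of "-\<i>" "R x"] by simp
    finally show "norm (R' x) \<le> 3 * norm (R x)" by simp
  qed simp
  define A where "A = R' \<circ> R"
  define B where "B = (\<lambda>x. R x + R' x)"
  have A: "compact_op A" "\<And>x y. cinner (A x) y = cinner x (A y)"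
    unfolding A_def by (auto intro: compact_op_comp_left bR' cR simp: c1 c2)
  have B: "compact_op B" "\<And>x y. cinner (B x) y = cinner x (B y)"
    unfolding B_def by (auto intro: compact_op_add cR cR' simp: c1 c2 cinner_simps)
  have AB: "A (B x) = B (A x)" for x
    by (simp add: A_def B_def bounded_clinear_add[OF bR] bounded_clinear_add[OF bR'] comm)
  obtain F where F: "orthonormal_basis F"
    "\<And>e. e \<in> F \<Longrightarrow> \<exists>\<alpha>. A e = complex_of_real \<alpha> *\<^sub>C e" "\<And>e. e \<in> F \<Longrightarrow> \<exists>\<beta>. B e = complex_of_real \<beta> *\<^sub>C e"
    using compact_joint_eigenbasis[OF A B AB] by metis
  have "\<exists>r. D e = Some (complex_of_real r *\<^sub>C e)" if e: "e \<in> F" for e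
  proof -
    have e0: "e \<noteq> 0" using F(1) e by (auto simp: orthonormal_basis_def)
    obtain \<alpha> \<beta> where ab: "A e = complex_of_real \<alpha> *\<^sub>C e" "B e = complex_of_real \<beta> *\<^sub>C e" using F(2,3)[OF e] by blast
    define \<rho> where "\<rho> = (complex_of_real \<beta> + 2 * \<i> * complex_of_real \<alpha>) / 2"
    have "2 *\<^sub>C R e = B e + (R e - R' e)"
      using scaleC_of_real[of 2 "R e"] by (simp add: B_def scaleR_2)
    also have "\<dots> = (2 * \<rho>) *\<^sub>C e"
    proof -
      have "2 * \<rho> = complex_of_real \<beta> + 2 * \<i> * complex_of_real \<alpha>" by (simp add: \<rho>_def)
      moreover have "R' (R e) = complex_of_real \<alpha> *\<^sub>C e" using ab(1) by (simp add: A_def)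
      ultimately show ?thesis unfolding ab(2) d1 by (simp only: scaleC_add_left scaleC_scaleC)
    qed
    finally have "(1 / 2) *\<^sub>C (2 *\<^sub>C R e) = (1 / 2) *\<^sub>C ((2 * \<rho>) *\<^sub>C e)" by simp
    then have Re: "R e = \<rho> *\<^sub>C e" by (simp add: scaleC_scaleC)
    have r0: "\<rho> \<noteq> 0"
    proof
      assume "\<rho> = 0"
      then have "R e = 0" using Re by simp
      then show False using resolvent_eq[OF D, of \<i> e] self_adjoint_zero[OF D] e0 by (simp add: R_def)
    qed
    have dR: "R e \<in> dom D" unfolding R_def by (rule resolvent_dom[OF D]) simp
    have "D ((1 / \<rho>) *\<^sub>C R e) = Some ((1 / \<rho>) *\<^sub>C the (D (R e)))" by (rule self_adjoint_scaleC[OF D dR])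
    also have "the (D (R e)) = e + \<i> *\<^sub>C (\<rho> *\<^sub>C e)"
      using resolvent_eq[OF D, of \<i> e] Re by (simp add: R_def)
    finally have De: "D e = Some ((1 / \<rho> + \<i>) *\<^sub>C e)"
      using r0 by (simp add: Re scaleC_scaleC scaleC_add_right scaleC_add_left)
    have "1 / \<rho> + \<i> \<in> \<real>" by (rule self_adjoint_eigenvalue_real[OF D De e0])
    then show ?thesis using De by (auto elim!: Reals_cases)
  qed
  then obtain \<mu> where "\<And>e. e \<in> F \<Longrightarrow> D e = Some (complex_of_real (\<mu> e) *\<^sub>C e)" by metis
  then have "eigenbasis D F \<mu>" using F(1) by (simp add: eigenbasis_def)
  then show ?thesis by (rule that)
qed

lemma resolvent_eigenvector:
  assumes D: "self_adjoint D" and e: "D e = Some (complex_of_real r *\<^sub>C e)"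
  shows "resolvent D \<i> e = (1 / (complex_of_real r - \<i>)) *\<^sub>C e"
proof -
  have nz: "complex_of_real r - \<i> \<noteq> 0" by (auto simp: complex_eq_iff)
  have "e \<in> dom D" using e by blast
  from self_adjoint_scaleC[OF D this, of "1 / (complex_of_real r - \<i>)"]
  have "D ((1 / (complex_of_real r - \<i>)) *\<^sub>C e) = Some ((complex_of_real r / (complex_of_real r - \<i>)) *\<^sub>C e)"
    by (simp add: e scaleC_scaleC)
  then show ?thesis
  proof (rule resolventI[OF D, rotated])
    have "complex_of_real r / (complex_of_real r - \<i>) = 1 + \<i> * (1 / (complex_of_real r - \<i>))"
      using nz by (simp add: field_simps)
    then show "(complex_of_real r / (complex_of_real r - \<i>)) *\<^sub>C e = e + \<i> *\<^sub>C ((1 / (complex_of_real r - \<i>)) *\<^sub>C e)"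
      by (simp add: scaleC_scaleC scaleC_add_left)
  qed simp
qed

subsection \<open>Bounded perturbations\<close>

lemma dom_perturb [simp]: "dom (perturb D B) = dom D"
  by (auto simp: perturb_def dom_def)

lemma perturb_zero: "perturb D (\<lambda>_. 0) = D"
  by (simp add: perturb_def fun_eq_iff option.map_ident)

lemma the_perturb: "x \<in> dom D \<Longrightarrow> the (perturb D B x) = the (D x) + B x"
  by (auto simp: perturb_def)

lemma self_adjoint_perturb:
  assumes D: "self_adjoint D" and B: "bounded_self_adjoint B"
  shows "self_adjoint (perturb D B)"
proof -
  have bB: "bounded_clinear B" and sB: "\<And>x y. cinner (B x) y = cinner x (B y)"
    using B by (auto simp: bounded_self_adjoint_def)
  have "linear_operator (perturb D B)"
    unfolding linear_operator_def dom_perturb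
  proof (intro conjI ballI allI)
    show "perturb D B 0 = Some 0" by (simp add: perturb_def self_adjoint_zero[OF D] bounded_clinear_zero[OF bB])
    fix x assume x: "x \<in> dom D"
    show "perturb D B (c *\<^sub>C x) = Some (c *\<^sub>C the (perturb D B x))" for c
      unfolding the_perturb[OF x]
      by (simp add: perturb_def self_adjoint_scaleC[OF D x] bounded_clinear_scaleC[OF bB] scaleC_add_right)
    fix y assume y: "y \<in> dom D"
    show "perturb D B (x + y) = Some (the (perturb D B x) + the (perturb D B y))"
      unfolding the_perturb[OF x] the_perturb[OF y]
      by (simp add: perturb_def self_adjoint_add[OF D x y] bounded_clinear_add[OF bB])
  qed
  moreover have "perturb D B y = Some z \<longleftrightarrow> (\<forall>x\<in>dom D. cinner y (the (perturb D B x)) = cinner z x)" for y z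
  proof -
    have "perturb D B y = Some z \<longleftrightarrow> D y = Some (z - B y)"
      by (auto simp: perturb_def)
    also have "\<dots> \<longleftrightarrow> (\<forall>x\<in>dom D. cinner y (the (D x)) = cinner (z - B y) x)"
      using D unfolding self_adjoint_iff by blast
    also have "\<dots> \<longleftrightarrow> (\<forall>x\<in>dom D. cinner y (the (perturb D B x)) = cinner z x)"
      by (rule ball_cong[OF refl]) (auto simp: the_perturb cinner_simps sB eq_diff_eq)
    finally show ?thesis .
  qed
  ultimately show ?thesis using D unfolding self_adjoint_iff dom_perturb by blast
qed

text \<open>The second resolvent identity, solved for the resolvent of the perturbed operator.\<close>

lemma resolvent_perturb:
  assumes D: "self_adjoint D" and B: "bounded_self_adjoint B"
  shows "resolvent (perturb D B) \<i> = (\<lambda>x. x - resolvent (perturb D B) \<i> (B x)) \<circ> resolvent D \<i>"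
proof
  fix y
  note D' = self_adjoint_perturb[OF D B]
  have i: "\<i> = \<i> \<or> \<i> = -\<i>" by simp
  note bc = bounded_clinear_resolvent[OF D' i]
  let ?x = "resolvent D \<i> y"
  have x: "?x \<in> dom D" by (rule resolvent_dom[OF D i])
  have "resolvent (perturb D B) \<i> (the (perturb D B ?x) - \<i> *\<^sub>C ?x) = ?x"
    by (rule resolvent_shift[OF D' i]) (simp add: x)
  then have "resolvent (perturb D B) \<i> (y + B ?x) = ?x"
    by (simp add: the_perturb[OF x] resolvent_eq[OF D i] algebra_simps)
  then show "resolvent (perturb D B) \<i> y
      = ((\<lambda>x. x - resolvent (perturb D B) \<i> (B x)) \<circ> resolvent D \<i>) y"
    by (simp add: bounded_clinear_add[OF bc] algebra_simps)
qed

lemma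
  assumes D: "self_adjoint D" and B: "bounded_self_adjoint B"
  shows bounded_clinear_perturb_factor: "bounded_clinear (\<lambda>x. x - resolvent (perturb D B) \<i> (B x))"
    and onorm_perturb_factor: "onorm (\<lambda>x. x - resolvent (perturb D B) \<i> (B x)) \<le> 1 + onorm B"
proof -
  note D' = self_adjoint_perturb[OF D B]
  have i: "\<i> = \<i> \<or> \<i> = -\<i>" by simp
  have bB: "bounded_clinear B" using B by (simp add: bounded_self_adjoint_def)
  show "bounded_clinear (\<lambda>x. x - resolvent (perturb D B) \<i> (B x))"
    by (intro bounded_clinear_sub bounded_clinear_compose[OF bounded_clinear_resolvent[OF D' i]] bB bounded_clinear_id)
  show "onorm (\<lambda>x. x - resolvent (perturb D B) \<i> (B x)) \<le> 1 + onorm B"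
  proof (rule onorm_bound)
    show "0 \<le> 1 + onorm B" using onorm_nonneg[OF bB] by simp
    show "norm (x - resolvent (perturb D B) \<i> (B x)) \<le> (1 + onorm B) * norm x" for x
    proof -
      have "norm (x - resolvent (perturb D B) \<i> (B x)) \<le> norm x + norm (resolvent (perturb D B) \<i> (B x))"
        by (rule norm_triangle_ineq4)
      also have "norm (resolvent (perturb D B) \<i> (B x)) \<le> norm (B x)" by (rule norm_resolvent_le[OF D' i])
      also have "norm (B x) \<le> onorm B * norm x" by (rule norm_le_onorm[OF bB])
      finally show ?thesis by (simp add: algebra_simps)
    qed
  qed
qed

lemma compact_op_resolvent_perturb:
  assumes "self_adjoint D" "bounded_self_adjoint B" "compact_op (resolvent D \<i>)"
  shows "compact_op (resolvent (perturb D B) \<i>)"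
  using compact_op_comp_left[OF bounded_clinear_perturb_factor[OF assms(1,2)] assms(3)]
  unfolding resolvent_perturb[OF assms(1,2), symmetric] .

section \<open>Diagonal operators\<close>

lemma cinner_has_sum_basis:
  assumes F: "orthonormal_basis F"
  shows "((\<lambda>e. cinner x e * cinner e y) has_sum cinner x y) F"
  using eigenbasis_has_sum[OF F bounded_clinear_id(1), of "\<lambda>_. 1" x y] by simp

lemma orthonormal_basis_eqI:
  assumes F: "orthonormal_basis F" and eq: "\<And>e. e \<in> F \<Longrightarrow> cinner e x = cinner e y"
  shows "x = y"
proof -
  have "\<forall>e\<in>F. cinner e (x - y) = 0" using eq by (simp add: cinner_diff_right)
  then have "x - y = 0" using F unfolding orthonormal_basis_def by blast
  then show ?thesis by simp
qed

theorem Riesz_Fischer: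
  assumes F: "orthonormal_basis F" and c: "(\<lambda>e. (cmod (c e))\<^sup>2) summable_on F"
  obtains z where "\<And>e. e \<in> F \<Longrightarrow> cinner e z = c e"
proof -
  define \<phi> where "\<phi> y = (\<Sum>\<^sub>\<infinity>e\<in>F. cnj (c e) * cinner e y)" for y
  have abs: "(\<lambda>e. norm (cnj (c e) * cinner e y)) summable_on F" for y
  proof (rule summable_on_comparison_test)
    show "(\<lambda>e. (cmod (c e))\<^sup>2 + (cmod (cinner e y))\<^sup>2) summable_on F"
      using Parseval[OF F, of y] by (intro summable_on_add c) (auto simp: summable_on_def)
    show "norm (cnj (c e) * cinner e y) \<le> (cmod (c e))\<^sup>2 + (cmod (cinner e y))\<^sup>2" for e
    proof -
      have "2 * (cmod (c e) * cmod (cinner e y)) \<le> (cmod (c e))\<^sup>2 + (cmod (cinner e y))\<^sup>2"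
        using sum_squares_bound[of "cmod (c e)" "cmod (cinner e y)"] by (simp add: mult.assoc)
      moreover have "0 \<le> cmod (c e) * cmod (cinner e y)" by simp
      ultimately show ?thesis unfolding norm_mult complex_mod_cnj by linarith
    qed
  qed simp
  have summ: "(\<lambda>e. cnj (c e) * cinner e y) summable_on F" for y by (rule abs_summable_summable[OF abs])
  have "\<phi> (x + y) = \<phi> x + \<phi> y" for x y
    unfolding \<phi>_def cinner_add_right distrib_left by (rule infsum_add[OF summ summ])
  moreover have "\<phi> (a *\<^sub>C x) = a * \<phi> x" for a x
  proof -
    have "\<phi> (a *\<^sub>C x) = (\<Sum>\<^sub>\<infinity>e\<in>F. a * (cnj (c e) * cinner e x))"
      unfolding \<phi>_def by (simp add: cinner_scaleC_right mult_ac)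
    then show ?thesis unfolding \<phi>_def by (simp add: infsum_cmult_right')
  qed
  moreover have "cmod (\<phi> y) \<le> sqrt (infsum (\<lambda>e. (cmod (c e))\<^sup>2) F) * norm y" for y
  proof -
    have "cmod (\<phi> y) \<le> (\<Sum>\<^sub>\<infinity>e\<in>F. norm (cnj (c e) * cinner e y))"
      unfolding \<phi>_def by (rule norm_infsum_bound[OF abs])
    also have "\<dots> \<le> sqrt (infsum (\<lambda>e. (cmod (c e))\<^sup>2) F) * norm y"
    proof (rule infsum_le_finite_sums[OF abs])
      fix G assume G: "finite G" "G \<subseteq> F"
      have "(\<Sum>e\<in>G. norm (cnj (c e) * cinner e y))
          \<le> L2_set (\<lambda>e. cmod (c e)) G * L2_set (\<lambda>e. cmod (cinner e y)) G"
        using L2_set_mult_ineq[of "\<lambda>e. cmod (c e)" "\<lambda>e. cmod (cinner e y)" G] by (simp add: norm_mult)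
      also have "L2_set (\<lambda>e. cmod (c e)) G \<le> sqrt (infsum (\<lambda>e. (cmod (c e))\<^sup>2) F)"
        unfolding L2_set_def using G by (intro real_sqrt_le_mono finite_sum_le_infsum c) auto
      also have "L2_set (\<lambda>e. cmod (cinner e y)) G \<le> norm y"
        unfolding L2_set_def using Bessel[OF orthonormal_subset[OF orthonormal_basis_orthonormal[OF F]], of G y] G
        by (intro real_le_lsqrt) (auto intro: sum_nonneg)
      finally show "(\<Sum>e\<in>G. norm (cnj (c e) * cinner e y)) \<le> sqrt (infsum (\<lambda>e. (cmod (c e))\<^sup>2) F) * norm y"
        by (simp add: mult_left_mono mult_right_mono L2_set_nonneg infsum_nonneg)
    qed
    finally show ?thesis .
  qed
  ultimately obtain z where z: "\<And>y. \<phi> y = cinner z y" using Riesz_representation[of \<phi>] by metis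
  have "cinner e z = c e" if e: "e \<in> F" for e
  proof -
    have "\<phi> e = (\<Sum>\<^sub>\<infinity>f\<in>F. if f = e then cnj (c e) else 0)"
      unfolding \<phi>_def
      using orthonormal_cinner[OF orthonormal_basis_orthonormal[OF F]] e by (intro infsum_cong) auto
    also have "\<dots> = (\<Sum>\<^sub>\<infinity>f\<in>{e}. cnj (c e))"
      using e by (intro infsum_cong_neutral) auto
    finally have "cinner z e = cnj (c e)" by (simp add: z)
    then show ?thesis by (metis cinner_commute complex_cnj_cnj)
  qed
  then show ?thesis by (rule that)
qed

theorem diagonal_operator_exists:
  assumes F: "orthonormal_basis F" and M: "0 \<le> M" "\<And>e. e \<in> F \<Longrightarrow> cmod (g e) \<le> M"
  obtains T where "bounded_clinear T" "\<And>e. e \<in> F \<Longrightarrow> T e = g e *\<^sub>C e" "\<And>x. norm (T x) \<le> M * norm x"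
proof -
  have le: "(cmod (g e * cinner e x))\<^sup>2 \<le> M\<^sup>2 * (cmod (cinner e x))\<^sup>2" if "e \<in> F" for e x
    unfolding norm_mult power_mult_distrib using M that by (intro mult_right_mono power_mono) auto
  have "\<exists>z. \<forall>e\<in>F. cinner e z = g e * cinner e x" for x
  proof -
    have "(\<lambda>e. M\<^sup>2 * (cmod (cinner e x))\<^sup>2) summable_on F"
      using Parseval[OF F, of x] by (intro summable_on_cmult_right) (auto simp: summable_on_def)
    then have "(\<lambda>e. (cmod (g e * cinner e x))\<^sup>2) summable_on F"
    proof (rule summable_on_comparison_test)
      show "(cmod (g e * cinner e x))\<^sup>2 \<le> M\<^sup>2 * (cmod (cinner e x))\<^sup>2" if "e \<in> F" for e
        using that by (rule le)
    qed simp
    from Riesz_Fischer[OF F this] obtain z where "\<And>e. e \<in> F \<Longrightarrow> cinner e z = g e * cinner e x" by blast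
    then show ?thesis by blast
  qed
  then obtain T where T: "\<And>x e. e \<in> F \<Longrightarrow> cinner e (T x) = g e * cinner e x" by metis
  have bound: "norm (T x) \<le> M * norm x" for x
  proof (rule power2_le_imp_le)
    have "(norm (T x))\<^sup>2 \<le> M\<^sup>2 * (norm x)\<^sup>2"
      by (rule has_sum_mono[OF Parseval[OF F] has_sum_cmult_right[OF Parseval[OF F]]])
        (use le T in simp)
    then show "(norm (T x))\<^sup>2 \<le> (M * norm x)\<^sup>2" by (simp add: power_mult_distrib)
  qed (use M in simp)
  have "bounded_clinear T"
  proof (rule bounded_clinearI[OF _ _ bound])
    show "T (x + y) = T x + T y" for x y
      by (rule orthonormal_basis_eqI[OF F]) (simp add: T cinner_add_right distrib_left)
    show "T (c *\<^sub>C x) = c *\<^sub>C T x" for c x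
      by (rule orthonormal_basis_eqI[OF F]) (simp add: T cinner_scaleC_right mult_ac)
  qed
  moreover have "T e = g e *\<^sub>C e" if "e \<in> F" for e
    by (rule orthonormal_basis_eqI[OF F])
      (use that orthonormal_cinner[OF orthonormal_basis_orthonormal[OF F]] in \<open>auto simp: T cinner_scaleC_right\<close>)
  ultimately show ?thesis using bound by (rule that)
qed

lemma strong_convergence_basis:
  fixes T :: "nat \<Rightarrow> 'a::complex_hilbert_space \<Rightarrow> 'a"
  assumes F: "orthonormal_basis F" and T: "\<And>n. bounded_clinear (T n)" and S: "bounded_clinear S"
    and K: "\<And>n x. norm (T n x) \<le> K * norm x"
    and lim: "\<And>e. e \<in> F \<Longrightarrow> (\<lambda>n. T n e) \<longlonglongrightarrow> S e"
  shows "(\<lambda>n. T n x) \<longlonglongrightarrow> S x"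
proof (rule LIMSEQ_I)
  fix \<epsilon> :: real assume e: "\<epsilon> > 0"
  define C where "C = \<bar>K\<bar> + onorm S + 1"
  have C: "C > 0" using onorm_nonneg[OF S] by (simp add: C_def)
  define \<delta> where "\<delta> = \<epsilon> / (2 * C)"
  have d: "\<delta> > 0" using e C by (simp add: \<delta>_def)
  have "((\<lambda>G. proj_on G x) \<longlongrightarrow> x) (finite_subsets_at_top F)"
    using orthonormal_basis_has_sum[OF F, of x] by (simp add: has_sum_def proj_on_def[abs_def])
  from tendstoD[OF this d] obtain G where G: "finite G" "G \<subseteq> F" "dist (proj_on G x) x < \<delta>"
    unfolding eventually_finite_subsets_at_top by blast
  define y where "y = proj_on G x"
  have xy: "norm (x - y) < \<delta>" using G by (simp add: y_def dist_norm norm_minus_commute)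
  have "(\<lambda>n. T n y) \<longlonglongrightarrow> S y"
    unfolding y_def proj_on_def bounded_clinear_sum[OF T] bounded_clinear_sum[OF S]
      bounded_clinear_scaleC[OF T] bounded_clinear_scaleC[OF S]
    by (intro tendsto_sum tendsto_scaleC tendsto_const lim) (use G in auto)
  from LIMSEQ_D[OF this, of "\<epsilon> / 2"] e
  obtain N where N: "\<And>n. n \<ge> N \<Longrightarrow> norm (T n y - S y) < \<epsilon> / 2" by auto
  have "norm (T n x - S x) < \<epsilon>" if n: "n \<ge> N" for n
  proof -
    have eq: "T n x - S x = T n (x - y) + (T n y - S y) - S (x - y)"
      by (simp add: bounded_clinear_diff[OF T] bounded_clinear_diff[OF S])
    have "norm (T n x - S x) \<le> norm (T n (x - y)) + norm (T n y - S y) + norm (S (x - y))"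
      unfolding eq using norm_triangle_ineq4[of "T n (x - y) + (T n y - S y)" "S (x - y)"]
        norm_triangle_ineq[of "T n (x - y)" "T n y - S y"] by linarith
    also have "\<dots> \<le> K * norm (x - y) + norm (T n y - S y) + onorm S * norm (x - y)"
      by (intro add_mono K norm_le_onorm S order_refl)
    also have "\<dots> \<le> C * norm (x - y) + norm (T n y - S y)"
    proof -
      have "K * norm (x - y) \<le> \<bar>K\<bar> * norm (x - y)" by (intro mult_right_mono) auto
      then show ?thesis unfolding C_def distrib_right mult_1_left using norm_ge_zero[of "x - y"] by linarith
    qed
    also have "\<dots> < C * \<delta> + \<epsilon> / 2"
      using N[OF n] mult_strict_left_mono[OF xy C] by linarith
    also have "C * \<delta> = \<epsilon> / 2" using C by (simp add: \<delta>_def)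
    finally show ?thesis by simp
  qed
  then show "\<exists>no. \<forall>n\<ge>no. norm (T n x - S x) < \<epsilon>" by blast
qed

section \<open>Spectral measures\<close>

lemma count_space_integral:
  fixes g :: "'b \<Rightarrow> 'c::{banach, second_countable_topology}"
  assumes "(\<lambda>e. norm (g e)) summable_on F"
  shows "integrable (count_space F) g" "integral\<^sup>L (count_space F) g = infsum g F"
proof -
  have a: "Infinite_Set_Sum.abs_summable_on g F" using assms abs_summable_equivalent by blast
  then show "integrable (count_space F) g" by (simp add: abs_summable_on_def)
  show "integral\<^sup>L (count_space F) g = infsum g F"
    using infsetsum_infsum[OF a] by (simp add: infsetsum_def)
qed

context
  fixes E :: "real set \<Rightarrow> 'a::complex_hilbert_space \<Rightarrow> 'a"
  assumes E: "projection_valued_measure E"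
begin

lemma pvm_bounded_clinear: "A \<in> sets borel \<Longrightarrow> bounded_clinear (E A)"
  and pvm_self_adjoint: "A \<in> sets borel \<Longrightarrow> cinner (E A x) y = cinner x (E A y)"
  and pvm_Int: "A \<in> sets borel \<Longrightarrow> A' \<in> sets borel \<Longrightarrow> E A (E A' x) = E (A \<inter> A') x"
  and pvm_UNIV: "E UNIV x = x"
  using E by (simp_all add: projection_valued_measure_def bounded_self_adjoint_def)

lemma pvm_form: "A \<in> sets borel \<Longrightarrow> cinner x (E A x) = of_real ((norm (E A x))\<^sup>2)"
  using pvm_Int[of A A x] pvm_self_adjoint[of A x "E A x"] by (simp add: cinner_self)

lemma sets_pvm_measure [simp]: "sets (pvm_measure E x) = sets borel"
  and space_pvm_measure [simp]: "space (pvm_measure E x) = UNIV"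
  unfolding pvm_measure_def using sets.sigma_sets_eq[of "borel :: real measure"] by simp_all

lemma emeasure_pvm_measure:
  assumes A: "A \<in> sets borel"
  shows "emeasure (pvm_measure E x) A = ennreal ((norm (E A x))\<^sup>2)"
proof -
  have "emeasure (pvm_measure E x) A = ennreal (Re (cinner x (E A x)))"
    unfolding pvm_measure_def
  proof (rule emeasure_measure_of_sigma)
    show "sigma_algebra UNIV (sets (borel :: real measure))"
      using sets.sigma_algebra_axioms[of "borel :: real measure"] by simp
    have z: "E {} x = 0"
    proof -
      have "(\<lambda>i::nat. E {} x) sums E (\<Union>i::nat. {}) x"
        using E unfolding projection_valued_measure_def by (auto simp: disjoint_family_on_def)
      then have "(\<lambda>i::nat. E {} x) \<longlonglongrightarrow> 0" by (intro summable_LIMSEQ_zero) (rule sums_summable)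
      then show ?thesis by (simp add: LIMSEQ_const_iff)
    qed
    then show "positive (sets borel) (\<lambda>A. ennreal (Re (cinner x (E A x))))"
      by (simp add: positive_def)
    show "countably_additive (sets borel) (\<lambda>A. ennreal (Re (cinner x (E A x))))"
    proof (rule countably_additiveI)
      fix A :: "nat \<Rightarrow> real set" assume A: "range A \<subseteq> sets borel" "disjoint_family A"
      have "(\<lambda>i. E (A i) x) sums E (\<Union>i. A i) x"
        using E A unfolding projection_valued_measure_def by blast
      from bounded_linear.sums[OF bounded_linear_compose[OF bounded_linear_Re bounded_linear_cinner_right] this]
      have "(\<lambda>i. Re (cinner x (E (A i) x))) sums Re (cinner x (E (\<Union>i. A i) x))" .
      then show "(\<Sum>i. ennreal (Re (cinner x (E (A i) x)))) = ennreal (Re (cinner x (E (\<Union>i. A i) x)))"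
        by (rule suminf_ennreal_eq[rotated]) (use A pvm_form in auto)
    qed
  qed (rule A)
  then show ?thesis by (simp add: pvm_form[OF A])
qed

lemma finite_measure_pvm_measure: "finite_measure (pvm_measure E x)"
  by (rule finite_measureI) (simp add: emeasure_pvm_measure pvm_UNIV)

text \<open>If a basis diagonalizes \<open>E\<close>, then the scalar spectral measures are sums of point masses.\<close>

lemma pvm_measure_eigenbasis:
  assumes F: "orthonormal_basis F"
    and ev: "\<And>A e. A \<in> sets borel \<Longrightarrow> e \<in> F \<Longrightarrow> E A e = complex_of_real (indicator A (\<mu> e)) *\<^sub>C e"
  shows "pvm_measure E x = distr (density (count_space F) (\<lambda>e. ennreal ((cmod (cinner e x))\<^sup>2))) borel \<mu>"
    (is "_ = ?N")
proof (rule measure_eqI)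
  show "sets (pvm_measure E x) = sets ?N" by simp
  fix A assume "A \<in> sets (pvm_measure E x)"
  then have A: "A \<in> sets borel" by simp
  let ?g = "\<lambda>e. (cmod (cinner e x))\<^sup>2 * indicator A (\<mu> e)"
  have "(?g has_sum Re (cinner x (E A x))) F"
  proof -
    have "cinner x e * complex_of_real (indicator A (\<mu> e)) * cinner e x = complex_of_real (?g e)" for e
      using complex_norm_square[of "cinner e x"] cinner_commute[of x e] by (simp add: mult_ac)
    with has_sum_Re[OF eigenbasis_has_sum[OF F pvm_bounded_clinear[OF A] ev[OF A], of x x]]
    show ?thesis by simp
  qed
  then have hs: "(?g has_sum (norm (E A x))\<^sup>2) F" by (simp add: pvm_form[OF A])
  then have s: "(\<lambda>e. norm (?g e)) summable_on F" by (auto simp: summable_on_def)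
  have "emeasure ?N A = (\<integral>\<^sup>+e. ennreal ((cmod (cinner e x))\<^sup>2) * indicator (\<mu> -` A \<inter> F) e \<partial>count_space F)"
    using A by (subst emeasure_distr) (auto simp: emeasure_density)
  also have "\<dots> = (\<integral>\<^sup>+e. ennreal (?g e) \<partial>count_space F)"
    by (intro nn_integral_cong) (auto simp: indicator_def)
  also have "\<dots> = ennreal (integral\<^sup>L (count_space F) ?g)"
    using count_space_integral(1)[OF s] by (intro nn_integral_eq_integral) auto
  also have "\<dots> = ennreal ((norm (E A x))\<^sup>2)"
    using count_space_integral(2)[OF s] infsumI[OF hs] by simp
  finally show "emeasure (pvm_measure E x) A = emeasure ?N A" by (simp add: emeasure_pvm_measure[OF A])
qed

lemma
  fixes f :: "real \<Rightarrow> 'c::{banach, second_countable_topology}"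
  assumes F: "orthonormal_basis F"
    and ev: "\<And>A e. A \<in> sets borel \<Longrightarrow> e \<in> F \<Longrightarrow> E A e = complex_of_real (indicator A (\<mu> e)) *\<^sub>C e"
    and f: "f \<in> borel_measurable borel"
  shows integrable_pvm_measure: "integrable (pvm_measure E x) f
      \<longleftrightarrow> integrable (count_space F) (\<lambda>e. (cmod (cinner e x))\<^sup>2 *\<^sub>R f (\<mu> e))"
    and integral_pvm_measure: "(\<integral>t. f t \<partial>pvm_measure E x)
      = (\<integral>e. (cmod (cinner e x))\<^sup>2 *\<^sub>R f (\<mu> e) \<partial>count_space F)"
proof -
  let ?M = "density (count_space F) (\<lambda>e. ennreal ((cmod (cinner e x))\<^sup>2))"
  have m: "\<mu> \<in> measurable ?M borel" by (simp add: measurable_def)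
  have "integrable (distr ?M borel \<mu>) f \<longleftrightarrow> integrable ?M (\<lambda>e. f (\<mu> e))"
    by (rule integrable_distr_eq[OF m f])
  also have "\<dots> \<longleftrightarrow> integrable (count_space F) (\<lambda>e. (cmod (cinner e x))\<^sup>2 *\<^sub>R f (\<mu> e))"
    by (rule integrable_density) auto
  finally show "integrable (pvm_measure E x) f
      \<longleftrightarrow> integrable (count_space F) (\<lambda>e. (cmod (cinner e x))\<^sup>2 *\<^sub>R f (\<mu> e))"
    by (simp only: pvm_measure_eigenbasis[OF F ev])
  have "integral\<^sup>L (distr ?M borel \<mu>) f = (\<integral>e. f (\<mu> e) \<partial>?M)"
    by (rule integral_distr[OF m f])
  also have "\<dots> = (\<integral>e. (cmod (cinner e x))\<^sup>2 *\<^sub>R f (\<mu> e) \<partial>count_space F)"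
    by (rule integral_density) auto
  finally show "(\<integral>t. f t \<partial>pvm_measure E x) = (\<integral>e. (cmod (cinner e x))\<^sup>2 *\<^sub>R f (\<mu> e) \<partial>count_space F)"
    by (simp only: pvm_measure_eigenbasis[OF F ev])
qed

end

text \<open>A self-adjoint operator with an eigenbasis is the maximal multiplication operator: if the coefficients
  \<open>\<mu> e * \<langle>e, x\<rangle>\<close> are square summable, then the vector with these coefficients shows that \<open>x\<close> is in the domain of
  the adjoint.\<close>

theorem dom_eigenbasis:
  assumes D: "self_adjoint D" and F: "eigenbasis D F \<mu>"
  shows "x \<in> dom D \<longleftrightarrow> (\<lambda>e. (\<mu> e)\<^sup>2 * (cmod (cinner e x))\<^sup>2) summable_on F"
    and "x \<in> dom D \<Longrightarrow> e \<in> F \<Longrightarrow> cinner e (the (D x)) = of_real (\<mu> e) * cinner e x"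
proof -
  have B: "orthonormal_basis F" and ev: "\<And>e. e \<in> F \<Longrightarrow> D e = Some (complex_of_real (\<mu> e) *\<^sub>C e)"
    using F by (auto simp: eigenbasis_def)
  show eq: "cinner e (the (D x)) = of_real (\<mu> e) * cinner e x" if "x \<in> dom D" "e \<in> F" for x e
  proof -
    have "e \<in> dom D" using ev[OF that(2)] by blast
    from self_adjoint_symmetric[OF D that(1) this] show ?thesis by (simp add: ev[OF that(2)] cinner_scaleC_left)
  qed
  have sq: "(cmod (of_real (\<mu> e) * cinner e x))\<^sup>2 = (\<mu> e)\<^sup>2 * (cmod (cinner e x))\<^sup>2" for e x
    by (simp add: norm_mult power_mult_distrib)
  show "x \<in> dom D \<longleftrightarrow> (\<lambda>e. (\<mu> e)\<^sup>2 * (cmod (cinner e x))\<^sup>2) summable_on F"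
  proof
    assume x: "x \<in> dom D"
    have "((\<lambda>e. (\<mu> e)\<^sup>2 * (cmod (cinner e x))\<^sup>2) has_sum (norm (the (D x)))\<^sup>2) F"
      using Parseval[OF B, of "the (D x)"]
      by (rule has_sum_cong[THEN iffD1, rotated]) (simp add: eq[OF x] sq)
    then show "(\<lambda>e. (\<mu> e)\<^sup>2 * (cmod (cinner e x))\<^sup>2) summable_on F" by (auto simp: summable_on_def)
  next
    assume "(\<lambda>e. (\<mu> e)\<^sup>2 * (cmod (cinner e x))\<^sup>2) summable_on F"
    then have "(\<lambda>e. (cmod (of_real (\<mu> e) * cinner e x))\<^sup>2) summable_on F" by (simp only: sq)
    from Riesz_Fischer[OF B this]
    obtain z where z: "\<And>e. e \<in> F \<Longrightarrow> cinner e z = of_real (\<mu> e) * cinner e x" by blast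
    have "D x = Some z"
    proof (rule self_adjoint_SomeI[OF D])
      fix v assume v: "v \<in> dom D"
      have "cinner z e * cinner e v = cinner x e * cinner e (the (D v))" if "e \<in> F" for e
        using z[OF that] eq[OF v that] cinner_commute[of z e] cinner_commute[of x e] by simp
      then have "((\<lambda>e. cinner z e * cinner e v) has_sum cinner x (the (D v))) F"
        using cinner_has_sum_basis[OF B, of x "the (D v)"] by (simp cong: has_sum_cong)
      with cinner_has_sum_basis[OF B, of z v] show "cinner x (the (D v)) = cinner z v"
        by (rule has_sum_unique[rotated])
    qed
    then show "x \<in> dom D" by blast
  qed
qed

text \<open>\<open>E A\<close> is the projection to the span of the eigenvectors with eigenvalue in \<open>A\<close>.\<close>

theorem spectral_resolution_exists:
  fixes D :: "'a::complex_hilbert_space \<rightharpoonup> 'a"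
  assumes D: "self_adjoint D" and F: "eigenbasis D F \<mu>"
  shows "\<exists>E. spectral_resolution D E"
proof -
  have B: "orthonormal_basis F" using F by (auto simp: eigenbasis_def)
  have "\<exists>T. bounded_clinear T \<and> (\<forall>e\<in>F. T e = complex_of_real (indicator A (\<mu> e)) *\<^sub>C e) \<and> (\<forall>x. norm (T x) \<le> 1 * norm x)" for A
    by (rule diagonal_operator_exists[OF B, of 1 "\<lambda>e. complex_of_real (indicator A (\<mu> e))"])
      (auto simp: indicator_def)
  then obtain E where E: "\<And>A. bounded_clinear (E A)" "\<And>A e. e \<in> F \<Longrightarrow> E A e = complex_of_real (indicator A (\<mu> e)) *\<^sub>C e"
    "\<And>A x. norm (E A x) \<le> 1 * norm x" by metis
  have ext: "E A = T" if "bounded_clinear T" "\<And>e. e \<in> F \<Longrightarrow> T e = complex_of_real (indicator A (\<mu> e)) *\<^sub>C e" for A T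
    by (rule orthonormal_basis_ext[OF B E(1) that(1)]) (simp add: E(2) that(2))
  have pvm: "projection_valued_measure E"
    unfolding projection_valued_measure_def
  proof (intro conjI ballI allI impI)
    show "bounded_self_adjoint (E A)" for A
    proof -
      have "cinner x (E A x) \<in> \<real>" for x
      proof -
        have "Im (cinner x e * complex_of_real (indicator A (\<mu> e)) * cinner e x) = 0" for e
        proof -
          have "cinner x e * complex_of_real (indicator A (\<mu> e)) * cinner e x
              = complex_of_real ((cmod (cinner e x))\<^sup>2 * indicator A (\<mu> e))"
            using complex_norm_square[of "cinner e x"] cinner_commute[of x e] by (simp add: mult_ac)
          then show ?thesis by (simp only: Im_complex_of_real)
        qed
        with has_sum_Im[OF eigenbasis_has_sum[OF B E(1) E(2), of x A x]]
        have "((\<lambda>e. 0) has_sum Im (cinner x (E A x))) F" by simp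
        then have "Im (cinner x (E A x)) = 0" using has_sum_unique[OF _ has_sum_0[of F "\<lambda>_. 0::real"]] by simp
        then show ?thesis by (simp add: complex_is_Real_iff)
      qed
      then show ?thesis
        unfolding bounded_self_adjoint_def using E(1) self_adjoint_quadratic_form[OF E(1)] by blast
    qed
    show "E (A \<inter> A') = E A \<circ> E A'" for A A'
      by (rule ext) (auto simp: bounded_clinear_comp E bounded_clinear_scaleC[OF E(1)] scaleC_scaleC indicator_def)
    show "E UNIV = id" by (rule ext) auto
    fix A :: "nat \<Rightarrow> real set" and x assume A: "range A \<subseteq> sets borel" "disjoint_family A"
    have S: "(\<lambda>x. \<Sum>i<n. E (A i) x) = E (\<Union>i<n. A i)" for n
    proof (rule ext[symmetric])
      show "bounded_clinear (\<lambda>x. \<Sum>i<n. E (A i) x)" by (intro bounded_clinear_sum_fun E(1))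
      fix e assume e: "e \<in> F"
      have "(\<Sum>i<n. E (A i) e) = complex_of_real (\<Sum>i<n. indicator (A i) (\<mu> e)) *\<^sub>C e"
        unfolding of_real_sum bounded_bilinear.sum_left[OF bounded_bilinear_scaleC] by (simp add: E(2)[OF e])
      also have "(\<Sum>i<n. indicator (A i) (\<mu> e)) = (indicator (\<Union>i<n. A i) (\<mu> e) :: real)"
        using A(2) by (intro indicator_UN_disjoint[symmetric]) (auto simp: disjoint_family_on_def)
      finally show "(\<Sum>i<n. E (A i) e) = complex_of_real (indicator (\<Union>i<n. A i) (\<mu> e)) *\<^sub>C e" .
    qed
    show "(\<lambda>i. E (A i) x) sums E (\<Union>i. A i) x"
      unfolding sums_def
    proof (rule strong_convergence_basis[OF B, where T = "\<lambda>n x. \<Sum>i<n. E (A i) x" and K = 1])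
      show "bounded_clinear (\<lambda>x. \<Sum>i<n. E (A i) x)" for n by (intro bounded_clinear_sum_fun E(1))
      show "norm (\<Sum>i<n. E (A i) x) \<le> 1 * norm x" for n x using fun_cong[OF S[of n], of x] E(3) by metis
      fix e assume e: "e \<in> F"
      have "(\<lambda>n. indicator (\<Union>i<n. A i) (\<mu> e) :: real) \<longlonglongrightarrow> indicator (\<Union>i. A i) (\<mu> e)"
        by (rule LIMSEQ_indicator_UN)
      then have "(\<lambda>n. complex_of_real (indicator (\<Union>i<n. A i) (\<mu> e)) *\<^sub>C e) \<longlonglongrightarrow> complex_of_real (indicator (\<Union>i. A i) (\<mu> e)) *\<^sub>C e"
        by (intro tendsto_scaleC tendsto_of_real tendsto_const)
      moreover have "(\<Sum>i<n. E (A i) e) = complex_of_real (indicator (\<Union>i<n. A i) (\<mu> e)) *\<^sub>C e" for n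
        using fun_cong[OF S[of n], of e] E(2)[OF e] by simp
      ultimately show "(\<lambda>n. \<Sum>i<n. E (A i) e) \<longlonglongrightarrow> E (\<Union>i. A i) e" by (simp only: E(2)[OF e])
    qed (rule E(1))
  qed
  note int_iff = integrable_pvm_measure[OF pvm B E(2)] and int_eq = integral_pvm_measure[OF pvm B E(2)]
  have nn: "(\<lambda>e. norm ((cmod (cinner e x))\<^sup>2 *\<^sub>R (\<mu> e)\<^sup>2)) = (\<lambda>e. (\<mu> e)\<^sup>2 * (cmod (cinner e x))\<^sup>2)" for x
    by (simp add: mult.commute fun_eq_iff)
  have d: "x \<in> dom D \<longleftrightarrow> integrable (pvm_measure E x) (\<lambda>t. t\<^sup>2)" for x
  proof -
    have "integrable (pvm_measure E x) (\<lambda>t. t\<^sup>2) \<longleftrightarrow> integrable (count_space F) (\<lambda>e. (cmod (cinner e x))\<^sup>2 *\<^sub>R (\<mu> e)\<^sup>2)"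
      by (rule int_iff) auto
    also have "\<dots> \<longleftrightarrow> (\<lambda>e. norm ((cmod (cinner e x))\<^sup>2 *\<^sub>R (\<mu> e)\<^sup>2)) summable_on F"
      using abs_summable_equivalent[of "\<lambda>e. (cmod (cinner e x))\<^sup>2 *\<^sub>R (\<mu> e)\<^sup>2" F] by (simp add: abs_summable_on_def)
    finally show ?thesis unfolding nn dom_eigenbasis(1)[OF D F] by simp
  qed
  have "cinner x (the (D x)) = complex_of_real (\<integral>t. t \<partial>pvm_measure E x)" if x: "x \<in> dom D" for x
  proof -
    let ?g = "\<lambda>e. (cmod (cinner e x))\<^sup>2 *\<^sub>R \<mu> e"
    have eq: "cinner x e * cinner e (the (D x)) = complex_of_real (?g e)" if "e \<in> F" for e
      using dom_eigenbasis(2)[OF D F x that] complex_norm_square[of "cinner e x"] cinner_commute[of x e]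
      by (simp add: mult_ac)
    have hs: "((\<lambda>e. complex_of_real (?g e)) has_sum cinner x (the (D x))) F"
      using cinner_has_sum_basis[OF B, of x "the (D x)"] by (rule has_sum_cong[THEN iffD1, rotated]) (rule eq)
    have "(\<lambda>e. norm (?g e)) summable_on F"
    proof (rule summable_on_comparison_test)
      show "(\<lambda>e. (cmod (cinner e x))\<^sup>2 + (\<mu> e)\<^sup>2 * (cmod (cinner e x))\<^sup>2) summable_on F"
        using Parseval[OF B, of x] x unfolding dom_eigenbasis(1)[OF D F]
        by (intro summable_on_add) (auto simp: summable_on_def)
      show "norm (?g e) \<le> (cmod (cinner e x))\<^sup>2 + (\<mu> e)\<^sup>2 * (cmod (cinner e x))\<^sup>2" for e
      proof -
        have "0 \<le> (\<bar>\<mu> e\<bar> - 1)\<^sup>2" by simp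
        then have "\<bar>\<mu> e\<bar> \<le> 1 + (\<mu> e)\<^sup>2" unfolding power2_diff power2_abs power_one mult_1_right using abs_ge_zero[of "\<mu> e"] by linarith
        then have "(cmod (cinner e x))\<^sup>2 * \<bar>\<mu> e\<bar> \<le> (cmod (cinner e x))\<^sup>2 * (1 + (\<mu> e)\<^sup>2)" by (intro mult_left_mono) auto
        then show ?thesis by (simp add: abs_mult algebra_simps)
      qed
    qed simp
    note c = count_space_integral[OF this] and gs = abs_summable_summable[OF this]
    have "(\<integral>t. t \<partial>pvm_measure E x) = infsum ?g F"
      using int_eq[of "\<lambda>t. t" x] c(2) by simp
    also have "complex_of_real \<dots> = cinner x (the (D x))"
      using has_sum_unique[OF _ hs] has_sum_bounded_linear[OF bounded_linear_of_real has_sum_infsum[OF gs]]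
      by (simp add: o_def)
    finally show ?thesis by simp
  qed
  then show ?thesis unfolding spectral_resolution_def using pvm d by blast
qed

text \<open>The functional calculus refers to an unspecified spectral resolution, so uniqueness is needed at least on the
  eigenvectors: \<open>e\<close> must be concentrated at \<open>r\<close>. Let \<open>C\<close> be a bounded set on one side of \<open>r\<close>, and split
  \<open>e = a + b\<close> with \<open>a = E C e\<close>. The spectral measure of \<open>a + c b\<close> is the same for all \<open>c\<close> of modulus \<open>1\<close>, so
  polarization gives \<open>\<langle>a, D b\<rangle> = 0\<close>. Then \<open>\<langle>a, D a\<rangle> = \<langle>a, D e\<rangle> = r \<parallel>a\<parallel>\<^sup>2\<close>, while \<open>\<langle>a, D a\<rangle>\<close> is the integral of \<open>t\<close> for
  the spectral measure of \<open>a\<close>, which lives on \<open>C\<close>. As \<open>t - r\<close> has a fixed sign on \<open>C\<close>, that measure is \<open>0\<close>.\<close>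

lemma spectral_resolution_eigenvector:
  fixes D :: "'a::complex_hilbert_space \<rightharpoonup> 'a"
  assumes D: "self_adjoint D" and E: "spectral_resolution D E"
    and e: "D e = Some (complex_of_real r *\<^sub>C e)" and A: "A \<in> sets borel"
  shows "E A e = complex_of_real (indicator A r) *\<^sub>C e"
proof -
  have pvm: "projection_valued_measure E"
    and dom: "\<And>x. x \<in> dom D \<longleftrightarrow> integrable (pvm_measure E x) (\<lambda>t. t\<^sup>2)"
    and form: "\<And>x. x \<in> dom D \<Longrightarrow> cinner x (the (D x)) = complex_of_real (\<integral>t. t \<partial>pvm_measure E x)"
    using E unfolding spectral_resolution_def by auto
  note bc = pvm_bounded_clinear[OF pvm] and sa = pvm_self_adjoint[OF pvm] and Int = pvm_Int[OF pvm]
    and frm = pvm_form[OF pvm] and em = emeasure_pvm_measure[OF pvm]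
  note [simp] = sets_pvm_measure[OF pvm] space_pvm_measure[OF pvm]
  have edom: "e \<in> dom D" using e by blast
  have null: "E C e = 0"
    if C: "C \<in> sets borel" "C \<subseteq> {- k..k}" and side: "(\<forall>t\<in>C. r < t) \<or> (\<forall>t\<in>C. t < r)" for C k
  proof -
    define a where "a = E C e"
    define b where "b = e - a"
    interpret Ma: finite_measure "pvm_measure E a" by (rule finite_measure_pvm_measure[OF pvm])
    have AEC: "AE t in pvm_measure E a. t \<in> C"
    proof (rule AE_I[where N = "- C"])
      have "E (- C) a = E (- C \<inter> C) e" unfolding a_def by (rule Int) (use C in auto)
      also have "\<dots> = 0" using em[of "{}" e] by simp
      finally show "emeasure (pvm_measure E a) (- C) = 0" using C(1) by (simp add: em)
    qed (use C in auto)
    have "integrable (pvm_measure E a) (\<lambda>t. t\<^sup>2)"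
    proof (rule Ma.integrable_const_bound[where B = "k\<^sup>2"])
      show "AE t in pvm_measure E a. norm (t\<^sup>2) \<le> k\<^sup>2"
        using AEC
      proof eventually_elim
        case (elim t)
        then have "t \<in> {- k..k}" using C(2) by blast
        then have "\<bar>t\<bar> \<le> \<bar>k\<bar>" unfolding atLeastAtMost_iff by linarith
        then show ?case by (simp add: abs_le_square_iff)
      qed
    qed (simp add: measurable_cong_sets[OF sets_pvm_measure[OF pvm] refl])
    then have adom: "a \<in> dom D" by (simp add: dom)
    have Db: "D b = Some (the (D e) - the (D a))" unfolding b_def by (rule self_adjoint_diff[OF D edom adom])
    then have bdom: "b \<in> dom D" by blast
    have Deq: "the (D e) = the (D a) + the (D b)" using Db by simp
    have meas: "pvm_measure E (a + c *\<^sub>C b) = pvm_measure E e" if c: "cmod c = 1" for c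
    proof (rule measure_eqI)
      fix S assume "S \<in> sets (pvm_measure E (a + c *\<^sub>C b))"
      then have S: "S \<in> sets borel" by simp
      have aS: "E S a = E (S \<inter> C) e" unfolding a_def by (rule Int[OF S C(1)])
      have SC: "S \<inter> C \<in> sets borel" using S C(1) by simp
      have orth: "cinner (E S a) (E S b) = 0"
      proof -
        have "cinner (E (S \<inter> C) e) (E S e) = cinner e (E (S \<inter> C) e)"
          unfolding sa[OF SC] Int[OF SC S] by (simp add: Int_ac)
        moreover have "cinner (E (S \<inter> C) e) (E (S \<inter> C) e) = cinner e (E (S \<inter> C) e)"
          unfolding sa[OF SC] Int[OF SC SC] by simp
        ultimately show ?thesis
          unfolding b_def bounded_clinear_diff[OF bc[OF S]] aS cinner_diff_right by simp
      qed
      have n: "(norm (E S (a + d *\<^sub>C b)))\<^sup>2 = (norm (E S a))\<^sup>2 + (norm (E S b))\<^sup>2" if "cmod d = 1" for d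
        unfolding bounded_clinear_add[OF bc[OF S]] bounded_clinear_scaleC[OF bc[OF S]] norm_add_sq
        by (simp add: cinner_scaleC_right orth norm_scaleC that)
      have "E S e = E S (a + 1 *\<^sub>C b)" by (simp add: b_def)
      then show "emeasure (pvm_measure E (a + c *\<^sub>C b)) S = emeasure (pvm_measure E e) S"
        using n[OF c] n[of 1] by (simp add: em[OF S])
    qed simp
    have q: "cinner a (the (D a)) + c * cinner a (the (D b)) + cnj c * cinner b (the (D a)) + cinner b (the (D b))
        = complex_of_real (\<integral>t. t \<partial>pvm_measure E e)" if c: "cmod c = 1" for c
    proof -
      have cb: "D (c *\<^sub>C b) = Some (c *\<^sub>C the (D b))" by (rule self_adjoint_scaleC[OF D bdom])
      then have "c *\<^sub>C b \<in> dom D" by blast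
      from self_adjoint_add[OF D adom this] have d: "D (a + c *\<^sub>C b) = Some (the (D a) + c *\<^sub>C the (D b))"
        by (simp add: cb)
      then have "a + c *\<^sub>C b \<in> dom D" by blast
      from form[OF this] have "cinner (a + c *\<^sub>C b) (the (D a) + c *\<^sub>C the (D b)) = complex_of_real (\<integral>t. t \<partial>pvm_measure E e)"
        by (simp add: d meas[OF c])
      moreover have "cnj c * c = 1" using c complex_norm_square[of c] by (simp add: mult.commute)
      ultimately show ?thesis
        by (simp add: cinner_simps algebra_simps flip: mult.assoc)
    qed
    have u0: "cinner a (the (D b)) = 0"
    proof -
      \<comment> \<open>The expression \<open>p + c u + cnj c v\<close> vanishes on the unit circle, so its coefficients are \<open>0\<close>; \<open>c = 1, -1, \<i>\<close> suffice.\<close>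
      define u v where "u = cinner a (the (D b))" and "v = cinner b (the (D a))"
      define p where "p = cinner a (the (D a)) + cinner b (the (D b)) - complex_of_real (\<integral>t. t \<partial>pvm_measure E e)"
      have q': "p + c * u + cnj c * v = 0" if "cmod c = 1" for c
      proof -
        have "p + c * u + cnj c * v = (cinner a (the (D a)) + c * u + cnj c * v + cinner b (the (D b)))
            - complex_of_real (\<integral>t. t \<partial>pvm_measure E e)" by (simp add: p_def)
        then show ?thesis using q[OF that] by (simp add: u_def v_def)
      qed
      have "p + u + v = 0" "p - u - v = 0" "p + \<i> * u - \<i> * v = 0"
        using q'[of 1] q'[of "-1"] q'[of \<i>] by simp_all
      then have "u + v = 0" "p = 0" by (simp_all add: complex_eq_iff)
      then have "\<i> * (u + u) = 0" using \<open>p + \<i> * u - \<i> * v = 0\<close> by (simp add: algebra_simps add_eq_0_iff)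
      then show ?thesis by (simp add: u_def)
    qed
    have "complex_of_real (\<integral>t. t \<partial>pvm_measure E a) = cinner a (the (D e))"
      unfolding Deq cinner_add_right u0 form[OF adom, symmetric] by simp
    also have "\<dots> = complex_of_real (r * (norm a)\<^sup>2)"
      unfolding e using frm[OF C(1), of e] by (simp add: cinner_scaleC_right a_def sa[OF C(1)])
    finally have i1: "(\<integral>t. t \<partial>pvm_measure E a) = r * (norm a)\<^sup>2" using of_real_eq_iff by blast
    have int: "integrable (pvm_measure E a) (\<lambda>t. t)"
    proof (rule Ma.integrable_const_bound[where B = "\<bar>k\<bar>"])
      show "AE t in pvm_measure E a. norm t \<le> \<bar>k\<bar>" using AEC
      proof eventually_elim
        case (elim t)
        then have "t \<in> {- k..k}" using C(2) by blast
        then show "norm t \<le> \<bar>k\<bar>" unfolding atLeastAtMost_iff real_norm_def by linarith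
      qed
    qed (simp add: measurable_cong_sets[OF sets_pvm_measure[OF pvm] refl])
    have "measure (pvm_measure E a) UNIV = (norm a)\<^sup>2"
      using em[of UNIV a] by (simp add: measure_def pvm_UNIV[OF pvm])
    then have i2: "(\<integral>t. t - r \<partial>pvm_measure E a) = 0"
      using int by (simp add: i1 Bochner_Integration.integral_diff)
    have AEr: "AE t in pvm_measure E a. t - r = 0"
    proof (cases "\<forall>t\<in>C. r < t")
      case True
      have "AE t in pvm_measure E a. 0 \<le> t - r" using AEC by eventually_elim (use True in force)
      then show ?thesis using i2 int by (subst (asm) integral_nonneg_eq_0_iff_AE) auto
    next
      case False
      have "AE t in pvm_measure E a. 0 \<le> r - t" using AEC by eventually_elim (use False side in force)
      moreover have "(\<integral>t. r - t \<partial>pvm_measure E a) = 0"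
        using i2 int by (simp add: Bochner_Integration.integral_diff)
      ultimately have "AE t in pvm_measure E a. r - t = 0"
        using int by (subst (asm) integral_nonneg_eq_0_iff_AE) auto
      then show ?thesis by eventually_elim simp
    qed
    have "AE t in pvm_measure E a. False"
      using AEr AEC by eventually_elim (use side in force)
    then have "emeasure (pvm_measure E a) UNIV = 0" by (simp add: AE_iff_measurable[of UNIV])
    then have "a = 0" using em[of UNIV a] by (simp add: pvm_UNIV[OF pvm])
    then show ?thesis by (simp add: a_def)
  qed
  have "emeasure (pvm_measure E e) (- {r}) = 0"
  proof -
    have "- {r} = (\<Union>n::nat. {r<..real n}) \<union> (\<Union>n::nat. {- real n..<r})"
    proof (intro equalityI subsetI)
      fix t assume "t \<in> - {r}"
      then have "r < t \<or> t < r" by auto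
      moreover obtain n :: nat where "\<bar>t\<bar> \<le> real n" using real_arch_simple by blast
      ultimately have "t \<in> {r<..real n} \<or> t \<in> {- real n..<r}" by (auto simp: abs_le_iff)
      then show "t \<in> (\<Union>n::nat. {r<..real n}) \<union> (\<Union>n::nat. {- real n..<r})" by blast
    qed auto
    moreover have "emeasure (pvm_measure E e) (\<Union>n::nat. {r<..real n}) = 0"
    proof (rule emeasure_UN_eq_0)
      fix n
      have "{r<..real n} \<subseteq> {- (\<bar>r\<bar> + real n)..\<bar>r\<bar> + real n}" by auto
      from null[OF _ this] show "emeasure (pvm_measure E e) {r<..real n} = 0" by (subst em) auto
    qed auto
    moreover have "emeasure (pvm_measure E e) (\<Union>n::nat. {- real n..<r}) = 0"
    proof (rule emeasure_UN_eq_0)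
      fix n
      have "{- real n..<r} \<subseteq> {- (\<bar>r\<bar> + real n)..\<bar>r\<bar> + real n}" by auto
      from null[OF _ this] show "emeasure (pvm_measure E e) {- real n..<r} = 0" by (subst em) auto
    qed auto
    ultimately show ?thesis by (simp add: emeasure_Un_null_set null_setsI)
  qed
  then have z: "E S e = 0" if "S \<in> sets borel" "r \<notin> S" for S
  proof -
    have "emeasure (pvm_measure E e) S \<le> emeasure (pvm_measure E e) (- {r})"
      using that by (intro emeasure_mono) auto
    then show ?thesis using \<open>emeasure (pvm_measure E e) (- {r}) = 0\<close> em[OF that(1)] by simp
  qed
  show ?thesis
  proof (cases "r \<in> A")
    case False
    then show ?thesis using z[OF A] by simp
  next
    case True
    have "emeasure (pvm_measure E e) UNIV = emeasure (pvm_measure E e) A + emeasure (pvm_measure E e) (- A)"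
      using A by (subst plus_emeasure) auto
    also have "emeasure (pvm_measure E e) (- A) = 0" using z[of "- A"] A True by (subst em) auto
    finally have "(norm e)\<^sup>2 = (norm (E A e))\<^sup>2" using A by (simp add: em pvm_UNIV[OF pvm])
    then have "(norm (e - E A e))\<^sup>2 = 0" unfolding norm_diff_sq using frm[OF A, of e] by simp
    then show ?thesis using True by simp
  qed
qed

theorem fun_calc_eigenbasis:
  fixes D :: "'a::complex_hilbert_space \<rightharpoonup> 'a"
  assumes D: "self_adjoint D" and F: "eigenbasis D F \<mu>"
    and f: "f \<in> borel_measurable borel" and M: "\<And>t. cmod (f t) \<le> M"
  shows bounded_clinear_fun_calc: "bounded_clinear (fun_calc f D)"
    and fun_calc_eigenvector: "\<And>e. e \<in> F \<Longrightarrow> fun_calc f D e = f (\<mu> e) *\<^sub>C e"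
    and norm_fun_calc_le: "\<And>x. norm (fun_calc f D x) \<le> M * norm x"
proof -
  have B: "orthonormal_basis F" and eD: "\<And>e. e \<in> F \<Longrightarrow> D e = Some (complex_of_real (\<mu> e) *\<^sub>C e)"
    using F by (auto simp: eigenbasis_def)
  define E where "E = spectral_measure D"
  have E: "spectral_resolution D E"
    unfolding E_def spectral_measure_def using spectral_resolution_exists[OF D F] by (rule someI_ex)
  then have pvm: "projection_valued_measure E" by (simp add: spectral_resolution_def)
  have ev: "E A e = complex_of_real (indicator A (\<mu> e)) *\<^sub>C e" if "A \<in> sets borel" "e \<in> F" for A e
    by (rule spectral_resolution_eigenvector[OF D E eD[OF that(2)] that(1)])
  have M0: "0 \<le> M" using M[of 0] norm_ge_zero order_trans by blast
  obtain T where T: "bounded_clinear T" "\<And>e. e \<in> F \<Longrightarrow> T e = f (\<mu> e) *\<^sub>C e" "\<And>x. norm (T x) \<le> M * norm x"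
    using diagonal_operator_exists[OF B M0, of "\<lambda>e. f (\<mu> e)"] M by blast
  have form: "cinner x (T x) = (\<integral>t. f t \<partial>pvm_measure E x)" for x
  proof -
    let ?g = "\<lambda>e. (cmod (cinner e x))\<^sup>2 *\<^sub>R f (\<mu> e)"
    have eq: "cinner x e * f (\<mu> e) * cinner e x = ?g e" for e
      using complex_norm_square[of "cinner e x"] cinner_commute[of x e]
      by (simp add: scaleR_conv_of_real mult_ac)
    have "(\<lambda>e. norm (?g e)) summable_on F"
    proof (rule summable_on_comparison_test)
      show "(\<lambda>e. M * (cmod (cinner e x))\<^sup>2) summable_on F"
        using Parseval[OF B, of x] by (intro summable_on_cmult_right) (auto simp: summable_on_def)
      show "norm (?g e) \<le> M * (cmod (cinner e x))\<^sup>2" for e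
        using mult_right_mono[OF M[of "\<mu> e"], of "(cmod (cinner e x))\<^sup>2"] by (simp add: mult.commute)
    qed simp
    from count_space_integral(2)[OF this] have "(\<integral>t. f t \<partial>pvm_measure E x) = infsum ?g F"
      by (simp add: integral_pvm_measure[OF pvm B ev f])
    also have "\<dots> = cinner x (T x)"
      using infsumI[OF eigenbasis_has_sum[OF B T(1) T(2), of x x]] by (simp only: eq)
    finally show ?thesis by simp
  qed
  have "fun_calc f D = T"
    unfolding fun_calc_def E_def[symmetric]
  proof (rule the_equality)
    show "bounded_clinear T \<and> (\<forall>x. cinner x (T x) = (\<integral>t. f t \<partial>pvm_measure E x))" using T(1) form by blast
    show "S = T" if "bounded_clinear S \<and> (\<forall>x. cinner x (S x) = (\<integral>t. f t \<partial>pvm_measure E x))" for S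
      by (rule polarization) (use that T(1) form in auto)
  qed
  then show "bounded_clinear (fun_calc f D)" "\<And>e. e \<in> F \<Longrightarrow> fun_calc f D e = f (\<mu> e) *\<^sub>C e"
    "\<And>x. norm (fun_calc f D x) \<le> M * norm x" using T by simp_all
qed

section \<open>Trace norms of products\<close>

text \<open>The trace norm is the supremum of \<open>\<Sum>i. |\<langle>g\<^sub>i, T f\<^sub>i\<rangle>|\<close> over pairs of orthonormal families, so both families
  need the same index set.\<close>

definition orthonormal_family :: "'i set \<Rightarrow> ('i \<Rightarrow> 'a::complex_hilbert_space) \<Rightarrow> bool" where
  "orthonormal_family I g \<longleftrightarrow> (\<forall>i\<in>I. \<forall>j\<in>I. cinner (g i) (g j) = (if i = j then 1 else 0))"

lemma orthonormal_family_Bessel: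
  assumes g: "orthonormal_family I g" and I: "finite I"
  shows "(\<Sum>i\<in>I. (cmod (cinner (g i) x))\<^sup>2) \<le> (norm x)\<^sup>2"
proof -
  have n: "norm (g i) = 1" if "i \<in> I" for i
  proof -
    have "cinner (g i) (g i) = 1" using g that by (simp add: orthonormal_family_def)
    then have "(norm (g i))\<^sup>2 = 1" unfolding cinner_self using of_real_eq_1_iff by blast
    then show ?thesis using norm_ge_zero[of "g i"] unfolding power2_eq_1_iff by linarith
  qed
  have inj: "inj_on g I"
  proof (rule inj_onI)
    fix i j assume ij: "i \<in> I" "j \<in> I" "g i = g j"
    then have "cinner (g i) (g j) = 1" using n[of j] by (simp add: cinner_self)
    then show "i = j" using g ij(1,2) unfolding orthonormal_family_def by (metis zero_neq_one)
  qed
  have "orthonormal (g ` I)"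
    using g n unfolding orthonormal_def orthonormal_family_def by force
  from Bessel[OF this, of x] show ?thesis using I by (simp add: sum.reindex[OF inj])
qed

lemma norm_adj_le:
  assumes B: "bounded_clinear B"
  shows "norm (adj B x) \<le> onorm B * norm x"
proof (cases "adj B x = 0")
  case False
  have "(norm (adj B x))\<^sup>2 = cmod (cinner (adj B x) (adj B x))" by (simp add: cinner_self norm_power)
  also have "\<dots> = cmod (cinner x (B (adj B x)))" by (simp add: cinner_adj[OF B])
  also have "\<dots> \<le> norm x * norm (B (adj B x))" by (rule Cauchy_Schwarz)
  also have "\<dots> \<le> norm x * (onorm B * norm (adj B x))" by (intro mult_left_mono norm_le_onorm B) simp
  finally show ?thesis using False by (simp add: power2_eq_square mult.commute)
qed (simp add: onorm_nonneg[OF B])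

lemma onorm_compose_le:
  assumes "bounded_clinear A" "bounded_clinear B" "onorm A \<le> a" "onorm B \<le> b"
  shows "onorm (\<lambda>x. A (B x)) \<le> a * b"
proof (rule onorm_bound)
  have "0 \<le> a" "0 \<le> b" using assms onorm_nonneg order_trans by blast+
  then show "0 \<le> a * b" by simp
  show "norm (A (B x)) \<le> a * b * norm x" for x
  proof -
    have "norm (A (B x)) \<le> onorm A * norm (B x)" by (rule norm_le_onorm[OF assms(1)])
    also have "\<dots> \<le> a * (b * norm x)"
      using assms \<open>0 \<le> a\<close> norm_le_onorm[OF assms(2), of x] mult_right_mono[OF assms(4), of "norm x"]
      by (intro mult_mono) auto
    finally show ?thesis by (simp add: mult.assoc)
  qed
qed

lemma onorm_proj_on_le: "orthonormal G \<Longrightarrow> finite G \<Longrightarrow> onorm (proj_on G) \<le> 1"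
  by (rule onorm_bound) (simp_all add: norm_proj_on_le)

text \<open>Sums of operators of the form \<open>A\<^sub>0 R A\<^sub>1 R \<dots> R A\<^sub>p\<close>; the cost is the sum over the summands of the
  products of the norms of the \<open>A\<^sub>j\<close>.\<close>

inductive R_word :: "('a::complex_hilbert_space \<Rightarrow> 'a) \<Rightarrow> nat \<Rightarrow> real \<Rightarrow> ('a \<Rightarrow> 'a) \<Rightarrow> bool" for R where
  base: "bounded_clinear A \<Longrightarrow> onorm A \<le> C \<Longrightarrow> R_word R 0 C A"
| step: "R_word R p C T \<Longrightarrow> bounded_clinear A \<Longrightarrow> onorm A \<le> a \<Longrightarrow>
    R_word R (Suc p) (C * a) (\<lambda>x. T (R (A x)))"
| add: "R_word R p C T \<Longrightarrow> R_word R p C' T' \<Longrightarrow> R_word R p (C + C') (\<lambda>x. T x + T' x)"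

lemma R_word_nonneg: "R_word R p C T \<Longrightarrow> 0 \<le> C"
proof (induction rule: R_word.induct)
  case (base A C)
  then show ?case using onorm_nonneg order_trans by blast
next
  case (step p C T A a)
  then show ?case using onorm_nonneg[of A] by (intro mult_nonneg_nonneg) auto
qed simp

lemma R_word_bounded_clinear: "R_word R p C T \<Longrightarrow> bounded_clinear R \<Longrightarrow> bounded_clinear T"
proof (induction rule: R_word.induct)
  case (step p C T A a)
  have "bounded_clinear T" "bounded_clinear (\<lambda>x. R (A x))"
    using step by (simp_all add: bounded_clinear_compose[OF step.prems step.hyps(2)])
  then show ?case by (rule bounded_clinear_compose)
qed (simp_all add: bounded_clinear_plus)

lemma R_word_comp_right:
  "R_word R p C T \<Longrightarrow> bounded_clinear B \<Longrightarrow> onorm B \<le> b \<Longrightarrow> R_word R p (C * b) (\<lambda>x. T (B x))"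
proof (induction rule: R_word.induct)
  case (base A C)
  show ?case
    by (rule R_word.base[OF bounded_clinear_compose[OF base.hyps(1) base.prems(1)]
          onorm_compose_le[OF base.hyps(1) base.prems(1) base.hyps(2) base.prems(2)]])
next
  case (step p C T A a)
  show ?case
    using R_word.step[OF step.hyps(1) bounded_clinear_compose[OF step.hyps(2) step.prems(1)]
        onorm_compose_le[OF step.hyps(2) step.prems(1) step.hyps(3) step.prems(2)]]
    by (simp add: mult.assoc)
next
  case (add p C T C' T')
  show ?case unfolding distrib_right by (rule R_word.add[OF add.IH(1)[OF add.prems] add.IH(2)[OF add.prems]])
qed

lemma R_word_compact: "R_word R p C T \<Longrightarrow> compact_op R \<Longrightarrow> p \<noteq> 0 \<Longrightarrow> compact_op T"
proof (induction rule: R_word.induct)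
  case (step p C T A a)
  have "compact_op (T \<circ> (R \<circ> A))"
    by (intro compact_op_comp_left compact_op_comp_right step
        R_word_bounded_clinear[OF step.hyps(1)] compact_op_bounded_clinear[OF step.prems(1)])
  then show ?case by (simp add: o_def)
qed (simp_all add: compact_op_add)

definition superlevel :: "'a set \<Rightarrow> ('a \<Rightarrow> complex) \<Rightarrow> real \<Rightarrow> 'a set" where
  "superlevel F \<rho> t = {e\<in>F. t < cmod (\<rho> e)}"

lemma superlevel_Int: "superlevel F \<rho> t \<inter> superlevel F \<rho> u = superlevel F \<rho> (max t u)"
  by (auto simp: superlevel_def)

lemma superlevel_mono: "t \<le> u \<Longrightarrow> superlevel F \<rho> u \<subseteq> superlevel F \<rho> t"
  by (auto simp: superlevel_def)

context
  fixes R :: "'a::complex_hilbert_space \<Rightarrow> 'a" and F :: "'a set" and \<rho> :: "'a \<Rightarrow> complex"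
    and I :: "'i set" and f g :: "'i \<Rightarrow> 'a"
  assumes R: "bounded_clinear R" and F: "orthonormal_basis F"
    and ev: "\<And>e. e \<in> F \<Longrightarrow> R e = \<rho> e *\<^sub>C e"
    and fin: "\<And>t. t > 0 \<Longrightarrow> finite (superlevel F \<rho> t)"
    and I: "finite I" and f: "orthonormal_family I f" and g: "orthonormal_family I g"
begin

lemma on_superlevel: "orthonormal (superlevel F \<rho> t)"
  by (rule orthonormal_subset[OF orthonormal_basis_orthonormal[OF F]]) (auto simp: superlevel_def)

text \<open>The part of \<open>R\<close> that the spectral projection for \<open>(t, \<infinity>)\<close> omits has norm at most \<open>t\<close>.\<close>

lemma norm_R_minus_truncation:
  assumes t: "t > 0"
  shows "norm (R (y - proj_on (superlevel F \<rho> t) y)) \<le> t * norm y"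
proof (rule power2_le_imp_le)
  let ?z = "y - proj_on (superlevel F \<rho> t) y"
  have adjR: "cinner e (R x) = \<rho> e * cinner e x" if e: "e \<in> F" for e x
  proof -
    have "cinner e (R x) = (\<Sum>\<^sub>\<infinity>f\<in>F. cinner e f * \<rho> f * cinner f x)"
      by (rule infsumI[OF eigenbasis_has_sum[OF F R ev], symmetric])
    also have "\<dots> = (\<Sum>\<^sub>\<infinity>f\<in>F. if f = e then \<rho> e * cinner e x else 0)"
      using orthonormal_cinner[OF orthonormal_basis_orthonormal[OF F]] e by (intro infsum_cong) auto
    also have "\<dots> = (\<Sum>\<^sub>\<infinity>f\<in>{e}. \<rho> e * cinner e x)"
      using e by (intro infsum_cong_neutral) auto
    finally show ?thesis by simp
  qed
  have z: "cinner e ?z = (if e \<in> superlevel F \<rho> t then 0 else cinner e y)" if e: "e \<in> F" for e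
  proof (cases "e \<in> superlevel F \<rho> t")
    case True
    then show ?thesis
      using cinner_orthonormal_sum[OF on_superlevel fin[OF t] True, of "\<lambda>e. cinner e y"]
      by (simp add: cinner_diff_right proj_on_def)
  next
    case False
    have "cinner e (proj_on (superlevel F \<rho> t) y) = 0"
      unfolding proj_on_def cinner_sum_right cinner_scaleC_right
    proof (rule sum.neutral, rule ballI)
      fix e' assume "e' \<in> superlevel F \<rho> t"
      then have "e' \<in> F" "e \<noteq> e'" using False by (auto simp: superlevel_def)
      then show "cinner e' y * cinner e e' = 0"
        using orthonormal_cinner[OF orthonormal_basis_orthonormal[OF F] e] by simp
    qed
    then show ?thesis using False by (simp add: cinner_diff_right)
  qed
  have "(norm (R ?z))\<^sup>2 \<le> t\<^sup>2 * (norm y)\<^sup>2"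
  proof (rule has_sum_mono[OF Parseval[OF F] has_sum_cmult_right[OF Parseval[OF F]]])
    fix e assume e: "e \<in> F"
    show "(cmod (cinner e (R ?z)))\<^sup>2 \<le> t\<^sup>2 * (cmod (cinner e y))\<^sup>2"
    proof (cases "e \<in> superlevel F \<rho> t")
      case False
      then have "cmod (\<rho> e) \<le> t" using e by (auto simp: superlevel_def)
      then have "(cmod (\<rho> e))\<^sup>2 \<le> t\<^sup>2" by (intro power_mono) auto
      then show ?thesis
        unfolding adjR[OF e] z[OF e] norm_mult power_mult_distrib using False by (auto intro: mult_right_mono)
    qed (simp add: adjR[OF e] z[OF e])
  qed
  then show "(norm (R ?z))\<^sup>2 \<le> (t * norm y)\<^sup>2" by (simp add: power_mult_distrib)
qed (use t in simp)

text \<open>Layer cake: \<open>R\<close>, truncated at \<open>\<delta>\<close>, is the integral over \<open>\<tau>\<close> of the spectral projections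
  of \<open>|R|\<close> for \<open>(max \<delta> \<tau>, \<infinity>)\<close>, up to the partial isometry \<open>U\<close> of the polar decomposition. If the words with a
  projection in place of \<open>R\<close> are bounded by a sum over a superlevel set, then integration over the levels adds the
  factor \<open>|\<rho>|\<close> to the summands.\<close>

lemma layer_cake:
  fixes y :: "'i \<Rightarrow> 'a" and w :: "'a \<Rightarrow> real"
  assumes d: "\<delta> > 0" and T: "bounded_clinear T"
    and le: "\<And>m U. \<delta> \<le> m \<Longrightarrow> bounded_clinear U \<Longrightarrow> onorm U \<le> 1 \<Longrightarrow>
      (\<Sum>i\<in>I. cmod (cinner (g i) (T (U (proj_on (superlevel F \<rho> m) (y i)))))) \<le> (\<Sum>e\<in>superlevel F \<rho> m \<inter> Q. w e)"
  shows "(\<Sum>i\<in>I. cmod (cinner (g i) (T (R (proj_on (superlevel F \<rho> \<delta>) (y i))))))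
    \<le> (\<Sum>e\<in>superlevel F \<rho> \<delta> \<inter> Q. w e * cmod (\<rho> e))"
proof -
  let ?G = "superlevel F \<rho>"
  let ?chi = "\<lambda>e \<tau>. indicator {0..<cmod (\<rho> e)} \<tau> :: real"
  have finG: "finite (?G \<delta>)" by (rule fin[OF d])
  define U where "U x = (\<Sum>e\<in>?G \<delta>. (sgn (\<rho> e) * cinner e x) *\<^sub>C e)" for x
  have U: "bounded_clinear U"
  proof -
    have "U = (\<lambda>x. \<Sum>e\<in>?G \<delta>. cinner e x *\<^sub>C (sgn (\<rho> e) *\<^sub>C e))"
      by (simp add: U_def fun_eq_iff scaleC_scaleC mult.commute)
    then show ?thesis by (simp only:) (intro bounded_clinear_sum_fun bounded_clinear_rank_one)
  qed
  have U1: "onorm U \<le> 1"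
  proof (rule onorm_bound)
    fix x
    have "(norm (U x))\<^sup>2 = (\<Sum>e\<in>?G \<delta>. (cmod (sgn (\<rho> e) * cinner e x))\<^sup>2)"
      unfolding U_def by (rule norm_orthonormal_sum[OF on_superlevel finG])
    also have "\<dots> \<le> (\<Sum>e\<in>?G \<delta>. (cmod (cinner e x))\<^sup>2)"
      by (intro sum_mono power_mono) (auto simp: norm_mult norm_sgn)
    also have "\<dots> \<le> (norm x)\<^sup>2" by (rule Bessel[OF on_superlevel finG])
    finally have "norm (U x) \<le> norm x" by (rule power2_le_imp_le) simp
    then show "norm (U x) \<le> 1 * norm x" by simp
  qed simp
  define z where "z i e = cinner (g i) (T (sgn (\<rho> e) *\<^sub>C e)) * cinner e (y i)" for i e
  have zU: "cinner (g i) (T (U (proj_on (?G m) (y i)))) = (\<Sum>e\<in>?G m. z i e)" if m: "\<delta> \<le> m" for i m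
  proof -
    have sub: "?G m \<subseteq> ?G \<delta>" by (rule superlevel_mono[OF m])
    have "U e = sgn (\<rho> e) *\<^sub>C e" if e: "e \<in> ?G m" for e
    proof -
      have "U e = (\<Sum>e'\<in>?G \<delta>. if e' = e then sgn (\<rho> e) *\<^sub>C e else 0)"
        unfolding U_def using sub e
        by (intro sum.cong refl) (auto simp: orthonormal_cinner[OF on_superlevel[of \<delta>]])
      then show ?thesis using e sub finG by auto
    qed
    then show ?thesis
      unfolding proj_on_def z_def
      by (simp add: bounded_clinear_sum[OF U] bounded_clinear_sum[OF T] bounded_clinear_scaleC[OF U]
          bounded_clinear_scaleC[OF T] cinner_sum_right cinner_scaleC_right mult.commute cong: sum.cong)
  qed
  have zR: "cinner (g i) (T (R (proj_on (?G \<delta>) (y i)))) = (\<Sum>e\<in>?G \<delta>. cmod (\<rho> e) *\<^sub>R z i e)" for i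
  proof -
    have "R e = cmod (\<rho> e) *\<^sub>R (sgn (\<rho> e) *\<^sub>C e)" if "e \<in> ?G \<delta>" for e
      using that ev[of e] by (simp add: superlevel_def scaleR_scaleC scaleC_scaleC sgn_eq)
    then show ?thesis
      unfolding proj_on_def z_def
      by (simp add: bounded_clinear_sum[OF R] bounded_clinear_sum[OF T] bounded_clinear_scaleC[OF R]
          bounded_clinear_scaleC[OF T] cinner_sum_right cinner_scaleC_right scaleR_scaleC
          scaleR_conv_of_real mult_ac cong: sum.cong)
  qed
  define h where "h i \<tau> = (\<Sum>e\<in>?G \<delta>. ?chi e \<tau> *\<^sub>R z i e)" for i \<tau>
  have hint: "integrable lborel (h i)" for i
    unfolding h_def by (intro Bochner_Integration.integrable_sum integrable_scaleR_left) auto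
  have hval: "integral\<^sup>L lborel (h i) = cinner (g i) (T (R (proj_on (?G \<delta>) (y i))))" for i
    unfolding h_def zR by (subst Bochner_Integration.integral_sum) (auto intro!: sum.cong)
  have pt: "(\<Sum>i\<in>I. cmod (h i \<tau>)) \<le> (\<Sum>e\<in>?G \<delta> \<inter> Q. ?chi e \<tau> * w e)" for \<tau>
  proof (cases "0 \<le> \<tau>")
    case True
    have set: "{e\<in>?G \<delta>. \<tau> < cmod (\<rho> e)} = ?G (max \<delta> \<tau>)" by (auto simp: superlevel_def)
    have "h i \<tau> = (\<Sum>e\<in>?G \<delta>. if \<tau> < cmod (\<rho> e) then z i e else 0)" for i
      unfolding h_def using True by (intro sum.cong refl) (auto simp: indicator_def)
    then have "h i \<tau> = (\<Sum>e\<in>?G (max \<delta> \<tau>). z i e)" for i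
      unfolding set[symmetric] using finG by (simp add: sum.inter_filter)
    then have "(\<Sum>i\<in>I. cmod (h i \<tau>)) = (\<Sum>i\<in>I. cmod (cinner (g i) (T (U (proj_on (?G (max \<delta> \<tau>)) (y i))))))"
      by (simp add: zU)
    also have "\<dots> \<le> (\<Sum>e\<in>?G (max \<delta> \<tau>) \<inter> Q. w e)" by (rule le[OF _ U U1]) simp
    also have "?G (max \<delta> \<tau>) \<inter> Q = {e\<in>?G \<delta> \<inter> Q. \<tau> < cmod (\<rho> e)}" by (auto simp: superlevel_def)
    also have "(\<Sum>e\<in>{e\<in>?G \<delta> \<inter> Q. \<tau> < cmod (\<rho> e)}. w e) = (\<Sum>e\<in>?G \<delta> \<inter> Q. if \<tau> < cmod (\<rho> e) then w e else 0)"
      using finG by (intro sum.inter_filter) auto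
    also have "\<dots> = (\<Sum>e\<in>?G \<delta> \<inter> Q. ?chi e \<tau> * w e)"
      using True by (intro sum.cong refl) (auto simp: indicator_def)
    finally show ?thesis .
  qed (simp add: h_def)
  have "(\<Sum>i\<in>I. cmod (cinner (g i) (T (R (proj_on (?G \<delta>) (y i)))))) \<le> (\<Sum>i\<in>I. \<integral>\<tau>. cmod (h i \<tau>) \<partial>lborel)"
    unfolding hval[symmetric] by (intro sum_mono integral_norm_bound)
  also have "\<dots> = (\<integral>\<tau>. (\<Sum>i\<in>I. cmod (h i \<tau>)) \<partial>lborel)"
    using hint by (subst Bochner_Integration.integral_sum) auto
  also have "\<dots> \<le> (\<integral>\<tau>. (\<Sum>e\<in>?G \<delta> \<inter> Q. ?chi e \<tau> * w e) \<partial>lborel)"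
    using hint by (intro integral_mono pt) (auto intro!: Bochner_Integration.integrable_sum integrable_mult_left)
  also have "\<dots> = (\<Sum>e\<in>?G \<delta> \<inter> Q. w e * cmod (\<rho> e))"
    by (subst Bochner_Integration.integral_sum) (auto intro!: sum.cong integrable_mult_left)
  finally show ?thesis .
qed

text \<open>The truncation that keeps all sums finite is removed by letting \<open>\<delta>\<close> tend to \<open>0\<close>.\<close>

lemma sum_R_le:
  assumes T: "bounded_clinear T" and S: "bounded_clinear S"
    and le: "\<And>\<delta>. \<delta> > 0 \<Longrightarrow>
      (\<Sum>i\<in>I. cmod (cinner (g i) (T (R (proj_on (superlevel F \<rho> \<delta>) (S (f i))))))) \<le> c"
  shows "(\<Sum>i\<in>I. cmod (cinner (g i) (T (R (S (f i)))))) \<le> c"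
proof (rule field_le_epsilon)
  fix \<epsilon> :: real assume e: "\<epsilon> > 0"
  define K where "K = (\<Sum>i\<in>I. norm (g i) * (onorm T * norm (S (f i))))"
  have K: "0 \<le> K" unfolding K_def by (intro sum_nonneg mult_nonneg_nonneg onorm_nonneg T) auto
  define \<delta> where "\<delta> = \<epsilon> / (K + 1)"
  have d: "\<delta> > 0" using e K by (simp add: \<delta>_def)
  let ?P = "proj_on (superlevel F \<rho> \<delta>)"
  have "cmod (cinner (g i) (T (R (S (f i))))) \<le> cmod (cinner (g i) (T (R (?P (S (f i))))))
      + \<delta> * (norm (g i) * (onorm T * norm (S (f i))))" for i
  proof -
    let ?y = "S (f i)"
    have "cinner (g i) (T (R ?y)) = cinner (g i) (T (R (?P ?y))) + cinner (g i) (T (R (?y - ?P ?y)))"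
      by (simp add: bounded_clinear_diff[OF R] bounded_clinear_diff[OF T] cinner_diff_right)
    then have "cmod (cinner (g i) (T (R ?y))) \<le> cmod (cinner (g i) (T (R (?P ?y)))) + cmod (cinner (g i) (T (R (?y - ?P ?y))))"
      by (simp only: norm_triangle_ineq)
    also have "cmod (cinner (g i) (T (R (?y - ?P ?y)))) \<le> norm (g i) * norm (T (R (?y - ?P ?y)))" by (rule Cauchy_Schwarz)
    also have "\<dots> \<le> norm (g i) * (onorm T * (\<delta> * norm ?y))"
      by (intro mult_left_mono order_trans[OF norm_le_onorm[OF T]] norm_R_minus_truncation d onorm_nonneg T) auto
    finally show ?thesis by (simp add: mult_ac)
  qed
  then have "(\<Sum>i\<in>I. cmod (cinner (g i) (T (R (S (f i)))))) \<le> (\<Sum>i\<in>I. cmod (cinner (g i) (T (R (?P (S (f i)))))) + \<delta> * (norm (g i) * (onorm T * norm (S (f i)))))"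
    by (rule sum_mono)
  also have "\<dots> \<le> c + \<delta> * K"
    unfolding sum.distrib K_def sum_distrib_left[symmetric] using le[OF d] by simp
  also have "\<delta> * K \<le> \<epsilon>"
    using e K by (simp add: \<delta>_def field_simps)
  finally show "(\<Sum>i\<in>I. cmod (cinner (g i) (T (R (S (f i)))))) \<le> c + \<epsilon>" by simp
qed

text \<open>A word with one projection \<open>P\<^sub>t\<close> behind it. Without factors \<open>R\<close> the bound is the rank of \<open>P\<^sub>t\<close>. For the last
  factor \<open>R\<close> the layer cake produces a second projection \<open>P\<^sub>m\<close>, and only one of the two may be kept for the induction
  hypothesis; the other one is absorbed as a contraction. Keeping the smaller one gives the sum over
  the superlevel set of \<open>max m t\<close>, which is the intersection of those of \<open>m\<close> and \<open>t\<close>, as the layer cake requires.\<close>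

lemma R_word_truncated_bound:
  assumes "R_word R p C T"
  shows "bounded_clinear A \<Longrightarrow> onorm A \<le> a \<Longrightarrow> bounded_clinear B \<Longrightarrow> onorm B \<le> b \<Longrightarrow> t > 0 \<Longrightarrow>
    (\<Sum>i\<in>I. cmod (cinner (g i) (T (A (proj_on (superlevel F \<rho> t) (B (f i)))))))
      \<le> C * a * b * (\<Sum>e\<in>superlevel F \<rho> t. cmod (\<rho> e) ^ p)"
  using assms
proof (induction arbitrary: A a B b t rule: R_word.induct)
  case (base A0 C)
  note A = base.prems(1,2) and B = base.prems(3,4) and t = base.prems(5) and A0 = base.hyps
  let ?G = "superlevel F \<rho> t"
  have C0: "0 \<le> C" using onorm_nonneg[OF A0(1)] A0(2) by simp
  have a0: "0 \<le> a" "0 \<le> b" using onorm_nonneg[OF A(1)] A(2) onorm_nonneg[OF B(1)] B(2) by auto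
  have each: "(\<Sum>i\<in>I. cmod (cinner e (B (f i))) * cmod (cinner (g i) (A0 (A e)))) \<le> C * a * b" if e: "e \<in> ?G" for e
  proof -
    have ne: "norm e = 1" using on_superlevel[of t] e by (simp add: orthonormal_def)
    have "(\<Sum>i\<in>I. cmod (cinner e (B (f i))) * cmod (cinner (g i) (A0 (A e))))
        \<le> L2_set (\<lambda>i. cmod (cinner e (B (f i)))) I * L2_set (\<lambda>i. cmod (cinner (g i) (A0 (A e)))) I"
      using L2_set_mult_ineq[of "\<lambda>i. cmod (cinner e (B (f i)))" "\<lambda>i. cmod (cinner (g i) (A0 (A e)))" I] by simp
    also have "\<dots> \<le> b * (C * a)"
    proof (rule mult_mono)
      have "cmod (cinner e (B (f i))) = cmod (cinner (f i) (adj B e))" for i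
        using cinner_adj[OF B(1), of e "f i"] cinner_commute[of "f i" "adj B e"] by simp
      then have "(\<Sum>i\<in>I. (cmod (cinner e (B (f i))))\<^sup>2) \<le> (norm (adj B e))\<^sup>2"
        using orthonormal_family_Bessel[OF f I, of "adj B e"] by simp
      then have "L2_set (\<lambda>i. cmod (cinner e (B (f i)))) I \<le> norm (adj B e)"
        unfolding L2_set_def by (intro real_le_lsqrt) (auto intro: sum_nonneg)
      also have "\<dots> \<le> b" using norm_adj_le[OF B(1), of e] B(2) ne by simp
      finally show "L2_set (\<lambda>i. cmod (cinner e (B (f i)))) I \<le> b" .
      have "L2_set (\<lambda>i. cmod (cinner (g i) (A0 (A e)))) I \<le> norm (A0 (A e))"
        unfolding L2_set_def using orthonormal_family_Bessel[OF g I, of "A0 (A e)"]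
        by (intro real_le_lsqrt) (auto intro: sum_nonneg)
      also have "\<dots> \<le> C * a * norm e"
        by (rule order_trans[OF norm_le_onorm[OF bounded_clinear_compose[OF A0(1) A(1)]]
              mult_right_mono[OF onorm_compose_le[OF A0(1) A(1) A0(2) A(2)]]]) simp
      finally show "L2_set (\<lambda>i. cmod (cinner (g i) (A0 (A e)))) I \<le> C * a" using ne by simp
    qed (use a0 in \<open>auto simp: L2_set_nonneg\<close>)
    finally show ?thesis by (simp add: mult_ac)
  qed
  have "cmod (cinner (g i) (A0 (A (proj_on ?G (B (f i)))))) \<le> (\<Sum>e\<in>?G. cmod (cinner e (B (f i))) * cmod (cinner (g i) (A0 (A e))))" for i
    unfolding proj_on_def
    by (simp add: bounded_clinear_sum[OF A(1)] bounded_clinear_sum[OF A0(1)] bounded_clinear_scaleC[OF A(1)]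
        bounded_clinear_scaleC[OF A0(1)] cinner_sum_right cinner_scaleC_right sum_norm_le norm_mult)
  then have "(\<Sum>i\<in>I. cmod (cinner (g i) (A0 (A (proj_on ?G (B (f i)))))))
      \<le> (\<Sum>i\<in>I. \<Sum>e\<in>?G. cmod (cinner e (B (f i))) * cmod (cinner (g i) (A0 (A e))))" by (rule sum_mono)
  also have "\<dots> = (\<Sum>e\<in>?G. \<Sum>i\<in>I. cmod (cinner e (B (f i))) * cmod (cinner (g i) (A0 (A e))))" by (rule sum.swap)
  also have "\<dots> \<le> (\<Sum>e\<in>?G. C * a * b)" by (intro sum_mono each)
  also have "\<dots> = C * a * b * (\<Sum>e\<in>?G. cmod (\<rho> e) ^ 0)" by simp
  finally show ?case .
next
  case (step p C T A' a')
  note A = step.prems(1,2) and B = step.prems(3,4) and t = step.prems(5) and A' = step.hyps(2,3)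
  have T: "bounded_clinear T" by (rule R_word_bounded_clinear[OF step.hyps(1) R])
  let ?G = "superlevel F \<rho>"
  let ?P = "\<lambda>m. proj_on (?G m)"
  define S where "S x = A' (A x)" for x
  have S: "bounded_clinear S" "onorm S \<le> a' * a"
    unfolding S_def[abs_def]
    by (rule bounded_clinear_compose[OF A'(1) A(1)], rule onorm_compose_le[OF A'(1) A(1) A'(2) A(2)])
  have a0: "0 \<le> a' * a" using onorm_nonneg[OF S(1)] S(2) by simp
  have b0: "0 \<le> b" using onorm_nonneg[OF B(1)] B(2) by simp
  have C0: "0 \<le> C" by (rule R_word_nonneg[OF step.hyps(1)])
  have P: "bounded_clinear (?P m)" "onorm (?P m) \<le> 1" if "m > 0" for m
    using onorm_proj_on_le[OF on_superlevel fin[OF that]] by (simp_all add: bounded_clinear_proj_on)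
  note PB = bounded_clinear_compose[OF P(1)[OF t] B(1)] onorm_compose_le[OF P(1)[OF t] B(1) P(2)[OF t] B(2)]
  note SPB = bounded_clinear_compose[OF S(1) PB(1)] onorm_compose_le[OF S(1) PB(1) S(2) PB(2)]
  have "(\<Sum>i\<in>I. cmod (cinner (g i) (T (R ((\<lambda>x. S (?P t (B x))) (f i))))))
      \<le> C * (a' * a) * b * (\<Sum>e\<in>?G t. cmod (\<rho> e) ^ Suc p)"
  proof (rule sum_R_le[OF T])
    show "bounded_clinear (\<lambda>x. S (?P t (B x)))"
      by (rule SPB(1))
    fix \<delta> :: real assume d: "\<delta> > 0"
    have "(\<Sum>i\<in>I. cmod (cinner (g i) (T (R (?P \<delta> (S (?P t (B (f i))))))))) \<le> (\<Sum>e\<in>?G \<delta> \<inter> ?G t. C * (a' * a) * b * cmod (\<rho> e) ^ p * cmod (\<rho> e))"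
    proof (rule layer_cake[OF d T])
      fix m and U :: "'a \<Rightarrow> 'a" assume m: "\<delta> \<le> m" and U: "bounded_clinear U" "onorm U \<le> 1"
      have m0: "m > 0" using m d by simp
      note PS = bounded_clinear_compose[OF P(1)[OF m0] S(1)] onorm_compose_le[OF P(1)[OF m0] S(1) P(2)[OF m0] S(2)]
      note UPS = bounded_clinear_compose[OF U(1) PS(1)] onorm_compose_le[OF U(1) PS(1) U(2) PS(2)]
      have "(\<Sum>i\<in>I. cmod (cinner (g i) (T (U (?P m (S (?P t (B (f i))))))))) \<le> C * (a' * a) * b * (\<Sum>e\<in>?G (max m t). cmod (\<rho> e) ^ p)"
      proof (cases "m \<le> t")
        case True
        have "(\<Sum>i\<in>I. cmod (cinner (g i) (T ((\<lambda>x. U (?P m (S x))) (?P t (B (f i))))))) \<le> C * (1 * (1 * (a' * a))) * b * (\<Sum>e\<in>?G t. cmod (\<rho> e) ^ p)"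
          by (rule step.IH[OF UPS B t])
        then show ?thesis using True by (simp add: max_def)
      next
        case False
        have "(\<Sum>i\<in>I. cmod (cinner (g i) (T (U (?P m ((\<lambda>x. S (?P t (B x))) (f i))))))) \<le> C * 1 * ((a' * a) * (1 * b)) * (\<Sum>e\<in>?G m. cmod (\<rho> e) ^ p)"
          by (rule step.IH[OF U SPB m0])
        then show ?thesis using False by (simp add: max_def mult_ac)
      qed
      then show "(\<Sum>i\<in>I. cmod (cinner (g i) (T (U (?P m (S (?P t (B (f i))))))))) \<le> (\<Sum>e\<in>?G m \<inter> ?G t. C * (a' * a) * b * cmod (\<rho> e) ^ p)"
        by (simp add: superlevel_Int sum_distrib_left)
    qed
    also have "\<dots> = C * (a' * a) * b * (\<Sum>e\<in>?G \<delta> \<inter> ?G t. cmod (\<rho> e) ^ Suc p)"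
      by (simp add: sum_distrib_left mult_ac)
    also have "\<dots> \<le> C * (a' * a) * b * (\<Sum>e\<in>?G t. cmod (\<rho> e) ^ Suc p)"
      using fin[OF t] by (intro mult_left_mono sum_mono2 mult_nonneg_nonneg[OF mult_nonneg_nonneg[OF C0 a0] b0]) auto
    finally show "(\<Sum>i\<in>I. cmod (cinner (g i) (T (R (?P \<delta> (S (?P t (B (f i)))))))))
        \<le> C * (a' * a) * b * (\<Sum>e\<in>?G t. cmod (\<rho> e) ^ Suc p)" .
  qed
  then show ?case by (simp add: S_def mult_ac)
next
  case (add p C T C' T')
  have "(\<Sum>i\<in>I. cmod (cinner (g i) (T (A (proj_on (superlevel F \<rho> t) (B (f i)))) + T' (A (proj_on (superlevel F \<rho> t) (B (f i)))))))
      \<le> (\<Sum>i\<in>I. cmod (cinner (g i) (T (A (proj_on (superlevel F \<rho> t) (B (f i)))))) + cmod (cinner (g i) (T' (A (proj_on (superlevel F \<rho> t) (B (f i)))))))"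
    unfolding cinner_add_right by (intro sum_mono norm_triangle_ineq)
  also have "\<dots> \<le> C * a * b * (\<Sum>e\<in>superlevel F \<rho> t. cmod (\<rho> e) ^ p) + C' * a * b * (\<Sum>e\<in>superlevel F \<rho> t. cmod (\<rho> e) ^ p)"
    unfolding sum.distrib using add.IH[OF add.prems] by (intro add_mono)
  finally show ?case by (simp add: algebra_simps)
qed

lemma R_word_bound:
  assumes "R_word R p C T"
  shows "p \<noteq> 0 \<Longrightarrow> (\<lambda>e. cmod (\<rho> e) ^ p) summable_on F \<Longrightarrow>
    (\<Sum>i\<in>I. cmod (cinner (g i) (T (f i)))) \<le> C * (\<Sum>\<^sub>\<infinity>e\<in>F. cmod (\<rho> e) ^ p)"
  using assms
proof (induction rule: R_word.induct)
  case (step p C T A a)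
  note A = step.hyps(2,3)
  have T: "bounded_clinear T" by (rule R_word_bounded_clinear[OF step.hyps(1) R])
  have a0: "0 \<le> a" using onorm_nonneg[OF A(1)] A(2) by simp
  have C0: "0 \<le> C" by (rule R_word_nonneg[OF step.hyps(1)])
  let ?G = "superlevel F \<rho>"
  show ?case
  proof (rule sum_R_le[OF T A(1)])
    fix \<delta> :: real assume d: "\<delta> > 0"
    have "(\<Sum>i\<in>I. cmod (cinner (g i) (T (R (proj_on (?G \<delta>) (A (f i))))))) \<le> (\<Sum>e\<in>?G \<delta> \<inter> UNIV. C * 1 * a * cmod (\<rho> e) ^ p * cmod (\<rho> e))"
    proof (rule layer_cake[OF d T])
      fix m and U :: "'a \<Rightarrow> 'a" assume m: "\<delta> \<le> m" and U: "bounded_clinear U" "onorm U \<le> 1"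
      have "m > 0" using m d by simp
      from R_word_truncated_bound[OF step.hyps(1) U A this]
      show "(\<Sum>i\<in>I. cmod (cinner (g i) (T (U (proj_on (?G m) (A (f i))))))) \<le> (\<Sum>e\<in>?G m \<inter> UNIV. C * 1 * a * cmod (\<rho> e) ^ p)"
        by (simp add: sum_distrib_left)
    qed
    also have "\<dots> = C * a * (\<Sum>e\<in>?G \<delta>. cmod (\<rho> e) ^ Suc p)" by (simp add: sum_distrib_left mult_ac)
    also have "\<dots> \<le> C * a * (\<Sum>\<^sub>\<infinity>e\<in>F. cmod (\<rho> e) ^ Suc p)"
      using fin[OF d] a0 C0 by (intro mult_left_mono finite_sum_le_infsum step.prems) (auto simp: superlevel_def)
    finally show "(\<Sum>i\<in>I. cmod (cinner (g i) (T (R (proj_on (?G \<delta>) (A (f i))))))) \<le> C * a * (\<Sum>\<^sub>\<infinity>e\<in>F. cmod (\<rho> e) ^ Suc p)" .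
  qed
next
  case (add p C T C' T')
  have "(\<Sum>i\<in>I. cmod (cinner (g i) (T (f i) + T' (f i)))) \<le> (\<Sum>i\<in>I. cmod (cinner (g i) (T (f i))) + cmod (cinner (g i) (T' (f i))))"
    unfolding cinner_add_right by (intro sum_mono norm_triangle_ineq)
  also have "\<dots> \<le> C * (\<Sum>\<^sub>\<infinity>e\<in>F. cmod (\<rho> e) ^ p) + C' * (\<Sum>\<^sub>\<infinity>e\<in>F. cmod (\<rho> e) ^ p)"
    unfolding sum.distrib using add.IH add.prems by (intro add_mono) auto
  finally show ?case by (simp add: distrib_right)
qed simp

end

lemma superlevel_finite:
  assumes "(\<lambda>e. cmod (\<rho> e) ^ p) summable_on F" "t > 0"
  shows "finite (superlevel F \<rho> t)"
proof (rule ccontr)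
  assume inf: "infinite (superlevel F \<rho> t)"
  define s where "s = (\<Sum>\<^sub>\<infinity>e\<in>F. cmod (\<rho> e) ^ p)"
  obtain n :: nat where n: "s < real n * t ^ p"
    using reals_Archimedean3[of "t ^ p"] assms(2) by auto
  obtain G where G: "G \<subseteq> superlevel F \<rho> t" "finite G" "card G = n"
    using infinite_arbitrarily_large[OF inf] by blast
  have "real n * t ^ p = (\<Sum>e\<in>G. t ^ p)" using G by simp
  also have "\<dots> \<le> (\<Sum>e\<in>G. cmod (\<rho> e) ^ p)"
    using G(1) assms(2) by (intro sum_mono power_mono) (auto simp: superlevel_def)
  also have "\<dots> \<le> s"
    unfolding s_def using G assms(1) by (intro finite_sum_le_infsum) (auto simp: superlevel_def)
  finally show False using n by simp
qed

text \<open>A word with at least one factor \<open>R\<close> is compact, so \<open>T\<^sup>* T\<close> has an eigenbasis \<open>H\<close>, and the trace norm of \<open>T\<close> is the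
  sum of the \<open>\<parallel>T e\<parallel> = \<langle>g\<^sub>e, T e\<rangle>\<close> for \<open>e \<in> H\<close>, where the vectors \<open>g\<^sub>e = T e / \<parallel>T e\<parallel>\<close> for \<open>T e \<noteq> 0\<close> are orthonormal.\<close>

theorem R_word_trace_class:
  fixes R :: "'a::complex_hilbert_space \<Rightarrow> 'a"
  assumes R: "schatten_class s R" and s: "s \<ge> 1" and F: "orthonormal_basis F"
    and ev: "\<And>e. e \<in> F \<Longrightarrow> R e = \<rho> e *\<^sub>C e" and T: "R_word R s C T"
  shows "trace_class T \<and> trace_norm T \<le> C * schatten_norm s R ^ s"
proof -
  have bR: "bounded_clinear R" and tr: "trace_pos (abs_op R ^^ s) < \<infinity>"
    using R by (auto simp: schatten_class_def)
  have cR: "compact_op R" by (rule schatten_class_compact[OF R s])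
  have bT: "bounded_clinear T" by (rule R_word_bounded_clinear[OF T bR])
  have adjR: "adj R (R e) = complex_of_real ((cmod (\<rho> e))\<^sup>2) *\<^sub>C e" if e: "e \<in> F" for e
  proof (rule orthonormal_basis_eqI[OF F])
    fix e' assume e': "e' \<in> F"
    have "cinner e' (adj R (R e)) = cnj (\<rho> e') * \<rho> e * cinner e' e"
      by (simp add: cinner_adj_right[OF bR] ev[OF e] ev[OF e'] cinner_simps)
    also have "\<dots> = cinner e' (complex_of_real ((cmod (\<rho> e))\<^sup>2) *\<^sub>C e)"
      using orthonormal_cinner[OF orthonormal_basis_orthonormal[OF F] e' e] complex_norm_square[of "\<rho> e"]
      by (auto simp: cinner_scaleC_right mult.commute)
    finally show "cinner e' (adj R (R e)) = cinner e' (complex_of_real ((cmod (\<rho> e))\<^sup>2) *\<^sub>C e)" .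
  qed
  have tr': "trace_pos (abs_op R ^^ s) = (\<Sum>\<^sub>\<infinity>e\<in>F. ennreal (cmod (\<rho> e) ^ s))"
    by (rule trace_pos_abs_op_pow[OF F bR adjR]) simp_all
  define S where "S = (\<Sum>\<^sub>\<infinity>e\<in>F. cmod (\<rho> e) ^ s)"
  have summ: "(\<lambda>e. cmod (\<rho> e) ^ s) summable_on F" and trS: "trace_pos (abs_op R ^^ s) = ennreal S"
    using summable_on_ennreal_bounded[of "\<lambda>e. cmod (\<rho> e) ^ s" F] tr unfolding tr' S_def by auto
  have S0: "0 \<le> S" unfolding S_def by (intro infsum_nonneg) simp
  have nS: "schatten_norm s R ^ s = S"
  proof (cases "S = 0")
    case True
    then show ?thesis using s by (simp add: schatten_norm_def trS power_0_left)
  next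
    case False
    then have "(S powr (1 / real s)) ^ s = S powr (1 / real s * real s)" by (simp add: powr_power)
    then show ?thesis using s S0 False by (simp add: schatten_norm_def trS)
  qed
  have C0: "0 \<le> C" by (rule R_word_nonneg[OF T])
  have cT: "compact_op T" by (rule R_word_compact[OF T cR]) (use s in simp)
  define A where "A = adj T \<circ> T"
  have cA: "compact_op A" unfolding A_def by (rule compact_op_comp_left[OF bounded_clinear_adj[OF bT] cT])
  have sA: "cinner (A x) y = cinner x (A y)" for x y
    by (simp add: A_def cinner_adj[OF bT] cinner_adj_right[OF bT])
  obtain H where H: "orthonormal_basis H" "\<And>e. e \<in> H \<Longrightarrow> \<exists>\<alpha>. A e = complex_of_real \<alpha> *\<^sub>C e"
    by (rule compact_joint_eigenbasis[OF cA sA cA sA]) auto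
  have AT: "adj T (T e) = complex_of_real ((norm (T e))\<^sup>2) *\<^sub>C e" if e: "e \<in> H" for e
  proof -
    obtain \<alpha> where a: "A e = complex_of_real \<alpha> *\<^sub>C e" using H(2)[OF e] by blast
    have n: "norm e = 1" using H(1) e by (simp add: orthonormal_basis_def)
    have "cinner (T e) (T e) = cinner e (A e)" by (simp add: A_def cinner_adj_right[OF bT])
    then have "complex_of_real ((norm (T e))\<^sup>2) = complex_of_real \<alpha>"
      unfolding a cinner_scaleC_right cinner_self n by simp
    then show ?thesis using a by (simp add: A_def)
  qed
  have trT: "trace_pos (abs_op T ^^ 1) = (\<Sum>\<^sub>\<infinity>e\<in>H. ennreal (norm (T e) ^ 1))"
    by (rule trace_pos_abs_op_pow[OF H(1) bT AT]) simp_all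
  have "trace_pos (abs_op T ^^ 1) \<le> ennreal (C * S)"
    unfolding trT
  proof (rule infsum_le_finite_sums[OF ennreal_summable_on])
    fix K assume K: "finite K" "K \<subseteq> H"
    define I where "I = {k\<in>K. T k \<noteq> 0}"
    define g where "g k = (1 / norm (T k)) *\<^sub>R T k" for k
    have I: "finite I" "I \<subseteq> H" using K by (auto simp: I_def)
    have oI: "orthonormal_family I (\<lambda>k. k)"
      using orthonormal_cinner[OF orthonormal_basis_orthonormal[OF H(1)]] I(2)
      unfolding orthonormal_family_def by blast
    have og: "orthonormal_family I g"
      unfolding orthonormal_family_def
    proof (intro ballI)
      fix i j assume ij: "i \<in> I" "j \<in> I"
      have "cinner (T i) (T j) = complex_of_real ((norm (T j))\<^sup>2) * cinner i j"
        using AT[of j] ij I(2) by (simp add: cinner_adj_right[OF bT, symmetric] subset_iff cinner_scaleC_right)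
      also have "cinner i j = (if i = j then 1 else 0)" using oI ij by (simp add: orthonormal_family_def)
      finally show "cinner (g i) (g j) = (if i = j then 1 else 0)"
        using ij by (auto simp: g_def cinner_scaleR_left cinner_scaleR_right I_def power2_eq_square)
    qed
    have "(\<Sum>k\<in>K. ennreal (norm (T k) ^ 1)) = (\<Sum>k\<in>I. ennreal (norm (T k)))"
      using K(1) by (intro sum.mono_neutral_cong_right) (auto simp: I_def)
    also have "\<dots> = ennreal (\<Sum>k\<in>I. norm (T k))" by (rule sum_ennreal) simp
    also have "(\<Sum>k\<in>I. norm (T k)) = (\<Sum>k\<in>I. cmod (cinner (g k) (T k)))"
    proof (rule sum.cong[OF refl])
      fix k assume "k \<in> I"
      then have "cinner (g k) (T k) = complex_of_real (norm (T k))"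
        by (simp add: g_def cinner_scaleR_left cinner_self power2_eq_square I_def)
      then show "norm (T k) = cmod (cinner (g k) (T k))" by simp
    qed
    also have "\<dots> \<le> C * S"
      unfolding S_def using R_word_bound[OF bR F ev superlevel_finite[OF summ] I(1) oI og T _ summ] s by simp
    finally show "(\<Sum>k\<in>K. ennreal (norm (T k) ^ 1)) \<le> ennreal (C * S)" by (simp add: ennreal_leI)
  qed
  moreover from this have "trace_pos (abs_op T ^^ 1) < \<infinity>" using order_le_less_trans ennreal_less_top by fastforce
  moreover have "enn2real (trace_pos (abs_op T ^^ 1)) \<le> C * S"
    by (rule enn2real_leI[OF _ calculation(1)]) (use C0 S0 in simp)
  ultimately show ?thesis
    unfolding schatten_class_def nS using bT by (simp add: schatten_norm_def)
qed

section \<open>Fourier inversion\<close>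

lemma nderiv_0 [simp]: "nderiv 0 f = f"
  and nderiv_Suc: "nderiv (Suc k) f = (\<lambda>x. vector_derivative (nderiv k f) (at x))"
  by (simp_all add: nderiv_def)

lemma nderiv_Suc_eqI:
  "(\<And>x. (nderiv k f has_vector_derivative g x) (at x)) \<Longrightarrow> nderiv (Suc k) f = g"
  by (simp add: nderiv_Suc fun_eq_iff vector_derivative_at)

lemma C_n_has_vector_derivative:
  "C_n n f \<Longrightarrow> k < n \<Longrightarrow> (nderiv k f has_vector_derivative nderiv (Suc k) f x) (at x)"
  by (simp add: C_n_def nderiv_Suc vector_derivative_works[symmetric])

lemma C_n_continuous:
  assumes "C_n n f" "k \<le> n"
  shows "continuous_on UNIV (nderiv k f)"
proof (cases "k = n")
  case False
  then have "nderiv k f differentiable (at x)" for x using assms by (simp add: C_n_def)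
  then have "isCont (nderiv k f) x" for x by (rule differentiable_imp_continuous_within)
  then show ?thesis by (simp add: continuous_at_imp_continuous_on)
qed (use assms in \<open>simp add: C_n_def\<close>)

text \<open>The transform of this Schwartz function is the normal density around \<open>a\<close> with standard deviation \<open>\<sigma>\<close>. Testing
  a distributional Fourier transform with it and letting \<open>\<sigma>\<close> tend to \<open>0\<close> gives the inversion formula at \<open>a\<close>.\<close>

definition modulated_gaussian :: "real \<Rightarrow> real \<Rightarrow> real \<Rightarrow> complex" where
  "modulated_gaussian a \<sigma> y = exp (\<i> * of_real (a * y)) * of_real (exp (- ((\<sigma> * y)\<^sup>2 / 2)))"

lemma modulated_gaussian_poly_deriv:
  "((\<lambda>x. poly p (of_real x) * modulated_gaussian a \<sigma> x) has_vector_derivative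
    poly (pderiv p + [:\<i> * of_real a, - of_real (\<sigma>\<^sup>2):] * p) (of_real x) * modulated_gaussian a \<sigma> x) (at x)"
proof -
  let ?E = "\<lambda>z::complex. exp (\<i> * (of_real a * z) - (of_real \<sigma> * z)\<^sup>2 / 2)"
  have E: "modulated_gaussian a \<sigma> y = ?E (of_real y)" for y
    unfolding modulated_gaussian_def exp_of_real[symmetric] exp_add[symmetric] by (rule arg_cong[of _ _ exp]) simp
  have "((\<lambda>z. poly p z * ?E z) has_field_derivative
      poly (pderiv p) z * ?E z + (?E z * (\<i> * of_real a - of_real \<sigma> * (of_real \<sigma> * z))) * poly p z) (at z)" for z
  proof (rule DERIV_mult[OF poly_DERIV])
    have "((\<lambda>z. \<i> * (of_real a * z) - (of_real \<sigma> * z)\<^sup>2 / 2) has_field_derivative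
        \<i> * of_real a - of_real \<sigma> * (of_real \<sigma> * z)) (at z)"
      by (auto intro!: derivative_eq_intros)
    then show "(?E has_field_derivative ?E z * (\<i> * of_real a - of_real \<sigma> * (of_real \<sigma> * z))) (at z)"
      by (rule DERIV_fun_exp)
  qed
  note d = has_vector_derivative_real_field[OF this[of "of_real x"]]
  have eq: "poly (pderiv p + [:\<i> * of_real a, - of_real (\<sigma>\<^sup>2):] * p) z
      = poly (pderiv p) z + (\<i> * of_real a - of_real \<sigma> * (of_real \<sigma> * z)) * poly p z" for z :: complex
    by (simp add: power2_eq_square algebra_simps)
  show ?thesis unfolding E eq
    by (rule has_vector_derivative_eq_rhs[OF d]) (simp add: algebra_simps)
qed

lemma nderiv_modulated_gaussian:
  "\<exists>p. nderiv k (modulated_gaussian a \<sigma>) = (\<lambda>x. poly p (of_real x) * modulated_gaussian a \<sigma> x)"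
proof (induction k)
  case 0
  show ?case by (rule exI[of _ 1]) simp
next
  case (Suc k)
  then obtain p where p: "nderiv k (modulated_gaussian a \<sigma>) = (\<lambda>x. poly p (of_real x) * modulated_gaussian a \<sigma> x)"
    by blast
  have "nderiv (Suc k) (modulated_gaussian a \<sigma>)
      = (\<lambda>x. poly (pderiv p + [:\<i> * of_real a, - of_real (\<sigma>\<^sup>2):] * p) (of_real x) * modulated_gaussian a \<sigma> x)"
    by (rule nderiv_Suc_eqI) (simp only: p modulated_gaussian_poly_deriv)
  then show ?case by blast
qed

lemma norm_modulated_gaussian: "cmod (modulated_gaussian a \<sigma> x) = exp (- ((\<sigma> * x)\<^sup>2 / 2))"
  by (simp add: modulated_gaussian_def norm_mult del: of_real_mult)

lemma power_le_fact_exp: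
  assumes "0 \<le> (u::real)"
  shows "u ^ m \<le> fact m * exp u"
proof -
  have "(\<lambda>n. u ^ n /\<^sub>R fact n) sums exp u" by (rule exp_converges)
  then have s: "summable (\<lambda>n. u ^ n /\<^sub>R fact n)" and e: "(\<Sum>n. u ^ n /\<^sub>R fact n) = exp u"
    by (auto simp: sums_iff)
  have "(\<Sum>n\<in>{m}. u ^ n /\<^sub>R fact n) \<le> (\<Sum>n. u ^ n /\<^sub>R fact n)"
    by (rule sum_le_suminf[OF s]) (use assms in auto)
  then show ?thesis unfolding e by (simp add: field_simps)
qed

lemma bounded_poly_gaussian:
  assumes s: "\<sigma> > 0"
  shows "\<exists>B. \<forall>x. cmod (poly p (of_real x)) * exp (- ((\<sigma> * x)\<^sup>2 / 2)) \<le> B"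
proof -
  have mono: "\<exists>B. \<forall>x. \<bar>x\<bar> ^ m * exp (- ((\<sigma> * x)\<^sup>2 / 2)) \<le> B" for m
  proof (intro exI allI)
    fix x :: real
    let ?u = "(\<sigma> * x)\<^sup>2 / 2"
    have "\<bar>x\<bar> ^ m \<le> 1 + (x\<^sup>2) ^ m"
    proof (cases "\<bar>x\<bar> \<le> 1")
      case True
      then have "\<bar>x\<bar> ^ m \<le> 1" by (simp add: power_le_one)
      moreover have "0 \<le> (x\<^sup>2) ^ m" by simp
      ultimately show ?thesis by linarith
    next
      case False
      then have "\<bar>x\<bar> ^ m \<le> \<bar>x\<bar> ^ (2 * m)" by (intro power_increasing) auto
      then show ?thesis by (simp add: power_mult)
    qed
    also have "(x\<^sup>2) ^ m = (2 / \<sigma>\<^sup>2) ^ m * ?u ^ m"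
    proof -
      have "x\<^sup>2 = 2 / \<sigma>\<^sup>2 * ?u" using s by (simp add: power_mult_distrib)
      then show ?thesis by (metis power_mult_distrib)
    qed
    also have "\<dots> \<le> (2 / \<sigma>\<^sup>2) ^ m * (fact m * exp ?u)"
      by (intro mult_left_mono power_le_fact_exp) auto
    finally have "\<bar>x\<bar> ^ m * exp (- ?u) \<le> (1 + (2 / \<sigma>\<^sup>2) ^ m * (fact m * exp ?u)) * exp (- ?u)"
      by (intro mult_right_mono) auto
    also have "\<dots> = exp (- ?u) + (2 / \<sigma>\<^sup>2) ^ m * fact m"
      by (simp add: exp_minus field_simps)
    also have "\<dots> \<le> 1 + (2 / \<sigma>\<^sup>2) ^ m * fact m" by simp
    finally show "\<bar>x\<bar> ^ m * exp (- ?u) \<le> 1 + (2 / \<sigma>\<^sup>2) ^ m * fact m" .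
  qed
  then obtain b where b: "\<And>m x. \<bar>x\<bar> ^ m * exp (- ((\<sigma> * x)\<^sup>2 / 2)) \<le> b m" by metis
  show ?thesis
  proof (intro exI allI)
    fix x
    have "cmod (poly p (of_real x)) \<le> (\<Sum>i\<le>degree p. cmod (coeff p i) * \<bar>x\<bar> ^ i)"
      unfolding poly_altdef by (rule sum_norm_le) (simp add: norm_mult norm_power)
    then have "cmod (poly p (of_real x)) * exp (- ((\<sigma> * x)\<^sup>2 / 2))
        \<le> (\<Sum>i\<le>degree p. cmod (coeff p i) * \<bar>x\<bar> ^ i) * exp (- ((\<sigma> * x)\<^sup>2 / 2))"
      by (rule mult_right_mono) simp
    also have "\<dots> = (\<Sum>i\<le>degree p. cmod (coeff p i) * (\<bar>x\<bar> ^ i * exp (- ((\<sigma> * x)\<^sup>2 / 2))))"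
      by (simp add: sum_distrib_right mult.assoc)
    also have "\<dots> \<le> (\<Sum>i\<le>degree p. cmod (coeff p i) * b i)"
      by (intro sum_mono mult_left_mono b) simp
    finally show "cmod (poly p (of_real x)) * exp (- ((\<sigma> * x)\<^sup>2 / 2)) \<le> (\<Sum>i\<le>degree p. cmod (coeff p i) * b i)" .
  qed
qed

lemma schwartz_modulated_gaussian:
  assumes s: "\<sigma> > 0"
  shows "schwartz (modulated_gaussian a \<sigma>)"
  unfolding schwartz_def
proof (intro conjI allI)
  have d: "nderiv k (modulated_gaussian a \<sigma>) differentiable (at x)" for k x
  proof -
    obtain p where p: "nderiv k (modulated_gaussian a \<sigma>) = (\<lambda>x. poly p (of_real x) * modulated_gaussian a \<sigma> x)"
      using nderiv_modulated_gaussian by blast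
    show ?thesis unfolding p
      using modulated_gaussian_poly_deriv[of p a \<sigma> x] differentiableI_vector by blast
  qed
  have "isCont (nderiv k (modulated_gaussian a \<sigma>)) x" for k x
    using d by (rule differentiable_imp_continuous_within)
  then show "C_n n (modulated_gaussian a \<sigma>)" for n
    unfolding C_n_def using d by (simp add: continuous_at_imp_continuous_on)
  fix m k
  obtain p where p: "nderiv k (modulated_gaussian a \<sigma>) = (\<lambda>x. poly p (of_real x) * modulated_gaussian a \<sigma> x)"
    using nderiv_modulated_gaussian by blast
  obtain B where B: "\<And>x. cmod (poly (monom 1 m * p) (of_real x)) * exp (- ((\<sigma> * x)\<^sup>2 / 2)) \<le> B"
    using bounded_poly_gaussian[OF s] by blast
  show "bounded (range (\<lambda>x. complex_of_real x ^ m * nderiv k (modulated_gaussian a \<sigma>) x))"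
    unfolding bounded_iff
  proof (intro exI ballI)
    fix y assume "y \<in> range (\<lambda>x. complex_of_real x ^ m * nderiv k (modulated_gaussian a \<sigma>) x)"
    then obtain x where "y = complex_of_real x ^ m * nderiv k (modulated_gaussian a \<sigma>) x" by blast
    then have "norm y = cmod (poly (monom 1 m * p) (of_real x)) * exp (- ((\<sigma> * x)\<^sup>2 / 2))"
      by (simp add: p norm_mult norm_modulated_gaussian poly_monom norm_power)
    then show "norm y \<le> B" using B by simp
  qed
qed

lemma fourier_modulated_gaussian:
  assumes s: "\<sigma> > 0"
  shows "fourier (modulated_gaussian a \<sigma>) x = of_real (normal_density a \<sigma> x)"
proof -
  define t where "t = - ((x - a) / \<sigma>)"
  have "complex_of_real (exp (- t\<^sup>2 / 2)) = (\<integral>z. std_normal_density z *\<^sub>R iexp (t * z) \<partial>lborel)"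
    using fun_cong[OF char_std_normal_distribution, of t] unfolding char_def
    by (subst (asm) integral_density) auto
  also have "\<dots> = \<sigma> *\<^sub>R (\<integral>y. std_normal_density (0 + \<sigma> * y) *\<^sub>R iexp (t * (0 + \<sigma> * y)) \<partial>lborel)"
    using lborel_integral_real_affine[of \<sigma> "\<lambda>z. std_normal_density z *\<^sub>R iexp (t * z)" 0] s by simp
  also have "(\<lambda>y. std_normal_density (0 + \<sigma> * y) *\<^sub>R iexp (t * (0 + \<sigma> * y)))
      = (\<lambda>y. of_real (2 * pi / sqrt (2 * pi)) * (modulated_gaussian a \<sigma> y * exp (- (\<i> * of_real (y * x))) / of_real (2 * pi)))"
  proof
    fix y
    have "t * (0 + \<sigma> * y) = a * y - y * x" using s by (simp add: t_def field_simps)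
    then have "iexp (t * (0 + \<sigma> * y)) = exp (\<i> * of_real (a * y)) * exp (- (\<i> * of_real (y * x)))"
      by (simp add: exp_add[symmetric] right_diff_distrib)
    then show "std_normal_density (0 + \<sigma> * y) *\<^sub>R iexp (t * (0 + \<sigma> * y))
      = of_real (2 * pi / sqrt (2 * pi)) * (modulated_gaussian a \<sigma> y * exp (- (\<i> * of_real (y * x))) / of_real (2 * pi))"
      by (simp add: std_normal_density_def modulated_gaussian_def scaleR_conv_of_real mult_ac)
  qed
  also have "\<sigma> *\<^sub>R (\<integral>y. of_real (2 * pi / sqrt (2 * pi)) * (modulated_gaussian a \<sigma> y * exp (- (\<i> * of_real (y * x))) / of_real (2 * pi)) \<partial>lborel)
      = of_real (\<sigma> * (2 * pi / sqrt (2 * pi))) * fourier (modulated_gaussian a \<sigma>) x"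
    unfolding fourier_def by (simp add: scaleR_conv_of_real mult.assoc)
  finally have eq: "complex_of_real (exp (- t\<^sup>2 / 2)) = of_real (\<sigma> * (2 * pi / sqrt (2 * pi))) * fourier (modulated_gaussian a \<sigma>) x" .
  have "2 * pi / sqrt (2 * pi) = sqrt (2 * pi)" by (rule real_div_sqrt) simp
  then have c: "\<sigma> * (2 * pi / sqrt (2 * pi)) = sqrt (2 * pi * \<sigma>\<^sup>2)" using s by (simp add: real_sqrt_mult)
  have "sqrt (2 * pi * \<sigma>\<^sup>2) \<noteq> 0" using s by simp
  then have "fourier (modulated_gaussian a \<sigma>) x = of_real (exp (- t\<^sup>2 / 2) / sqrt (2 * pi * \<sigma>\<^sup>2))"
    using eq unfolding c by (simp add: field_simps)
  also have "exp (- t\<^sup>2 / 2) / sqrt (2 * pi * \<sigma>\<^sup>2) = normal_density a \<sigma> x"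
    using s by (simp add: normal_density_def t_def power_divide)
  finally show ?thesis .
qed

text \<open>Only the integrals of \<open>g\<close> against the densities are assumed to exist, so away from \<open>a\<close> the narrow densities are
  compared with the density of standard deviation \<open>1\<close>.\<close>

lemma normal_density_concentrates:
  fixes g :: "real \<Rightarrow> complex"
  assumes g: "continuous_on UNIV g"
    and int: "\<And>\<sigma>. \<sigma> > 0 \<Longrightarrow> integrable lborel (\<lambda>x. g x * of_real (normal_density a \<sigma> x))"
  shows "(\<lambda>n. \<integral>x. g x * of_real (normal_density a (1 / real (Suc n)) x) \<partial>lborel) \<longlonglongrightarrow> g a"
proof -
  define N where "N n = normal_density a (1 / real (Suc n))" for n
  define d where "d x = g x - g a" for x
  have N0: "0 \<le> N n x" for n x by (simp add: N_def)
  have Nint: "integrable lborel (N n)" "(\<integral>x. N n x \<partial>lborel) = 1" for n unfolding N_def by simp_all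
  have gint: "integrable lborel (\<lambda>x. g x * of_real (N n x))" for n unfolding N_def by (rule int) simp
  have dint: "integrable lborel (\<lambda>x. d x * of_real (N n x))" for n
    unfolding d_def left_diff_distrib using Nint(1)[of n]
    by (intro Bochner_Integration.integrable_diff gint integrable_mult_right) (simp add: integrable_of_real)
  have dval: "(\<integral>x. d x * of_real (N n x) \<partial>lborel) = (\<integral>x. g x * of_real (N n x) \<partial>lborel) - g a" for n
  proof -
    have "(\<integral>x. d x * of_real (N n x) \<partial>lborel)
        = (\<integral>x. g x * of_real (N n x) \<partial>lborel) - (\<integral>x. g a * of_real (N n x) \<partial>lborel)"
      unfolding d_def left_diff_distrib using Nint(1)[of n]
      by (intro Bochner_Integration.integral_diff gint integrable_mult_right) (simp add: integrable_of_real)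
    then show ?thesis using Nint[of n] by simp
  qed
  define K where "K = (\<integral>x. cmod (d x) * N 0 x \<partial>lborel)"
  have K0int: "integrable lborel (\<lambda>x. cmod (d x) * N 0 x)"
    using integrable_norm[OF dint[of 0]] N0[of 0] by (simp add: norm_mult)
  have K0: "0 \<le> K" unfolding K_def using N0 by (intro integral_nonneg_AE) simp
  have "(\<lambda>n. \<integral>x. d x * of_real (N n x) \<partial>lborel) \<longlonglongrightarrow> 0"
  proof (rule LIMSEQ_I)
    fix \<epsilon> :: real assume e: "0 < \<epsilon>"
    have "isCont g a" using g by (simp add: continuous_on_eq_continuous_at)
    then obtain \<delta> where dl: "\<delta> > 0" "\<And>x. dist x a < \<delta> \<Longrightarrow> dist (g x) (g a) < \<epsilon> / 2"
      using e unfolding continuous_at_eps_delta by (metis half_gt_zero)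
    \<comment> \<open>At distance \<open>\<delta>\<close> or more from \<open>a\<close>, \<open>C n\<close> bounds the ratio of the densities \<open>N n\<close> and \<open>N 0\<close>.\<close>
    define C where "C n = real (Suc n) * exp (- (((real (Suc n))\<^sup>2 - 1) * \<delta>\<^sup>2 / 2))" for n
    have "C \<longlonglongrightarrow> 0"
    proof (rule Lim_null_comparison)
      have "\<bar>exp (- \<delta>\<^sup>2)\<bar> < 1" using dl(1) by simp
      then have "(\<lambda>n. real n * exp (- \<delta>\<^sup>2) ^ n + exp (- \<delta>\<^sup>2) ^ n) \<longlonglongrightarrow> 0 + 0"
        by (intro tendsto_add powser_times_n_limit_0 LIMSEQ_power_zero) simp_all
      then show "(\<lambda>n. real (Suc n) * exp (- \<delta>\<^sup>2) ^ n) \<longlonglongrightarrow> 0" by (simp add: distrib_right add.commute)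
      have "norm (C n) \<le> real (Suc n) * exp (- \<delta>\<^sup>2) ^ n" for n
      proof -
        have "real n * \<delta>\<^sup>2 \<le> ((real (Suc n))\<^sup>2 - 1) * \<delta>\<^sup>2 / 2"
        proof -
          have "((real (Suc n))\<^sup>2 - 1) * \<delta>\<^sup>2 / 2 = real n * \<delta>\<^sup>2 + real n * real n * \<delta>\<^sup>2 / 2"
            by (simp add: power2_eq_square field_simps)
          moreover have "0 \<le> real n * real n * \<delta>\<^sup>2 / 2" by simp
          ultimately show ?thesis by linarith
        qed
        then have "exp (- (((real (Suc n))\<^sup>2 - 1) * \<delta>\<^sup>2 / 2)) \<le> exp (real n * (- \<delta>\<^sup>2))" by simp
        also have "\<dots> = exp (- \<delta>\<^sup>2) ^ n" by (rule exp_of_nat_mult)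
        finally show ?thesis by (simp add: C_def mult_left_mono del: of_nat_Suc)
      qed
      then show "\<forall>\<^sub>F n in sequentially. norm (C n) \<le> real (Suc n) * exp (- \<delta>\<^sup>2) ^ n" by simp
    qed
    then have "(\<lambda>n. C n * K) \<longlonglongrightarrow> 0" by (rule tendsto_mult_left_zero)
    from LIMSEQ_D[OF this, of "\<epsilon> / 2"] e obtain n0 where n0: "\<And>n. n \<ge> n0 \<Longrightarrow> \<bar>C n * K\<bar> < \<epsilon> / 2" by auto
    have pt: "cmod (d x) * N n x \<le> \<epsilon> / 2 * N n x + C n * (cmod (d x) * N 0 x)" for n x
    proof (cases "dist x a < \<delta>")
      case True
      then have "cmod (d x) \<le> \<epsilon> / 2" using dl(2)[OF True] by (simp add: d_def dist_norm)
      then have "cmod (d x) * N n x \<le> \<epsilon> / 2 * N n x" by (rule mult_right_mono[OF _ N0])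
      moreover have "0 \<le> C n * (cmod (d x) * N 0 x)" using N0 by (simp add: C_def)
      ultimately show ?thesis by linarith
    next
      case False
      then have z: "\<delta>\<^sup>2 \<le> (x - a)\<^sup>2" using dl(1) unfolding dist_real_def abs_le_square_iff[symmetric] by auto
      have "(real (Suc n))\<^sup>2 \<ge> 1\<^sup>2" by (intro power_mono) auto
      then have "((real (Suc n))\<^sup>2 - 1) * \<delta>\<^sup>2 \<le> ((real (Suc n))\<^sup>2 - 1) * (x - a)\<^sup>2"
        using z by (intro mult_left_mono) auto
      then have ex: "exp (- ((real (Suc n))\<^sup>2 * (x - a)\<^sup>2 / 2)) \<le> exp (- (((real (Suc n))\<^sup>2 - 1) * \<delta>\<^sup>2 / 2)) * exp (- ((x - a)\<^sup>2 / 2))"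
        unfolding exp_add[symmetric] exp_le_cancel_iff by (simp add: left_diff_distrib diff_divide_distrib)
      have Nn: "N n x = real (Suc n) / sqrt (2 * pi) * exp (- ((real (Suc n))\<^sup>2 * (x - a)\<^sup>2 / 2))" for n
        unfolding N_def normal_density_def
        by (simp add: real_sqrt_mult real_sqrt_divide power_divide mult.commute)
      have "N n x \<le> C n * N 0 x"
      proof -
        have "real (Suc n) / sqrt (2 * pi) * exp (- ((real (Suc n))\<^sup>2 * (x - a)\<^sup>2 / 2))
            \<le> real (Suc n) / sqrt (2 * pi) * (exp (- (((real (Suc n))\<^sup>2 - 1) * \<delta>\<^sup>2 / 2)) * exp (- ((x - a)\<^sup>2 / 2)))"
          by (rule mult_left_mono[OF ex]) simp
        also have "\<dots> = C n * N 0 x" unfolding Nn[of 0] C_def by simp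
        finally show ?thesis unfolding Nn[of n] .
      qed
      then have "cmod (d x) * N n x \<le> cmod (d x) * (C n * N 0 x)" by (rule mult_left_mono) simp
      moreover have "0 \<le> \<epsilon> / 2 * N n x" using e N0 by simp
      ultimately show ?thesis by (simp add: mult_ac)
    qed
    have "norm ((\<integral>x. d x * of_real (N n x) \<partial>lborel) - 0) < \<epsilon>" if n: "n \<ge> n0" for n
    proof -
      have "norm (\<integral>x. d x * of_real (N n x) \<partial>lborel) \<le> (\<integral>x. cmod (d x) * N n x \<partial>lborel)"
        using integral_norm_bound[of lborel "\<lambda>x. d x * of_real (N n x)"] N0 by (simp add: norm_mult)
      also have "\<dots> \<le> (\<integral>x. \<epsilon> / 2 * N n x + C n * (cmod (d x) * N 0 x) \<partial>lborel)"
        using integrable_norm[OF dint[of n]] N0[of n] Nint(1)[of n] K0int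
        by (intro integral_mono pt Bochner_Integration.integrable_add integrable_mult_right) (simp_all add: norm_mult)
      also have "\<dots> = \<epsilon> / 2 + C n * K"
        using Nint[of n] K0int by (simp add: K_def)
      also have "\<dots> < \<epsilon>" using n0[OF n] by (simp add: abs_less_iff)
      finally show ?thesis by simp
    qed
    then show "\<exists>no. \<forall>n\<ge>no. norm ((\<integral>x. d x * of_real (N n x) \<partial>lborel) - 0) < \<epsilon>" by blast
  qed
  then have "(\<lambda>n. (\<integral>x. g x * of_real (N n x) \<partial>lborel) - g a) \<longlonglongrightarrow> 0" by (simp only: dval)
  then show ?thesis unfolding N_def by (rule LIM_zero_cancel)
qed

theorem Fourier_inversion:
  fixes g h :: "real \<Rightarrow> complex"
  assumes g: "continuous_on UNIV g" and h: "has_L1_fourier g h"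
  shows "g a = (\<integral>t. h t * exp (\<i> * of_real (t * a)) \<partial>lborel)"
proof -
  let ?\<phi> = "\<lambda>n. modulated_gaussian a (1 / real (Suc n))"
  have hint: "integrable lborel h"
    and eq: "\<And>\<phi>. schwartz \<phi> \<Longrightarrow> (\<integral>x. g x * fourier \<phi> x \<partial>lborel) = (\<integral>x. h x * \<phi> x \<partial>lborel)"
    and gint: "\<And>\<phi>. schwartz \<phi> \<Longrightarrow> integrable lborel (\<lambda>x. g x * fourier \<phi> x)"
    using h unfolding has_L1_fourier_def by auto
  have [measurable]: "h \<in> borel_measurable borel" using borel_measurable_integrable[OF hint] by simp
  have [measurable]: "modulated_gaussian b \<sigma> \<in> borel_measurable borel" for b \<sigma>
    unfolding modulated_gaussian_def[abs_def] by measurable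
  have "(\<lambda>n. \<integral>x. g x * of_real (normal_density a (1 / real (Suc n)) x) \<partial>lborel) \<longlonglongrightarrow> g a"
  proof (rule normal_density_concentrates[OF g])
    fix \<sigma> :: real assume "\<sigma> > 0"
    from gint[OF schwartz_modulated_gaussian[OF this]]
    show "integrable lborel (\<lambda>x. g x * of_real (normal_density a \<sigma> x))"
      by (simp add: fourier_modulated_gaussian[OF \<open>\<sigma> > 0\<close>])
  qed
  moreover have "(\<integral>x. g x * of_real (normal_density a (1 / real (Suc n)) x) \<partial>lborel) = (\<integral>t. h t * ?\<phi> n t \<partial>lborel)" for n
    using eq[OF schwartz_modulated_gaussian[of "1 / real (Suc n)" a]]
    by (simp add: fourier_modulated_gaussian)
  moreover have "(\<lambda>n. \<integral>t. h t * ?\<phi> n t \<partial>lborel) \<longlonglongrightarrow> (\<integral>t. h t * exp (\<i> * of_real (t * a)) \<partial>lborel)"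
  proof (rule integral_dominated_convergence[where w = "\<lambda>t. cmod (h t)"])
    show "AE t in lborel. (\<lambda>n. h t * ?\<phi> n t) \<longlonglongrightarrow> h t * exp (\<i> * of_real (t * a))"
    proof (rule AE_I2)
      fix t
      have "(\<lambda>n. exp (- ((1 / real (Suc n) * t)\<^sup>2 / 2))) \<longlonglongrightarrow> exp (- ((0 * t)\<^sup>2 / 2))"
        using LIMSEQ_inverse_real_of_nat unfolding inverse_eq_divide
        by (intro tendsto_exp tendsto_minus tendsto_divide tendsto_power tendsto_mult tendsto_const) simp_all
      then have "(\<lambda>n. h t * (exp (\<i> * of_real (a * t)) * of_real (exp (- ((1 / real (Suc n) * t)\<^sup>2 / 2)))))
          \<longlonglongrightarrow> h t * (exp (\<i> * of_real (a * t)) * of_real (exp (- ((0 * t)\<^sup>2 / 2))))"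
        by (intro tendsto_mult tendsto_const tendsto_of_real)
      then show "(\<lambda>n. h t * ?\<phi> n t) \<longlonglongrightarrow> h t * exp (\<i> * of_real (t * a))"
        unfolding modulated_gaussian_def by (simp add: mult.commute)
    qed
    show "AE t in lborel. norm (h t * ?\<phi> n t) \<le> cmod (h t)" for n
      by (rule AE_I2) (simp add: norm_mult norm_modulated_gaussian mult_left_le)
    show "integrable lborel (\<lambda>t. cmod (h t))" by (rule integrable_norm[OF hint])
  qed measurable
  ultimately show ?thesis using LIMSEQ_unique by simp
qed

lemma has_L1_fourier_fourier_L1:
  assumes "\<exists>h. has_L1_fourier g h"
  shows "has_L1_fourier g (fourier_L1 g)"
  unfolding fourier_L1_def using assms by (rule someI_ex[where P = "has_L1_fourier g"])

section \<open>The simplex\<close>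

\<comment> \<open>Keeps the index sets \<open>{1..n}\<close> in this form, in which the measures and sums over them match.\<close>
declare One_nat_def [simp del]

text \<open>The simplex scaled by \<open>r\<close>, in the coordinates \<open>1, \<dots>, n\<close>, which determine the coordinate \<open>0\<close>.\<close>

definition corner :: "nat \<Rightarrow> real \<Rightarrow> (nat \<Rightarrow> real) set" where
  "corner n r = {t. (\<forall>j\<in>{1..n}. 0 \<le> t j) \<and> (\<Sum>j=1..n. t j) \<le> r}"

abbreviation lborel_n :: "nat \<Rightarrow> (nat \<Rightarrow> real) measure" where
  "lborel_n n \<equiv> \<Pi>\<^sub>M j\<in>{1..n}. lborel"

definition barycentric :: "nat \<Rightarrow> (nat \<Rightarrow> real) \<Rightarrow> nat \<Rightarrow> real" where
  "barycentric n t = (\<lambda>j\<in>{0..n}. if j = 0 then 1 - (\<Sum>k=1..n. t k) else t j)"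

lemma corner_measurable [measurable]: "corner n r \<inter> space (lborel_n n) \<in> sets (lborel_n n)"
proof -
  have "{t \<in> space (lborel_n n). (\<forall>j\<in>{1..n}. 0 \<le> t j) \<and> (\<Sum>j=1..n. t j) \<le> r} \<in> sets (lborel_n n)"
    by measurable
  then show ?thesis by (simp add: corner_def Int_def conj_commute)
qed

lemma indicator_corner_measurable [measurable]:
  "(\<lambda>t. indicator (corner n r) t :: real) \<in> borel_measurable (lborel_n n)"
proof (rule borel_measurable_indicator')
  have "{t \<in> space (lborel_n n). t \<in> corner n r} = corner n r \<inter> space (lborel_n n)" by auto
  then show "{t \<in> space (lborel_n n). t \<in> corner n r} \<in> sets (lborel_n n)" by (simp only: corner_measurable)
qed

lemma indicator_corner_measurable2:
  fixes r :: "'b \<Rightarrow> real"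
  assumes g: "g \<in> measurable M (lborel_n n)" and r: "r \<in> borel_measurable M"
  shows "(\<lambda>p. indicator (corner n (1 - r p)) (g p) :: real) \<in> borel_measurable M"
proof -
  have c: "(\<lambda>p. g p j) \<in> borel_measurable M" if "j \<in> {1..n}" for j
    using measurable_compose[OF g measurable_component_singleton[OF that]] by simp
  have "indicator (corner n (1 - r p)) (g p)
      = (\<Prod>j\<in>{1..n}. indicator {0..} (g p j)) * (indicator {..0} ((\<Sum>j\<in>{1..n}. g p j) - (1 - r p)) :: real)" for p
  proof (cases "\<forall>j\<in>{1..n}. 0 \<le> g p j")
    case True
    then have "(\<Prod>j\<in>{1..n}. indicator {0..} (g p j)) = (1::real)" by (intro prod.neutral) auto
    then show ?thesis using True by (auto simp: corner_def indicator_def)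
  next
    case False
    then have "(\<Prod>j\<in>{1..n}. indicator {0..} (g p j)) = (0::real)"
      by (intro prod_zero) (auto simp: indicator_def)
    then show ?thesis using False by (auto simp: corner_def indicator_def)
  qed
  moreover have "(\<lambda>p. indicator {0..} (g p j) :: real) \<in> borel_measurable M" if "j \<in> {1..n}" for j
    using measurable_compose[OF c[OF that] borel_measurable_indicator[of "{0..}" borel]] by simp
  moreover have "(\<lambda>p. indicator {..0} ((\<Sum>j\<in>{1..n}. g p j) - (1 - r p)) :: real) \<in> borel_measurable M"
  proof -
    have "(\<lambda>p. (\<Sum>j\<in>{1..n}. g p j) - (1 - r p)) \<in> borel_measurable M"
      by (intro borel_measurable_diff borel_measurable_sum c r) simp_all
    from measurable_compose[OF this borel_measurable_indicator[of "{..0}" borel]] show ?thesis by simp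
  qed
  ultimately show ?thesis
    by (simp only:) (intro borel_measurable_times borel_measurable_prod)
qed

lemma emeasure_corner: "0 \<le> r \<Longrightarrow> emeasure (lborel_n n) (corner n r \<inter> space (lborel_n n)) = ennreal (r ^ n / fact n)"
  using emeasure_std_simplex_aux[of "{1..n}" r]
  by (simp add: corner_def divide_ennreal[symmetric] ennreal_fact ennreal_power)

lemma barycentric_measurable [measurable]:
  "barycentric n \<in> measurable (restrict_space (lborel_n n) (corner n 1)) (\<Pi>\<^sub>M j\<in>{0..n}. borel)"
  unfolding barycentric_def[abs_def]
proof (intro measurable_restrict_space1 measurable_restrict)
  fix j assume j: "j \<in> {0..n}"
  show "(\<lambda>t. if j = 0 then 1 - (\<Sum>k=1..n. t k) else t j) \<in> borel_measurable (lborel_n n)"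
  proof (cases "j = 0")
    case False
    then have "j \<in> {1..n}" using j by auto
    then have "(\<lambda>t. t j) \<in> measurable (lborel_n n) lborel" by (rule measurable_component_singleton)
    then show ?thesis using False by simp
  qed simp
qed

lemma simplex_measure_eq:
  "simplex_measure n = distr (restrict_space (lborel_n n) (corner n 1)) (\<Pi>\<^sub>M j\<in>{0..n}. borel) (barycentric n)"
  by (simp add: simplex_measure_def corner_def barycentric_def[abs_def])

lemma sets_simplex_measure [measurable_cong, simp]: "sets (simplex_measure n) = sets (\<Pi>\<^sub>M j\<in>{0..n}. borel)"
  by (simp add: simplex_measure_eq)

lemma emeasure_simplex_measure: "emeasure (simplex_measure n) (space (simplex_measure n)) = ennreal (1 / fact n)"
proof -
  have "emeasure (simplex_measure n) (space (simplex_measure n))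
      = emeasure (restrict_space (lborel_n n) (corner n 1)) (space (restrict_space (lborel_n n) (corner n 1)))"
    unfolding simplex_measure_eq
    by (subst emeasure_distr) (auto intro!: arg_cong2[where f = emeasure] simp: measurable_space[OF barycentric_measurable])
  also have "\<dots> = emeasure (lborel_n n) (corner n 1 \<inter> space (lborel_n n))"
    by (subst emeasure_restrict_space) (auto simp: space_restrict_space Int_commute)
  finally show ?thesis by (simp add: emeasure_corner)
qed

lemma finite_measure_simplex_measure: "finite_measure (simplex_measure n)"
  by (rule finite_measureI) (simp add: emeasure_simplex_measure)

lemma measure_simplex_measure: "measure (simplex_measure n) (space (simplex_measure n)) = 1 / fact n"
  by (simp add: measure_def emeasure_simplex_measure)

text \<open>The convex combination of the \<open>x j\<close> with barycentric coordinates \<open>t\<close>, in which the weight of \<open>x 0\<close> is eliminated.\<close>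

definition simplex_point :: "nat \<Rightarrow> (nat \<Rightarrow> real) \<Rightarrow> (nat \<Rightarrow> real) \<Rightarrow> real" where
  "simplex_point n x t = x 0 + (\<Sum>j=1..n. t j * (x j - x 0))"

lemma simplex_point_barycentric: "(\<Sum>j\<le>n. barycentric n t j * x j) = simplex_point n x t"
proof -
  have "{..n} = insert 0 {1..n}" by auto
  then have "(\<Sum>j\<le>n. barycentric n t j * x j) = barycentric n t 0 * x 0 + (\<Sum>j=1..n. barycentric n t j * x j)"
    by simp
  also have "(\<Sum>j=1..n. barycentric n t j * x j) = (\<Sum>j=1..n. t j * x j)"
    by (intro sum.cong) (auto simp: barycentric_def)
  also have "barycentric n t 0 = 1 - (\<Sum>j=1..n. t j)" by (simp add: barycentric_def)
  finally show ?thesis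
    by (simp add: simplex_point_def right_diff_distrib left_diff_distrib sum_subtractf sum_distrib_right)
qed

lemma integral_simplex_measure:
  fixes G :: "real \<Rightarrow> complex"
  assumes [measurable]: "G \<in> borel_measurable borel"
  shows "(\<integral>s. G (\<Sum>j\<le>n. s j * x j) \<partial>simplex_measure n)
    = (\<integral>t. indicator (corner n 1) t *\<^sub>R G (simplex_point n x t) \<partial>lborel_n n)"
proof -
  have "(\<lambda>s. G (\<Sum>j\<le>n. s j * x j)) \<in> borel_measurable (\<Pi>\<^sub>M j\<in>{0..n}. borel)" by measurable
  then show ?thesis
    unfolding simplex_measure_eq
    by (subst integral_distr[OF barycentric_measurable], assumption)
      (simp add: simplex_point_barycentric integral_restrict_space)
qed

lemma measurable_simplex_point [measurable]: "simplex_point n x \<in> borel_measurable (lborel_n n)"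
  unfolding simplex_point_def[abs_def] by measurable

lemma abs_simplex_point_le:
  assumes "t \<in> corner n 1"
  shows "\<bar>simplex_point n x t\<bar> \<le> \<bar>x 0\<bar> + (\<Sum>j=1..n. \<bar>x j - x 0\<bar>)"
proof -
  have "\<bar>t j * (x j - x 0)\<bar> \<le> \<bar>x j - x 0\<bar>" if "j \<in> {1..n}" for j
  proof -
    have "t j \<le> (\<Sum>j=1..n. t j)" using assms that by (intro member_le_sum) (auto simp: corner_def)
    then have "\<bar>t j\<bar> \<le> 1" using assms that by (auto simp: corner_def)
    then show ?thesis by (simp add: abs_mult mult_left_le_one_le)
  qed
  then have "\<bar>\<Sum>j=1..n. t j * (x j - x 0)\<bar> \<le> (\<Sum>j=1..n. \<bar>x j - x 0\<bar>)"
    by (intro order_trans[OF sum_abs] sum_mono)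
  then show ?thesis unfolding simplex_point_def by linarith
qed

lemma integrable_bounded_support:
  fixes f :: "'b \<Rightarrow> complex"
  assumes f: "f \<in> borel_measurable M" and A: "A \<in> sets M" "emeasure M A < \<infinity>"
    and le: "\<And>x. x \<in> space M \<Longrightarrow> norm (f x) \<le> K * indicator A x"
  shows "integrable M f"
proof (rule Bochner_Integration.integrable_bound[OF _ f])
  show "integrable M (\<lambda>x. K * indicator A x)"
    using A by (intro integrable_mult_right integrable_real_indicator) (auto simp: less_top)
  show "AE x in M. norm (f x) \<le> norm (K * indicator A x)"
    using le by (intro AE_I2) (force intro: order_trans)
qed

lemma continuous_bounded_interval:
  fixes G :: "real \<Rightarrow> complex"
  assumes "continuous_on UNIV G"
  obtains K where "\<And>y. \<bar>y\<bar> \<le> X \<Longrightarrow> cmod (G y) \<le> K"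
proof -
  have "compact (G ` {-X..X})"
    by (intro compact_continuous_image continuous_on_subset[OF assms]) auto
  then obtain K where "\<And>z. z \<in> G ` {-X..X} \<Longrightarrow> norm z \<le> K"
    using compact_imp_bounded bounded_iff by metis
  then have "\<And>y. \<bar>y\<bar> \<le> X \<Longrightarrow> cmod (G y) \<le> K" by (simp add: abs_le_iff)
  then show ?thesis by (rule that)
qed

lemma integrable_corner:
  fixes G :: "real \<Rightarrow> complex"
  assumes G: "continuous_on UNIV G"
  shows "integrable (lborel_n n) (\<lambda>t. indicator (corner n 1) t *\<^sub>R G (simplex_point n x t))"
proof -
  obtain K where K: "\<And>y. \<bar>y\<bar> \<le> \<bar>x 0\<bar> + (\<Sum>j=1..n. \<bar>x j - x 0\<bar>) \<Longrightarrow> cmod (G y) \<le> K"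
    using continuous_bounded_interval[OF G] by blast
  have [measurable]: "G \<in> borel_measurable borel" using G by (rule borel_measurable_continuous_onI)
  show ?thesis
  proof (rule integrable_bounded_support)
    show "corner n 1 \<inter> space (lborel_n n) \<in> sets (lborel_n n)" by (rule corner_measurable)
    show "emeasure (lborel_n n) (corner n 1 \<inter> space (lborel_n n)) < \<infinity>" by (simp add: emeasure_corner)
    show "norm (indicator (corner n 1) t *\<^sub>R G (simplex_point n x t)) \<le> K * indicator (corner n 1 \<inter> space (lborel_n n)) t"
      if "t \<in> space (lborel_n n)" for t
      using that K[OF abs_simplex_point_le[of t n x]] by (auto simp: indicator_def)
  qed measurable
qed

lemma lborel_n_scale:
  assumes c: "c > 0"
  shows "density (distr (lborel_n n) (lborel_n n) (\<lambda>t. \<lambda>j\<in>{1..n}. c * t j)) (\<lambda>_. ennreal (c ^ n)) = lborel_n n"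
    (is "?P = _")
proof -
  interpret product_sigma_finite "\<lambda>_::nat. lborel :: real measure" by standard
  let ?s = "\<lambda>t. \<lambda>j\<in>{1..n}. c * t j"
  have [measurable]: "?s \<in> measurable (lborel_n n) (lborel_n n)" by measurable
  show ?thesis
  proof (rule PiM_eqI)
    fix A :: "nat \<Rightarrow> real set" assume A: "\<And>i. i \<in> {1..n} \<Longrightarrow> A i \<in> sets lborel"
    then have PA: "Pi\<^sub>E {1..n} A \<in> sets (lborel_n n)" by (intro sets_PiM_I_finite) auto
    have "emeasure ?P (Pi\<^sub>E {1..n} A) = ennreal (c ^ n) * emeasure (lborel_n n) (?s -` Pi\<^sub>E {1..n} A \<inter> space (lborel_n n))"
      using PA by (subst emeasure_density_const) (simp_all add: emeasure_distr)
    also have "?s -` Pi\<^sub>E {1..n} A \<inter> space (lborel_n n) = Pi\<^sub>E {1..n} (\<lambda>i. (\<lambda>y. c * y) -` A i)"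
      by (auto simp: space_PiM PiE_iff)
    also have "emeasure (lborel_n n) (Pi\<^sub>E {1..n} (\<lambda>i. (\<lambda>y. c * y) -` A i)) = (\<Prod>i\<in>{1..n}. emeasure lborel ((\<lambda>y. c * y) -` A i))"
    proof (rule emeasure_PiM)
      fix i assume "i \<in> {1..n}"
      then have "A i \<in> sets borel" using A by simp
      then show "(\<lambda>y. c * y) -` A i \<in> sets lborel"
        using measurable_sets[of "\<lambda>y. c * y" borel borel "A i"] by simp
    qed simp
    also have "ennreal (c ^ n) * \<dots> = (\<Prod>i\<in>{1..n}. ennreal c * emeasure lborel ((\<lambda>y. c * y) -` A i))"
      using c by (simp add: prod.distrib ennreal_power)
    also have "\<dots> = (\<Prod>i\<in>{1..n}. emeasure lborel (A i))"
    proof (rule prod.cong[OF refl])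
      fix i assume "i \<in> {1..n}"
      then have Ai: "A i \<in> sets borel" using A by simp
      have "emeasure lborel (A i) = emeasure (density (distr lborel borel (\<lambda>x. 0 + c * x)) (\<lambda>_. ennreal \<bar>c\<bar>)) (A i)"
        using lborel_real_affine[of c 0] c by simp
      also have "\<dots> = ennreal c * emeasure lborel ((\<lambda>y. c * y) -` A i)"
        using Ai c by (subst emeasure_density_const) (simp_all add: emeasure_distr)
      finally show "ennreal c * emeasure lborel ((\<lambda>y. c * y) -` A i) = emeasure lborel (A i)" by simp
    qed
    finally show "emeasure ?P (Pi\<^sub>E {1..n} A) = (\<Prod>i\<in>{1..n}. emeasure lborel (A i))" .
  qed simp_all
qed

lemma integral_lborel_n_scale:
  fixes F :: "(nat \<Rightarrow> real) \<Rightarrow> complex"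
  assumes c: "c > 0" and [measurable]: "F \<in> borel_measurable (lborel_n n)"
  shows "integral\<^sup>L (lborel_n n) F = c ^ n *\<^sub>R (\<integral>t. F (\<lambda>j\<in>{1..n}. c * t j) \<partial>lborel_n n)"
proof -
  have [measurable]: "(\<lambda>t. \<lambda>j\<in>{1..n}. c * t j) \<in> measurable (lborel_n n) (lborel_n n)" by measurable
  have "integral\<^sup>L (lborel_n n) F
      = integral\<^sup>L (density (distr (lborel_n n) (lborel_n n) (\<lambda>t. \<lambda>j\<in>{1..n}. c * t j)) (\<lambda>_. ennreal (c ^ n))) F"
    by (simp only: lborel_n_scale[OF c])
  also have "\<dots> = c ^ n *\<^sub>R (\<integral>t. F (\<lambda>j\<in>{1..n}. c * t j) \<partial>lborel_n n)"
    using c assms(2) by (subst integral_density) (simp_all add: integral_distr)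
  finally show ?thesis .
qed

text \<open>The simplex of dimension \<open>n + 1\<close> is the cone over the one of dimension \<open>n\<close> with the last
  vertex as apex. The slice at height \<open>r = 1 - \<rho>\<close> is a copy of the base scaled by \<open>\<rho>\<close>, which accounts for the
  factor \<open>\<rho>\<^sup>n\<close>.\<close>

theorem simplex_cone:
  fixes G :: "real \<Rightarrow> complex"
  assumes G: "continuous_on UNIV G"
  shows "(\<integral>s. G (\<Sum>j\<le>Suc n. s j * x j) \<partial>simplex_measure (Suc n))
    = (\<integral>t. indicator (corner n 1) t *\<^sub>R
        (\<integral>\<rho>. (indicator {0..1} \<rho> * \<rho> ^ n) *\<^sub>R G (\<rho> * simplex_point n x t + (1 - \<rho>) * x (Suc n)) \<partial>lborel) \<partial>lborel_n n)"
proof -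
  interpret product_sigma_finite "\<lambda>_::nat. lborel :: real measure" by standard
  interpret L: sigma_finite_measure "lborel_n n" by (rule sigma_finite) simp
  interpret P: pair_sigma_finite "lborel_n n" "lborel :: real measure" by standard
  have Gm [measurable]: "G \<in> borel_measurable borel" using G by (rule borel_measurable_continuous_onI)
  let ?y = "x (Suc n)"
  have ins: "{1..Suc n} = insert (Suc n) {1..n}" by auto
  let ?F = "\<lambda>t. indicator (corner (Suc n) 1) t *\<^sub>R G (simplex_point (Suc n) x t)"
  let ?H = "\<lambda>t r. (indicator {0..1} r * indicator (corner n (1 - r)) t) *\<^sub>R G (simplex_point n x t + r * (?y - x 0))"
  have upd: "?F (t(Suc n := r)) = ?H t r" for t r
  proof -
    have s: "(\<Sum>j=1..n. (t(Suc n := r)) j * f j) = (\<Sum>j=1..n. t j * f j)" for f :: "nat \<Rightarrow> real"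
      by (intro sum.cong) auto
    have "(\<Sum>j=1..n. (t(Suc n := r)) j) = (\<Sum>j=1..n. t j)" by (intro sum.cong) auto
    then have "t(Suc n := r) \<in> corner (Suc n) 1 \<longleftrightarrow> 0 \<le> r \<and> (\<forall>j\<in>{1..n}. 0 \<le> t j) \<and> (\<Sum>j=1..n. t j) + r \<le> 1"
      by (auto simp: corner_def ins)
    also have "\<dots> \<longleftrightarrow> r \<in> {0..1} \<and> t \<in> corner n (1 - r)"
    proof -
      have "0 \<le> (\<Sum>j=1..n. t j)" if "\<forall>j\<in>{1..n}. 0 \<le> t j" using that by (intro sum_nonneg) auto
      then show ?thesis by (auto simp: corner_def)
    qed
    finally have "indicator (corner (Suc n) 1) (t(Suc n := r)) = (indicator {0..1} r * indicator (corner n (1 - r)) t :: real)"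
      by (simp add: indicator_def)
    moreover have "simplex_point (Suc n) x (t(Suc n := r)) = simplex_point n x t + r * (?y - x 0)"
      by (simp add: simplex_point_def s)
    ultimately show ?thesis by simp
  qed
  have "(\<integral>s. G (\<Sum>j\<le>Suc n. s j * x j) \<partial>simplex_measure (Suc n)) = integral\<^sup>L (lborel_n (Suc n)) ?F"
    by (rule integral_simplex_measure) measurable
  also have "\<dots> = (\<integral>t. (\<integral>r. ?H t r \<partial>lborel) \<partial>lborel_n n)"
    using product_integral_insert[of "{1..n}" "Suc n" ?F] integrable_corner[OF G, of "Suc n" x]
    unfolding ins upd by simp
  also have "\<dots> = (\<integral>r. (\<integral>t. ?H t r \<partial>lborel_n n) \<partial>lborel)"
  proof (rule P.Fubini_integral[symmetric])
    obtain K where K: "\<And>y. \<bar>y\<bar> \<le> \<bar>x 0\<bar> + (\<Sum>j=1..n. \<bar>x j - x 0\<bar>) + \<bar>?y - x 0\<bar> \<Longrightarrow> cmod (G y) \<le> K"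
      using continuous_bounded_interval[OF G] by blast
    let ?A = "(corner n 1 \<inter> space (lborel_n n)) \<times> {0..1::real}"
    have [measurable]: "(\<lambda>p. indicator (corner n (1 - snd p)) (fst p) :: real) \<in> borel_measurable (lborel_n n \<Otimes>\<^sub>M lborel)"
      by (rule indicator_corner_measurable2) simp_all
    have m: "case_prod ?H \<in> borel_measurable (lborel_n n \<Otimes>\<^sub>M lborel)"
      unfolding split_beta' by measurable
    show "integrable (lborel_n n \<Otimes>\<^sub>M lborel) (case_prod ?H)"
    proof (rule integrable_bounded_support[OF m])
      show "?A \<in> sets (lborel_n n \<Otimes>\<^sub>M lborel)" by (intro pair_measureI corner_measurable) simp
      show "emeasure (lborel_n n \<Otimes>\<^sub>M lborel) ?A < \<infinity>"
        by (subst lborel.emeasure_pair_measure_Times) (auto simp: emeasure_corner ennreal_mult_less_top)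
      show "norm (case_prod ?H p) \<le> K * indicator ?A p" if "p \<in> space (lborel_n n \<Otimes>\<^sub>M lborel)" for p
      proof (cases p)
        case (Pair t r)
        show ?thesis
        proof (cases "r \<in> {0..1} \<and> t \<in> corner n (1 - r)")
          case True
          then have t: "t \<in> corner n 1" by (auto simp: corner_def)
          have "\<bar>r * (?y - x 0)\<bar> \<le> \<bar>?y - x 0\<bar>" using True by (simp add: abs_mult mult_left_le_one_le)
          then have "\<bar>simplex_point n x t + r * (?y - x 0)\<bar> \<le> \<bar>x 0\<bar> + (\<Sum>j=1..n. \<bar>x j - x 0\<bar>) + \<bar>?y - x 0\<bar>"
            using abs_simplex_point_le[OF t, of x] by linarith
          from K[OF this] have "norm (case_prod ?H p) \<le> K" using True by (simp add: Pair)
          moreover have "indicator ?A p = (1::real)" using True t that by (simp add: Pair space_pair_measure)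
          ultimately show ?thesis by simp
        next
          case False
          have "cmod (G 0) \<le> K" by (rule K) (simp add: sum_nonneg)
          then have "0 \<le> K" using norm_ge_zero order_trans by blast
          moreover have "case_prod ?H p = 0" using False by (auto simp: Pair)
          ultimately show ?thesis by simp
        qed
      qed
    qed
  qed
  also have "\<dots> = (\<integral>r. (indicator {0..1} r * (1 - r) ^ n) *\<^sub>R
      (\<integral>t. indicator (corner n 1) t *\<^sub>R G ((1 - r) * simplex_point n x t + r * ?y) \<partial>lborel_n n) \<partial>lborel)"
  proof (rule integral_cong_AE)
    show "AE r in lborel. (\<integral>t. ?H t r \<partial>lborel_n n) = (indicator {0..1} r * (1 - r) ^ n) *\<^sub>R
      (\<integral>t. indicator (corner n 1) t *\<^sub>R G ((1 - r) * simplex_point n x t + r * ?y) \<partial>lborel_n n)"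
      \<comment> \<open>At \<open>r = 1\<close> the slice degenerates to the apex.\<close>
      using AE_lborel_singleton[of "1::real"]
    proof eventually_elim
      case (elim r)
      show ?case
      proof (cases "r \<in> {0..1}")
        case True
        then have c: "1 - r > 0" using elim by auto
        have "(\<integral>t. ?H t r \<partial>lborel_n n) = (1 - r) ^ n *\<^sub>R (\<integral>t. ?H (\<lambda>j\<in>{1..n}. (1 - r) * t j) r \<partial>lborel_n n)"
          by (rule integral_lborel_n_scale[OF c]) measurable
        also have "(\<lambda>t. ?H (\<lambda>j\<in>{1..n}. (1 - r) * t j) r) = (\<lambda>t. indicator (corner n 1) t *\<^sub>R G ((1 - r) * simplex_point n x t + r * ?y))"
        proof
          fix t
          have "(\<lambda>j\<in>{1..n}. (1 - r) * t j) \<in> corner n (1 - r) \<longleftrightarrow> t \<in> corner n 1"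
            using c by (auto simp: corner_def zero_le_mult_iff simp flip: sum_distrib_left)
          moreover have "simplex_point n x (\<lambda>j\<in>{1..n}. (1 - r) * t j) + r * (?y - x 0) = (1 - r) * simplex_point n x t + r * ?y"
            by (simp add: simplex_point_def distrib_left sum_distrib_left mult.assoc) (simp add: algebra_simps)
          ultimately show "?H (\<lambda>j\<in>{1..n}. (1 - r) * t j) r = indicator (corner n 1) t *\<^sub>R G ((1 - r) * simplex_point n x t + r * ?y)"
            using True by (simp add: indicator_def)
        qed
        finally show ?thesis using True by simp
      qed simp
    qed
    have [measurable]: "(\<lambda>p. indicator (corner n (1 - fst p)) (snd p) :: real) \<in> borel_measurable (lborel \<Otimes>\<^sub>M lborel_n n)"
      by (rule indicator_corner_measurable2) simp_all
    show "(\<lambda>r. \<integral>t. ?H t r \<partial>lborel_n n) \<in> borel_measurable lborel"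
      by (intro L.borel_measurable_lebesgue_integral) (unfold split_beta', measurable)
    show "(\<lambda>r. (indicator {0..1} r * (1 - r) ^ n) *\<^sub>R
      (\<integral>t. indicator (corner n 1) t *\<^sub>R G ((1 - r) * simplex_point n x t + r * ?y) \<partial>lborel_n n)) \<in> borel_measurable lborel"
      by (intro borel_measurable_scaleR L.borel_measurable_lebesgue_integral) measurable
  qed
  also have "\<dots> = (\<integral>\<rho>. (indicator {0..1} \<rho> * \<rho> ^ n) *\<^sub>R
      (\<integral>t. indicator (corner n 1) t *\<^sub>R G (\<rho> * simplex_point n x t + (1 - \<rho>) * ?y) \<partial>lborel_n n) \<partial>lborel)"
    by (subst lborel_integral_real_affine[where c = "-1" and t = 1])
      (auto intro!: Bochner_Integration.integral_cong simp: indicator_def)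
  also have "\<dots> = (\<integral>\<rho>. (\<integral>t. (indicator {0..1} \<rho> * \<rho> ^ n * indicator (corner n 1) t) *\<^sub>R
      G (\<rho> * simplex_point n x t + (1 - \<rho>) * ?y) \<partial>lborel_n n) \<partial>lborel)"
    by (simp flip: scaleR_scaleR)
  also have "\<dots> = (\<integral>t. (\<integral>\<rho>. (indicator {0..1} \<rho> * \<rho> ^ n * indicator (corner n 1) t) *\<^sub>R
      G (\<rho> * simplex_point n x t + (1 - \<rho>) * ?y) \<partial>lborel) \<partial>lborel_n n)"
  proof (rule P.Fubini_integral)
    let ?X = "\<bar>x 0\<bar> + (\<Sum>j=1..n. \<bar>x j - x 0\<bar>)"
    obtain K where K: "\<And>y. \<bar>y\<bar> \<le> ?X + \<bar>?y\<bar> \<Longrightarrow> cmod (G y) \<le> K"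
      using continuous_bounded_interval[OF G] by blast
    let ?A = "(corner n 1 \<inter> space (lborel_n n)) \<times> {0..1::real}"
    let ?J = "\<lambda>t \<rho>. (indicator {0..1} \<rho> * \<rho> ^ n * indicator (corner n 1) t) *\<^sub>R G (\<rho> * simplex_point n x t + (1 - \<rho>) * ?y)"
    have m: "case_prod ?J \<in> borel_measurable (lborel_n n \<Otimes>\<^sub>M lborel)"
      unfolding split_beta' by measurable
    show "integrable (lborel_n n \<Otimes>\<^sub>M lborel) (case_prod ?J)"
    proof (rule integrable_bounded_support[OF m])
      show "?A \<in> sets (lborel_n n \<Otimes>\<^sub>M lborel)" by (intro pair_measureI corner_measurable) simp
      show "emeasure (lborel_n n \<Otimes>\<^sub>M lborel) ?A < \<infinity>"
        by (subst lborel.emeasure_pair_measure_Times) (auto simp: emeasure_corner ennreal_mult_less_top)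
      show "norm (case_prod ?J p) \<le> K * indicator ?A p" if "p \<in> space (lborel_n n \<Otimes>\<^sub>M lborel)" for p
      proof (cases p)
        case (Pair t r)
        have "cmod (G 0) \<le> K" by (rule K) (simp add: sum_nonneg)
        then have K0: "0 \<le> K" using norm_ge_zero order_trans by blast
        show ?thesis
        proof (cases "r \<in> {0..1} \<and> t \<in> corner n 1")
          case True
          have "\<bar>r * simplex_point n x t\<bar> \<le> \<bar>simplex_point n x t\<bar>" "\<bar>(1 - r) * ?y\<bar> \<le> \<bar>?y\<bar>"
            using True by (simp_all add: abs_mult mult_left_le_one_le)
          then have "\<bar>r * simplex_point n x t + (1 - r) * ?y\<bar> \<le> ?X + \<bar>?y\<bar>"
            using abs_simplex_point_le[of t n x] True by linarith
          from K[OF this] have "r ^ n * cmod (G (r * simplex_point n x t + (1 - r) * ?y)) \<le> 1 * K"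
            using True K0 by (intro mult_mono power_le_one) auto
          then have "norm (case_prod ?J p) \<le> K" using True by (simp add: Pair abs_mult)
          moreover have "indicator ?A p = (1::real)" using True that by (simp add: Pair space_pair_measure)
          ultimately show ?thesis by simp
        next
          case False
          then have "case_prod ?J p = 0" by (auto simp: Pair)
          then show ?thesis using K0 by simp
        qed
      qed
    qed
  qed
  also have "\<dots> = (\<integral>t. indicator (corner n 1) t *\<^sub>R
        (\<integral>\<rho>. (indicator {0..1} \<rho> * \<rho> ^ n) *\<^sub>R G (\<rho> * simplex_point n x t + (1 - \<rho>) * ?y) \<partial>lborel) \<partial>lborel_n n)"
    by (simp add: mult.commute flip: scaleR_scaleR)
  finally show ?thesis .
qed

text \<open>Divergence theorem on the cone, whose boundary contribution is that of the base: on the ray from the apex \<open>y\<close> to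
  the point \<open>c\<close> of the base, the integrand times \<open>\<rho>\<^sup>n\<close> is the derivative of \<open>\<rho>\<^sup>n\<^sup>+\<^sup>1 f (\<rho> c + (1 - \<rho>) y)\<close>.\<close>

theorem simplex_integration_by_parts:
  fixes f f' :: "real \<Rightarrow> complex"
  assumes f: "\<And>x. (f has_vector_derivative f' x) (at x)" and f': "continuous_on UNIV f'"
  shows "(\<integral>s. (f' (\<Sum>j\<le>Suc n. s j * x j) * of_real ((\<Sum>j\<le>Suc n. s j * x j) - x (Suc n))
      + of_nat (Suc n) * f (\<Sum>j\<le>Suc n. s j * x j)) \<partial>simplex_measure (Suc n))
    = (\<integral>s. f (\<Sum>j\<le>n. s j * x j) \<partial>simplex_measure n)"
proof -
  let ?y = "x (Suc n)"
  define G where "G z = f' z * of_real (z - ?y) + of_nat (Suc n) * f z" for z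
  have fc: "continuous_on UNIV f"
    by (rule continuous_at_imp_continuous_on) (use f has_vector_derivative_continuous in blast)
  have G: "continuous_on UNIV G" unfolding G_def[abs_def] by (intro continuous_intros f' fc)
  have inner: "(\<integral>\<rho>. (indicator {0..1} \<rho> * \<rho> ^ n) *\<^sub>R G (\<rho> * c + (1 - \<rho>) * ?y) \<partial>lborel) = f c" for c
  proof -
    let ?z = "\<lambda>\<rho>. \<rho> * c + (1 - \<rho>) * ?y"
    have d: "((\<lambda>\<rho>. \<rho> ^ Suc n *\<^sub>R f (?z \<rho>)) has_vector_derivative \<rho> ^ n *\<^sub>R G (?z \<rho>)) (at \<rho> within {0..1})" for \<rho>
    proof -
      have 1: "((\<lambda>\<rho>. f (?z \<rho>)) has_vector_derivative (c - ?y) *\<^sub>R f' (?z \<rho>)) (at \<rho>)"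
      proof -
        have "(?z has_vector_derivative (c - ?y)) (at \<rho>)"
          by (auto intro!: derivative_eq_intros simp: has_real_derivative_iff_has_vector_derivative[symmetric])
        from vector_diff_chain_at[OF this f] show ?thesis by (simp add: o_def)
      qed
      have 2: "((\<lambda>\<rho>. \<rho> ^ Suc n) has_field_derivative real (Suc n) * \<rho> ^ n) (at \<rho>)"
        using DERIV_pow[of "Suc n" \<rho>] by simp
      have "((\<lambda>\<rho>. \<rho> ^ Suc n *\<^sub>R f (?z \<rho>)) has_vector_derivative
          \<rho> ^ Suc n *\<^sub>R ((c - ?y) *\<^sub>R f' (?z \<rho>)) + (real (Suc n) * \<rho> ^ n) *\<^sub>R f (?z \<rho>)) (at \<rho>)"
        by (rule has_vector_derivative_scaleR[OF 2 1])
      moreover have "\<rho> ^ Suc n *\<^sub>R ((c - ?y) *\<^sub>R f' (?z \<rho>)) + (real (Suc n) * \<rho> ^ n) *\<^sub>R f (?z \<rho>) = \<rho> ^ n *\<^sub>R G (?z \<rho>)"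
      proof -
        have "?z \<rho> - ?y = \<rho> * (c - ?y)" by (simp add: algebra_simps)
        then show ?thesis unfolding G_def by (simp add: scaleR_conv_of_real algebra_simps)
      qed
      ultimately show ?thesis by (simp add: has_vector_derivative_at_within)
    qed
    have cont: "continuous_on {0..1} (\<lambda>\<rho>. \<rho> ^ n *\<^sub>R G (?z \<rho>))"
      by (intro continuous_intros continuous_on_compose2[OF G]) auto
    have "(\<integral>\<rho>. indicator {0..1} \<rho> *\<^sub>R (\<rho> ^ n *\<^sub>R G (?z \<rho>)) \<partial>lborel) = 1 ^ Suc n *\<^sub>R f (?z 1) - 0 ^ Suc n *\<^sub>R f (?z 0)"
      by (rule integral_FTC_atLeastAtMost[OF _ d cont]) simp
    then show ?thesis by simp
  qed
  have "(\<integral>s. G (\<Sum>j\<le>Suc n. s j * x j) \<partial>simplex_measure (Suc n))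
      = (\<integral>t. indicator (corner n 1) t *\<^sub>R f (simplex_point n x t) \<partial>lborel_n n)"
    unfolding simplex_cone[OF G] inner ..
  also have "\<dots> = (\<integral>s. f (\<Sum>j\<le>n. s j * x j) \<partial>simplex_measure n)"
    using fc by (intro integral_simplex_measure[symmetric] borel_measurable_continuous_onI)
  finally show ?thesis unfolding G_def .
qed

declare One_nat_def [simp]

section \<open>Truncation to finitely many basis vectors\<close>

text \<open>A sequence of finite sets, rather than the net of all of them, since limits under integrals will be taken.\<close>

definition truncated_basis :: "'a set \<Rightarrow> nat \<Rightarrow> 'a set" where
  "truncated_basis B k = {e\<in>B. to_nat_on B e < k}"

lemma truncated_basis_subset: "truncated_basis B k \<subseteq> B"
  by (auto simp: truncated_basis_def)

lemma finite_truncated_basis: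
  assumes "countable B"
  shows "finite (truncated_basis B k)"
proof (rule inj_on_finite)
  show "inj_on (to_nat_on B) (truncated_basis B k)"
    by (rule inj_on_subset[OF inj_on_to_nat_on[OF assms] truncated_basis_subset])
  show "to_nat_on B ` truncated_basis B k \<subseteq> {..<k}" by (auto simp: truncated_basis_def)
qed simp

lemma eventually_truncated_basis: "e \<in> B \<Longrightarrow> \<forall>\<^sub>F k in sequentially. e \<in> truncated_basis B k"
  unfolding truncated_basis_def eventually_sequentially by (auto intro!: exI[of _ "Suc (to_nat_on B e)"])

lemma proj_on_truncated_basis_tendsto:
  fixes B :: "'a::{complex_hilbert_space, second_countable_topology} set"
  assumes B: "orthonormal_basis B"
  shows "(\<lambda>k. proj_on (truncated_basis B k) x) \<longlonglongrightarrow> x"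
proof (rule strong_convergence_basis[OF B bounded_clinear_proj_on bounded_clinear_id(1)])
  note o = orthonormal_basis_orthonormal[OF B]
  have fin: "finite (truncated_basis B k)" for k
    by (rule finite_truncated_basis[OF orthonormal_countable[OF o]])
  have ok: "orthonormal (truncated_basis B k)" for k
    by (rule orthonormal_subset[OF o truncated_basis_subset])
  show "norm (proj_on (truncated_basis B k) x) \<le> 1 * norm x" for k x
    using norm_proj_on_le[OF ok fin] by simp
  fix e assume e: "e \<in> B"
  have "\<forall>\<^sub>F k in sequentially. e = proj_on (truncated_basis B k) e"
    using eventually_truncated_basis[OF e]
  proof eventually_elim
    case (elim k)
    have "proj_on (truncated_basis B k) e = (\<Sum>f\<in>truncated_basis B k. if f = e then e else 0)"
      unfolding proj_on_def using elim by (intro sum.cong refl) (auto simp: orthonormal_cinner[OF ok[of k]])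
    then show ?case using elim fin by simp
  qed
  then show "(\<lambda>k. proj_on (truncated_basis B k) e) \<longlonglongrightarrow> e"
    by (rule Lim_transform_eventually[OF tendsto_const])
qed

lemma alternating_comp_cong:
  "(\<And>j. j \<le> n \<Longrightarrow> W j = W' j) \<Longrightarrow> alternating_comp W V n = alternating_comp W' V n"
  by (induction n) simp_all

lemma bounded_clinear_alternating_comp:
  "(\<And>j. j \<le> n \<Longrightarrow> bounded_clinear (W j)) \<Longrightarrow> (\<And>j. j \<in> {1..n} \<Longrightarrow> bounded_clinear (V j)) \<Longrightarrow>
    bounded_clinear (alternating_comp W V n)"
proof (induction n)
  case (Suc n)
  have "bounded_clinear (alternating_comp W V n)" by (rule Suc.IH) (simp_all add: Suc.prems)
  moreover have "bounded_clinear (V (Suc n))" "bounded_clinear (W (Suc n))" using Suc.prems by simp_all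
  ultimately show ?case unfolding alternating_comp.simps by (intro bounded_clinear_comp)
qed simp

lemma norm_alternating_comp_le:
  "(\<And>j x. j \<le> n \<Longrightarrow> norm (W j x) \<le> norm x) \<Longrightarrow> (\<And>j. j \<in> {1..n} \<Longrightarrow> bounded_clinear (V j)) \<Longrightarrow>
    norm (alternating_comp W V n y) \<le> (\<Prod>j=1..n. onorm (V j)) * norm y"
proof (induction n arbitrary: y)
  case (Suc n)
  have V: "bounded_clinear (V (Suc n))" and P: "0 \<le> (\<Prod>j=1..n. onorm (V j))"
    using Suc.prems(2) by (auto intro!: prod_nonneg onorm_nonneg)
  have "norm (alternating_comp W V (Suc n) y) \<le> (\<Prod>j=1..n. onorm (V j)) * norm (V (Suc n) (W (Suc n) y))"
    using Suc.IH[of "V (Suc n) (W (Suc n) y)"] Suc.prems by simp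
  also have "\<dots> \<le> (\<Prod>j=1..n. onorm (V j)) * (onorm (V (Suc n)) * norm y)"
    by (intro mult_left_mono[OF _ P] order_trans[OF norm_le_onorm[OF V] mult_left_mono[OF Suc.prems(1) onorm_nonneg[OF V]]]) simp
  also have "\<dots> = (\<Prod>j=1..Suc n. onorm (V j)) * norm y" by (simp add: mult.assoc)
  finally show ?case .
qed simp

lemma alternating_comp_tendsto:
  assumes W: "\<And>j k x. norm (W k j x) \<le> norm x" "\<And>j k. bounded_clinear (W k j)"
    and lim: "\<And>j x. (\<lambda>k. W k j x) \<longlonglongrightarrow> W' j x"
  shows "(\<And>j. j \<in> {1..n} \<Longrightarrow> bounded_clinear (V j)) \<Longrightarrow> y \<longlonglongrightarrow> l \<Longrightarrow>
    (\<lambda>k. alternating_comp (W k) V n (y k)) \<longlonglongrightarrow> alternating_comp W' V n l"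
proof (induction n arbitrary: y l)
  have Wlim: "(\<lambda>k. W k j (y k)) \<longlonglongrightarrow> W' j l" if "y \<longlonglongrightarrow> l" for j y l
  proof -
    have "(\<lambda>k. W k j (y k - l)) \<longlonglongrightarrow> 0"
    proof (rule Lim_null_comparison)
      have "(\<lambda>k. y k - l) \<longlonglongrightarrow> 0" using that by (rule LIM_zero)
      then show "(\<lambda>k. norm (y k - l)) \<longlonglongrightarrow> 0" by (rule tendsto_norm_zero)
    qed (simp add: W)
    from tendsto_add[OF this lim[of j l]] show ?thesis by (simp add: bounded_clinear_diff[OF W(2)])
  qed
  {
    case 0
    then show ?case using Wlim by simp
  next
    case (Suc n)
    have V: "bounded_clinear (V (Suc n))" using Suc.prems(1) by simp
    have "(\<lambda>k. alternating_comp (W k) V n (V (Suc n) (W k (Suc n) (y k))))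
        \<longlonglongrightarrow> alternating_comp W' V n (V (Suc n) (W' (Suc n) l))"
      by (rule Suc.IH[OF _ bounded_clinear_tendsto[OF V Wlim[OF Suc.prems(2)]]]) (simp add: Suc.prems(1))
    then show ?case by simp
  }
qed

lemma sum_PiE_insert:
  fixes g :: "('i \<Rightarrow> 'b) \<Rightarrow> 'c::comm_monoid_add"
  assumes "i \<notin> I"
  shows "(\<Sum>m\<in>Pi\<^sub>E (insert i I) F. g m) = (\<Sum>e\<in>F i. \<Sum>m\<in>Pi\<^sub>E I F. g (m(i := e)))"
proof -
  have "(\<Sum>m\<in>Pi\<^sub>E (insert i I) F. g m) = (\<Sum>(e, m)\<in>F i \<times> Pi\<^sub>E I F. g (m(i := e)))"
    unfolding PiE_insert_eq using inj_combinator[OF assms, of F]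
    by (subst sum.reindex) (auto simp: case_prod_unfold)
  then show ?thesis by (simp add: sum.cartesian_product)
qed

text \<open>Multilinear expansion of an alternating product of diagonal finite rank operators.\<close>

lemma alternating_comp_expand:
  fixes c :: "nat \<Rightarrow> 'a::complex_hilbert_space \<Rightarrow> complex"
  shows "(\<And>j. j \<in> {1..n} \<Longrightarrow> bounded_clinear (V j)) \<Longrightarrow>
    alternating_comp (\<lambda>j x. \<Sum>e\<in>F j. c j e *\<^sub>C (cinner e x *\<^sub>C e)) V n y
      = (\<Sum>m\<in>Pi\<^sub>E {..n} F. (\<Prod>j\<le>n. c j (m j)) *\<^sub>C alternating_comp (\<lambda>j x. cinner (m j) x *\<^sub>C m j) V n y)"
proof (induction n arbitrary: y)
  case 0
  have "{..0::nat} = insert 0 {}" by auto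
  then show ?case by (subst (2) \<open>{..0::nat} = insert 0 {}\<close>, subst sum_PiE_insert) simp_all
next
  case (Suc n)
  let ?W = "\<lambda>j x. \<Sum>e\<in>F j. c j e *\<^sub>C (cinner e x *\<^sub>C e)"
  let ?P = "\<lambda>m j x. cinner (m j) x *\<^sub>C m j"
  have V: "bounded_clinear (V (Suc n))" using Suc.prems by simp
  have W: "bounded_clinear (alternating_comp ?W V n)"
    by (intro bounded_clinear_alternating_comp bounded_clinear_sum_fun bounded_clinear_scaled bounded_clinear_rank_one)
      (use Suc.prems in simp)
  have "alternating_comp ?W V (Suc n) y
      = (\<Sum>e\<in>F (Suc n). c (Suc n) e *\<^sub>C alternating_comp ?W V n (V (Suc n) (cinner e y *\<^sub>C e)))"
    by (simp add: bounded_clinear_sum[OF V] bounded_clinear_sum[OF W] bounded_clinear_scaleC[OF V] bounded_clinear_scaleC[OF W])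
  also have "\<dots> = (\<Sum>e\<in>F (Suc n). \<Sum>m\<in>Pi\<^sub>E {..n} F. (c (Suc n) e * (\<Prod>j\<le>n. c j (m j))) *\<^sub>C
      alternating_comp (?P m) V n (V (Suc n) (cinner e y *\<^sub>C e)))"
    using Suc.IH Suc.prems by (simp add: scaleC_sum_right scaleC_scaleC)
  also have "\<dots> = (\<Sum>e\<in>F (Suc n). \<Sum>m\<in>Pi\<^sub>E {..n} F. (\<Prod>j\<le>Suc n. c j ((m(Suc n := e)) j)) *\<^sub>C
      alternating_comp (?P (m(Suc n := e))) V (Suc n) y)"
  proof (intro sum.cong refl)
    fix e m
    have "alternating_comp (?P (m(Suc n := e))) V n = alternating_comp (?P m) V n"
      by (rule alternating_comp_cong) simp
    then show "(c (Suc n) e * (\<Prod>j\<le>n. c j (m j))) *\<^sub>C alternating_comp (?P m) V n (V (Suc n) (cinner e y *\<^sub>C e))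
      = (\<Prod>j\<le>Suc n. c j ((m(Suc n := e)) j)) *\<^sub>C alternating_comp (?P (m(Suc n := e))) V (Suc n) y"
      by (simp add: mult.commute)
  qed
  also have "\<dots> = (\<Sum>m\<in>Pi\<^sub>E {..Suc n} F. (\<Prod>j\<le>Suc n. c j (m j)) *\<^sub>C alternating_comp (?P m) V (Suc n) y)"
    unfolding atMost_Suc by (subst sum_PiE_insert) simp_all
  finally show ?case .
qed

section \<open>Divided differences\<close>

text \<open>The formula of Hermite and Genocchi, which makes sense for coinciding arguments as well.\<close>

definition divided_difference :: "nat \<Rightarrow> (real \<Rightarrow> complex) \<Rightarrow> (nat \<Rightarrow> real) \<Rightarrow> complex" where
  "divided_difference n f x = (\<integral>s. nderiv n f (\<Sum>j\<le>n. s j * x j) \<partial>simplex_measure n)"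

lemma divided_difference_cong:
  "(\<And>j. j \<le> n \<Longrightarrow> x j = x' j) \<Longrightarrow> divided_difference n f x = divided_difference n f x'"
  by (simp add: divided_difference_def)

lemma divided_difference_0:
  assumes "continuous_on UNIV f"
  shows "divided_difference 0 f x = f (x 0)"
proof -
  have c: "corner 0 1 = UNIV" by (auto simp: corner_def)
  have "measure (lborel_n 0) (space (lborel_n 0)) = 1"
    using emeasure_corner[of 1 0] by (simp add: c measure_def)
  then show ?thesis
    unfolding divided_difference_def
    using integral_simplex_measure[OF borel_measurable_continuous_onI[OF assms], of 0 x]
    by (simp add: c simplex_point_def)
qed

lemma component_simplex_measure [measurable]:
  assumes "j \<le> n"
  shows "(\<lambda>s. s j) \<in> borel_measurable (simplex_measure n)"
proof -
  have "(\<lambda>s. s j) \<in> measurable (\<Pi>\<^sub>M j\<in>{0..n}. borel) borel"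
    using assms by (intro measurable_component_singleton) simp
  then show ?thesis by (simp cong: measurable_cong_sets)
qed

lemma integrable_simplex_measure:
  fixes G :: "real \<Rightarrow> complex"
  assumes G: "continuous_on UNIV G"
  shows "integrable (simplex_measure n) (\<lambda>s. G (\<Sum>j\<le>n. s j * x j))"
proof -
  have Gm: "G \<in> borel_measurable borel" by (rule borel_measurable_continuous_onI[OF G])
  have c: "(\<lambda>s. \<Sum>j\<le>n. s j * x j) \<in> borel_measurable (\<Pi>\<^sub>M j\<in>{0..n}. borel)"
    by (intro borel_measurable_sum borel_measurable_times borel_measurable_const measurable_component_singleton) simp
  have "(\<lambda>s. G (\<Sum>j\<le>n. s j * x j)) \<in> borel_measurable (\<Pi>\<^sub>M j\<in>{0..n}. borel)"
    by (rule measurable_compose[OF c Gm])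
  then show ?thesis
    unfolding simplex_measure_eq
    by (subst integrable_distr_eq[OF barycentric_measurable], assumption)
      (simp add: simplex_point_barycentric integrable_restrict_space integrable_corner[OF G] del: One_nat_def)
qed

lemma u_weight_has_derivative: "(u_weight has_vector_derivative 1) (at x)"
proof -
  have "((\<lambda>z. z - \<i>) has_field_derivative 1) (at (complex_of_real x))"
    by (auto intro!: derivative_eq_intros)
  from has_vector_derivative_real_field[OF this] show ?thesis unfolding u_weight_def[abs_def] .
qed

lemma nderiv_mult_u_weight:
  assumes f: "C_n n f"
  shows "k \<le> n \<Longrightarrow> nderiv k (\<lambda>x. f x * u_weight x)
    = (\<lambda>x. nderiv k f x * u_weight x + of_nat k * nderiv (k - 1) f x)"
proof (induction k)
  case (Suc k)
  show ?case
  proof (rule nderiv_Suc_eqI)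
    fix x
    have 1: "((\<lambda>x. nderiv k f x * u_weight x) has_vector_derivative nderiv k f x * 1 + nderiv (Suc k) f x * u_weight x) (at x)"
      by (rule has_vector_derivative_mult[OF C_n_has_vector_derivative[OF f] u_weight_has_derivative]) (use Suc.prems in simp)
    have 2: "((\<lambda>x. of_nat k * nderiv (k - 1) f x) has_vector_derivative of_nat k * nderiv k f x) (at x)"
    proof (cases k)
      case (Suc l)
      have "(nderiv l f has_vector_derivative nderiv (Suc l) f x) (at x)"
        using Suc Suc.prems by (intro C_n_has_vector_derivative[OF f]) simp
      from has_vector_derivative_mult_right[OF this] show ?thesis by (simp add: Suc)
    qed simp
    have "nderiv k (\<lambda>x. f x * u_weight x) = (\<lambda>x. nderiv k f x * u_weight x + of_nat k * nderiv (k - 1) f x)"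
      using Suc by simp
    then show "(nderiv k (\<lambda>x. f x * u_weight x) has_vector_derivative
        nderiv (Suc k) f x * u_weight x + of_nat (Suc k) * nderiv (Suc k - 1) f x) (at x)"
      using has_vector_derivative_add[OF 1 2] by (simp add: algebra_simps)
  qed
qed simp

lemma C_n_mult_u_weight:
  assumes f: "C_n n f"
  shows "C_n n (\<lambda>x. f x * u_weight x)"
proof -
  have uc: "continuous_on UNIV u_weight"
    by (rule continuous_at_imp_continuous_on)
      (use u_weight_has_derivative has_vector_derivative_continuous in blast)
  have "nderiv k (\<lambda>x. f x * u_weight x) differentiable (at x)" if k: "k < n" for k x
  proof -
    have "((\<lambda>x. nderiv k f x * u_weight x) has_vector_derivative nderiv k f x * 1 + nderiv (Suc k) f x * u_weight x) (at x)"
      by (rule has_vector_derivative_mult[OF C_n_has_vector_derivative[OF f k] u_weight_has_derivative])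
    then have 1: "(\<lambda>x. nderiv k f x * u_weight x) differentiable (at x)" by (rule differentiableI_vector)
    have "(nderiv (k - 1) f has_vector_derivative nderiv (Suc (k - 1)) f x) (at x)"
      using k by (intro C_n_has_vector_derivative[OF f]) simp
    then have "(\<lambda>x. of_nat k * nderiv (k - 1) f x) differentiable (at x)"
      using has_vector_derivative_mult_right differentiableI_vector by blast
    with 1 show ?thesis unfolding nderiv_mult_u_weight[OF f less_imp_le[OF k]] by (rule differentiable_add)
  qed
  moreover have "continuous_on UNIV (nderiv n (\<lambda>x. f x * u_weight x))"
    unfolding nderiv_mult_u_weight[OF f order_refl]
    by (intro continuous_intros uc C_n_continuous[OF f]) simp_all
  ultimately show ?thesis by (simp add: C_n_def)
qed

text \<open>The derivative of order \<open>n + 1\<close> of \<open>f u\<close> at \<open>z\<close> is \<open>u(y) f\<^sup>(\<^sup>n\<^sup>+\<^sup>1\<^sup>)(z)\<close> plus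
  \<open>(z - y) f\<^sup>(\<^sup>n\<^sup>+\<^sup>1\<^sup>)(z) + (n + 1) f\<^sup>(\<^sup>n\<^sup>)(z)\<close>, for every \<open>y\<close>. For \<open>y = x\<^sub>n\<^sub>+\<^sub>1\<close> the integral of the latter over the
  simplex reduces to an integral over the face opposite to \<open>x\<^sub>n\<^sub>+\<^sub>1\<close>.\<close>

theorem divided_difference_mult_u_weight:
  assumes f: "C_n (Suc n) f"
  shows "divided_difference (Suc n) (\<lambda>x. f x * u_weight x) x
    = u_weight (x (Suc n)) * divided_difference (Suc n) f x + divided_difference n f x"
proof -
  let ?y = "x (Suc n)" and ?z = "\<lambda>s. \<Sum>j\<le>Suc n. s j * x j"
  let ?G = "\<lambda>z. nderiv (Suc n) f z * of_real (z - ?y) + of_nat (Suc n) * nderiv n f z"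
  have c: "continuous_on UNIV (nderiv (Suc n) f)" "continuous_on UNIV (nderiv n f)"
    using C_n_continuous[OF f] by simp_all
  have "nderiv (Suc n) (\<lambda>x. f x * u_weight x) z = u_weight ?y * nderiv (Suc n) f z + ?G z" for z
    unfolding nderiv_mult_u_weight[OF f order_refl] by (simp add: u_weight_def algebra_simps)
  then have "divided_difference (Suc n) (\<lambda>x. f x * u_weight x) x
      = (\<integral>s. u_weight ?y * nderiv (Suc n) f (?z s) + ?G (?z s) \<partial>simplex_measure (Suc n))"
    by (simp only: divided_difference_def)
  also have "\<dots> = (\<integral>s. u_weight ?y * nderiv (Suc n) f (?z s) \<partial>simplex_measure (Suc n))
      + (\<integral>s. ?G (?z s) \<partial>simplex_measure (Suc n))"
    by (intro Bochner_Integration.integral_add integrable_simplex_measure continuous_intros c)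
  also have "(\<integral>s. ?G (?z s) \<partial>simplex_measure (Suc n)) = divided_difference n f x"
    unfolding divided_difference_def
    by (rule simplex_integration_by_parts[OF C_n_has_vector_derivative[OF f] c(1)]) simp
  finally show ?thesis by (simp add: divided_difference_def)
qed

section \<open>Multiple operator integrals as limits\<close>

lemma integrable_simplex_lborel:
  fixes h :: "real \<Rightarrow> complex"
  assumes h: "integrable lborel h"
  shows "integrable (simplex_measure n \<Otimes>\<^sub>M lborel) (\<lambda>p. cmod (h (snd p)))"
    and "(\<integral>p. cmod (h (snd p)) \<partial>(simplex_measure n \<Otimes>\<^sub>M lborel)) = L1_norm h / fact n"
proof -
  interpret S: finite_measure "simplex_measure n" by (rule finite_measure_simplex_measure)
  interpret P: pair_sigma_finite "simplex_measure n" "lborel :: real measure" by unfold_locales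
  have [measurable]: "h \<in> borel_measurable borel" using borel_measurable_integrable[OF h] by simp
  show i: "integrable (simplex_measure n \<Otimes>\<^sub>M lborel) (\<lambda>p. cmod (h (snd p)))"
  proof (rule P.Fubini_integrable)
    show "(\<lambda>p. cmod (h (snd p))) \<in> borel_measurable (simplex_measure n \<Otimes>\<^sub>M lborel)" by measurable
    show "integrable (simplex_measure n) (\<lambda>x. \<integral>y. norm (cmod (h (snd (x, y)))) \<partial>lborel)" by simp
    show "AE x in simplex_measure n. integrable lborel (\<lambda>y. cmod (h (snd (x, y))))"
      using integrable_norm[OF h] by simp
  qed
  show "(\<integral>p. cmod (h (snd p)) \<partial>(simplex_measure n \<Otimes>\<^sub>M lborel)) = L1_norm h / fact n"
    using P.integral_fst'[OF i] by (simp add: L1_norm_def measure_simplex_measure)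
qed

context
  fixes D :: "nat \<Rightarrow> 'a::{complex_hilbert_space, second_countable_topology} \<rightharpoonup> 'a"
    and B :: "nat \<Rightarrow> 'a set" and \<mu> :: "nat \<Rightarrow> 'a \<Rightarrow> real"
  assumes D: "\<And>j. self_adjoint (D j)" and B: "\<And>j. eigenbasis (D j) (B j) (\<mu> j)"
begin

lemma eb_basis: "orthonormal_basis (B j)"
  using B by (simp add: eigenbasis_def)

lemma finite_tb: "finite (truncated_basis (B j) k)"
  by (rule finite_truncated_basis[OF orthonormal_countable[OF orthonormal_basis_orthonormal[OF eb_basis]]])

lemma orthonormal_tb: "orthonormal (truncated_basis (B j) k)"
  by (rule orthonormal_subset[OF orthonormal_basis_orthonormal[OF eb_basis] truncated_basis_subset])

text \<open>The unitary group generated by \<open>D j\<close>.\<close>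

lemma unitary_group:
  shows "bounded_clinear (fun_calc (\<lambda>x. exp (\<i> * of_real (c * x))) (D j))" (is ?A)
    and "norm (fun_calc (\<lambda>x. exp (\<i> * of_real (c * x))) (D j) x) \<le> norm x" (is ?B)
    and "e \<in> B j \<Longrightarrow> fun_calc (\<lambda>x. exp (\<i> * of_real (c * x))) (D j) e = exp (\<i> * of_real (c * \<mu> j e)) *\<^sub>C e"
proof -
  have m: "(\<lambda>x. exp (\<i> * of_real (c * x)) :: complex) \<in> borel_measurable borel" by measurable
  have b: "cmod (exp (\<i> * of_real (c * x))) \<le> 1" for x by (simp add: norm_exp_i_times del: of_real_mult)
  note * = bounded_clinear_fun_calc[OF D B m b] norm_fun_calc_le[OF D B m b] fun_calc_eigenvector[OF D B m b]
  show ?A by (rule *(1))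
  show ?B using *(2)[of j x] by simp
  show "e \<in> B j \<Longrightarrow> fun_calc (\<lambda>x. exp (\<i> * of_real (c * x))) (D j) e = exp (\<i> * of_real (c * \<mu> j e)) *\<^sub>C e"
    by (rule *(3))
qed

definition moi_integrand ::
    "nat \<Rightarrow> (nat \<Rightarrow> 'a \<Rightarrow> 'a) \<Rightarrow> 'a \<Rightarrow> (nat \<Rightarrow> real) \<times> real \<Rightarrow> 'a" where
  "moi_integrand n V y p
    = alternating_comp (\<lambda>j. fun_calc (\<lambda>x. exp (\<i> * of_real (snd p * fst p j * x))) (D j)) V n y"

text \<open>The alternating product of the \<open>V j\<close> and the rank one projections to the \<open>m j\<close>.\<close>

definition truncated_term :: "nat \<Rightarrow> (nat \<Rightarrow> 'a \<Rightarrow> 'a) \<Rightarrow> 'a \<Rightarrow> (nat \<Rightarrow> 'a) \<Rightarrow> 'a" where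
  "truncated_term n V y m = alternating_comp (\<lambda>j x. cinner (m j) x *\<^sub>C m j) V n y"

text \<open>Inserting projections to truncated bases next to the unitary groups turns the integrand into a finite sum of phases,
  with a bound that is uniform in the truncation. The limit also provides measurability of the integrand.\<close>

lemma moi_integrand_tendsto:
  assumes V: "\<And>j. j \<in> {1..n} \<Longrightarrow> bounded_clinear (V j)"
  shows "(\<lambda>k. \<Sum>m\<in>Pi\<^sub>E {..n} (\<lambda>j. truncated_basis (B j) k).
      exp (\<i> * of_real (snd p * (\<Sum>j\<le>n. fst p j * \<mu> j (m j)))) *\<^sub>C truncated_term n V y m)
    \<longlonglongrightarrow> moi_integrand n V y p"
    and "norm (\<Sum>m\<in>Pi\<^sub>E {..n} (\<lambda>j. truncated_basis (B j) k).
      exp (\<i> * of_real (snd p * (\<Sum>j\<le>n. fst p j * \<mu> j (m j)))) *\<^sub>C truncated_term n V y m)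
    \<le> (\<Prod>j=1..n. onorm (V j)) * norm y"
proof -
  let ?U = "\<lambda>j. fun_calc (\<lambda>x. exp (\<i> * of_real (snd p * fst p j * x))) (D j)"
  let ?W = "\<lambda>k j x. ?U j (proj_on (truncated_basis (B j) k) x)"
  note U = unitary_group[where c = "snd p * fst p j" and j = j for j]
  have W: "norm (?W k j x) \<le> norm x" "bounded_clinear (?W k j)" for k j x
    using order_trans[OF U(2) norm_proj_on_le[OF orthonormal_tb finite_tb]]
      bounded_clinear_compose[OF U(1) bounded_clinear_proj_on] by blast+
  have lim: "(\<lambda>k. ?W k j x) \<longlonglongrightarrow> ?U j x" for j x
    by (rule bounded_clinear_tendsto[OF U(1) proj_on_truncated_basis_tendsto[OF eb_basis]])
  have "?W k j = (\<lambda>x. \<Sum>e\<in>truncated_basis (B j) k. exp (\<i> * of_real (snd p * fst p j * \<mu> j e)) *\<^sub>C (cinner e x *\<^sub>C e))" for k j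
  proof
    fix x
    show "?W k j x = (\<Sum>e\<in>truncated_basis (B j) k. exp (\<i> * of_real (snd p * fst p j * \<mu> j e)) *\<^sub>C (cinner e x *\<^sub>C e))"
      unfolding proj_on_def bounded_clinear_sum[OF U(1)] bounded_clinear_scaleC[OF U(1)]
    proof (rule sum.cong[OF refl])
      fix e assume "e \<in> truncated_basis (B j) k"
      then have "e \<in> B j" by (rule subsetD[OF truncated_basis_subset])
      show "cinner e x *\<^sub>C ?U j e = exp (\<i> * of_real (snd p * fst p j * \<mu> j e)) *\<^sub>C (cinner e x *\<^sub>C e)"
        unfolding U(3)[OF \<open>e \<in> B j\<close>] scaleC_scaleC by (simp only: mult.commute)
    qed
  qed
  then have "alternating_comp (?W k) V n y = (\<Sum>m\<in>Pi\<^sub>E {..n} (\<lambda>j. truncated_basis (B j) k).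
      (\<Prod>j\<le>n. exp (\<i> * of_real (snd p * fst p j * \<mu> j (m j)))) *\<^sub>C truncated_term n V y m)" for k
    unfolding truncated_term_def by (simp only: alternating_comp_expand[OF V])
  moreover have "(\<Prod>j\<le>n. exp (\<i> * of_real (snd p * fst p j * \<mu> j (m j))))
      = exp (\<i> * of_real (snd p * (\<Sum>j\<le>n. fst p j * \<mu> j (m j))))" for m
    by (simp add: exp_sum[symmetric] sum_distrib_left mult.assoc)
  ultimately have eq: "(\<Sum>m\<in>Pi\<^sub>E {..n} (\<lambda>j. truncated_basis (B j) k).
      exp (\<i> * of_real (snd p * (\<Sum>j\<le>n. fst p j * \<mu> j (m j)))) *\<^sub>C truncated_term n V y m)
      = alternating_comp (?W k) V n y" for k by simp
  show "(\<lambda>k. \<Sum>m\<in>Pi\<^sub>E {..n} (\<lambda>j. truncated_basis (B j) k).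
      exp (\<i> * of_real (snd p * (\<Sum>j\<le>n. fst p j * \<mu> j (m j)))) *\<^sub>C truncated_term n V y m)
    \<longlonglongrightarrow> moi_integrand n V y p"
    unfolding eq moi_integrand_def by (rule alternating_comp_tendsto[OF W lim V tendsto_const])
  show "norm (\<Sum>m\<in>Pi\<^sub>E {..n} (\<lambda>j. truncated_basis (B j) k).
      exp (\<i> * of_real (snd p * (\<Sum>j\<le>n. fst p j * \<mu> j (m j)))) *\<^sub>C truncated_term n V y m)
    \<le> (\<Prod>j=1..n. onorm (V j)) * norm y"
    unfolding eq by (rule norm_alternating_comp_le[OF W(1) V])
qed

lemma norm_moi_integrand_le:
  assumes V: "\<And>j. j \<in> {1..n} \<Longrightarrow> bounded_clinear (V j)"
  shows "norm (moi_integrand n V y p) \<le> (\<Prod>j=1..n. onorm (V j)) * norm y"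
  unfolding moi_integrand_def by (rule norm_alternating_comp_le[OF unitary_group(2) V])

lemma bounded_clinear_moi_integrand:
  assumes V: "\<And>j. j \<in> {1..n} \<Longrightarrow> bounded_clinear (V j)"
  shows "bounded_clinear (\<lambda>y. moi_integrand n V y p)"
  unfolding moi_integrand_def by (rule bounded_clinear_alternating_comp[OF unitary_group(1) V])

lemma truncated_phase_measurable [measurable]:
  "(\<lambda>p. exp (\<i> * of_real (snd p * (\<Sum>j\<le>n. fst p j * x j))) :: complex) \<in> borel_measurable (simplex_measure n \<Otimes>\<^sub>M lborel)"
proof -
  have c: "(\<lambda>p. fst p j) \<in> borel_measurable (simplex_measure n \<Otimes>\<^sub>M lborel)" if "j \<le> n" for j
    using measurable_compose[OF measurable_fst component_simplex_measure[OF that]] .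
  have "(\<lambda>p. \<Sum>j\<le>n. fst p j * x j) \<in> borel_measurable (simplex_measure n \<Otimes>\<^sub>M lborel)"
    by (intro borel_measurable_sum borel_measurable_times borel_measurable_const c) simp
  moreover have "snd \<in> borel_measurable (simplex_measure n \<Otimes>\<^sub>M lborel)" by simp
  ultimately have "(\<lambda>p. snd p * (\<Sum>j\<le>n. fst p j * x j)) \<in> borel_measurable (simplex_measure n \<Otimes>\<^sub>M lborel)"
    by (rule borel_measurable_times[rotated])
  then show ?thesis by measurable
qed

lemma moi_integrand_measurable [measurable]:
  assumes V: "\<And>j. j \<in> {1..n} \<Longrightarrow> bounded_clinear (V j)"
  shows "moi_integrand n V y \<in> borel_measurable (simplex_measure n \<Otimes>\<^sub>M lborel)"
  by (rule borel_measurable_LIMSEQ_metric[OF _ moi_integrand_tendsto(1)[OF V]]) measurable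

lemma
  fixes h :: "real \<Rightarrow> complex"
  assumes V: "\<And>j. j \<in> {1..n} \<Longrightarrow> bounded_clinear (V j)" and h: "integrable lborel h"
  shows integrable_moi_integrand:
      "integrable (simplex_measure n \<Otimes>\<^sub>M lborel) (\<lambda>p. h (snd p) *\<^sub>C moi_integrand n V y p)"
    and norm_integral_moi_integrand:
      "norm (\<integral>p. h (snd p) *\<^sub>C moi_integrand n V y p \<partial>(simplex_measure n \<Otimes>\<^sub>M lborel))
        \<le> L1_norm h / fact n * (\<Prod>j=1..n. onorm (V j)) * norm y"
proof -
  let ?M = "simplex_measure n \<Otimes>\<^sub>M lborel" and ?C = "(\<Prod>j=1..n. onorm (V j)) * norm y"
  have [measurable]: "h \<in> borel_measurable borel" using borel_measurable_integrable[OF h] by simp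
  note [measurable] = moi_integrand_measurable[OF V]
  note i = integrable_simplex_lborel[OF h, of n]
  have C0: "0 \<le> ?C" using V by (intro mult_nonneg_nonneg prod_nonneg) (auto intro: onorm_nonneg)
  have le: "norm (h (snd p) *\<^sub>C moi_integrand n V y p) \<le> cmod (h (snd p)) * ?C" for p
    unfolding norm_scaleC by (intro mult_left_mono norm_moi_integrand_le V) simp_all
  have m: "(\<lambda>p. h (snd p) *\<^sub>C moi_integrand n V y p) \<in> borel_measurable ?M" by measurable
  have ic: "integrable ?M (\<lambda>p. cmod (h (snd p)) * ?C)" using i(1) by (rule integrable_mult_left)
  show int: "integrable ?M (\<lambda>p. h (snd p) *\<^sub>C moi_integrand n V y p)"
  proof (rule Bochner_Integration.integrable_bound[OF ic m])
    show "AE p in ?M. norm (h (snd p) *\<^sub>C moi_integrand n V y p) \<le> norm (cmod (h (snd p)) * ?C)"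
      using order_trans[OF le abs_ge_self] by (intro AE_I2) simp
  qed
  have "norm (\<integral>p. h (snd p) *\<^sub>C moi_integrand n V y p \<partial>?M) \<le> (\<integral>p. norm (h (snd p) *\<^sub>C moi_integrand n V y p) \<partial>?M)"
    by (rule integral_norm_bound)
  also have "\<dots> \<le> (\<integral>p. cmod (h (snd p)) * ?C \<partial>?M)"
    by (intro integral_mono integrable_norm[OF int] ic le)
  also have "\<dots> = L1_norm h / fact n * ?C" using i by simp
  finally show "norm (\<integral>p. h (snd p) *\<^sub>C moi_integrand n V y p \<partial>?M) \<le> L1_norm h / fact n * (\<Prod>j=1..n. onorm (V j)) * norm y"
    by (simp add: mult.assoc)
qed

lemma moi_eq_integral:
  assumes V: "\<And>j. j \<in> {1..n} \<Longrightarrow> bounded_clinear (V j)" and n: "n \<noteq> 0"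
    and h: "integrable lborel (fourier_L1 (nderiv n f))"
  shows "moi n D f V y
    = (\<integral>p. fourier_L1 (nderiv n f) (snd p) *\<^sub>C moi_integrand n V y p \<partial>(simplex_measure n \<Otimes>\<^sub>M lborel))"
proof -
  interpret S: finite_measure "simplex_measure n" by (rule finite_measure_simplex_measure)
  interpret P: pair_sigma_finite "simplex_measure n" "lborel :: real measure" by unfold_locales
  show ?thesis
    using P.integral_fst'[OF integrable_moi_integrand[OF V h]] n by (simp add: moi_def moi_integrand_def)
qed

text \<open>By dominated convergence the integral is the limit of the integrals of the truncated integrands. In these the
  \<open>t\<close>-integral is a value of the derivative of order \<open>n\<close> by Fourier inversion, so the integral over the simplex is a
  divided difference of the eigenvalues.\<close>

theorem
  assumes V: "\<And>j. j \<in> {1..n} \<Longrightarrow> bounded_clinear (V j)"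
    and c: "continuous_on UNIV (nderiv n f)" and F: "\<exists>h. has_L1_fourier (nderiv n f) h"
  shows bounded_clinear_moi: "bounded_clinear (moi n D f V)"
    and onorm_moi_le: "onorm (moi n D f V) \<le> L1_norm (fourier_L1 (nderiv n f)) / fact n * (\<Prod>j=1..n. onorm (V j))"
    and moi_tendsto: "\<And>y. (\<lambda>k. \<Sum>m\<in>Pi\<^sub>E {..n} (\<lambda>j. truncated_basis (B j) k).
      divided_difference n f (\<lambda>j. \<mu> j (m j)) *\<^sub>C truncated_term n V y m) \<longlonglongrightarrow> moi n D f V y"
proof -
  define h where "h = fourier_L1 (nderiv n f)"
  have hF: "has_L1_fourier (nderiv n f) h" unfolding h_def by (rule has_L1_fourier_fourier_L1[OF F])
  then have h: "integrable lborel h" by (simp add: has_L1_fourier_def)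
  have inv: "nderiv n f a = (\<integral>t. h t * exp (\<i> * of_real (t * a)) \<partial>lborel)" for a
    by (rule Fourier_inversion[OF c hF])
  have P0: "0 \<le> L1_norm h / fact n * (\<Prod>j=1..n. onorm (V j))"
    unfolding L1_norm_def using V
    by (intro mult_nonneg_nonneg divide_nonneg_nonneg integral_nonneg_AE prod_nonneg) (auto intro: onorm_nonneg)
  have "bounded_clinear (moi n D f V)
    \<and> (\<forall>y. norm (moi n D f V y) \<le> L1_norm h / fact n * (\<Prod>j=1..n. onorm (V j)) * norm y)
    \<and> (\<forall>y. (\<lambda>k. \<Sum>m\<in>Pi\<^sub>E {..n} (\<lambda>j. truncated_basis (B j) k).
      divided_difference n f (\<lambda>j. \<mu> j (m j)) *\<^sub>C truncated_term n V y m) \<longlonglongrightarrow> moi n D f V y)"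
  proof (cases "n = 0")
    case True
    have fc: "continuous_on UNIV f" using c True by simp
    have fm: "f \<in> borel_measurable borel" by (rule borel_measurable_continuous_onI[OF fc])
    have fb: "cmod (f t) \<le> L1_norm h" for t
    proof -
      have "cmod (f t) \<le> (\<integral>x. norm (h x * exp (\<i> * of_real (x * t))) \<partial>lborel)"
        using inv[of t] True integral_norm_bound[of lborel "\<lambda>x. h x * exp (\<i> * of_real (x * t))"] by simp
      also have "\<dots> = L1_norm h"
        unfolding L1_norm_def by (simp add: norm_mult norm_exp_i_times del: of_real_mult)
      finally show ?thesis .
    qed
    note fcalc = bounded_clinear_fun_calc[OF D B fm fb] norm_fun_calc_le[OF D B fm fb] fun_calc_eigenvector[OF D B fm fb]
    have moi0: "moi n D f V = fun_calc f (D 0)" using True by (simp add: moi_def)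
    have "(\<lambda>k. \<Sum>m\<in>Pi\<^sub>E {..n} (\<lambda>j. truncated_basis (B j) k).
      divided_difference n f (\<lambda>j. \<mu> j (m j)) *\<^sub>C truncated_term n V y m) \<longlonglongrightarrow> fun_calc f (D 0) y" for y
    proof -
      have "(\<lambda>k. fun_calc f (D 0) (proj_on (truncated_basis (B 0) k) y)) \<longlonglongrightarrow> fun_calc f (D 0) y"
        by (rule bounded_clinear_tendsto[OF fcalc(1) proj_on_truncated_basis_tendsto[OF eb_basis]])
      moreover have "fun_calc f (D 0) (proj_on (truncated_basis (B 0) k) y)
          = (\<Sum>m\<in>Pi\<^sub>E {..n} (\<lambda>j. truncated_basis (B j) k).
              divided_difference n f (\<lambda>j. \<mu> j (m j)) *\<^sub>C truncated_term n V y m)" for k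
      proof -
        have z: "{..n} = insert 0 {}" using True by auto
        have "fun_calc f (D 0) (proj_on (truncated_basis (B 0) k) y)
            = (\<Sum>e\<in>truncated_basis (B 0) k. f (\<mu> 0 e) *\<^sub>C (cinner e y *\<^sub>C e))"
          unfolding proj_on_def bounded_clinear_sum[OF fcalc(1)] bounded_clinear_scaleC[OF fcalc(1)]
        proof (rule sum.cong[OF refl])
          fix e assume "e \<in> truncated_basis (B 0) k"
          then have "e \<in> B 0" by (rule subsetD[OF truncated_basis_subset])
          show "cinner e y *\<^sub>C fun_calc f (D 0) e = f (\<mu> 0 e) *\<^sub>C (cinner e y *\<^sub>C e)"
            unfolding fcalc(3)[OF \<open>e \<in> B 0\<close>] scaleC_scaleC by (simp only: mult.commute)
        qed
        also have "\<dots> = (\<Sum>m\<in>Pi\<^sub>E {..n} (\<lambda>j. truncated_basis (B j) k).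
              divided_difference n f (\<lambda>j. \<mu> j (m j)) *\<^sub>C truncated_term n V y m)"
          unfolding z using True by (subst sum_PiE_insert) (simp_all add: divided_difference_0[OF fc] truncated_term_def)
        finally show ?thesis .
      qed
      ultimately show ?thesis by simp
    qed
    moreover have "norm (fun_calc f (D 0) y) \<le> L1_norm h / fact n * (\<Prod>j=1..n. onorm (V j)) * norm y" for y
      using fcalc(2)[of 0 y] True by simp
    ultimately show ?thesis unfolding moi0 using fcalc(1) by blast
  next
    case False
    let ?M = "simplex_measure n \<Otimes>\<^sub>M lborel"
    interpret S: finite_measure "simplex_measure n" by (rule finite_measure_simplex_measure)
    interpret P: pair_sigma_finite "simplex_measure n" "lborel :: real measure" by unfold_locales
    have [measurable]: "h \<in> borel_measurable borel" using borel_measurable_integrable[OF h] by simp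
    have moi: "moi n D f V y = (\<integral>p. h (snd p) *\<^sub>C moi_integrand n V y p \<partial>?M)" for y
      unfolding h_def by (rule moi_eq_integral[OF _ False]) (use V h in \<open>simp_all add: h_def\<close>)
    have int: "integrable ?M (\<lambda>p. h (snd p) *\<^sub>C moi_integrand n V y p)" for y
      by (rule integrable_moi_integrand[OF _ h]) (rule V)
    have bi: "bounded_clinear (\<lambda>y. moi_integrand n V y p)" for p
      by (rule bounded_clinear_moi_integrand) (rule V)
    have bound: "norm (moi n D f V y) \<le> L1_norm h / fact n * (\<Prod>j=1..n. onorm (V j)) * norm y" for y
      unfolding moi by (rule norm_integral_moi_integrand[OF V h])
    have "bounded_clinear (moi n D f V)"
    proof (rule bounded_clinearI[OF _ _ bound])
      show "moi n D f V (x + y) = moi n D f V x + moi n D f V y" for x y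
        unfolding moi bounded_clinear_add[OF bi] scaleC_add_right by (rule Bochner_Integration.integral_add[OF int int])
      show "moi n D f V (a *\<^sub>C x) = a *\<^sub>C moi n D f V x" for a x
      proof -
        have "moi n D f V (a *\<^sub>C x) = (\<integral>p. a *\<^sub>C (h (snd p) *\<^sub>C moi_integrand n V x p) \<partial>?M)"
          unfolding moi bounded_clinear_scaleC[OF bi] by (simp add: scaleC_scaleC mult.commute)
        also have "\<dots> = a *\<^sub>C moi n D f V x"
          unfolding moi by (rule integral_bounded_linear[OF bounded_linear_scaleC_right int])
        finally show ?thesis .
      qed
    qed
    moreover have "(\<lambda>k. \<Sum>m\<in>Pi\<^sub>E {..n} (\<lambda>j. truncated_basis (B j) k).
      divided_difference n f (\<lambda>j. \<mu> j (m j)) *\<^sub>C truncated_term n V y m) \<longlonglongrightarrow> moi n D f V y" for y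
    proof -
      let ?e = "\<lambda>p m. exp (\<i> * of_real (snd p * (\<Sum>j\<le>n. fst p j * \<mu> j (m j))))"
      let ?T = "\<lambda>k. Pi\<^sub>E {..n} (\<lambda>j. truncated_basis (B j) k)"
      let ?C = "(\<Prod>j=1..n. onorm (V j)) * norm y"
      let ?s = "\<lambda>k p. h (snd p) *\<^sub>C (\<Sum>m\<in>?T k. ?e p m *\<^sub>C truncated_term n V y m)"
      note [measurable] = moi_integrand_measurable[OF V]
      have "(\<lambda>k. \<integral>p. ?s k p \<partial>?M) \<longlonglongrightarrow> (\<integral>p. h (snd p) *\<^sub>C moi_integrand n V y p \<partial>?M)"
      proof (rule integral_dominated_convergence[where w = "\<lambda>p. cmod (h (snd p)) * ?C"])
        show "(\<lambda>p. h (snd p) *\<^sub>C moi_integrand n V y p) \<in> borel_measurable ?M" by measurable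
        show "?s k \<in> borel_measurable ?M" for k by measurable
        show "integrable ?M (\<lambda>p. cmod (h (snd p)) * ?C)"
          using integrable_simplex_lborel(1)[OF h] by (rule integrable_mult_left)
        show "AE p in ?M. (\<lambda>k. ?s k p) \<longlonglongrightarrow> h (snd p) *\<^sub>C moi_integrand n V y p"
          by (intro AE_I2 tendsto_scaleC tendsto_const moi_integrand_tendsto(1)[OF V])
        show "AE p in ?M. norm (?s k p) \<le> cmod (h (snd p)) * ?C" for k
          unfolding norm_scaleC by (intro AE_I2 mult_left_mono moi_integrand_tendsto(2)) (simp_all add: V)
      qed
      moreover have "(\<integral>p. ?s k p \<partial>?M) = (\<Sum>m\<in>?T k. divided_difference n f (\<lambda>j. \<mu> j (m j)) *\<^sub>C truncated_term n V y m)" for k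
      proof -
        have i1: "integrable ?M (\<lambda>p. h (snd p) * ?e p m)" for m
        proof (rule Bochner_Integration.integrable_bound[OF integrable_simplex_lborel(1)[OF h, of n]])
          show "(\<lambda>p. h (snd p) * ?e p m) \<in> borel_measurable ?M" by measurable
          show "AE p in ?M. norm (h (snd p) * ?e p m) \<le> norm (cmod (h (snd p)))"
            by (intro AE_I2) (simp add: norm_mult norm_exp_i_times del: of_real_mult of_real_sum)
        qed
        have dd: "(\<integral>p. h (snd p) * ?e p m \<partial>?M) = divided_difference n f (\<lambda>j. \<mu> j (m j))" for m
          unfolding P.integral_fst'[OF i1, symmetric] divided_difference_def inv by simp
        have "(\<integral>p. ?s k p \<partial>?M) = (\<integral>p. (\<Sum>m\<in>?T k. (h (snd p) * ?e p m) *\<^sub>C truncated_term n V y m) \<partial>?M)"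
          by (simp add: scaleC_sum_right scaleC_scaleC)
        also have "\<dots> = (\<Sum>m\<in>?T k. (\<integral>p. (h (snd p) * ?e p m) *\<^sub>C truncated_term n V y m \<partial>?M))"
          by (rule Bochner_Integration.integral_sum) (rule integrable_bounded_linear[OF bounded_linear_scaleC_left i1])
        also have "\<dots> = (\<Sum>m\<in>?T k. divided_difference n f (\<lambda>j. \<mu> j (m j)) *\<^sub>C truncated_term n V y m)"
          unfolding dd[symmetric] by (intro sum.cong refl integral_bounded_linear[OF bounded_linear_scaleC_left i1])
        finally show ?thesis .
      qed
      ultimately show ?thesis unfolding moi by simp
    qed
    ultimately show ?thesis using bound by blast
  qed
  then show "bounded_clinear (moi n D f V)"
    "onorm (moi n D f V) \<le> L1_norm (fourier_L1 (nderiv n f)) / fact n * (\<Prod>j=1..n. onorm (V j))"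
    "\<And>y. (\<lambda>k. \<Sum>m\<in>Pi\<^sub>E {..n} (\<lambda>j. truncated_basis (B j) k).
      divided_difference n f (\<lambda>j. \<mu> j (m j)) *\<^sub>C truncated_term n V y m) \<longlonglongrightarrow> moi n D f V y"
    using onorm_bound[OF P0, of "moi n D f V"] unfolding h_def by blast+
qed

text \<open>On an eigenvector of the last operator only one choice of the last basis vector contributes, so the last argument of
  the divided difference is fixed.\<close>

lemma moi_Suc_eigenvector_tendsto:
  assumes V: "\<And>j. j \<in> {1..Suc n} \<Longrightarrow> bounded_clinear (V j)"
    and c: "continuous_on UNIV (nderiv (Suc n) f)" and F: "\<exists>h. has_L1_fourier (nderiv (Suc n) f) h"
    and e: "e \<in> B (Suc n)"
  shows "(\<lambda>k. \<Sum>m\<in>Pi\<^sub>E {..n} (\<lambda>j. truncated_basis (B j) k).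
      divided_difference (Suc n) f ((\<lambda>j. \<mu> j (m j))(Suc n := \<mu> (Suc n) e)) *\<^sub>C truncated_term n V (V (Suc n) e) m)
    \<longlonglongrightarrow> moi (Suc n) D f V e"
proof (rule Lim_transform_eventually[OF moi_tendsto[OF V c F]])
  have V': "bounded_clinear (V (Suc n))" and Vn: "\<And>j. j \<in> {1..n} \<Longrightarrow> bounded_clinear (V j)" using V by simp_all
  show "\<forall>\<^sub>F k in sequentially. (\<Sum>m\<in>Pi\<^sub>E {..Suc n} (\<lambda>j. truncated_basis (B j) k).
      divided_difference (Suc n) f (\<lambda>j. \<mu> j (m j)) *\<^sub>C truncated_term (Suc n) V e m)
    = (\<Sum>m\<in>Pi\<^sub>E {..n} (\<lambda>j. truncated_basis (B j) k).
      divided_difference (Suc n) f ((\<lambda>j. \<mu> j (m j))(Suc n := \<mu> (Suc n) e)) *\<^sub>C truncated_term n V (V (Suc n) e) m)"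
    using eventually_truncated_basis[OF e]
  proof eventually_elim
    case (elim k)
    let ?T = "\<lambda>j. truncated_basis (B j) k"
    let ?g = "\<lambda>e' m. divided_difference (Suc n) f (\<lambda>j. \<mu> j ((m(Suc n := e')) j)) *\<^sub>C truncated_term (Suc n) V e (m(Suc n := e'))"
    have tt: "truncated_term (Suc n) V e (m(Suc n := e')) = (if e' = e then truncated_term n V (V (Suc n) e) m else 0)"
      if "e' \<in> ?T (Suc n)" for e' m
    proof -
      have "alternating_comp (\<lambda>j x. cinner ((m(Suc n := e')) j) x *\<^sub>C (m(Suc n := e')) j) V n
          = alternating_comp (\<lambda>j x. cinner (m j) x *\<^sub>C m j) V n"
        by (rule alternating_comp_cong) simp
      then have "truncated_term (Suc n) V e (m(Suc n := e')) = truncated_term n V (V (Suc n) (cinner e' e *\<^sub>C e')) m"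
        by (simp add: truncated_term_def)
      moreover have "truncated_term n V 0 m = 0"
        unfolding truncated_term_def
        by (rule bounded_clinear_zero[OF bounded_clinear_alternating_comp[OF bounded_clinear_rank_one Vn]])
      ultimately show ?thesis
        using orthonormal_cinner[OF orthonormal_tb that elim] by (simp add: bounded_clinear_zero[OF V'])
    qed
    have "(\<Sum>m\<in>Pi\<^sub>E {..Suc n} ?T. divided_difference (Suc n) f (\<lambda>j. \<mu> j (m j)) *\<^sub>C truncated_term (Suc n) V e m)
        = (\<Sum>e'\<in>?T (Suc n). \<Sum>m\<in>Pi\<^sub>E {..n} ?T. ?g e' m)"
      unfolding atMost_Suc by (rule sum_PiE_insert) simp
    also have "\<dots> = (\<Sum>e'\<in>?T (Suc n). if e' = e then (\<Sum>m\<in>Pi\<^sub>E {..n} ?T. ?g e m) else 0)"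
      by (intro sum.cong refl) (auto simp: tt)
    also have "\<dots> = (\<Sum>m\<in>Pi\<^sub>E {..n} ?T. ?g e m)" using elim finite_tb by simp
    also have "\<dots> = (\<Sum>m\<in>Pi\<^sub>E {..n} ?T.
        divided_difference (Suc n) f ((\<lambda>j. \<mu> j (m j))(Suc n := \<mu> (Suc n) e)) *\<^sub>C truncated_term n V (V (Suc n) e) m)"
    proof (intro sum.cong refl)
      fix m
      have "(\<lambda>j. \<mu> j ((m(Suc n := e)) j)) = (\<lambda>j. \<mu> j (m j))(Suc n := \<mu> (Suc n) e)" by auto
      then show "?g e m = divided_difference (Suc n) f ((\<lambda>j. \<mu> j (m j))(Suc n := \<mu> (Suc n) e)) *\<^sub>C truncated_term n V (V (Suc n) e) m"
        by (simp add: tt[OF elim])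
    qed
    finally show ?case .
  qed
qed

text \<open>Both sides are compared on an eigenvector of the last operator, on which the resolvent is division by \<open>u\<close>. There the
  truncated sums satisfy the Leibniz rule summand by summand.\<close>

theorem moi_Suc_resolvent:
  assumes V: "\<And>j. j \<in> {1..Suc n} \<Longrightarrow> bounded_clinear (V j)" and f: "C_n (Suc n) f"
    and F: "\<exists>h. has_L1_fourier (nderiv n f) h" "\<exists>h. has_L1_fourier (nderiv (Suc n) f) h"
      "\<exists>h. has_L1_fourier (nderiv (Suc n) (\<lambda>x. f x * u_weight x)) h"
  shows "moi (Suc n) D f V = (\<lambda>x. moi (Suc n) D (\<lambda>x. f x * u_weight x) V (resolvent (D (Suc n)) \<i> x)
    - moi n D f V (V (Suc n) (resolvent (D (Suc n)) \<i> x)))"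
proof (rule orthonormal_basis_ext[OF eb_basis[of "Suc n"]])
  let ?g = "\<lambda>x. f x * u_weight x" and ?R = "resolvent (D (Suc n)) \<i>"
  have V': "bounded_clinear (V (Suc n))" and Vn: "\<And>j. j \<in> {1..n} \<Longrightarrow> bounded_clinear (V j)" using V by simp_all
  have cn: "continuous_on UNIV (nderiv n f)" and cS: "continuous_on UNIV (nderiv (Suc n) f)"
    and cg: "continuous_on UNIV (nderiv (Suc n) ?g)"
    using C_n_continuous[OF f] C_n_continuous[OF C_n_mult_u_weight[OF f]] by simp_all
  have b1: "bounded_clinear (moi (Suc n) D f V)" by (rule bounded_clinear_moi[OF _ cS F(2)]) (rule V)
  have b2: "bounded_clinear (moi (Suc n) D ?g V)" by (rule bounded_clinear_moi[OF _ cg F(3)]) (rule V)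
  have b3: "bounded_clinear (moi n D f V)" by (rule bounded_clinear_moi[OF _ cn F(1)]) (rule Vn)
  have bR: "bounded_clinear ?R" by (rule bounded_clinear_resolvent[OF D]) simp
  show "bounded_clinear (moi (Suc n) D f V)" by (rule b1)
  show "bounded_clinear (\<lambda>x. moi (Suc n) D ?g V (?R x) - moi n D f V (V (Suc n) (?R x)))"
    by (rule bounded_clinear_sub[OF bounded_clinear_compose[OF b2 bR]
          bounded_clinear_compose[OF b3 bounded_clinear_compose[OF V' bR]]])
  fix e assume e: "e \<in> B (Suc n)"
  let ?u = "u_weight (\<mu> (Suc n) e)"
  let ?x = "\<lambda>m. (\<lambda>j. \<mu> j (m j))(Suc n := \<mu> (Suc n) e)"
  let ?T = "\<lambda>k. Pi\<^sub>E {..n} (\<lambda>j. truncated_basis (B j) k)"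
  have "(\<lambda>k. ?u *\<^sub>C (\<Sum>m\<in>?T k. divided_difference (Suc n) f (?x m) *\<^sub>C truncated_term n V (V (Suc n) e) m)
      + (\<Sum>m\<in>?T k. divided_difference n f (\<lambda>j. \<mu> j (m j)) *\<^sub>C truncated_term n V (V (Suc n) e) m))
    \<longlonglongrightarrow> ?u *\<^sub>C moi (Suc n) D f V e + moi n D f V (V (Suc n) e)"
    by (intro tendsto_add tendsto_scaleC tendsto_const moi_Suc_eigenvector_tendsto[OF V cS F(2) e] moi_tendsto[OF Vn cn F(1)])
  moreover have "?u *\<^sub>C (\<Sum>m\<in>?T k. divided_difference (Suc n) f (?x m) *\<^sub>C truncated_term n V (V (Suc n) e) m)
      + (\<Sum>m\<in>?T k. divided_difference n f (\<lambda>j. \<mu> j (m j)) *\<^sub>C truncated_term n V (V (Suc n) e) m)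
    = (\<Sum>m\<in>?T k. divided_difference (Suc n) ?g (?x m) *\<^sub>C truncated_term n V (V (Suc n) e) m)" for k
  proof -
    have "divided_difference (Suc n) ?g (?x m)
        = ?u * divided_difference (Suc n) f (?x m) + divided_difference n f (\<lambda>j. \<mu> j (m j))" for m
    proof -
      have "divided_difference n f (?x m) = divided_difference n f (\<lambda>j. \<mu> j (m j))"
        by (rule divided_difference_cong) simp
      then show ?thesis using divided_difference_mult_u_weight[OF f, of "?x m"] by simp
    qed
    then show ?thesis
      by (simp add: scaleC_sum_right scaleC_scaleC scaleC_add_left sum.distrib)
  qed
  moreover have "(\<lambda>k. \<Sum>m\<in>?T k. divided_difference (Suc n) ?g (?x m) *\<^sub>C truncated_term n V (V (Suc n) e) m)
    \<longlonglongrightarrow> moi (Suc n) D ?g V e"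
    by (rule moi_Suc_eigenvector_tendsto[OF _ cg F(3) e]) (rule V)
  ultimately have "?u *\<^sub>C moi (Suc n) D f V e + moi n D f V (V (Suc n) e) = moi (Suc n) D ?g V e"
    by (simp only: LIMSEQ_unique)
  then have eq: "moi (Suc n) D ?g V e - moi n D f V (V (Suc n) e) = ?u *\<^sub>C moi (Suc n) D f V e"
    by (metis add_diff_cancel_right')
  have u0: "?u \<noteq> 0" by (auto simp: u_weight_def complex_eq_iff)
  have Re: "?R e = (1 / ?u) *\<^sub>C e"
    using resolvent_eigenvector[OF D, of "Suc n" e] B[of "Suc n"] e by (simp add: eigenbasis_def u_weight_def)
  have "moi (Suc n) D ?g V (?R e) - moi n D f V (V (Suc n) (?R e))
      = (1 / ?u) *\<^sub>C (moi (Suc n) D ?g V e - moi n D f V (V (Suc n) e))"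
    unfolding Re by (simp add: bounded_clinear_scaleC[OF b2] bounded_clinear_scaleC[OF b3] bounded_clinear_scaleC[OF V'] scaleC_diff_right)
  also have "\<dots> = moi (Suc n) D f V e" unfolding eq using u0 by (simp add: scaleC_scaleC)
  finally show "moi (Suc n) D f V e = moi (Suc n) D ?g V (?R e) - moi n D f V (V (Suc n) (?R e))" by simp
qed

lemma moi_0_resolvent:
  assumes f: "C_n 0 f" and F: "\<exists>h. has_L1_fourier f h" "\<exists>h. has_L1_fourier (\<lambda>x. f x * u_weight x) h"
  shows "moi 0 D f V = (\<lambda>x. moi 0 D (\<lambda>x. f x * u_weight x) V (resolvent (D 0) \<i> x))"
proof (rule orthonormal_basis_ext[OF eb_basis[of 0]])
  let ?g = "\<lambda>x. f x * u_weight x" and ?R = "resolvent (D 0) \<i>"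
  have cf: "continuous_on UNIV f" and cg: "continuous_on UNIV ?g"
    using C_n_continuous[OF f, of 0] C_n_continuous[OF C_n_mult_u_weight[OF f], of 0] by simp_all
  have b: "bounded_clinear (moi 0 D f V)" "bounded_clinear (moi 0 D ?g V)"
    by (rule bounded_clinear_moi; use cf cg F in simp)+
  show "bounded_clinear (moi 0 D f V)" by (rule b)
  show "bounded_clinear (\<lambda>x. moi 0 D ?g V (?R x))"
    by (rule bounded_clinear_compose[OF b(2) bounded_clinear_resolvent[OF D]]) simp
  have moi0: "moi 0 D q V e = q (\<mu> 0 e) *\<^sub>C e"
    if e: "e \<in> B 0" and q: "continuous_on UNIV q" "\<exists>h. has_L1_fourier q h" for q e
  proof -
    have "(\<lambda>k. \<Sum>m\<in>Pi\<^sub>E {..0} (\<lambda>j. truncated_basis (B j) k).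
        divided_difference 0 q (\<lambda>j. \<mu> j (m j)) *\<^sub>C truncated_term 0 V e m) \<longlonglongrightarrow> moi 0 D q V e"
      by (rule moi_tendsto) (use q in simp_all)
    moreover have "\<forall>\<^sub>F k in sequentially. (\<Sum>m\<in>Pi\<^sub>E {..0} (\<lambda>j. truncated_basis (B j) k).
        divided_difference 0 q (\<lambda>j. \<mu> j (m j)) *\<^sub>C truncated_term 0 V e m) = q (\<mu> 0 e) *\<^sub>C e"
      using eventually_truncated_basis[OF e]
    proof eventually_elim
      case (elim k)
      have z: "{..0::nat} = insert 0 {}" by auto
      have "(\<Sum>m\<in>Pi\<^sub>E {..0} (\<lambda>j. truncated_basis (B j) k). divided_difference 0 q (\<lambda>j. \<mu> j (m j)) *\<^sub>C truncated_term 0 V e m)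
          = (\<Sum>e'\<in>truncated_basis (B 0) k. q (\<mu> 0 e') *\<^sub>C (cinner e' e *\<^sub>C e'))"
        unfolding z by (subst sum_PiE_insert) (simp_all add: divided_difference_0[OF q(1)] truncated_term_def)
      also have "\<dots> = (\<Sum>e'\<in>truncated_basis (B 0) k. if e' = e then q (\<mu> 0 e) *\<^sub>C e else 0)"
        using elim by (intro sum.cong refl) (auto simp: orthonormal_cinner[OF orthonormal_tb])
      finally show ?case using elim finite_tb by simp
    qed
    ultimately have "(\<lambda>k. q (\<mu> 0 e) *\<^sub>C e) \<longlonglongrightarrow> moi 0 D q V e" by (rule Lim_transform_eventually)
    then show ?thesis by (simp add: LIMSEQ_const_iff)
  qed
  fix e assume e: "e \<in> B 0"
  have u0: "u_weight (\<mu> 0 e) \<noteq> 0" by (auto simp: u_weight_def complex_eq_iff)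
  have Re: "?R e = (1 / u_weight (\<mu> 0 e)) *\<^sub>C e"
    using resolvent_eigenvector[OF D, of 0 e] B[of 0] e by (simp add: eigenbasis_def u_weight_def)
  show "moi 0 D f V e = moi 0 D ?g V (?R e)"
    unfolding Re bounded_clinear_scaleC[OF b(2)] moi0[OF e cf F(1)] moi0[OF e cg F(2)]
    using u0 by (simp add: scaleC_scaleC)
qed

end

section \<open>The trace-norm estimate\<close>

lemma C_n_mono: "C_n n f \<Longrightarrow> k \<le> n \<Longrightarrow> C_n k f"
  using C_n_continuous[of n f k] by (simp add: C_n_def)

lemma W_class_C_n: "f \<in> W_class s n \<Longrightarrow> C_n n f"
  by (simp add: W_class_def)

lemma W_class_fourier:
  "f \<in> W_class s n \<Longrightarrow> m \<le> s \<Longrightarrow> k \<le> n \<Longrightarrow> \<exists>h. has_L1_fourier (nderiv k (\<lambda>x. f x * u_weight x ^ m)) h"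
  by (simp add: W_class_def)

lemma W_class_mult_u_weight:
  assumes f: "f \<in> W_class (Suc s) n"
  shows "(\<lambda>x. f x * u_weight x) \<in> W_class s n"
proof -
  have "\<exists>h. has_L1_fourier (nderiv k (\<lambda>x. f x * u_weight x * u_weight x ^ m)) h" if "m \<le> s" "k \<le> n" for m k
    using W_class_fourier[OF f, of "Suc m" k] that by (simp add: mult.assoc)
  then show ?thesis using C_n_mult_u_weight[OF W_class_C_n[OF f]] by (simp add: W_class_def)
qed

lemma W_class_mono: "f \<in> W_class s n \<Longrightarrow> s' \<le> s \<Longrightarrow> n' \<le> n \<Longrightarrow> f \<in> W_class s' n'"
  by (auto simp: W_class_def intro: C_n_mono)

definition weighted_fourier_norm :: "(real \<Rightarrow> complex) \<Rightarrow> nat \<Rightarrow> nat \<Rightarrow> real" where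
  "weighted_fourier_norm f a b = L1_norm (fourier_L1 (nderiv b (\<lambda>x. f x * u_weight x ^ a))) / fact b"

lemma weighted_fourier_norm_mult_u_weight: "weighted_fourier_norm (\<lambda>x. f x * u_weight x) a b = weighted_fourier_norm f (Suc a) b"
  by (simp add: weighted_fourier_norm_def mult.assoc)

lemma weighted_fourier_norm_nonneg: "0 \<le> weighted_fourier_norm f a b"
  by (simp add: weighted_fourier_norm_def L1_norm_def)

text \<open>Replacing \<open>min s n\<close> by \<open>n\<close> makes the range of summation independent of \<open>s\<close>; the additional binomial coefficients are \<open>0\<close>.\<close>

lemma c_const_eq: "c_const s n f = (\<Sum>k\<le>n. real (s choose k) * weighted_fourier_norm f (s - k) (n - k))"
proof -
  have "c_const s n f = (\<Sum>k\<in>{0..min s n}. real (s choose k) * weighted_fourier_norm f (s - k) (n - k))"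
    by (simp add: c_const_def weighted_fourier_norm_def)
  also have "\<dots> = (\<Sum>k\<le>n. real (s choose k) * weighted_fourier_norm f (s - k) (n - k))"
    by (rule sum.mono_neutral_left) auto
  finally show ?thesis .
qed

lemma c_const_nonneg: "0 \<le> c_const s n f"
  unfolding c_const_eq by (intro sum_nonneg mult_nonneg_nonneg weighted_fourier_norm_nonneg) simp

lemma c_const_0: "c_const 0 n f = L1_norm (fourier_L1 (nderiv n f)) / fact n"
  by (simp add: c_const_def)

lemma c_const_Suc_0: "c_const (Suc s) 0 f = c_const s 0 (\<lambda>x. f x * u_weight x)"
  by (simp add: c_const_eq weighted_fourier_norm_mult_u_weight)

text \<open>Pascal's rule, in the form that matches the two terms of \<open>moi_Suc_resolvent\<close>.\<close>

lemma c_const_Suc_Suc: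
  "c_const (Suc s) (Suc n) f = c_const s (Suc n) (\<lambda>x. f x * u_weight x) + c_const s n f"
proof -
  let ?t = "\<lambda>k. weighted_fourier_norm f (s - k) (n - k)"
  \<comment> \<open>For \<open>k \<ge> s\<close> the truncated subtraction differs, but then the binomial coefficient is \<open>0\<close>.\<close>
  have shift: "real (s choose Suc k) * weighted_fourier_norm f (Suc (s - Suc k)) b = real (s choose Suc k) * weighted_fourier_norm f (s - k) b" for k b
    by (cases "k < s") (simp_all add: Suc_diff_Suc)
  have "c_const (Suc s) (Suc n) f
      = weighted_fourier_norm f (Suc s) (Suc n) + (\<Sum>k\<le>n. real (Suc s choose Suc k) * ?t k)"
    unfolding c_const_eq by (subst sum.atMost_Suc_shift) simp
  also have "(\<Sum>k\<le>n. real (Suc s choose Suc k) * ?t k)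
      = (\<Sum>k\<le>n. real (s choose Suc k) * ?t k) + (\<Sum>k\<le>n. real (s choose k) * ?t k)"
    by (simp add: sum.distrib[symmetric] algebra_simps)
  also have "weighted_fourier_norm f (Suc s) (Suc n) + ((\<Sum>k\<le>n. real (s choose Suc k) * ?t k) + (\<Sum>k\<le>n. real (s choose k) * ?t k))
      = c_const s (Suc n) (\<lambda>x. f x * u_weight x) + c_const s n f"
    unfolding c_const_eq weighted_fourier_norm_mult_u_weight by (subst sum.atMost_Suc_shift) (simp add: shift)
  finally show ?thesis .
qed

text \<open>Induction over \<open>s\<close> for all \<open>n\<close> and \<open>f\<close>. The factor \<open>1 + onorm B\<close> is charged at every step to keep the bound uniform, although it
  occurs only in the steps with \<open>n = 0\<close>, where the resolvent of the perturbed operator appears.\<close>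

theorem moi_R_word:
  fixes D :: "'a::{complex_hilbert_space, second_countable_topology} \<rightharpoonup> 'a"
  assumes D: "self_adjoint D" and B: "bounded_self_adjoint B"
    and F: "eigenbasis D F \<mu>" and F': "eigenbasis (perturb D B) F' \<mu>'"
    and f: "f \<in> W_class s n" and V: "\<And>j. j \<in> {1..n} \<Longrightarrow> bounded_clinear (V j)"
  shows "R_word (resolvent D \<i>) s (c_const s n f * (\<Prod>j=1..n. onorm (V j)) * (1 + onorm B) ^ s)
    (moi n (\<lambda>j. if j = 0 then perturb D B else D) f V)"
proof -
  let ?D = "\<lambda>j. if j = 0 then perturb D B else D" and ?R = "resolvent D \<i>"
  let ?B = "\<lambda>j::nat. if j = 0 then F' else F" and ?m = "\<lambda>j::nat. if j = 0 then \<mu>' else \<mu>"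
  have sa: "self_adjoint (?D j)" for j using D self_adjoint_perturb[OF D B] by simp
  have eb: "eigenbasis (?D j) (?B j) (?m j)" for j using F F' by simp
  note R = bounded_clinear_moi[OF sa eb] onorm_moi_le[OF sa eb]
  define K where "K = 1 + onorm B"
  have bB: "bounded_clinear B" using B by (simp add: bounded_self_adjoint_def)
  have K1: "1 \<le> K" using onorm_nonneg[OF bB] by (simp add: K_def)
  have id_le: "onorm (\<lambda>x::'a. x) \<le> 1" by (rule onorm_bound) simp_all
  show ?thesis
    unfolding K_def[symmetric] using f V
  proof (induction s arbitrary: n f)
    case 0
    have c: "continuous_on UNIV (nderiv n f)" using C_n_continuous[OF W_class_C_n[OF 0(1)]] by simp
    have h: "\<exists>h. has_L1_fourier (nderiv n f) h" using W_class_fourier[OF 0(1), of 0 n] by simp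
    have "bounded_clinear (moi n ?D f V)" by (rule R(1)[OF _ c h]) (rule 0(2))
    moreover have "onorm (moi n ?D f V) \<le> L1_norm (fourier_L1 (nderiv n f)) / fact n * (\<Prod>j=1..n. onorm (V j))"
      by (rule R(2)[OF _ c h]) (rule 0(2))
    ultimately show ?case by (intro R_word.base) (simp_all add: c_const_0)
  next
    case (Suc s)
    note f = Suc.prems(1)
    let ?g = "\<lambda>x. f x * u_weight x"
    show ?case
    proof (cases n)
      case 0
      let ?A = "\<lambda>x. x - resolvent (perturb D B) \<i> (B x)"
      have eq: "moi 0 ?D f V = (\<lambda>x. moi 0 ?D ?g V (resolvent (perturb D B) \<i> x))"
        using moi_0_resolvent[OF sa eb W_class_C_n[OF f[unfolded 0]], where V = V]
          W_class_fourier[OF f, of 0 0] W_class_fourier[OF f, of 1 0] by simp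
      \<comment> \<open>A word ends with the resolvent of the unperturbed operator, hence the factorization.\<close>
      have fac: "resolvent (perturb D B) \<i> x = ?A (?R x)" for x
        by (subst resolvent_perturb[OF D B]) simp
      have w: "R_word ?R s (c_const s 0 ?g * (\<Prod>j=1..0. onorm (V j)) * K ^ s) (moi 0 ?D ?g V)"
        by (rule Suc.IH) (use W_class_mult_u_weight[OF f] 0 in simp_all)
      have wA: "R_word ?R s (c_const s 0 ?g * (\<Prod>j=1..0. onorm (V j)) * K ^ s * K) (\<lambda>x. moi 0 ?D ?g V (?A x))"
        by (rule R_word_comp_right[OF w bounded_clinear_perturb_factor[OF D B]])
          (use onorm_perturb_factor[OF D B] in \<open>simp add: K_def\<close>)
      have "R_word ?R (Suc s) (c_const s 0 ?g * (\<Prod>j=1..0. onorm (V j)) * K ^ s * K * 1)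
          (\<lambda>x. moi 0 ?D ?g V (?A (?R x)))"
        by (rule R_word.step[OF wA bounded_clinear_id(1) id_le])
      then show ?thesis
        unfolding 0 eq fac[symmetric] by (simp add: c_const_Suc_0 mult.assoc mult.commute)
    next
      case (Suc n')
      have Vb: "bounded_clinear (V j)" if "j \<in> {1..Suc n'}" for j using Suc.prems(2) Suc that by simp
      have f': "f \<in> W_class (Suc s) (Suc n')" using f Suc by simp
      have fn: "f \<in> W_class s n'" by (rule W_class_mono[OF f']) simp_all
      have F: "\<exists>h. has_L1_fourier (nderiv n' f) h" "\<exists>h. has_L1_fourier (nderiv (Suc n') f) h"
        "\<exists>h. has_L1_fourier (nderiv (Suc n') ?g) h"
        using W_class_fourier[OF f', of 0 n'] W_class_fourier[OF f', of 0 "Suc n'"] W_class_fourier[OF f', of 1 "Suc n'"]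
        by simp_all
      have eq: "moi (Suc n') ?D f V = (\<lambda>x. moi (Suc n') ?D ?g V (resolvent (?D (Suc n')) \<i> x)
          - moi n' ?D f V (V (Suc n') (resolvent (?D (Suc n')) \<i> x)))"
        by (rule moi_Suc_resolvent[OF sa eb _ W_class_C_n[OF f'] F]) (rule Vb)
      let ?P = "\<Prod>j=1..n'. onorm (V j)"
      have w1: "R_word ?R s (c_const s (Suc n') ?g * (\<Prod>j=1..Suc n'. onorm (V j)) * K ^ s) (moi (Suc n') ?D ?g V)"
        by (rule Suc.IH[OF W_class_mult_u_weight[OF f']]) (rule Vb)
      have w2: "R_word ?R s (c_const s n' f * ?P * K ^ s) (moi n' ?D f V)"
        by (rule Suc.IH[OF fn]) (use Vb in simp)
      have bV: "bounded_clinear (\<lambda>x. - V (Suc n') x)"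
        using bounded_clinear_sub[OF bounded_clinear_const_zero Vb[of "Suc n'"]] by simp
      have oV: "onorm (\<lambda>x. - V (Suc n') x) \<le> onorm (V (Suc n'))" by (simp add: onorm_neg)
      \<comment> \<open>The identity is charged with \<open>K\<close> as well, so that both terms carry the same power of \<open>K\<close>.\<close>
      have idK: "onorm (\<lambda>x::'a. x) \<le> K" using id_le K1 by simp
      have cn: "continuous_on UNIV (nderiv n' f)" using C_n_continuous[OF W_class_C_n[OF f']] by simp
      have bn: "bounded_clinear (moi n' ?D f V)" by (rule R(1)[OF _ cn F(1)]) (use Vb in simp)
      have "R_word ?R (Suc s)
          (c_const s (Suc n') ?g * (\<Prod>j=1..Suc n'. onorm (V j)) * K ^ s * K
            + c_const s n' f * ?P * K ^ s * onorm (V (Suc n')) * K)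
          (\<lambda>x. moi (Suc n') ?D ?g V (?R x) + moi n' ?D f V (- V (Suc n') (?R x)))"
        by (rule R_word.add[OF R_word.step[OF w1 bounded_clinear_id(1) idK]
              R_word.step[OF R_word_comp_right[OF w2 bV oV] bounded_clinear_id(1) idK]])
      moreover have "moi n' ?D f V (- y) = - moi n' ?D f V y" for y
        using bn by (simp add: bounded_clinear_def linear_neg bounded_linear.linear)
      moreover have "c_const s (Suc n') ?g * (\<Prod>j=1..Suc n'. onorm (V j)) * K ^ s * K
            + c_const s n' f * ?P * K ^ s * onorm (V (Suc n')) * K
          = c_const (Suc s) (Suc n') f * (\<Prod>j=1..Suc n'. onorm (V j)) * K ^ Suc s"
        by (simp add: c_const_Suc_Suc algebra_simps)
      ultimately show ?thesis unfolding Suc eq by simp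
    qed
  qed
qed

theorem theorem6:
  fixes s n :: nat
    and D :: "'a::{complex_hilbert_space, second_countable_topology} \<rightharpoonup> 'a"
    and f :: "real \<Rightarrow> complex"
    and V :: "nat \<Rightarrow> 'a \<Rightarrow> 'a"
  assumes "s \<ge> 1"
    and "self_adjoint D"
    and "schatten_class s (resolvent D \<i>)"
    and "f \<in> W_class s n"
    and "\<And>j. j \<in> {1..n} \<Longrightarrow> bounded_clinear (V j)"
  shows "trace_class (moi n (\<lambda>_. D) f V) \<and>
    trace_norm (moi n (\<lambda>_. D) f V)
      \<le> c_const s n f * (\<Prod>j=1..n. onorm (V j)) * schatten_norm s (resolvent D \<i>) ^ s \<and>
    (\<forall>B. bounded_self_adjoint B \<longrightarrow>
      trace_class (moi n (\<lambda>j. if j = 0 then perturb D B else D) f V) \<and>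
      trace_norm (moi n (\<lambda>j. if j = 0 then perturb D B else D) f V)
        \<le> c_const s n f * (\<Prod>j=1..n. onorm (V j)) * (1 + onorm B) ^ (2 * s) *
          schatten_norm s (resolvent D \<i>) ^ s)"
proof -
  note D = assms(2) and S = assms(3) and s1 = assms(1)
  have comp: "compact_op (resolvent D \<i>)" by (rule schatten_class_compact[OF S s1])
  obtain F \<mu> where F: "eigenbasis D F \<mu>" by (rule self_adjoint_eigenbasis[OF D comp])
  have ev: "resolvent D \<i> e = (1 / (complex_of_real (\<mu> e) - \<i>)) *\<^sub>C e" if "e \<in> F" for e
    using F that by (intro resolvent_eigenvector[OF D]) (simp add: eigenbasis_def)
  have Fo: "orthonormal_basis F" using F by (simp add: eigenbasis_def)
  have main: "trace_class (moi n (\<lambda>j. if j = 0 then perturb D B else D) f V) \<and>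
      trace_norm (moi n (\<lambda>j. if j = 0 then perturb D B else D) f V)
        \<le> c_const s n f * (\<Prod>j=1..n. onorm (V j)) * (1 + onorm B) ^ s * schatten_norm s (resolvent D \<i>) ^ s"
    if B: "bounded_self_adjoint B" for B
  proof -
    obtain F' \<mu>' where F': "eigenbasis (perturb D B) F' \<mu>'"
      by (rule self_adjoint_eigenbasis[OF self_adjoint_perturb[OF D B] compact_op_resolvent_perturb[OF D B comp]])
    show ?thesis
      by (rule R_word_trace_class[OF S s1 Fo ev moi_R_word[OF D B F F' assms(4)]]) (use assms(5) in simp_all)
  qed
  \<comment> \<open>The unperturbed case is the perturbation by \<open>0\<close>.\<close>
  have z: "bounded_self_adjoint (\<lambda>_::'a. 0)" by (simp add: bounded_self_adjoint_def)
  have e: "(\<lambda>j::nat. if j = 0 then perturb D (\<lambda>_. 0) else D) = (\<lambda>_. D)"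
    unfolding perturb_zero by simp
  have "trace_class (moi n (\<lambda>_. D) f V) \<and>
    trace_norm (moi n (\<lambda>_. D) f V) \<le> c_const s n f * (\<Prod>j=1..n. onorm (V j)) * schatten_norm s (resolvent D \<i>) ^ s"
    using main[OF z] unfolding e by (simp add: onorm_zero)
  moreover have "c_const s n f * (\<Prod>j=1..n. onorm (V j)) * (1 + onorm B) ^ s * schatten_norm s (resolvent D \<i>) ^ s
      \<le> c_const s n f * (\<Prod>j=1..n. onorm (V j)) * (1 + onorm B) ^ (2 * s) * schatten_norm s (resolvent D \<i>) ^ s"
    if B: "bounded_self_adjoint B" for B
  proof -
    have "0 \<le> onorm B" using B by (intro onorm_nonneg) (simp add: bounded_self_adjoint_def)
    then have "(1 + onorm B) ^ s \<le> (1 + onorm B) ^ (2 * s)" by (intro power_increasing) simp_all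
    moreover have "0 \<le> (\<Prod>j=1..n. onorm (V j))" using assms(5) by (intro prod_nonneg) (auto intro: onorm_nonneg)
    moreover have "0 \<le> schatten_norm s (resolvent D \<i>)" by (simp add: schatten_norm_def)
    ultimately show ?thesis by (intro mult_right_mono mult_left_mono mult_nonneg_nonneg c_const_nonneg) simp_all
  qed
  ultimately show ?thesis using main order_trans by blast
qed

end
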